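(* Consider the statistical learning setting described in the context. Let $\mathcal S_p$ be a domain of Gaussianity for $\mathbf x$, suppose that the regime, constraint-set, penalty and restricted-subgaussianity assumptions of the context hold, that the loss and labels satisfy either alternative (I) or alternative (II) of the context, and that $\mathcal C_p\subseteq\mathcal S_p$ and $\boldsymbol\theta_j^\star\in\mathcal S_p$ for each $j\le k^\star$. Assume moreover that $\lim_{n\to\infty}\mathbb P(\mathrm{ERM}_0(\mathbf G)\ne\emptyset)=1$. Then for all $\delta>0$, $\alpha>0$ and $\rho\in\mathbb R$, $$\limsup_{n\to\infty}\mathbb P\Big(\min_{\boldsymbol\Theta\in\mathrm{ERM}_\alpha(\mathbf X)}R_n^{\mathbf x}(\boldsymbol\Theta)\ge\rho+\delta\Big)\le\limsup_{n\to\infty}\mathbb P\Big(\min_{\boldsymbol\Theta\in\mathrm{ERM}_0(\mathbf G)}R_n^{\mathbf g}(\boldsymbol\Theta)>\rho\Big),$$ $$\limsup_{t\to0}\limsup_{n\to\infty}\mathbb P\Big(\min_{\boldsymbol\Theta\in\mathrm{ERM}_t(\mathbf X)}R_n^{\mathbf x}(\boldsymbol\Theta)\le\rho-\delta\Big)\le\limsup_{n\to\infty}\mathbb P\Big(\min_{\boldsymbol\Theta\in\mathrm{ERM}_\alpha(\mathbf G)}R_n^{\mathbf g}(\boldsymbol\Theta)\le\rho\Big),$$ and the same inequalities hold with each $\limsup_{n\to\infty}$ replaced by $\liminf_{n\to\infty}$.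
   Context: **Setting.** A sequence of problems indexed by $n$, $p=p(n)$; $k,k^\star\ge1$ fixed integers. The set $\mathcal C_p\subseteq\mathbb R^p$, the domain $\mathcal S_p$, the penalty $r$, the matrix $\boldsymbol\Theta^\star$, the laws of $\mathbf x$ and $\varepsilon_i$, and $\boldsymbol\mu_{\mathbf g},\boldsymbol\Sigma_{\mathbf g}$ may depend on $n$; the functions $L,F,\eta$ and all constants do not. $\mathbf x_1,\dots,\mathbf x_n$ are i.i.d. copies of a random vector $\mathbf x\in\mathbb R^p$ (rows of $\mathbf X$); $\mathbf g_1,\dots,\mathbf g_n$ are i.i.d. copies of $\mathbf g\sim\mathcal N(\boldsymbol\mu_{\mathbf g},\boldsymbol\Sigma_{\mathbf g})$ (rows of $\mathbf G$); $\varepsilon_1,\dots,\varepsilon_n$ are i.i.d. copies of a real variable $\varepsilon$, independent of $\mathbf X$ and of $\mathbf G$. $\boldsymbol\Theta^\star=(\boldsymbol\theta_1^\star,\dots,\boldsymbol\theta^\star_{k^\star})\in\mathbb R^{p\times k^\star}$ is deterministic, $F:\mathbb R^k\to\mathbb R$, $L:\mathbb R\times\mathbb R\to\mathbb R_{\ge0}$, $\eta:\mathbb R^{k^\star+1}\to\mathbb R$; labels are $y_i(\mathbf X)=\eta(\boldsymbol\Theta^{\star\top}\mathbf x_i,\varepsilon_i)$ and $y_i(\mathbf G)=\eta(\boldsymbol\Theta^{\star\top}\mathbf g_i,\varepsilon_i)$; $$L_F(\mathbf v,y)=L(F(\mathbf v),y),\qquad \ell(\mathbf u,\mathbf u^\star;\varepsilon)=L(F(\mathbf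 u),\eta(\mathbf u^\star,\varepsilon)).$$ For $\boldsymbol\Theta\in\mathbb R^{p\times k}$, $\widehat R_n(\boldsymbol\Theta;\mathbf X,\mathbf y(\mathbf X))=\frac1n\sum_{i=1}^n\ell(\boldsymbol\Theta^\top\mathbf x_i,\boldsymbol\Theta^{\star\top}\mathbf x_i;\varepsilon_i)+r(\boldsymbol\Theta)$, and similarly with $\mathbf G$. $\mathcal C_p^k$ is the set of matrices with all $k$ columns in $\mathcal C_p$. $\|\cdot\|_{\psi_2}$ is the subgaussian norm. **Near-minimizers and test error.** $\mathrm{ERM}_t(\mathbf X)=\{\boldsymbol\Theta\in\mathcal C_p^k:\widehat R_n(\boldsymbol\Theta;\mathbf X,\mathbf y(\mathbf X))\le t\}$, and similarly $\mathrm{ERM}_t(\mathbf G)$. For deterministic $\boldsymbol\Theta$, $R_n^{\mathbf x}(\boldsymbol\Theta)=\mathbb E[\ell(\boldsymbol\Theta^\top\mathbf x,\boldsymbol\Theta^{\star\top}\mathbf x;\varepsilon)]$ with $\mathbf x,\varepsilon$ independent, and $R_n^{\mathbf g}(\boldsymbol\Theta)=\mathbb E[\ell(\boldsymbol\Theta^\top\mathbf g,\boldsymbol\Theta^{\star\top}\mathbf g;\varepsilon)]$ with $\mathbf g,\varepsilon$ independent. A minimum over the empty set is $+\infty$. **Regime.** $C_0^{-1}\le p(n)/n\le C_0$ for all $n$, some constant $C_0>0$. **Constraint set.** $\mathcal C_p$ is compact and contained in the Euclidean ball of radius $R$ centered at $0$ ($R$ a constant), and $\|\boldsymbol\theta_j^\star\|_2\le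 R$. **Penalty.** $r:\mathbb R^{p\times k}\to\mathbb R_{\ge0}$ is continuous and for every $B>0$ there is $K_r(B)>0$ independent of $p$ with $|r(\boldsymbol\Theta)-r(\widetilde{\boldsymbol\Theta})|\le K_r(B)\|\boldsymbol\Theta-\widetilde{\boldsymbol\Theta}\|_F$ whenever $\|\boldsymbol\Theta\|_F,\|\widetilde{\boldsymbol\Theta}\|_F\le B$. **Domain of Gaussianity.** A sequence of symmetric convex sets $\mathcal S_p\subseteq\mathbb R^p$ such that for every bounded Lipschitz $\varphi:\mathbb R\to\mathbb R$, $\lim_{p\to\infty}\sup_{\boldsymbol\theta\in\mathcal S_p}|\mathbb E[\varphi(\boldsymbol\theta^\top\mathbf g)]-\mathbb E[\varphi(\boldsymbol\theta^\top\mathbf x)]|=0$, $\mathbf g\sim\mathcal N(\boldsymbol\mu_{\mathbf g},\boldsymbol\Sigma_{\mathbf g})$. **Restricted subgaussianity.** $\mathcal S_p$ is contained in the Euclidean ball of radius $R$ and, for a constant $K$ independent of $n,p$, $\sup_{\boldsymbol\theta\in\mathcal S_p,\|\boldsymbol\theta\|_2\le1}\|\mathbf x^\top\boldsymbol\theta\|_{\psi_2}\le K$, $\sup_{\boldsymbol\theta\in\mathcal S_p,\|\boldsymbol\theta\|_2\le1}\|\boldsymbol\Sigma_{\mathbf g}^{1/2}\boldsymbol\theta\|_2\le K$, $\|\boldsymbol\mu_{\mathbf g}\|_2\le K$. **Alternative (I).** $\max_i\|\varepsilon_i\|_{\psi_2}\le K$ for a constant $K$, and $\ell$, viewed as a function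 of $(\mathbf w,\varepsilon)$ with $\mathbf w=(\mathbf u,\mathbf u^\star)\in\mathbb R^{k+k^\star}$, is non-negative and is either Lipschitz, i.e. $|\ell(\mathbf w,\varepsilon)-\ell(\tilde{\mathbf w},\tilde\varepsilon)|\le K(\|\mathbf w-\tilde{\mathbf w}\|_2+|\varepsilon-\tilde\varepsilon|)$, or locally Lipschitz (the same inequality with constant $K_\ell(B)$ on $\{\|(\mathbf w,\varepsilon)\|_2\le B\}$ for every $B>0$) with $-K_0+K_1(\|\mathbf w\|_2^a+|\varepsilon|^a)\le\ell(\mathbf w,\varepsilon)\le K(1+\|\mathbf w\|_2^b+|\varepsilon|^b)$ for some constants $K_0$, $K_1>0$, $K$, $b\ge a>0$. **Alternative (II).** $L_F$ is non-negative and for all $\mathbf v,\tilde{\mathbf v}\in\mathbb R^k$, $y,\tilde y\in\mathbb R$: $|L_F(\mathbf v,y)-L_F(\tilde{\mathbf v},y)|\le K(1+|y|)\|\mathbf v-\tilde{\mathbf v}\|_2$ and $|L_F(\mathbf v,y)-L_F(\mathbf v,\tilde y)|\le K(1+\|\mathbf v\|_2)|y-\tilde y|$. Labels are binary: $y_i\in\{+1,-1\}$ with $\mathbb P(y_i=+1\mid\mathbf x_i)=g(\boldsymbol\Theta^{\star\top}\mathbf x_i)$ (and likewise with $\mathbf g_i$ in the Gaussian model), where $g:\mathbb R^{k^\star}\to[0,1]$ satisfies $|g(\mathbf v)-g(\tilde{\mathbf v})|\le K(1+\|\mathbf v\|_2+\|\tilde{\mathbf v}\|_2)\|\mathbf v-\tilde{\mathbf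 v}\|_2$. *)

theory Defs
  imports "HOL-Probability.Probability"
begin

(* The dimension p varies with the sample size, so a vector of R^p is a sequence that vanishes from
   index p on.  R^p is thus a closed subspace of nat => real; the product topology of nat => real and
   its Borel sigma-algebra induce the usual topology and Borel sets on R^p.
   The numbers of columns k and kstar are fixed, and are the cardinalities of the finite (nonempty)
   index types 'k and 'm.  A p x k matrix is the family of its columns: T j i is the entry in
   row i and column j. *)

type_synonym rvec = "nat \<Rightarrow> real"

definition Rvec :: "nat \<Rightarrow> rvec set" where
  "Rvec p = {v. \<forall>i\<ge>p. v i = 0}"

definition Rmat :: "nat \<Rightarrow> ('k::finite \<Rightarrow> rvec) set" where
  "Rmat p = {T. \<forall>j. T j \<in> Rvec p}"

definition dotp :: "nat \<Rightarrow> rvec \<Rightarrow> rvec \<Rightarrow> real" where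
  "dotp p u v = (\<Sum>i<p. u i * v i)"

definition norm2 :: "nat \<Rightarrow> rvec \<Rightarrow> real" where
  "norm2 p v = L2_set v {..<p}"

definition frob_norm :: "nat \<Rightarrow> ('k::finite \<Rightarrow> rvec) \<Rightarrow> real" where
  "frob_norm p T = L2_set (\<lambda>(i, j). T j i) ({..<p} \<times> UNIV)"

definition mat_diff :: "('k::finite \<Rightarrow> rvec) \<Rightarrow> ('k \<Rightarrow> rvec) \<Rightarrow> 'k \<Rightarrow> rvec" where
  "mat_diff T T' = (\<lambda>j i. T j i - T' j i)"

definition transp_mult :: "nat \<Rightarrow> ('k::finite \<Rightarrow> rvec) \<Rightarrow> rvec \<Rightarrow> real ^ 'k" where
  "transp_mult p T v = (\<chi> j. dotp p (T j) v)"

definition symmetric_convex :: "rvec set \<Rightarrow> bool" where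
  "symmetric_convex S \<longleftrightarrow>
     (\<forall>u\<in>S. (\<lambda>i. - u i) \<in> S) \<and>
     (\<forall>u\<in>S. \<forall>v\<in>S. \<forall>t\<in>{0..1}. (\<lambda>i. (1 - t) * u i + t * v i) \<in> S)"


(* Square matrices of size p: only the entries A i j with i, j < p matter. *)

definition mat_apply :: "nat \<Rightarrow> (nat \<Rightarrow> nat \<Rightarrow> real) \<Rightarrow> rvec \<Rightarrow> rvec" where
  "mat_apply p A v = (\<lambda>i. if i < p then (\<Sum>j<p. A i j * v j) else 0)"

definition sym_psd :: "nat \<Rightarrow> (nat \<Rightarrow> nat \<Rightarrow> real) \<Rightarrow> bool" where
  "sym_psd p A \<longleftrightarrow>
     (\<forall>i<p. \<forall>j<p. A i j = A j i) \<and> (\<forall>v\<in>Rvec p. 0 \<le> dotp p v (mat_apply p A v))"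

(* A is the positive semidefinite square root of Sg, which exists and is unique (as a p x p
   matrix) when Sg is symmetric and positive semidefinite. *)
definition psd_sqrt :: "nat \<Rightarrow> (nat \<Rightarrow> nat \<Rightarrow> real) \<Rightarrow> (nat \<Rightarrow> nat \<Rightarrow> real) \<Rightarrow> bool" where
  "psd_sqrt p Sg A \<longleftrightarrow>
     sym_psd p A \<and> (\<forall>i<p. \<forall>j<p. (\<Sum>l<p. A i l * A l j) = Sg i j)"


definition law_on :: "nat \<Rightarrow> rvec measure \<Rightarrow> bool" where
  "law_on p P \<longleftrightarrow> prob_space P \<and> sets P = sets borel \<and> (AE v in P. v \<in> Rvec p)"

(* Univariate normal law with mean m and variance s, a point mass when s = 0. *)
definition normal_law :: "real \<Rightarrow> real \<Rightarrow> real measure" where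
  "normal_law m s = (if s = 0 then return borel m else density lborel (normal_density m (sqrt s)))"

definition gaussian_law :: "nat \<Rightarrow> rvec \<Rightarrow> (nat \<Rightarrow> nat \<Rightarrow> real) \<Rightarrow> rvec measure \<Rightarrow> bool" where
  "gaussian_law p mu Sg P \<longleftrightarrow>
     law_on p P \<and> mu \<in> Rvec p \<and> sym_psd p Sg \<and>
     (\<forall>u\<in>Rvec p. distr P borel (dotp p u) = normal_law (dotp p u mu) (dotp p u (mat_apply p Sg u)))"

(* Infinite when no admissible t exists. *)
definition subgaussian_norm :: "'w measure \<Rightarrow> ('w \<Rightarrow> real) \<Rightarrow> ennreal" where
  "subgaussian_norm M Z =
     (INF t \<in> {t::real. 0 < t \<and> (\<integral>\<^sup>+\<omega>. ennreal (exp ((Z \<omega>)\<^sup>2 / t\<^sup>2)) \<partial>M) \<le> 2}. ennreal t)"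

definition iid_sample :: "'w measure \<Rightarrow> nat \<Rightarrow> 'b::topological_space measure \<Rightarrow> (nat \<Rightarrow> 'w \<Rightarrow> 'b) \<Rightarrow> bool" where
  "iid_sample M n P X \<longleftrightarrow>
     prob_space.indep_vars M (\<lambda>_. borel) X {..<n} \<and> (\<forall>i<n. distr M borel (X i) = P)"

definition sample_algebra :: "'w measure \<Rightarrow> nat \<Rightarrow> (nat \<Rightarrow> 'w \<Rightarrow> 'b::topological_space) \<Rightarrow> 'w measure" where
  "sample_algebra M n X =
     vimage_algebra (space M) (\<lambda>\<omega>. \<lambda>i\<in>{..<n}. X i \<omega>) (\<Pi>\<^sub>M i\<in>{..<n}. borel)"

(* Features X_i i.i.d. with law P, noise variables e_i i.i.d. with law Q, and the noise sample
   independent of the feature sample; i ranges over 0, ..., n - 1. *)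
definition regression_sample ::
  "'w measure \<Rightarrow> nat \<Rightarrow> rvec measure \<Rightarrow> real measure \<Rightarrow> (nat \<Rightarrow> 'w \<Rightarrow> rvec) \<Rightarrow> (nat \<Rightarrow> 'w \<Rightarrow> real) \<Rightarrow> bool" where
  "regression_sample M n P Q X e \<longleftrightarrow>
     iid_sample M n P X \<and> iid_sample M n Q e \<and>
     prob_space.indep_set M (sets (sample_algebra M n X)) (sets (sample_algebra M n e))"


definition label :: "(real ^ 'm::finite \<Rightarrow> real \<Rightarrow> real) \<Rightarrow> nat \<Rightarrow> ('m \<Rightarrow> rvec) \<Rightarrow> rvec \<Rightarrow> real \<Rightarrow> real" where
  "label \<eta> p Ts v s = \<eta> (transp_mult p Ts v) s"

definition loss_F :: "(real \<Rightarrow> real \<Rightarrow> real) \<Rightarrow> (real ^ 'k::finite \<Rightarrow> real) \<Rightarrow> real ^ 'k \<Rightarrow> real \<Rightarrow> real" where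
  "loss_F L F v y = L (F v) y"

definition loss ::
  "(real \<Rightarrow> real \<Rightarrow> real) \<Rightarrow> (real ^ 'k::finite \<Rightarrow> real) \<Rightarrow> (real ^ 'm::finite \<Rightarrow> real \<Rightarrow> real)
   \<Rightarrow> (real ^ 'k) \<times> (real ^ 'm) \<Rightarrow> real \<Rightarrow> real" where
  "loss L F \<eta> w s = L (F (fst w)) (\<eta> (snd w) s)"

definition emp_risk ::
  "nat \<Rightarrow> nat \<Rightarrow> ((real ^ 'k::finite) \<times> (real ^ 'm::finite) \<Rightarrow> real \<Rightarrow> real) \<Rightarrow> (('k \<Rightarrow> rvec) \<Rightarrow> real)
   \<Rightarrow> ('m \<Rightarrow> rvec) \<Rightarrow> (nat \<Rightarrow> rvec) \<Rightarrow> (nat \<Rightarrow> real) \<Rightarrow> ('k \<Rightarrow> rvec) \<Rightarrow> real" where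
  "emp_risk n p ell r Ts x s T =
     1 / real n * (\<Sum>i<n. ell (transp_mult p T (x i), transp_mult p Ts (x i)) (s i)) + r T"

definition ERM ::
  "nat \<Rightarrow> nat \<Rightarrow> ((real ^ 'k::finite) \<times> (real ^ 'm::finite) \<Rightarrow> real \<Rightarrow> real) \<Rightarrow> (('k \<Rightarrow> rvec) \<Rightarrow> real)
   \<Rightarrow> ('m \<Rightarrow> rvec) \<Rightarrow> rvec set \<Rightarrow> (nat \<Rightarrow> rvec) \<Rightarrow> (nat \<Rightarrow> real) \<Rightarrow> real \<Rightarrow> ('k \<Rightarrow> rvec) set" where
  "ERM n p ell r Ts C x s t = {T. (\<forall>j. T j \<in> C) \<and> emp_risk n p ell r Ts x s T \<le> t}"

definition test_risk ::
  "nat \<Rightarrow> ((real ^ 'k::finite) \<times> (real ^ 'm::finite) \<Rightarrow> real \<Rightarrow> real) \<Rightarrow> ('m \<Rightarrow> rvec)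
   \<Rightarrow> rvec measure \<Rightarrow> real measure \<Rightarrow> ('k \<Rightarrow> rvec) \<Rightarrow> real" where
  "test_risk p ell Ts P Q T =
     (\<integral>z. ell (transp_mult p T (fst z), transp_mult p Ts (fst z)) (snd z) \<partial>(P \<Otimes>\<^sub>M Q))"

(* Equal to infinity on the empty set. *)
definition min_test_risk ::
  "nat \<Rightarrow> ((real ^ 'k::finite) \<times> (real ^ 'm::finite) \<Rightarrow> real \<Rightarrow> real) \<Rightarrow> ('m \<Rightarrow> rvec)
   \<Rightarrow> rvec measure \<Rightarrow> real measure \<Rightarrow> ('k \<Rightarrow> rvec) set \<Rightarrow> ereal" where
  "min_test_risk p ell Ts P Q A = (INF T\<in>A. ereal (test_risk p ell Ts P Q T))"


(* In the following, sequences are indexed by the sample size n, restricted to n > 0. *)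

definition proportional_regime :: "(nat \<Rightarrow> nat) \<Rightarrow> bool" where
  "proportional_regime p \<longleftrightarrow> (\<exists>C0>0. \<forall>n>0. 1 / C0 \<le> real (p n) / real n \<and> real (p n) / real n \<le> C0)"

definition constraint_sets :: "(nat \<Rightarrow> nat) \<Rightarrow> real \<Rightarrow> (nat \<Rightarrow> rvec set) \<Rightarrow> (nat \<Rightarrow> 'm::finite \<Rightarrow> rvec) \<Rightarrow> bool" where
  "constraint_sets p R C Ts \<longleftrightarrow>
     (\<forall>n>0. C n \<subseteq> Rvec (p n) \<and> compact (C n) \<and> (\<forall>v\<in>C n. norm2 (p n) v \<le> R) \<and>
            Ts n \<in> Rmat (p n) \<and> (\<forall>j. norm2 (p n) (Ts n j) \<le> R))"

definition penalty :: "(nat \<Rightarrow> nat) \<Rightarrow> (nat \<Rightarrow> ('k::finite \<Rightarrow> rvec) \<Rightarrow> real) \<Rightarrow> bool" where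
  "penalty p r \<longleftrightarrow>
     (\<forall>n>0. (\<forall>T\<in>Rmat (p n). 0 \<le> r n T) \<and> continuous_on (Rmat (p n)) (r n)) \<and>
     (\<forall>B>0. \<exists>K>0. \<forall>n>0. \<forall>T\<in>Rmat (p n). \<forall>T'\<in>Rmat (p n).
        frob_norm (p n) T \<le> B \<longrightarrow> frob_norm (p n) T' \<le> B \<longrightarrow>
        \<bar>r n T - r n T'\<bar> \<le> K * frob_norm (p n) (mat_diff T T'))"

definition domain_of_gaussianity ::
  "(nat \<Rightarrow> nat) \<Rightarrow> (nat \<Rightarrow> rvec measure) \<Rightarrow> (nat \<Rightarrow> rvec measure) \<Rightarrow> (nat \<Rightarrow> rvec set) \<Rightarrow> bool" where
  "domain_of_gaussianity p Px Pg S \<longleftrightarrow>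
     (\<forall>n>0. S n \<subseteq> Rvec (p n) \<and> symmetric_convex (S n)) \<and>
     (\<forall>\<phi>::real \<Rightarrow> real. bounded (range \<phi>) \<and> (\<exists>K. K-lipschitz_on UNIV \<phi>) \<longrightarrow>
        (\<lambda>n. SUP u\<in>S n. \<bar>(\<integral>v. \<phi> (dotp (p n) u v) \<partial>Pg n) - (\<integral>v. \<phi> (dotp (p n) u v) \<partial>Px n)\<bar>)
          \<longlonglongrightarrow> 0)"

definition restricted_subgaussian ::
  "(nat \<Rightarrow> nat) \<Rightarrow> real \<Rightarrow> (nat \<Rightarrow> rvec measure) \<Rightarrow> (nat \<Rightarrow> rvec) \<Rightarrow> (nat \<Rightarrow> nat \<Rightarrow> nat \<Rightarrow> real)
   \<Rightarrow> (nat \<Rightarrow> rvec set) \<Rightarrow> bool" where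
  "restricted_subgaussian p R Px mu Sg S \<longleftrightarrow>
     (\<forall>n>0. \<forall>u\<in>S n. norm2 (p n) u \<le> R) \<and>
     (\<exists>K. \<forall>n>0.
        (\<forall>u\<in>S n. norm2 (p n) u \<le> 1 \<longrightarrow> subgaussian_norm (Px n) (\<lambda>v. dotp (p n) v u) \<le> ennreal K) \<and>
        (\<exists>A. psd_sqrt (p n) (Sg n) A \<and>
             (\<forall>u\<in>S n. norm2 (p n) u \<le> 1 \<longrightarrow> norm2 (p n) (mat_apply (p n) A u) \<le> K)) \<and>
        norm2 (p n) (mu n) \<le> K)"

(* Q n is the common law of the noise variables.  The norm of a pair is the Euclidean norm. *)
definition alternative_I ::
  "((real ^ 'k::finite) \<times> (real ^ 'm::finite) \<Rightarrow> real \<Rightarrow> real) \<Rightarrow> (nat \<Rightarrow> real measure) \<Rightarrow> bool" where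
  "alternative_I ell Q \<longleftrightarrow>
     (\<exists>K. \<forall>n>0. subgaussian_norm (Q n) (\<lambda>s. s) \<le> ennreal K) \<and>
     (\<forall>w s. 0 \<le> ell w s) \<and>
     ((\<exists>K. \<forall>w s w' s'. \<bar>ell w s - ell w' s'\<bar> \<le> K * (norm (w - w') + \<bar>s - s'\<bar>)) \<or>
      ((\<forall>B>0. \<exists>K. \<forall>w s w' s'. norm (w, s) \<le> B \<longrightarrow> norm (w', s') \<le> B \<longrightarrow>
           \<bar>ell w s - ell w' s'\<bar> \<le> K * (norm (w - w') + \<bar>s - s'\<bar>)) \<and>
       (\<exists>K0 K1 K a b. 0 < K1 \<and> 0 < a \<and> a \<le> b \<and>
           (\<forall>w s. - K0 + K1 * (norm w powr a + \<bar>s\<bar> powr a) \<le> ell w s \<and>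
                  ell w s \<le> K * (1 + norm w powr b + \<bar>s\<bar> powr b)))))"

(* y takes the values 1 and -1, and P(y = 1 | x) = h x almost surely. *)
definition binary_label :: "'w measure \<Rightarrow> ('w \<Rightarrow> rvec) \<Rightarrow> ('w \<Rightarrow> real) \<Rightarrow> (rvec \<Rightarrow> real) \<Rightarrow> bool" where
  "binary_label M x y h \<longleftrightarrow>
     (AE \<omega> in M. y \<omega> = 1 \<or> y \<omega> = - 1) \<and>
     (AE \<omega> in M. real_cond_exp M (vimage_algebra (space M) x borel)
                    (indicator {\<omega>'\<in>space M. y \<omega>' = 1}) \<omega> = h (x \<omega>))"

definition alternative_II ::
  "(real \<Rightarrow> real \<Rightarrow> real) \<Rightarrow> (real ^ 'k::finite \<Rightarrow> real) \<Rightarrow> (real ^ 'm::finite \<Rightarrow> real \<Rightarrow> real)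
   \<Rightarrow> (nat \<Rightarrow> nat) \<Rightarrow> (nat \<Rightarrow> 'm \<Rightarrow> rvec) \<Rightarrow> (nat \<Rightarrow> 'w measure)
   \<Rightarrow> (nat \<Rightarrow> nat \<Rightarrow> 'w \<Rightarrow> rvec) \<Rightarrow> (nat \<Rightarrow> nat \<Rightarrow> 'w \<Rightarrow> rvec) \<Rightarrow> (nat \<Rightarrow> nat \<Rightarrow> 'w \<Rightarrow> real) \<Rightarrow> bool" where
  "alternative_II L F \<eta> p Ts M X G e \<longleftrightarrow>
     (\<forall>v y. 0 \<le> loss_F L F v y) \<and>
     (\<exists>K. \<forall>v v' y y'.
        \<bar>loss_F L F v y - loss_F L F v' y\<bar> \<le> K * (1 + \<bar>y\<bar>) * norm (v - v') \<and>
        \<bar>loss_F L F v y - loss_F L F v y'\<bar> \<le> K * (1 + norm v) * \<bar>y - y'\<bar>) \<and>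
     (\<exists>g :: real ^ 'm \<Rightarrow> real.
        (\<forall>v. 0 \<le> g v \<and> g v \<le> 1) \<and>
        (\<exists>K. \<forall>v v'. \<bar>g v - g v'\<bar> \<le> K * (1 + norm v + norm v') * norm (v - v')) \<and>
        (\<forall>n. \<forall>i<n.
           binary_label (M n) (X n i) (\<lambda>\<omega>. label \<eta> (p n) (Ts n) (X n i \<omega>) (e n i \<omega>))
             (\<lambda>v. g (transp_mult (p n) (Ts n) v)) \<and>
           binary_label (M n) (G n i) (\<lambda>\<omega>. label \<eta> (p n) (Ts n) (G n i \<omega>) (e n i \<omega>))
             (\<lambda>v. g (transp_mult (p n) (Ts n) v))))"

end

theory Submission
  imports Defs
begin
text \<open>
  The sublevel set \<open>A\<close> of the Gaussian test error inside the constraint set is compact, and the best test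
  error among the \<open>t\<close>-near-minimizers is at most \<open>\<rho>\<close> iff the empirical risk drops to \<open>t\<close> somewhere on \<open>A\<close>.
  So it suffices that the two test errors are uniformly close and that, for arbitrary compact \<open>A\<close>, the
  minimum of the empirical risk over \<open>A\<close> is universal up to an arbitrarily small change of the level.

  For the latter the minimum is replaced by a free energy of the capped loss over a finite net of \<open>A\<close>.
  The features enter only through linear forms with coefficients in the symmetric convex set \<open>S\<close>, so a net
  in the gauge of \<open>S\<close> is fine enough, and a volume argument bounds its cardinality exponentially in the
  dimension. Capping is harmless because a Gibbs measure gives least weight to the points at the cap.
  The samples are then exchanged one at a time: the effect of one sample on the free energy is a cavity
  term, a smooth function of a weighted average of bounded factors; after polynomial approximation it is a
  weighted average of functions of boundedly many linear forms. Trigonometric approximation reduces its expectation to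
  expectations of the cosine of a single linear form, where the domain of Gaussianity applies.
\<close>

subsection \<open>Free energies and Gibbs weights\<close>

text \<open>The dimension is proportional to \<open>n\<close>, so a net has exponentially many
  points, and the hypotheses speak of one linear form at a time. The entropy of the net costs
  \<open>c / \<beta>\<close> per sample, with \<open>c\<close> independent of \<open>n\<close>; so
  \<open>\<beta>\<close> is a constant, and what one exchange leaves beyond first order is of size
  \<open>1 / n^2\<close>. The weights in the cavity term come from all the other samples and have as
  many atoms as the net, so the comparison must be uniform over all weights on all finite sets. It
  can be, because averaging over the net does not increase the total coefficient of a trigonometric
  sum, a polynomial in the average involves only products of bounded length, and sums of linear
  forms with coefficients in \<open>S\<close> have coefficients in a multiple of \<open>S\<close>.
  Euclidean closeness of coefficient vectors does not control the linear forms; closeness in the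
  gauge of \<open>S\<close> does, because exponential moments are bounded on \<open>S\<close>. The
  constants are chosen along these dependencies: gap between the levels, cap, radius of the net,
  \<open>\<beta>\<close>, accuracy of the cavity comparison, and \<open>n\<close> last.\<close>

definition partition_sum :: "real \<Rightarrow> 'i set \<Rightarrow> ('i \<Rightarrow> real) \<Rightarrow> real" where
  "partition_sum \<beta> N E = (\<Sum>i\<in>N. exp (- \<beta> * E i))"

definition gibbs :: "real \<Rightarrow> 'i set \<Rightarrow> ('i \<Rightarrow> real) \<Rightarrow> 'i \<Rightarrow> real" where
  "gibbs \<beta> N E i = exp (- \<beta> * E i) / partition_sum \<beta> N E"

definition free_energy :: "real \<Rightarrow> 'i set \<Rightarrow> ('i \<Rightarrow> real) \<Rightarrow> real" where
  "free_energy \<beta> N E = - ln (partition_sum \<beta> N E) / \<beta>"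

text \<open>The increment of the free energy when the energies \<open>h\<close> of one more sample
  are added to energies whose Gibbs weights are \<open>\<nu>\<close>. Later bounds allow arbitrary
  weights, since the Gibbs weights depend on all other samples.\<close>

definition cavity :: "real \<Rightarrow> 'i set \<Rightarrow> ('i \<Rightarrow> real) \<Rightarrow> ('i \<Rightarrow> real) \<Rightarrow> real" where
  "cavity \<beta> N \<nu> h = - ln (\<Sum>i\<in>N. \<nu> i * exp (- \<beta> * h i)) / \<beta>"

definition weights :: "'i set \<Rightarrow> ('i \<Rightarrow> real) \<Rightarrow> bool" where
  "weights N \<nu> \<longleftrightarrow> (\<forall>i\<in>N. 0 \<le> \<nu> i) \<and> sum \<nu> N = 1"

lemma partition_sum_pos: "finite N \<Longrightarrow> N \<noteq> {} \<Longrightarrow> 0 < partition_sum \<beta> N E"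
  unfolding partition_sum_def by (rule sum_pos) auto

lemma weights_gibbs:
  assumes "finite N" "N \<noteq> {}"
  shows "weights N (gibbs \<beta> N E)"
  using partition_sum_pos[OF assms, of \<beta> E]
  unfolding weights_def gibbs_def
  by (auto simp flip: sum_divide_distrib simp: partition_sum_def)

lemma weights_sum_exp_pos:
  assumes "finite N" "weights N \<nu>"
  shows "0 < (\<Sum>i\<in>N. \<nu> i * exp (- \<beta> * h i))"
proof -
  obtain i where "i \<in> N" "\<nu> i > 0"
    using assms unfolding weights_def
    by (metis less_eq_real_def sum.neutral zero_neq_one)
  then show ?thesis
    using assms by (intro sum_pos2[of N i]) (auto simp: weights_def)
qed

lemma weighted_average_le:
  assumes "finite N" "weights N \<nu>" "\<And>i. i \<in> N \<Longrightarrow> f i \<le> (c :: real)"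
  shows "(\<Sum>i\<in>N. \<nu> i * f i) \<le> c"
proof -
  have "(\<Sum>i\<in>N. \<nu> i * f i) \<le> (\<Sum>i\<in>N. \<nu> i * c)"
    using assms by (intro sum_mono mult_left_mono) (auto simp: weights_def)
  also have "\<dots> = c" using assms(2) by (simp add: weights_def flip: sum_distrib_right)
  finally show ?thesis .
qed

lemma weighted_average_ge:
  assumes "finite N" "weights N \<nu>" "\<And>i. i \<in> N \<Longrightarrow> (c :: real) \<le> f i"
  shows "c \<le> (\<Sum>i\<in>N. \<nu> i * f i)"
  using weighted_average_le[OF assms(1,2), of "\<lambda>i. - f i" "- c"] assms(3) by (simp add: sum_negf)

lemma free_energy_le:
  assumes "finite N" "i \<in> N" "\<beta> > 0"
  shows "free_energy \<beta> N E \<le> E i"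
proof -
  have "exp (- \<beta> * E i) \<le> partition_sum \<beta> N E"
    unfolding partition_sum_def using assms by (intro member_le_sum) auto
  then have "- \<beta> * E i \<le> ln (partition_sum \<beta> N E)"
    by (metis exp_gt_zero ln_exp ln_mono order_less_le_trans)
  then show ?thesis unfolding free_energy_def using assms by (simp add: field_simps)
qed

text \<open>The Gibbs variational principle: the entropy of the Gibbs weights is at most \<open>ln (card N)\<close>.\<close>
lemma gibbs_average_le:
  assumes "finite N" "N \<noteq> {}" "\<beta> > 0"
  shows "(\<Sum>i\<in>N. gibbs \<beta> N E i * E i) \<le> free_energy \<beta> N E + ln (card N) / \<beta>"
proof -
  let ?Z = "partition_sum \<beta> N E" and ?w = "gibbs \<beta> N E"
  have Z: "0 < ?Z" using assms partition_sum_pos by blast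
  have c: "0 < real (card N)" using assms by (simp add: card_gt_0_iff)
  have w: "?w i > 0" for i using Z by (simp add: gibbs_def)
  have lnw: "ln (1 / (?w i * card N)) = \<beta> * E i + ln ?Z - ln (card N)" for i
    using Z c w[of i] by (simp add: gibbs_def ln_div ln_mult)
  \<comment> \<open>\<open>ln x \<le> x - 1\<close> at the ratio of the uniform weight to the Gibbs
    weight: the relative entropy of the Gibbs weights with respect to the uniform ones is
    nonnegative.\<close>
  have "(\<Sum>i\<in>N. ?w i * (\<beta> * E i + ln ?Z - ln (card N))) \<le> (\<Sum>i\<in>N. ?w i * (1 / (?w i * card N) - 1))"
    unfolding lnw[symmetric] using w c
    by (intro sum_mono mult_left_mono ln_le_minus_one) (auto simp: less_imp_le)
  also have "\<dots> = (\<Sum>i\<in>N. 1 / card N - ?w i)"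
  proof (rule sum.cong[OF refl])
    fix i
    show "?w i * (1 / (?w i * card N) - 1) = 1 / card N - ?w i"
      using w[of i] c by (simp add: field_simps)
  qed
  also have "\<dots> = 0"
    using weights_gibbs[OF assms(1,2), of \<beta> E] c by (simp add: sum_subtractf weights_def)
  finally have "(\<Sum>i\<in>N. ?w i * (\<beta> * E i) + ?w i * (ln ?Z - ln (card N))) \<le> 0"
    by (simp add: algebra_simps)
  then have "\<beta> * (\<Sum>i\<in>N. ?w i * E i) + (ln ?Z - ln (card N)) * sum ?w N \<le> 0"
    by (simp add: sum.distrib sum_distrib_left mult_ac flip: sum_distrib_right)
  then have "\<beta> * (\<Sum>i\<in>N. ?w i * E i) \<le> ln (card N) - ln ?Z"
    using weights_gibbs[OF assms(1,2), of \<beta> E] by (simp add: weights_def)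
  then show ?thesis using assms(3) unfolding free_energy_def by (simp add: field_simps)
qed

text \<open>Multiplying Gibbs weights by the Boltzmann factor of \<open>h\<close> gives the
  unnormalised Gibbs weights of \<open>E + h\<close>. With \<open>g = 1\<close> the sum is the ratio
  of the two partition sums.\<close>

lemma gibbs_cavity_sum:
  "(\<Sum>i\<in>N. gibbs \<beta> N E i * (exp (- \<beta> * h i) * g i)) =
    (\<Sum>i\<in>N. exp (- \<beta> * (E i + h i)) * g i) / partition_sum \<beta> N E"
  by (simp add: gibbs_def sum_divide_distrib algebra_simps flip: exp_add)

lemma free_energy_add:
  assumes "finite N" "N \<noteq> {}"
  shows "free_energy \<beta> N (\<lambda>i. E i + h i) = free_energy \<beta> N E + cavity \<beta> N (gibbs \<beta> N E) h"
proof -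
  have "(\<Sum>i\<in>N. gibbs \<beta> N E i * exp (- \<beta> * h i)) = partition_sum \<beta> N (\<lambda>i. E i + h i) / partition_sum \<beta> N E"
    using gibbs_cavity_sum[of \<beta> N E h "\<lambda>_. 1"] by (simp add: partition_sum_def)
  then show ?thesis
    using partition_sum_pos[OF assms, of \<beta> E] partition_sum_pos[OF assms, of \<beta> "\<lambda>i. E i + h i"]
    unfolding free_energy_def cavity_def
    by (simp add: ln_div add_divide_distrib diff_divide_distrib)
qed

text \<open>An average of Boltzmann factors lies between \<open>exp (- \<beta> * B)\<close> and 1.
  The resulting bound is free of the weights and of the size of \<open>N\<close>, which is why the
  loss is capped before the samples are exchanged.\<close>

lemma cavity_bounds:
  assumes "finite N" "weights N \<nu>" "\<beta> > 0" "\<And>i. i \<in> N \<Longrightarrow> 0 \<le> h i \<and> h i \<le> B"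
  shows "0 \<le> cavity \<beta> N \<nu> h" "cavity \<beta> N \<nu> h \<le> B"
proof -
  let ?s = "\<Sum>i\<in>N. \<nu> i * exp (- \<beta> * h i)"
  have "?s \<le> 1" using assms by (intro weighted_average_le) auto
  moreover have pos: "?s > 0" using weights_sum_exp_pos assms by blast
  ultimately have "ln ?s \<le> 0" by simp
  then show "0 \<le> cavity \<beta> N \<nu> h" unfolding cavity_def using assms(3) by (simp add: field_simps)
  have "exp (- \<beta> * B) \<le> ?s" using assms by (intro weighted_average_ge) auto
  then have "- \<beta> * B \<le> ln ?s" by (metis exp_gt_zero ln_exp ln_mono order_less_le_trans)
  then show "cavity \<beta> N \<nu> h \<le> B" unfolding cavity_def using assms(3) by (simp add: field_simps)
qed

text \<open>Where the capped loss \<open>h\<close> reaches its cap \<open>B\<close>, its Boltzmann factor is minimal; so tilting by it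
  cannot increase the average of a function supported there.\<close>
lemma gibbs_tilt_le:
  assumes "finite N" "N \<noteq> {}" "\<beta> > 0" "\<And>i. i \<in> N \<Longrightarrow> h i \<le> B"
    and "\<And>i. i \<in> N \<Longrightarrow> 0 \<le> g i" "\<And>i. i \<in> N \<Longrightarrow> g i \<noteq> 0 \<Longrightarrow> h i = B"
  shows "(\<Sum>i\<in>N. gibbs \<beta> N (\<lambda>i. E i + h i) i * g i) \<le> (\<Sum>i\<in>N. gibbs \<beta> N E i * g i)"
proof -
  let ?w = "gibbs \<beta> N E"
  let ?s = "\<Sum>i\<in>N. ?w i * exp (- \<beta> * h i)"
  have w: "weights N ?w" using weights_gibbs assms by blast
  have Z: "0 < partition_sum \<beta> N E" using assms partition_sum_pos by blast
  have s: "?s = partition_sum \<beta> N (\<lambda>i. E i + h i) / partition_sum \<beta> N E"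
    using gibbs_cavity_sum[of \<beta> N E h "\<lambda>_. 1"] by (simp add: partition_sum_def)
  have spos: "0 < ?s" using weights_sum_exp_pos w assms by blast
  have sB: "exp (- \<beta> * B) \<le> ?s" using assms w by (intro weighted_average_ge) auto
  have nn: "0 \<le> (\<Sum>i\<in>N. ?w i * g i)"
    using w assms by (intro sum_nonneg mult_nonneg_nonneg) (auto simp: weights_def)
  have "(\<Sum>i\<in>N. gibbs \<beta> N (\<lambda>i. E i + h i) i * g i) =
        (\<Sum>i\<in>N. exp (- \<beta> * (E i + h i)) * g i) / partition_sum \<beta> N (\<lambda>i. E i + h i)"
    by (simp add: gibbs_def sum_divide_distrib)
  also have "\<dots> = (\<Sum>i\<in>N. ?w i * (exp (- \<beta> * h i) * g i)) / ?s"
    unfolding gibbs_cavity_sum s using Z by simp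
  also have "(\<Sum>i\<in>N. ?w i * (exp (- \<beta> * h i) * g i)) = exp (- \<beta> * B) * (\<Sum>i\<in>N. ?w i * g i)"
    unfolding sum_distrib_left using assms(6) by (intro sum.cong) auto
  also have "\<dots> / ?s \<le> ?s * (\<Sum>i\<in>N. ?w i * g i) / ?s"
    using nn sB spos by (intro divide_right_mono mult_right_mono) auto
  finally show ?thesis using spos by simp
qed

subsection \<open>Replacing the rows one at a time\<close>

lemma measurable_partition_sum [measurable]:
  "(\<And>i. i \<in> N \<Longrightarrow> (\<lambda>x. E x i) \<in> borel_measurable M) \<Longrightarrow> (\<lambda>x. partition_sum \<beta> N (E x)) \<in> borel_measurable M"
  unfolding partition_sum_def by measurable

lemma measurable_free_energy [measurable]:
  "(\<And>i. i \<in> N \<Longrightarrow> (\<lambda>x. E x i) \<in> borel_measurable M) \<Longrightarrow> (\<lambda>x. free_energy \<beta> N (E x)) \<in> borel_measurable M"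
  unfolding free_energy_def
  by (intro borel_measurable_divide borel_measurable_uminus borel_measurable_ln measurable_partition_sum) auto

lemma measurable_gibbs:
  "(\<And>i. i \<in> N \<Longrightarrow> (\<lambda>x. E x i) \<in> borel_measurable M) \<Longrightarrow> i \<in> N \<Longrightarrow>
    (\<lambda>x. gibbs \<beta> N (E x) i) \<in> borel_measurable M"
  unfolding gibbs_def
  by (intro borel_measurable_divide borel_measurable_exp borel_measurable_times measurable_partition_sum) auto

lemma measurable_cavity [measurable]:
  "(\<And>i. i \<in> N \<Longrightarrow> (\<lambda>x. h x i) \<in> borel_measurable M) \<Longrightarrow> (\<lambda>x. cavity \<beta> N \<nu> (h x)) \<in> borel_measurable M"
  unfolding cavity_def
  by (intro borel_measurable_divide borel_measurable_uminus borel_measurable_ln borel_measurable_sum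
      borel_measurable_times borel_measurable_exp) auto

text \<open>One sample moves the argument of \<open>\<psi>\<close> by \<open>h z / n\<close> only,
  so a first-order expansion suffices: it isolates the mean of \<open>h\<close>, and the remainder
  of size \<open>1 / n^2\<close> still vanishes after summation over \<open>n\<close>
  samples.\<close>

lemma lindeberg_step:
  fixes \<psi> \<psi>' :: "real \<Rightarrow> real"
  assumes "prob_space D" "h \<in> borel_measurable D" "\<And>z. 0 \<le> h z \<and> h z \<le> B" "n > 0" "B \<ge> 0"
    and \<psi>: "\<And>x. 0 \<le> \<psi> x \<and> \<psi> x \<le> 1" "\<psi> \<in> borel_measurable borel"
    and \<psi>': "\<And>a t. \<bar>\<psi> (a + t) - \<psi> a - \<psi>' a * t\<bar> \<le> c2 * t\<^sup>2" "c2 \<ge> 0"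
  shows "\<bar>(\<integral>z. \<psi> (a + h z / real n) \<partial>D) - \<psi> a - \<psi>' a * (\<integral>z. h z \<partial>D) / real n\<bar> \<le> c2 * B\<^sup>2 / (real n)\<^sup>2"
proof -
  interpret D: prob_space D by fact
  note [measurable] = assms(2) \<psi>(2)
  have ih: "integrable D h"
    by (rule D.integrable_const_bound[where B=B]) (use assms in auto)
  have ip: "integrable D (\<lambda>z. \<psi> (a + h z / real n))"
    by (rule D.integrable_const_bound[where B=1]) (use \<psi> in auto)
  have eq: "(\<integral>z. \<psi> (a + h z / real n) \<partial>D) - \<psi> a - \<psi>' a * (\<integral>z. h z \<partial>D) / real n =
    (\<integral>z. \<psi> (a + h z / real n) - \<psi> a - \<psi>' a * (h z / real n) \<partial>D)"
    using ih ip by (simp add: D.prob_space)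
  have "\<bar>\<integral>z. \<psi> (a + h z / real n) - \<psi> a - \<psi>' a * (h z / real n) \<partial>D\<bar> \<le>
     (\<integral>z. \<bar>\<psi> (a + h z / real n) - \<psi> a - \<psi>' a * (h z / real n)\<bar> \<partial>D)"
    by (rule integral_abs_bound)
  also have "\<dots> \<le> (\<integral>z. c2 * B\<^sup>2 / (real n)\<^sup>2 \<partial>D)"
  proof (rule integral_mono)
    show "integrable D (\<lambda>z. \<bar>\<psi> (a + h z / real n) - \<psi> a - \<psi>' a * (h z / real n)\<bar>)"
      using ih ip by (intro integrable_abs Bochner_Integration.integrable_diff) auto
    fix z
    have "\<bar>\<psi> (a + h z / real n) - \<psi> a - \<psi>' a * (h z / real n)\<bar> \<le> c2 * (h z / real n)\<^sup>2"
      by (rule \<psi>')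
    also have "\<dots> \<le> c2 * (B / real n)\<^sup>2"
      using assms by (intro mult_left_mono power_mono divide_right_mono) auto
    finally show "\<bar>\<psi> (a + h z / real n) - \<psi> a - \<psi>' a * (h z / real n)\<bar> \<le> c2 * B\<^sup>2 / (real n)\<^sup>2"
      by (simp add: power_divide)
  qed auto
  also have "\<dots> = c2 * B\<^sup>2 / (real n)\<^sup>2" by (simp add: D.prob_space)
  finally show ?thesis unfolding eq .
qed

lemma lindeberg_swap:
  fixes l :: "'i \<Rightarrow> 'z \<Rightarrow> real" and r :: "'i \<Rightarrow> real" and \<psi> \<psi>' :: "real \<Rightarrow> real"
  assumes D: "prob_space D1" "prob_space D2" "sets D1 = sets D2"
    and N: "finite N" "N \<noteq> {}" and n: "n > 0" and \<beta>: "\<beta> > 0" and B: "B \<ge> 0"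
    and l: "\<And>i. i \<in> N \<Longrightarrow> l i \<in> borel_measurable D1" "\<And>i z. i \<in> N \<Longrightarrow> 0 \<le> l i z \<and> l i z \<le> B"
    and \<kappa>: "\<And>\<nu>. weights N \<nu> \<Longrightarrow>
      \<bar>(\<integral>z. cavity \<beta> N \<nu> (\<lambda>i. l i z) \<partial>D1) - (\<integral>z. cavity \<beta> N \<nu> (\<lambda>i. l i z) \<partial>D2)\<bar> \<le> \<kappa>"
    and \<psi>: "\<And>x. 0 \<le> \<psi> x \<and> \<psi> x \<le> 1" "\<psi> \<in> borel_measurable borel"
    and \<psi>': "\<And>a t. \<bar>\<psi> (a + t) - \<psi> a - \<psi>' a * t\<bar> \<le> c2 * t\<^sup>2" "c2 \<ge> 0" "\<And>a. \<bar>\<psi>' a\<bar> \<le> c1"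
  defines "f \<equiv> (\<lambda>Z. free_energy \<beta> N (\<lambda>i. r i + (\<Sum>a<n. l i (Z a))) / real n)"
  shows "\<bar>(\<integral>Z. \<psi> (f Z) \<partial>(\<Pi>\<^sub>M a\<in>{..<n}. D1)) - (\<integral>Z. \<psi> (f Z) \<partial>(\<Pi>\<^sub>M a\<in>{..<n}. D2))\<bar>
    \<le> c1 * \<kappa> + 2 * c2 * B\<^sup>2 / real n"
proof -
  interpret D1: prob_space D1 by fact
  interpret D2: prob_space D2 by fact
  define H where "H m a = (if a < m then D2 else D1)" for m a :: nat
  interpret H: product_prob_space "H m" for m
    by (simp add: H_def D product_prob_space_def product_prob_space_axioms_def product_sigma_finite_def
        D1.sigma_finite_measure_axioms D2.sigma_finite_measure_axioms)
  have HP: "prob_space (H m a)" for m a by (simp add: H_def D)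
  have [measurable]: "l i \<in> borel_measurable D2" if "i \<in> N" for i
    using l(1)[OF that] D(3) measurable_cong_sets by blast
  have lH [measurable]: "l i \<in> borel_measurable (H m a)" if "i \<in> N" for i m a
    using l(1)[OF that] that by (simp add: H_def)
  note [measurable] = l(1) \<psi>(2)
  define c where "c = c1 * (\<kappa> / real n) + 2 * (c2 * B\<^sup>2 / (real n)\<^sup>2)"
  define I where "I m = (\<integral>Z. \<psi> (f Z) \<partial>(PiM {..<n} (H m)))" for m
  have step: "\<bar>I m - I (Suc m)\<bar> \<le> c" if m: "m < n" for m
  proof -
    define J where "J = {..<n} - {m}"
    have J: "insert m J = {..<n}" "m \<notin> J" "finite J" using m by (auto simp: J_def)
    have split: "(\<Sum>a<n. F a) = F m + (\<Sum>a\<in>J. F a)" for F :: "nat \<Rightarrow> real"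
      unfolding J_def using m by (intro sum.remove) auto
    define E where "E Z i = r i + (\<Sum>a\<in>J. l i (Z a))" for Z i
    have f_upd: "f (Z(m := z)) = free_energy \<beta> N (E Z) / real n +
        cavity \<beta> N (gibbs \<beta> N (E Z)) (\<lambda>i. l i z) / real n" for Z z
    proof -
      have "r i + (\<Sum>a<n. l i ((Z(m := z)) a)) = E Z i + l i z" for i
      proof -
        have "(\<Sum>a\<in>J. l i ((Z(m := z)) a)) = (\<Sum>a\<in>J. l i (Z a))"
          using J(2) by (intro sum.cong) auto
        then show ?thesis unfolding E_def using split[of "\<lambda>a. l i ((Z(m := z)) a)"] by simp
      qed
      then show ?thesis unfolding f_def using free_energy_add[OF N, of \<beta> "E Z" "\<lambda>i. l i z"]
        by (simp add: add_divide_distrib)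
    qed
    \<comment> \<open>The two consecutive hybrids differ in coordinate \<open>m\<close> only, so
      their difference can be taken under one common integral over the remaining
      coordinates.\<close>
    have PJ: "PiM J (H (Suc m)) = PiM J (H m)"
      by (rule PiM_cong) (auto simp: H_def J_def)
    have fm: "(\<lambda>Z. \<psi> (f Z)) \<in> borel_measurable (PiM (insert m J) (H m'))" for m'
      unfolding f_def J(1) by (measurable; simp add: lH)
    have int: "integrable (PiM (insert m J) (H m')) (\<lambda>Z. \<psi> (f Z))" for m'
    proof -
      interpret Pm: prob_space "PiM (insert m J) (H m')" by (rule prob_space_PiM) (rule HP)
      show ?thesis using \<psi> by (intro Pm.integrable_const_bound[where B=1] fm) auto
    qed
    have Im: "I m' = (\<integral>Z. (\<integral>z. \<psi> (f (Z(m := z))) \<partial>H m' m) \<partial>PiM J (H m'))" for m'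
      unfolding I_def J(1)[symmetric] by (rule H.product_integral_insert[OF J(3,2) int])
    have meas: "(\<lambda>Z. \<integral>z. \<psi> (f (Z(m := z))) \<partial>H m' m) \<in> borel_measurable (PiM J (H m'))" for m'
    proof -
      have "(\<lambda>x. \<psi> (f (case x of (Z, z) \<Rightarrow> Z(m := z)))) \<in> borel_measurable (PiM J (H m') \<Otimes>\<^sub>M H m' m)"
        by (rule measurable_compose[OF measurable_add_dim fm])
      then have [measurable]: "(\<lambda>(Z, z). \<psi> (f (Z(m := z)))) \<in> borel_measurable (PiM J (H m') \<Otimes>\<^sub>M H m' m)"
        by (simp add: case_prod_unfold)
      interpret sigma_finite_measure "H m' m" by (simp add: H.sigma_finite_measures)
      show ?thesis by measurable
    qed
    interpret PJ: prob_space "PiM J (H m)" by (rule prob_space_PiM) (rule HP)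
    have ii: "integrable (PiM J (H m)) (\<lambda>Z. \<integral>z. \<psi> (f (Z(m := z))) \<partial>H m' m)"
      if "m' = m \<or> m' = Suc m" for m'
    proof (rule PJ.integrable_const_bound[where B=1])
      show "(\<lambda>Z. \<integral>z. \<psi> (f (Z(m := z))) \<partial>H m' m) \<in> borel_measurable (PiM J (H m))"
        using meas[of m'] that PJ by auto
      have "\<bar>\<integral>z. \<psi> (f (Z(m := z))) \<partial>H m' m\<bar> \<le> 1" for Z
      proof -
        \<comment> \<open>The integral of a function that is not integrable is 0, so the bound by 1
          holds for every \<open>Z\<close> without a discussion of measurability.\<close>
        have "(\<integral>z. \<psi> (f (Z(m := z))) \<partial>H m' m) \<le> 1"
          using prob_space.prob_space[OF HP] \<psi>
          by (cases "integrable (H m' m) (\<lambda>z. \<psi> (f (Z(m := z))))")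
             (auto intro!: prob_space.integral_le_const[OF HP] simp: not_integrable_integral_eq)
        moreover have "0 \<le> (\<integral>z. \<psi> (f (Z(m := z))) \<partial>H m' m)"
          using \<psi> by (intro Bochner_Integration.integral_nonneg) auto
        ultimately show ?thesis by simp
      qed
      then show "AE Z in PiM J (H m). norm (\<integral>z. \<psi> (f (Z(m := z))) \<partial>H m' m) \<le> 1" by simp
    qed
    have pt: "\<bar>(\<integral>z. \<psi> (f (Z(m := z))) \<partial>D1) - (\<integral>z. \<psi> (f (Z(m := z))) \<partial>D2)\<bar> \<le> c" for Z
    proof -
      define a where "a = free_energy \<beta> N (E Z) / real n"
      define \<nu> where "\<nu> = gibbs \<beta> N (E Z)"
      define h where "h z = cavity \<beta> N \<nu> (\<lambda>i. l i z)" for z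
      have w: "weights N \<nu>" unfolding \<nu>_def by (rule weights_gibbs[OF N])
      have h: "0 \<le> h z \<and> h z \<le> B" for z
        unfolding h_def using cavity_bounds[OF N(1) w \<beta>, of "\<lambda>i. l i z" B] l by auto
      have hm: "h \<in> borel_measurable D1" "h \<in> borel_measurable D2"
        unfolding h_def by measurable
      have s1: "\<bar>(\<integral>z. \<psi> (a + h z / real n) \<partial>D1) - \<psi> a - \<psi>' a * (\<integral>z. h z \<partial>D1) / real n\<bar> \<le> c2 * B\<^sup>2 / (real n)\<^sup>2"
        by (rule lindeberg_step[OF D(1) hm(1) h n B \<psi> \<psi>'(1,2)])
      have s2: "\<bar>(\<integral>z. \<psi> (a + h z / real n) \<partial>D2) - \<psi> a - \<psi>' a * (\<integral>z. h z \<partial>D2) / real n\<bar> \<le> c2 * B\<^sup>2 / (real n)\<^sup>2"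
        by (rule lindeberg_step[OF D(2) hm(2) h n B \<psi> \<psi>'(1,2)])
      have "\<bar>\<psi>' a * ((\<integral>z. h z \<partial>D1) - (\<integral>z. h z \<partial>D2))\<bar> \<le> c1 * \<kappa>"
        unfolding abs_mult using \<psi>'(3)[of a] \<kappa>[OF w] abs_ge_zero[of "\<psi>' a"]
        by (intro mult_mono) (auto simp: h_def[abs_def] simp del: abs_ge_zero)
      then have "\<bar>\<psi>' a * ((\<integral>z. h z \<partial>D1) - (\<integral>z. h z \<partial>D2))\<bar> / real n \<le> c1 * \<kappa> / real n"
        by (intro divide_right_mono) auto
      then have s3: "\<bar>\<psi>' a * (\<integral>z. h z \<partial>D1) / real n - \<psi>' a * (\<integral>z. h z \<partial>D2) / real n\<bar> \<le> c1 * (\<kappa> / real n)"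
        using n by (simp add: algebra_simps abs_divide flip: diff_divide_distrib)
      have "\<psi> (f (Z(m := z))) = \<psi> (a + h z / real n)" for z
        unfolding f_upd a_def h_def \<nu>_def ..
      then show ?thesis using s1 s2 s3 unfolding c_def by simp
    qed
    have "I m - I (Suc m) = (\<integral>Z. (\<integral>z. \<psi> (f (Z(m := z))) \<partial>H m m) - (\<integral>z. \<psi> (f (Z(m := z))) \<partial>H (Suc m) m) \<partial>PiM J (H m))"
      unfolding Im PJ using ii by (intro Bochner_Integration.integral_diff[symmetric]) auto
    also have "\<bar>\<dots>\<bar> \<le> (\<integral>Z. \<bar>(\<integral>z. \<psi> (f (Z(m := z))) \<partial>H m m) - (\<integral>z. \<psi> (f (Z(m := z))) \<partial>H (Suc m) m)\<bar> \<partial>PiM J (H m))"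
      by (rule integral_abs_bound)
    also have "\<dots> \<le> (\<integral>Z. c \<partial>PiM J (H m))"
      using ii[of m] ii[of "Suc m"] pt by (intro integral_mono integrable_abs Bochner_Integration.integrable_diff) (auto simp: H_def)
    also have "\<dots> = c" by (simp add: PJ.prob_space)
    finally show ?thesis .
  qed
  have "\<bar>I 0 - I m\<bar> \<le> real m * c" if "m \<le> n" for m
    using that
  proof (induction m)
    case (Suc m)
    then show ?case using step[of m] by (simp add: algebra_simps)
  qed auto
  from this[of n] have "\<bar>I 0 - I n\<bar> \<le> real n * c" by simp
  \<comment> \<open>The number of exchanges cancels the factor \<open>1 / n\<close> in front of
    \<open>\<kappa>\<close> and lowers the order of the quadratic remainder to
    \<open>1 / n\<close>.\<close>
  also have "real n * c = c1 * \<kappa> + 2 * c2 * B\<^sup>2 / real n"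
    using n by (simp add: c_def field_simps power2_eq_square)
  finally have "\<bar>I 0 - I n\<bar> \<le> c1 * \<kappa> + 2 * c2 * B\<^sup>2 / real n" .
  moreover have "PiM {..<n} (H 0) = (\<Pi>\<^sub>M a\<in>{..<n}. D1)" "PiM {..<n} (H n) = (\<Pi>\<^sub>M a\<in>{..<n}. D2)"
    by (auto intro!: PiM_cong simp: H_def)
  ultimately show ?thesis by (simp add: I_def)
qed

text \<open>The weights depend on the very sample whose excess \<open>g\<close> they average. Taking
  that sample out of the energy can only increase the average, by \<open>gibbs_tilt_le\<close>;
  afterwards weights and sample are independent, and integrating the sample alone gives
  \<open>\<epsilon>\<close>. The size of \<open>N\<close> does not enter.\<close>

lemma gibbs_overflow:
  fixes l g :: "'i \<Rightarrow> 'z \<Rightarrow> real"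
  assumes D: "prob_space D" and N: "finite N" "N \<noteq> {}" and \<beta>: "\<beta> > 0"
    and l: "\<And>i. i \<in> N \<Longrightarrow> l i \<in> borel_measurable D" "\<And>i z. i \<in> N \<Longrightarrow> l i z \<le> B"
    and g: "\<And>i. i \<in> N \<Longrightarrow> g i \<in> borel_measurable D" "\<And>i z. i \<in> N \<Longrightarrow> 0 \<le> g i z"
      "\<And>i z. i \<in> N \<Longrightarrow> g i z \<noteq> 0 \<Longrightarrow> l i z = B"
    and \<epsilon>: "\<And>i. i \<in> N \<Longrightarrow> (\<integral>\<^sup>+z. ennreal (g i z) \<partial>D) \<le> ennreal \<epsilon>" "\<epsilon> \<ge> 0"
  shows "(\<integral>\<^sup>+Z. ennreal (\<Sum>i\<in>N. gibbs \<beta> N (\<lambda>i. r i + (\<Sum>a<n. l i (Z a))) i * (\<Sum>a<n. g i (Z a)))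
            \<partial>(\<Pi>\<^sub>M a\<in>{..<n}. D)) \<le> ennreal (real n * \<epsilon>)"
proof -
  interpret D: prob_space D by fact
  interpret P: product_prob_space "\<lambda>_::nat. D"
    by (simp add: D product_prob_space_def product_prob_space_axioms_def product_sigma_finite_def
        D.sigma_finite_measure_axioms)
  note [measurable] = l(1) g(1)
  let ?w = "\<lambda>Z. gibbs \<beta> N (\<lambda>i. r i + (\<Sum>a<n. l i (Z a)))"
  have wm [measurable]: "(\<lambda>Z. ?w Z i) \<in> borel_measurable (\<Pi>\<^sub>M a\<in>{..<n}. D)" if "i \<in> N" for i
    using that by (intro measurable_gibbs) auto
  have w0: "0 \<le> ?w Z i" if "i \<in> N" for Z i
    using weights_gibbs[OF N] that by (auto simp: weights_def)
  have one: "(\<integral>\<^sup>+Z. ennreal (\<Sum>i\<in>N. ?w Z i * g i (Z m)) \<partial>(\<Pi>\<^sub>M a\<in>{..<n}. D)) \<le> ennreal \<epsilon>" if m: "m < n" for m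
  proof -
    define J where "J = {..<n} - {m}"
    have J: "insert m J = {..<n}" "m \<notin> J" "finite J" using m by (auto simp: J_def)
    have split: "(\<Sum>a<n. F a) = F m + (\<Sum>a\<in>J. F a)" for F :: "nat \<Rightarrow> real"
      unfolding J_def using m by (intro sum.remove) auto
    define E where "E Z i = r i + (\<Sum>a\<in>J. l i (Z a))" for Z i
    have E_upd: "(\<lambda>i. r i + (\<Sum>a<n. l i ((Z(m := z)) a))) = (\<lambda>i. E Z i + l i z)" for Z z
    proof
      fix i
      have "(\<Sum>a\<in>J. l i ((Z(m := z)) a)) = (\<Sum>a\<in>J. l i (Z a))"
        using J(2) by (intro sum.cong) auto
      then show "r i + (\<Sum>a<n. l i ((Z(m := z)) a)) = E Z i + l i z"
        unfolding E_def using split[of "\<lambda>a. l i ((Z(m := z)) a)"] by simp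
    qed
    have fm: "(\<lambda>Z. ennreal (\<Sum>i\<in>N. ?w Z i * g i (Z m))) \<in> borel_measurable (\<Pi>\<^sub>M a\<in>insert m J. D)"
      unfolding J(1) by (measurable; use m in simp)
    have "(\<integral>\<^sup>+Z. ennreal (\<Sum>i\<in>N. ?w Z i * g i (Z m)) \<partial>(\<Pi>\<^sub>M a\<in>{..<n}. D)) =
        (\<integral>\<^sup>+Z. (\<integral>\<^sup>+z. ennreal (\<Sum>i\<in>N. ?w (Z(m := z)) i * g i ((Z(m := z)) m)) \<partial>D) \<partial>(\<Pi>\<^sub>M a\<in>J. D))"
      using P.product_nn_integral_insert[OF J(3,2) fm] unfolding J(1) .
    also have "\<dots> \<le> (\<integral>\<^sup>+Z. ennreal \<epsilon> \<partial>(\<Pi>\<^sub>M a\<in>J. D))"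
    proof (rule nn_integral_mono)
      fix Z
      \<comment> \<open>These weights ignore the sample \<open>z\<close> that is integrated
        next.\<close>
      let ?v = "gibbs \<beta> N (E Z)"
      have v: "weights N ?v" by (rule weights_gibbs[OF N])
      have "(\<integral>\<^sup>+z. ennreal (\<Sum>i\<in>N. ?w (Z(m := z)) i * g i ((Z(m := z)) m)) \<partial>D) \<le>
            (\<integral>\<^sup>+z. ennreal (\<Sum>i\<in>N. ?v i * g i z) \<partial>D)"
        unfolding E_upd using l g N \<beta>
        by (intro nn_integral_mono ennreal_leI) (auto intro!: gibbs_tilt_le[where B=B])
      also have "\<dots> = (\<integral>\<^sup>+z. (\<Sum>i\<in>N. ennreal (?v i) * ennreal (g i z)) \<partial>D)"
      proof (rule nn_integral_cong)
        fix z
        have "(\<Sum>i\<in>N. ennreal (?v i) * ennreal (g i z)) = (\<Sum>i\<in>N. ennreal (?v i * g i z))"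
          using v g by (intro sum.cong) (auto simp: weights_def ennreal_mult)
        also have "\<dots> = ennreal (\<Sum>i\<in>N. ?v i * g i z)"
          using v g by (intro sum_ennreal) (auto simp: weights_def)
        finally show "ennreal (\<Sum>i\<in>N. ?v i * g i z) = (\<Sum>i\<in>N. ennreal (?v i) * ennreal (g i z))" ..
      qed
      also have "\<dots> = (\<Sum>i\<in>N. ennreal (?v i) * (\<integral>\<^sup>+z. ennreal (g i z) \<partial>D))"
        by (subst nn_integral_sum) (auto simp: nn_integral_cmult)
      also have "\<dots> \<le> (\<Sum>i\<in>N. ennreal (?v i) * ennreal \<epsilon>)"
        using \<epsilon> by (intro sum_mono mult_left_mono) auto
      also have "\<dots> = (\<Sum>i\<in>N. ennreal (?v i * \<epsilon>))"
        using v \<epsilon> by (intro sum.cong) (auto simp: weights_def ennreal_mult)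
      also have "\<dots> = ennreal (\<Sum>i\<in>N. ?v i * \<epsilon>)"
        using v \<epsilon> by (intro sum_ennreal) (auto simp: weights_def)
      also have "\<dots> = ennreal \<epsilon>" using v by (simp add: weights_def flip: sum_distrib_right)
      finally show "(\<integral>\<^sup>+z. ennreal (\<Sum>i\<in>N. ?w (Z(m := z)) i * g i ((Z(m := z)) m)) \<partial>D) \<le> ennreal \<epsilon>" .
    qed
    also have "\<dots> = ennreal \<epsilon>"
      by (simp add: prob_space.emeasure_space_1[OF prob_space_PiM] D)
    finally show ?thesis .
  qed
  have "(\<integral>\<^sup>+Z. ennreal (\<Sum>i\<in>N. ?w Z i * (\<Sum>a<n. g i (Z a))) \<partial>(\<Pi>\<^sub>M a\<in>{..<n}. D)) =
        (\<integral>\<^sup>+Z. (\<Sum>a<n. ennreal (\<Sum>i\<in>N. ?w Z i * g i (Z a))) \<partial>(\<Pi>\<^sub>M a\<in>{..<n}. D))"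
  proof (rule nn_integral_cong)
    fix Z
    have "(\<Sum>i\<in>N. ?w Z i * (\<Sum>a<n. g i (Z a))) = (\<Sum>a<n. \<Sum>i\<in>N. ?w Z i * g i (Z a))"
      unfolding sum_distrib_left by (rule sum.swap)
    then show "ennreal (\<Sum>i\<in>N. ?w Z i * (\<Sum>a<n. g i (Z a))) = (\<Sum>a<n. ennreal (\<Sum>i\<in>N. ?w Z i * g i (Z a)))"
      using w0 g by (subst sum_ennreal) (auto intro!: sum_nonneg mult_nonneg_nonneg)
  qed
  also have "\<dots> = (\<Sum>a<n. \<integral>\<^sup>+Z. ennreal (\<Sum>i\<in>N. ?w Z i * g i (Z a)) \<partial>(\<Pi>\<^sub>M a\<in>{..<n}. D))"
    by (rule nn_integral_sum) measurable
  also have "\<dots> \<le> (\<Sum>a<n. ennreal \<epsilon>)" using one by (intro sum_mono) auto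
  also have "\<dots> = ennreal (real n * \<epsilon>)" using \<epsilon>(2) by (simp add: ennreal_mult ennreal_of_nat_eq_real_of_nat)
  finally show ?thesis .
qed

subsection \<open>Covering numbers of symmetric convex sets\<close>

text \<open>Lebesgue measure of dimension \<open>p\<close>, carried by \<open>Rvec p\<close> inside
  the space of sequences. Since \<open>p\<close> varies with \<open>n\<close>, no fixed Euclidean
  type is available for the volume argument.\<close>

definition vol :: "nat \<Rightarrow> rvec measure" where
  "vol p = distr (\<Pi>\<^sub>M i\<in>{..<p}. (lborel :: real measure)) borel (\<lambda>x i. if i < p then x i else 0)"

text \<open>The Borel sets of a countable product of real lines are generated by the
  coordinates.\<close>

lemma measurable_to_rvec:
  fixes f :: "'a \<Rightarrow> rvec"
  assumes "\<And>i. (\<lambda>x. f x i) \<in> borel_measurable M"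
  shows "f \<in> borel_measurable M"
proof -
  have "f \<in> measurable M (PiM UNIV (\<lambda>_. borel))"
    using assms by (intro measurable_PiM_single') auto
  then show ?thesis
    by (subst measurable_cong_sets[OF refl sets_PiM_equal_borel[symmetric]])
qed

lemma measurable_coordinate [measurable]: "(\<lambda>v. (v :: rvec) i) \<in> borel_measurable borel"
  by (intro borel_measurable_continuous_onI continuous_on_product_coordinates)

lemma measurable_embed [measurable]:
  "(\<lambda>x (i::nat). if i < p then x i else (0::real)) \<in> borel_measurable (\<Pi>\<^sub>M i\<in>{..<p}. (lborel :: real measure))"
proof (rule measurable_to_rvec)
  fix i
  show "(\<lambda>x. if i < p then x i else (0::real)) \<in> borel_measurable (\<Pi>\<^sub>M i\<in>{..<p}. (lborel :: real measure))"
    using measurable_component_singleton[of i "{..<p}" "\<lambda>_. lborel :: real measure"] by (cases "i < p") auto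
qed

lemma emeasure_lborel_affine:
  fixes A :: "real set"
  assumes "c > 0" "A \<in> sets borel"
  shows "emeasure lborel {x. (x - t) / c \<in> A} = ennreal c * emeasure lborel A"
proof -
  have m: "{x. (x - t) / c \<in> A} \<in> sets borel"
    using assms(2) by measurable
  have "emeasure lborel {x. (x - t) / c \<in> A} =
      emeasure (density (distr lborel borel (\<lambda>x. t + c * x)) (\<lambda>_. \<bar>c\<bar>)) {x. (x - t) / c \<in> A}"
    using assms by (subst lborel_affine[of c t]) auto
  also have "\<dots> = ennreal c * emeasure (distr lborel borel (\<lambda>x. t + c * x)) {x. (x - t) / c \<in> A}"
    using assms m by (subst emeasure_density) (auto simp: nn_integral_cmult)
  also have "emeasure (distr lborel borel (\<lambda>x. t + c * x)) {x. (x - t) / c \<in> A} = emeasure lborel A"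
    using assms m by (subst emeasure_distr) (auto simp: vimage_def)
  finally show ?thesis .
qed

text \<open>A product measure is determined by its values on boxes, and there the claim factors into
  one-dimensional scalings.\<close>

lemma PiM_lborel_affine:
  fixes t :: rvec and p :: nat
  assumes c: "c > 0"
  defines "f \<equiv> (\<lambda>x. \<lambda>i\<in>{..<p}. (x i - t i) / c)"
  shows "scale_measure (ennreal (1 / c) ^ p)
      (distr (\<Pi>\<^sub>M i\<in>{..<p}. (lborel :: real measure)) (\<Pi>\<^sub>M i\<in>{..<p}. lborel) f) = (\<Pi>\<^sub>M i\<in>{..<p}. lborel)"
proof -
  interpret product_sigma_finite "\<lambda>_::nat. lborel :: real measure" by standard
  have fm: "f \<in> measurable (\<Pi>\<^sub>M i\<in>{..<p}. (lborel :: real measure)) (\<Pi>\<^sub>M i\<in>{..<p}. lborel)"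
    unfolding f_def by measurable
  show ?thesis
  proof (rule PiM_eqI)
    fix A :: "nat \<Rightarrow> real set"
    assume "\<And>i. i \<in> {..<p} \<Longrightarrow> A i \<in> sets lborel"
    then have A: "\<And>i. i < p \<Longrightarrow> A i \<in> sets borel" by simp
    have vi: "f -` (Pi\<^sub>E {..<p} A) \<inter> space (\<Pi>\<^sub>M i\<in>{..<p}. (lborel :: real measure)) =
        Pi\<^sub>E {..<p} (\<lambda>i. {x. (x - t i) / c \<in> A i})"
      by (rule set_eqI) (simp add: f_def space_PiM PiE_iff Ball_def)
    have m: "{x. (x - t i) / c \<in> A i} \<in> sets borel" if "i < p" for i
      using A[OF that] by measurable
    have "emeasure (distr (\<Pi>\<^sub>M i\<in>{..<p}. (lborel :: real measure)) (\<Pi>\<^sub>M i\<in>{..<p}. lborel) f) (Pi\<^sub>E {..<p} A) =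
        emeasure (\<Pi>\<^sub>M i\<in>{..<p}. (lborel :: real measure)) (Pi\<^sub>E {..<p} (\<lambda>i. {x. (x - t i) / c \<in> A i}))"
      using A by (subst emeasure_distr[OF fm]) (auto intro!: sets_PiM_I_finite simp: vi)
    also have "\<dots> = (\<Prod>i<p. emeasure lborel {x. (x - t i) / c \<in> A i})"
      using m by (subst emeasure_PiM) auto
    also have "\<dots> = (\<Prod>i<p. ennreal c * emeasure lborel (A i))"
      using A c by (intro prod.cong refl emeasure_lborel_affine) auto
    also have "\<dots> = ennreal c ^ p * (\<Prod>i<p. emeasure lborel (A i))"
      by (simp add: prod.distrib)
    finally have "emeasure (distr (\<Pi>\<^sub>M i\<in>{..<p}. (lborel :: real measure)) (\<Pi>\<^sub>M i\<in>{..<p}. lborel) f) (Pi\<^sub>E {..<p} A)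
        = ennreal c ^ p * (\<Prod>i<p. emeasure lborel (A i))" .
    moreover have "ennreal (1 / c) ^ p * ennreal c ^ p = 1"
      using c by (simp flip: power_mult_distrib ennreal_mult)
    ultimately show "emeasure (scale_measure (ennreal (1 / c) ^ p)
      (distr (\<Pi>\<^sub>M i\<in>{..<p}. (lborel :: real measure)) (\<Pi>\<^sub>M i\<in>{..<p}. lborel) f)) (Pi\<^sub>E {..<p} A) =
       (\<Prod>i\<in>{..<p}. emeasure lborel (A i))"
      by (simp add: mult.assoc[symmetric])
  qed auto
qed

text \<open>The set on the left is the dilate \<open>t + c W\<close>. The exponent \<open>p\<close>
  of the dilation factor is the source of covering numbers exponential in the dimension.\<close>

lemma vol_affine:
  assumes c: "c > 0" and t: "t \<in> Rvec p" and W: "W \<in> sets borel"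
  shows "emeasure (vol p) {v. (\<lambda>i. (v i - t i) / c) \<in> W} = ennreal c ^ p * emeasure (vol p) W"
proof -
  let ?P = "\<Pi>\<^sub>M i\<in>{..<p}. (lborel :: real measure)"
  let ?E = "\<lambda>x (i::nat). if i < p then x i else (0::real)"
  let ?f = "\<lambda>x. \<lambda>i\<in>{..<p}. (x i - t i) / c"
  have fm: "?f \<in> measurable ?P ?P" by measurable
  have gm: "(\<lambda>v. (\<lambda>i. (v i - t i) / c)) \<in> borel_measurable (borel :: rvec measure)"
    by (rule measurable_to_rvec) measurable
  have W': "{v. (\<lambda>i. (v i - t i) / c) \<in> W} \<in> sets borel"
    using measurable_sets[OF gm W] by (simp add: vimage_def)
  have WE: "?E -` W \<inter> space ?P \<in> sets ?P" by (rule measurable_sets[OF measurable_embed W])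
  have "emeasure (vol p) W = emeasure ?P (?E -` W \<inter> space ?P)"
    unfolding vol_def by (rule emeasure_distr[OF measurable_embed W])
  also have "\<dots> = emeasure (scale_measure (ennreal (1 / c) ^ p) (distr ?P ?P ?f)) (?E -` W \<inter> space ?P)"
    using PiM_lborel_affine[OF c, of p t] by simp
  also have "\<dots> = ennreal (1 / c) ^ p * emeasure ?P (?f -` (?E -` W \<inter> space ?P) \<inter> space ?P)"
    using WE by (simp add: emeasure_distr[OF fm])
  also have "?f -` (?E -` W \<inter> space ?P) \<inter> space ?P = ?E -` {v. (\<lambda>i. (v i - t i) / c) \<in> W} \<inter> space ?P"
  proof -
    \<comment> \<open>\<open>t\<close> vanishes from \<open>p\<close> on, so the affine map of
      sequences keeps the zeros that the embedding inserts.\<close>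
    have "?E (?f x) = (\<lambda>i. (?E x i - t i) / c)" for x
      using t by (auto simp: Rvec_def)
    then show ?thesis by (auto simp: space_PiM)
  qed
  also have "emeasure ?P \<dots> = emeasure (vol p) {v. (\<lambda>i. (v i - t i) / c) \<in> W}"
    unfolding vol_def by (rule emeasure_distr[OF measurable_embed W', symmetric])
  finally have "ennreal c ^ p * emeasure (vol p) W =
      (ennreal c ^ p * ennreal (1 / c) ^ p) * emeasure (vol p) {v. (\<lambda>i. (v i - t i) / c) \<in> W}"
    by (simp add: mult.assoc)
  moreover have "ennreal c ^ p * ennreal (1 / c) ^ p = 1"
    using c by (simp flip: power_mult_distrib ennreal_mult)
  ultimately show ?thesis by simp
qed

lemma open_box: "open {v :: rvec. \<forall>i<p. \<bar>v i - s i\<bar> < a}"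
proof -
  have "open {v :: rvec. \<bar>v i - s i\<bar> < a}" for i
    by (intro open_Collect_less continuous_intros continuous_on_product_coordinates)
  then have "open (\<Inter>i\<in>{..<p}. {v :: rvec. \<bar>v i - s i\<bar> < a})" by (intro open_INT) auto
  also have "(\<Inter>i\<in>{..<p}. {v :: rvec. \<bar>v i - s i\<bar> < a}) = {v. \<forall>i<p. \<bar>v i - s i\<bar> < a}" by auto
  finally show ?thesis .
qed

lemma vol_box:
  assumes "a > 0"
  shows "emeasure (vol p) {v. \<forall>i<p. \<bar>v i\<bar> < a} = ennreal (2 * a) ^ p"
proof -
  interpret product_sigma_finite "\<lambda>_::nat. lborel :: real measure" by standard
  let ?P = "\<Pi>\<^sub>M i\<in>{..<p}. (lborel :: real measure)"
  have m: "{v :: rvec. \<forall>i<p. \<bar>v i\<bar> < a} \<in> sets borel"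
    using open_box[of p "\<lambda>_. 0" a] by simp
  have "emeasure (vol p) {v. \<forall>i<p. \<bar>v i\<bar> < a} =
     emeasure ?P ((\<lambda>x i. if i < p then x i else 0) -` {v. \<forall>i<p. \<bar>v i\<bar> < a} \<inter> space ?P)"
    unfolding vol_def by (rule emeasure_distr[OF measurable_embed m])
  also have "(\<lambda>x i. if i < p then x i else 0) -` {v. \<forall>i<p. \<bar>v i\<bar> < a} \<inter> space ?P = (\<Pi>\<^sub>E i\<in>{..<p}. {-a<..<a})"
  proof -
    have "\<bar>y\<bar> < a \<longleftrightarrow> - a < y \<and> y < a" for y by linarith
    then show ?thesis by (intro set_eqI) (simp add: space_PiM PiE_iff Ball_def conj_commute)
  qed
  also have "emeasure ?P \<dots> = (\<Prod>i<p. emeasure lborel {-a<..<a})"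
    by (subst emeasure_PiM) auto
  also have "\<dots> = ennreal (2 * a) ^ p" using assms by simp
  finally show ?thesis .
qed

text \<open>\<open>S\<close> contains the segment from \<open>-w\<close> to \<open>w\<close>, hence
  absorbs every factor of modulus at most 1: a symmetric convex set is absolutely convex.\<close>

lemma symmetric_convex_comb:
  assumes S: "symmetric_convex S" "u \<in> S" "v \<in> S" and ab: "\<bar>a\<bar> + \<bar>b\<bar> \<le> 1"
  shows "(\<lambda>i. a * u i + b * v i) \<in> S"
proof -
  have neg: "(\<lambda>i. - w i) \<in> S" if "w \<in> S" for w using S(1) that by (auto simp: symmetric_convex_def)
  have conv: "(\<lambda>i. (1 - t) * w i + t * w' i) \<in> S" if "w \<in> S" "w' \<in> S" "0 \<le> t" "t \<le> 1" for w w' t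
    using S(1) that by (auto simp: symmetric_convex_def)
  have sc: "(\<lambda>i. c * w i) \<in> S" if "w \<in> S" "\<bar>c\<bar> \<le> 1" for w c
  proof -
    have "(\<lambda>i. (1 - (1 - c) / 2) * w i + ((1 - c) / 2) * (- w i)) \<in> S"
      using that by (intro conv neg) auto
    moreover have "(1 - (1 - c) / 2) * x + ((1 - c) / 2) * (- x) = c * x" for x :: real
      by (simp add: field_simps)
    ultimately show ?thesis by simp
  qed
  show ?thesis
  proof (cases "\<bar>a\<bar> + \<bar>b\<bar> = 0")
    case True
    then have "a = 0" "b = 0" by linarith+
    then show ?thesis using sc[OF S(2), of 0] by simp
  next
    case False
    define m where "m = \<bar>a\<bar> + \<bar>b\<bar>"
    have m: "m > 0" "m \<le> 1" using False ab by (auto simp: m_def)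
    \<comment> \<open>With \<open>m\<close> the sum of the moduli, the combination is convex in the
      points \<open>m * sgn a * u\<close> and \<open>m * sgn b * v\<close>, with the modulus of
      \<open>b\<close> divided by \<open>m\<close> as its parameter.\<close>
    have "(\<lambda>i. (1 - \<bar>b\<bar> / m) * (m * sgn a * u i) + (\<bar>b\<bar> / m) * (m * sgn b * v i)) \<in> S"
    proof (rule conv)
      show "(\<lambda>i. m * sgn a * u i) \<in> S" "(\<lambda>i. m * sgn b * v i) \<in> S"
        using m sc[OF S(2), of "m * sgn a"] sc[OF S(3), of "m * sgn b"] by (auto simp: abs_mult sgn_if)
      show "0 \<le> \<bar>b\<bar> / m" "\<bar>b\<bar> / m \<le> 1" using m by (auto simp: m_def)
    qed
    moreover have "(1 - \<bar>b\<bar> / m) * (m * sgn a * x) + (\<bar>b\<bar> / m) * (m * sgn b * y) = a * x + b * y" for x y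
    proof -
      have "(1 - \<bar>b\<bar> / m) * m = \<bar>a\<bar>" using m by (simp add: field_simps m_def)
      then have "(1 - \<bar>b\<bar> / m) * (m * sgn a * x) = (\<bar>a\<bar> * sgn a) * x"
        by (metis mult.assoc)
      moreover have "(\<bar>b\<bar> / m) * (m * sgn b * y) = (\<bar>b\<bar> * sgn b) * y" using m by simp
      ultimately show ?thesis by (simp only: abs_mult_sgn)
    qed
    ultimately show ?thesis by simp
  qed
qed

text \<open>Comparison of volumes of dilates gives the base \<open>1 + 2 / \<epsilon>\<close>; the
  constant 3 arises because \<open>1 \<le> 1 / \<epsilon>\<close>.\<close>

lemma volume_ratio_bound:
  fixes k x \<epsilon> :: real
  assumes x: "x > 0" and \<epsilon>: "0 < \<epsilon>" "\<epsilon> \<le> 1" and le: "k * ((\<epsilon> / 2) ^ p * x) \<le> (1 + \<epsilon> / 2) ^ p * x"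
  shows "k \<le> (3 / \<epsilon>) ^ p"
proof -
  have "k * (\<epsilon> / 2) ^ p * x \<le> (1 + \<epsilon> / 2) ^ p * x" using le by (simp only: mult.assoc)
  then have *: "k * (\<epsilon> / 2) ^ p \<le> (1 + \<epsilon> / 2) ^ p" using x by (rule mult_right_le_imp_le)
  have "0 < (\<epsilon> / 2) ^ p" using \<epsilon>(1) by (intro zero_less_power) simp
  then have "k \<le> (1 + \<epsilon> / 2) ^ p / (\<epsilon> / 2) ^ p" using * by (rule pos_le_divide_eq[THEN iffD2])
  also have "\<dots> = ((1 + \<epsilon> / 2) / (\<epsilon> / 2)) ^ p" by (rule power_divide[symmetric])
  also have "\<dots> \<le> (3 / \<epsilon>) ^ p"
  proof (rule power_mono)
    have "(1 + \<epsilon> / 2) / (\<epsilon> / 2) = 2 / \<epsilon> + 1" using \<epsilon>(1) by (simp add: field_simps)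
    also have "\<dots> \<le> 2 / \<epsilon> + 1 / \<epsilon>" using \<epsilon> by (intro add_left_mono) (simp add: le_divide_eq_1)
    finally show "(1 + \<epsilon> / 2) / (\<epsilon> / 2) \<le> 3 / \<epsilon>" by (simp flip: add_divide_distrib)
    show "0 \<le> (1 + \<epsilon> / 2) / (\<epsilon> / 2)" using \<epsilon>(1) by simp
  qed
  finally show ?thesis .
qed

text \<open>The volume argument is run on the open set \<open>S\<close> + box, because \<open>S\<close> may have empty interior.\<close>
lemma separated_card_le:
  assumes S: "S \<subseteq> Rvec p" "symmetric_convex S" "\<And>u i. u \<in> S \<Longrightarrow> \<bar>u i\<bar> \<le> R"
    and \<tau>: "\<tau> > 0" and \<epsilon>: "0 < \<epsilon>" "\<epsilon> \<le> 1" and N: "finite N" "N \<subseteq> S"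
    and sep: "\<And>u v s. u \<in> N \<Longrightarrow> v \<in> N \<Longrightarrow> u \<noteq> v \<Longrightarrow> s \<in> S \<Longrightarrow> \<exists>i<p. \<epsilon> * \<tau> \<le> \<bar>u i - v i - \<epsilon> * s i\<bar>"
  shows "real (card N) \<le> (3 / \<epsilon>) ^ p"
proof (cases "N = {}")
  case False
  define V where "V = (\<Union>s\<in>S. {v :: rvec. \<forall>i<p. \<bar>v i - s i\<bar> < \<tau>})"
  have V: "V \<in> sets borel" unfolding V_def using open_box by (intro borel_open open_UN) auto
  obtain s0 where s0: "s0 \<in> S" using False N by auto
  have zero: "(\<lambda>i. 0) \<in> S" using symmetric_convex_comb[OF S(2) s0 s0, of 0 0] by simp
  have zR: "(\<lambda>i. 0) \<in> Rvec p" by (simp add: Rvec_def)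
  have R: "R \<ge> 0" using S(3)[OF zero] by simp
  \<comment> \<open>The body \<open>u + (\<epsilon> / 2) V\<close>. For separated centres these
    bodies are disjoint, and all of them lie in the dilate
    \<open>W = (1 + \<epsilon> / 2) V\<close>.\<close>
  define D where "D u = {v. (\<lambda>i. (v i - u i) / (\<epsilon> / 2)) \<in> V}" for u
  have Dm: "D u \<in> sets borel" for u
  proof -
    have "(\<lambda>v. (\<lambda>i. (v i - u i) / (\<epsilon> / 2))) \<in> borel_measurable (borel :: rvec measure)"
      by (rule measurable_to_rvec) measurable
    from measurable_sets[OF this V] show ?thesis by (simp add: D_def vimage_def)
  qed
  have vD: "emeasure (vol p) (D u) = ennreal (\<epsilon> / 2) ^ p * emeasure (vol p) V" if "u \<in> N" for u
    unfolding D_def using \<epsilon> that N S by (intro vol_affine V) auto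
  have disj: "disjoint_family_on D N"
    unfolding disjoint_family_on_def
  proof (intro ballI impI, rule ccontr)
    fix u v assume uv: "u \<in> N" "v \<in> N" "u \<noteq> v" "D u \<inter> D v \<noteq> {}"
    then obtain w where "w \<in> D u" "w \<in> D v" by auto
    then obtain a b where ab: "a \<in> S" "b \<in> S" "\<And>i. i < p \<Longrightarrow> \<bar>(w i - u i) / (\<epsilon> / 2) - a i\<bar> < \<tau>"
      "\<And>i. i < p \<Longrightarrow> \<bar>(w i - v i) / (\<epsilon> / 2) - b i\<bar> < \<tau>"
      by (auto simp: D_def V_def)
    \<comment> \<open>A common point \<open>w\<close> gives
      \<open>u - v = \<epsilon> (b - a) / 2\<close> up to errors below
      \<open>\<epsilon> * \<tau>\<close> in each coordinate. Half the difference of two points of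
      \<open>S\<close> lies in \<open>S\<close>, against the separation of \<open>u\<close> and
      \<open>v\<close>.\<close>
    have s: "(\<lambda>i. (1/2) * b i + (-1/2) * a i) \<in> S"
      by (rule symmetric_convex_comb[OF S(2) ab(2,1)]) simp
    have "\<bar>u i - v i - \<epsilon> * ((1/2) * b i + (-1/2) * a i)\<bar> < \<epsilon> * \<tau>" if "i < p" for i
    proof -
      have eq: "u i - v i - \<epsilon> * ((1/2) * b i + (-1/2) * a i) =
        (\<epsilon> / 2) * (((w i - v i) / (\<epsilon> / 2) - b i) - ((w i - u i) / (\<epsilon> / 2) - a i))"
        using \<epsilon> by (simp add: field_simps)
      have "\<bar>((w i - v i) / (\<epsilon> / 2) - b i) - ((w i - u i) / (\<epsilon> / 2) - a i)\<bar> < 2 * \<tau>"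
        using ab(3)[OF that] ab(4)[OF that] by linarith
      then have "(\<epsilon> / 2) * \<bar>((w i - v i) / (\<epsilon> / 2) - b i) - ((w i - u i) / (\<epsilon> / 2) - a i)\<bar> < (\<epsilon> / 2) * (2 * \<tau>)"
        using \<epsilon> by (intro mult_strict_left_mono) auto
      then show ?thesis unfolding eq abs_mult using \<epsilon> by simp
    qed
    with sep[OF uv(1-3) s] show False by (meson not_le)
  qed
  define W where "W = {v. (\<lambda>i. (v i - (\<lambda>i. 0) i) / (1 + \<epsilon> / 2)) \<in> V}"
  have Wm: "W \<in> sets borel"
  proof -
    have "(\<lambda>v. (\<lambda>i. (v i - (\<lambda>i. 0) i) / (1 + \<epsilon> / 2))) \<in> borel_measurable (borel :: rvec measure)"
      by (rule measurable_to_rvec) measurable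
    from measurable_sets[OF this V] show ?thesis by (simp add: W_def vimage_def)
  qed
  have vW: "emeasure (vol p) W = ennreal (1 + \<epsilon> / 2) ^ p * emeasure (vol p) V"
    unfolding W_def using \<epsilon> by (intro vol_affine V zR) auto
  have gen: "(x - 0) / c - ((1 / c) * y + (e / c) * z) = (e / c) * ((x - y) / e - z)"
    if "c > 0" "e > 0" for x y z c e :: real
    using that by (simp add: field_simps)
  have sub: "D u \<subseteq> W" if u: "u \<in> N" for u
  proof
    fix w assume "w \<in> D u"
    then obtain a where a: "a \<in> S" "\<And>i. i < p \<Longrightarrow> \<bar>(w i - u i) / (\<epsilon> / 2) - a i\<bar> < \<tau>"
      by (auto simp: D_def V_def)
    \<comment> \<open>Division by \<open>1 + \<epsilon> / 2\<close> turns
      \<open>u + (\<epsilon> / 2) a\<close> into a convex combination, while the error inside the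
      box only shrinks.\<close>
    have "(\<lambda>i. (1 / (1 + \<epsilon> / 2)) * u i + ((\<epsilon> / 2) / (1 + \<epsilon> / 2)) * a i) \<in> S"
      using u N \<epsilon> a by (intro symmetric_convex_comb[OF S(2)]) (auto simp: field_simps)
    moreover have "\<bar>(w i - 0) / (1 + \<epsilon> / 2) - ((1 / (1 + \<epsilon> / 2)) * u i + ((\<epsilon> / 2) / (1 + \<epsilon> / 2)) * a i)\<bar> < \<tau>"
      if "i < p" for i
    proof -
      have eq: "(w i - 0) / (1 + \<epsilon> / 2) - ((1 / (1 + \<epsilon> / 2)) * u i + ((\<epsilon> / 2) / (1 + \<epsilon> / 2)) * a i) =
        ((\<epsilon> / 2) / (1 + \<epsilon> / 2)) * ((w i - u i) / (\<epsilon> / 2) - a i)"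
        by (rule gen) (use \<epsilon> in auto)
      have c: "0 < (\<epsilon> / 2) / (1 + \<epsilon> / 2)" "(\<epsilon> / 2) / (1 + \<epsilon> / 2) \<le> 1" using \<epsilon> by (auto simp: field_simps)
      have "\<bar>((\<epsilon> / 2) / (1 + \<epsilon> / 2)) * ((w i - u i) / (\<epsilon> / 2) - a i)\<bar> =
          ((\<epsilon> / 2) / (1 + \<epsilon> / 2)) * \<bar>(w i - u i) / (\<epsilon> / 2) - a i\<bar>"
        by (simp only: abs_mult abs_of_pos[OF c(1)])
      also have "\<dots> \<le> 1 * \<bar>(w i - u i) / (\<epsilon> / 2) - a i\<bar>" using c by (intro mult_right_mono) auto
      also have "\<dots> < \<tau>" using a(2)[OF that] by simp
      finally show ?thesis unfolding eq .
    qed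
    ultimately show "w \<in> W" unfolding W_def V_def by blast
  qed
  have sv: "sets (vol p) = sets borel" by (simp add: vol_def)
  have "of_nat (card N) * (ennreal (\<epsilon> / 2) ^ p * emeasure (vol p) V) = (\<Sum>u\<in>N. emeasure (vol p) (D u))"
    using vD by simp
  also have "\<dots> = emeasure (vol p) (\<Union>u\<in>N. D u)"
    using Dm disj N sv by (intro sum_emeasure) auto
  also have "\<dots> \<le> emeasure (vol p) W" using sub Wm sv by (intro emeasure_mono) auto
  finally have le: "of_nat (card N) * (ennreal (\<epsilon> / 2) ^ p * emeasure (vol p) V) \<le>
      ennreal (1 + \<epsilon> / 2) ^ p * emeasure (vol p) V" using vW by simp
  \<comment> \<open>The volume of \<open>V\<close> has to be cancelled. It is finite because
    coordinates on \<open>S\<close> are bounded, and positive because \<open>V\<close> contains a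
    box around 0.\<close>
  have "emeasure (vol p) V \<le> emeasure (vol p) {v. \<forall>i<p. \<bar>v i\<bar> < R + \<tau>}"
  proof (rule emeasure_mono)
    show "{v. \<forall>i<p. \<bar>v i\<bar> < R + \<tau>} \<in> sets (vol p)" unfolding sv using open_box[of p "\<lambda>_. 0"] by simp
    show "V \<subseteq> {v. \<forall>i<p. \<bar>v i\<bar> < R + \<tau>}"
    proof
      fix v assume "v \<in> V"
      then obtain s where s: "s \<in> S" "\<And>i. i < p \<Longrightarrow> \<bar>v i - s i\<bar> < \<tau>" by (auto simp: V_def)
      have "\<bar>v i\<bar> < R + \<tau>" if "i < p" for i
        using S(3)[OF s(1), of i] s(2)[OF that] by linarith
      then show "v \<in> {v. \<forall>i<p. \<bar>v i\<bar> < R + \<tau>}" by blast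
    qed
  qed
  also have "\<dots> < \<top>" using R \<tau> by (subst vol_box) (auto simp: ennreal_power simp del: ennreal_plus)
  finally obtain x where x: "emeasure (vol p) V = ennreal x" "x \<ge> 0" by (cases "emeasure (vol p) V") auto
  have "0 < ennreal (2 * \<tau>) ^ p" using \<tau> by (simp add: ennreal_power)
  moreover have "ennreal (2 * \<tau>) ^ p \<le> ennreal x"
    unfolding x(1)[symmetric] vol_box[OF \<tau>, symmetric]
  proof (rule emeasure_mono)
    show "{v. \<forall>i<p. \<bar>v i\<bar> < \<tau>} \<subseteq> V"
      unfolding V_def using zero by (auto intro!: bexI[of _ "\<lambda>i. 0"])
    show "V \<in> sets (vol p)" unfolding sv by (rule V)
  qed
  ultimately have "0 < ennreal x" by (rule order.strict_trans2)
  then have xpos: "x > 0" by simp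
  have "ennreal (real (card N) * ((\<epsilon> / 2) ^ p * x)) \<le> ennreal ((1 + \<epsilon> / 2) ^ p * x)"
  proof -
    have e1: "of_nat (card N) * (ennreal (\<epsilon> / 2) ^ p * emeasure (vol p) V) = ennreal (real (card N) * ((\<epsilon> / 2) ^ p * x))"
      unfolding x(1) ennreal_of_nat_eq_real_of_nat
      using \<epsilon> x(2) by (subst ennreal_power) (auto simp flip: ennreal_mult)
    have e2: "ennreal (1 + \<epsilon> / 2) ^ p * emeasure (vol p) V = ennreal ((1 + \<epsilon> / 2) ^ p * x)"
      unfolding x(1) using \<epsilon> x(2) by (subst ennreal_power) (auto simp flip: ennreal_mult simp del: ennreal_plus)
    show ?thesis using le unfolding e1 e2 .
  qed
  then have "real (card N) * ((\<epsilon> / 2) ^ p * x) \<le> (1 + \<epsilon> / 2) ^ p * x"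
    by (subst (asm) ennreal_le_iff) (use x(2) \<epsilon>(1) in simp)
  then show ?thesis by (rule volume_ratio_bound[OF xpos \<epsilon>])
next
  case True
  have "0 \<le> (3 / \<epsilon>) ^ p" using \<epsilon> by (intro zero_le_power) auto
  then show ?thesis using True by simp
qed

text \<open>A separated subset of greatest cardinality is a net, since a point far from all its
  members could be added. The slack \<open>\<epsilon> * \<tau>\<close> per coordinate stems from the
  thickening of \<open>S\<close>; as \<open>\<tau>\<close> is absent from the bound on the
  cardinality, it may be taken as small as the samples require.\<close>

lemma gauge_net:
  assumes S: "S \<subseteq> Rvec p" "S \<noteq> {}" "symmetric_convex S" "\<forall>u\<in>S. \<forall>i. \<bar>u i\<bar> \<le> R"
    and \<tau>: "\<tau> > 0" and \<epsilon>: "0 < \<epsilon>" "\<epsilon> \<le> 1"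
  shows "\<exists>N\<subseteq>S. finite N \<and> real (card N) \<le> (3 / \<epsilon>) ^ p \<and>
    (\<forall>u\<in>S. \<exists>v\<in>N. \<exists>s\<in>S. \<forall>i<p. \<bar>u i - v i - \<epsilon> * s i\<bar> < \<epsilon> * \<tau>)"
proof -
  define close where "close u v \<longleftrightarrow> (\<exists>s\<in>S. \<forall>i<p. \<bar>u i - v i - \<epsilon> * s i\<bar> < \<epsilon> * \<tau>)" for u v :: rvec
  have sym: "close v u" if uv: "close u v" for u v
  proof -
    obtain s where s: "s \<in> S" "\<And>i. i < p \<Longrightarrow> \<bar>u i - v i - \<epsilon> * s i\<bar> < \<epsilon> * \<tau>"
      using uv unfolding close_def by blast
    show ?thesis unfolding close_def
    proof (rule bexI[where x="\<lambda>i. - s i"], intro allI impI)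
      show "(\<lambda>i. - s i) \<in> S" using S(3) s(1) unfolding symmetric_convex_def by blast
      fix i assume "i < p"
      from s(2)[OF this] show "\<bar>v i - u i - \<epsilon> * - s i\<bar> < \<epsilon> * \<tau>" by (simp add: abs_less_iff)
    qed
  qed
  define sep where "sep N \<longleftrightarrow> finite N \<and> N \<subseteq> S \<and> (\<forall>u\<in>N. \<forall>v\<in>N. u \<noteq> v \<longrightarrow> \<not> close u v)" for N
  define b where "b = nat \<lfloor>(3 / \<epsilon>) ^ p\<rfloor>"
  have card: "real (card N) \<le> (3 / \<epsilon>) ^ p" if "sep N" for N
  proof (rule separated_card_le[where S=S and R=R and \<tau>=\<tau>])
    fix u v s assume "u \<in> N" "v \<in> N" "u \<noteq> v" and s: "s \<in> S"
    then have "\<not> close u v" using that by (simp add: sep_def)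
    then show "\<exists>i<p. \<epsilon> * \<tau> \<le> \<bar>u i - v i - \<epsilon> * s i\<bar>"
      unfolding close_def using s by (meson not_le)
  qed (use S \<tau> \<epsilon> that in \<open>simp_all add: sep_def\<close>)
  then have bound: "card N \<le> b" if "sep N" for N
    using that by (simp add: b_def le_nat_floor)
  have "sep {}" by (simp add: sep_def)
  then have "\<exists>N. sep N \<and> (\<forall>N'. sep N' \<longrightarrow> card N' \<le> card N)"
    by (rule ex_has_greatest_nat[of sep "{}" card "Suc b"]) (use bound in \<open>auto simp: less_Suc_eq_le intro: le_SucI\<close>)
  then obtain N where N: "sep N" "\<And>N'. sep N' \<Longrightarrow> card N' \<le> card N" by blast
  obtain u0 where u0: "u0 \<in> S" using S(2) by blast
  show ?thesis
  proof (intro exI[of _ N] conjI ballI)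
    show "finite N" "N \<subseteq> S" "real (card N) \<le> (3 / \<epsilon>) ^ p" using N card by (auto simp: sep_def)
    have "(\<lambda>i. 0) \<in> S"
      using symmetric_convex_comb[OF S(3) u0 u0, of 0 0] by simp
    then have self: "close u u" for u unfolding close_def using \<epsilon> \<tau> by (intro bexI[of _ "\<lambda>i. 0"]) auto
    fix u assume u: "u \<in> S"
    have "\<exists>v\<in>N. close u v"
    proof (rule ccontr)
      assume n: "\<not> (\<exists>v\<in>N. close u v)"
      then have "u \<notin> N" using self by blast
      moreover have "sep (insert u N)"
        unfolding sep_def
      proof (intro conjI)
        show "finite (insert u N)" "insert u N \<subseteq> S" using N(1) u by (auto simp: sep_def)
        show "\<forall>a\<in>insert u N. \<forall>b\<in>insert u N. a \<noteq> b \<longrightarrow> \<not> close a b"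
          using N(1) n sym unfolding sep_def by blast
      qed
      ultimately show False using N(1) N(2)[of "insert u N"] by (simp add: sep_def)
    qed
    then show "\<exists>v\<in>N. \<exists>s\<in>S. \<forall>i<p. \<bar>u i - v i - \<epsilon> * s i\<bar> < \<epsilon> * \<tau>" by (simp add: close_def)
  qed
qed

subsection \<open>Averaged linear forms\<close>

text \<open>The empirical \<open>L1\<close> norm of a linear form. The capped loss is Lipschitz in
  the linear forms, so this seminorm bounds the variation of its empirical mean; the Euclidean norm
  is kept for the penalty.\<close>

definition avg_abs :: "nat \<Rightarrow> nat \<Rightarrow> (nat \<Rightarrow> rvec) \<Rightarrow> rvec \<Rightarrow> real" where
  "avg_abs n p x u = (\<Sum>l<n. \<bar>dotp p u (x l)\<bar>) / real n"

lemma dotp_add: "dotp p (\<lambda>i. u i + v i) x = dotp p u x + dotp p v x"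
  by (simp add: dotp_def sum.distrib distrib_right)

lemma dotp_diff: "dotp p (\<lambda>i. u i - v i) x = dotp p u x - dotp p v x"
  by (simp add: dotp_def sum_subtractf left_diff_distrib)

lemma dotp_scale: "dotp p (\<lambda>i. c * u i) x = c * dotp p u x"
  by (simp add: dotp_def sum_distrib_left mult.assoc)

lemma dotp_commute: "dotp p u v = dotp p v u"
  by (simp add: dotp_def mult.commute)

lemma avg_abs_add: "avg_abs n p x (\<lambda>i. u i + v i) \<le> avg_abs n p x u + avg_abs n p x v"
proof -
  have "(\<Sum>l<n. \<bar>dotp p u (x l) + dotp p v (x l)\<bar>) \<le> (\<Sum>l<n. \<bar>dotp p u (x l)\<bar> + \<bar>dotp p v (x l)\<bar>)"
    by (intro sum_mono abs_triangle_ineq)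
  then show ?thesis
    unfolding avg_abs_def dotp_add add_divide_distrib[symmetric] sum.distrib by (intro divide_right_mono) auto
qed

lemma avg_abs_scale: "avg_abs n p x (\<lambda>i. c * u i) = \<bar>c\<bar> * avg_abs n p x u"
  unfolding avg_abs_def dotp_scale abs_mult by (simp add: sum_distrib_left)

lemma avg_abs_diff: "avg_abs n p x (\<lambda>i. u i - v i) \<le> avg_abs n p x u + avg_abs n p x v"
  using avg_abs_add[of n p x u "\<lambda>i. (-1) * v i"] unfolding avg_abs_scale by simp

text \<open>Takes care of the coordinatewise slack of the net: \<open>\<tau>\<close> times the
  \<open>l1\<close> norm of every row is at most 1.\<close>

lemma avg_abs_small:
  assumes "n > 0" "\<And>i. i < p \<Longrightarrow> \<bar>w i\<bar> \<le> \<epsilon> * \<tau>" "\<epsilon> \<ge> 0" "\<tau> \<ge> 0"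
    and x: "\<And>l. l < n \<Longrightarrow> \<tau> * (\<Sum>i<p. \<bar>x l i\<bar>) \<le> 1"
  shows "avg_abs n p x w \<le> \<epsilon>"
proof -
  have "\<bar>dotp p w (x l)\<bar> \<le> \<epsilon>" if "l < n" for l
  proof -
    have "\<bar>dotp p w (x l)\<bar> \<le> (\<Sum>i<p. \<bar>w i\<bar> * \<bar>x l i\<bar>)"
      unfolding dotp_def by (rule order_trans[OF sum_abs]) (simp add: abs_mult)
    also have "\<dots> \<le> (\<Sum>i<p. (\<epsilon> * \<tau>) * \<bar>x l i\<bar>)"
      using assms(2) by (intro sum_mono mult_right_mono) auto
    also have "\<dots> = \<epsilon> * (\<tau> * (\<Sum>i<p. \<bar>x l i\<bar>))" by (simp add: sum_distrib_left mult.assoc)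
    also have "\<dots> \<le> \<epsilon> * 1" using x[OF that] assms(3) by (intro mult_left_mono) auto
    finally show ?thesis by simp
  qed
  then have "(\<Sum>l<n. \<bar>dotp p w (x l)\<bar>) \<le> (\<Sum>l<n. \<epsilon>)" by (intro sum_mono) auto
  then show ?thesis using assms(1) by (simp add: avg_abs_def divide_le_eq mult.commute)
qed

lemma avg_abs_net_diff:
  assumes "n > 0" "\<And>i. i < p \<Longrightarrow> \<bar>u i - v i - \<epsilon> * s i\<bar> < \<epsilon> * \<tau>" "\<epsilon> \<ge> 0" "\<tau> \<ge> 0"
    and x: "\<And>l. l < n \<Longrightarrow> \<tau> * (\<Sum>i<p. \<bar>x l i\<bar>) \<le> 1"
  shows "avg_abs n p x (\<lambda>i. u i - v i) \<le> \<epsilon> * avg_abs n p x s + \<epsilon>"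
proof -
  have "avg_abs n p x (\<lambda>i. \<epsilon> * s i + (u i - v i - \<epsilon> * s i)) \<le> avg_abs n p x (\<lambda>i. \<epsilon> * s i) + avg_abs n p x (\<lambda>i. u i - v i - \<epsilon> * s i)"
    by (rule avg_abs_add)
  also have "avg_abs n p x (\<lambda>i. u i - v i - \<epsilon> * s i) \<le> \<epsilon>"
    using assms less_imp_le by (intro avg_abs_small[where \<tau>=\<tau>]) auto
  finally show ?thesis using assms(3) by (simp add: avg_abs_scale)
qed

lemma norm2_nonneg: "0 \<le> norm2 p v"
  unfolding norm2_def by simp

lemma coordinate_le_norm2:
  assumes "i < p" shows "\<bar>v i\<bar> \<le> norm2 p v"
  using member_le_L2_set[of "{..<p}" i "\<lambda>i. \<bar>v i\<bar>"] assms
  by (simp add: norm2_def L2_set_def)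

lemma norm2_add: "norm2 p (\<lambda>i. u i + v i) \<le> norm2 p u + norm2 p v"
  unfolding norm2_def by (rule L2_set_triangle_ineq)

lemma norm2_scale: "norm2 p (\<lambda>i. c * u i) = \<bar>c\<bar> * norm2 p u"
  unfolding norm2_def L2_set_def
  by (simp add: power_mult_distrib real_sqrt_mult flip: sum_distrib_left)

lemma norm2_diff: "norm2 p (\<lambda>i. u i - v i) \<le> norm2 p u + norm2 p v"
  using norm2_add[of p u "\<lambda>i. (-1) * v i"] unfolding norm2_scale by simp

text \<open>The difference is split into a gauge part and the slack. The Euclidean norm of the slack
  is at most its \<open>l1\<close> norm, whence the condition
  \<open>real p * \<tau> \<le> 1\<close>.\<close>

lemma norm2_net_diff:
  assumes "\<And>i. i < p \<Longrightarrow> \<bar>u i - v i - \<epsilon> * s i\<bar> < \<epsilon> * \<tau>" "\<epsilon> \<ge> 0" "real p * \<tau> \<le> 1" "norm2 p s \<le> R"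
  shows "norm2 p (\<lambda>i. u i - v i) \<le> \<epsilon> * (R + 1)"
proof -
  have "norm2 p (\<lambda>i. \<epsilon> * s i + (u i - v i - \<epsilon> * s i)) \<le> norm2 p (\<lambda>i. \<epsilon> * s i) + norm2 p (\<lambda>i. u i - v i - \<epsilon> * s i)"
    by (rule norm2_add)
  also have "norm2 p (\<lambda>i. u i - v i - \<epsilon> * s i) \<le> (\<Sum>i<p. \<bar>u i - v i - \<epsilon> * s i\<bar>)"
    unfolding norm2_def by (rule L2_set_le_sum_abs)
  also have "\<dots> \<le> (\<Sum>i<p. \<epsilon> * \<tau>)" using assms(1) by (intro sum_mono) (auto intro: less_imp_le)
  also have "\<dots> = \<epsilon> * (real p * \<tau>)" by simp
  also have "\<dots> \<le> \<epsilon> * 1" using assms by (intro mult_left_mono) auto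
  finally have "norm2 p (\<lambda>i. u i - v i) \<le> \<epsilon> * norm2 p s + \<epsilon>" using assms(2) by (simp add: norm2_scale)
  also have "\<epsilon> * norm2 p s \<le> \<epsilon> * R" using assms by (intro mult_left_mono) auto
  finally show ?thesis by (simp add: algebra_simps)
qed

lemma frob_norm_le:
  fixes T :: "'a::finite \<Rightarrow> rvec"
  shows "frob_norm p T \<le> (\<Sum>j\<in>UNIV. norm2 p (T j))"
proof -
  have "(\<Sum>i\<in>{..<p} \<times> (UNIV :: 'a set). (case i of (i, j) \<Rightarrow> T j i)\<^sup>2) = (\<Sum>i<p. \<Sum>j\<in>UNIV. (T j i)\<^sup>2)"
    by (subst sum.cartesian_product) (auto intro!: sum.cong)
  also have "\<dots> = (\<Sum>j\<in>UNIV. (norm2 p (T j))\<^sup>2)"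
    by (subst sum.swap) (simp add: norm2_def L2_set_def sum_nonneg)
  finally have "frob_norm p T = L2_set (\<lambda>j. norm2 p (T j)) UNIV"
    unfolding frob_norm_def L2_set_def by (rule arg_cong)
  also have "\<dots> \<le> (\<Sum>j\<in>UNIV. \<bar>norm2 p (T j)\<bar>)" by (rule L2_set_le_sum_abs)
  finally show ?thesis by (simp add: norm2_nonneg)
qed

text \<open>The usual net argument, with respect to the gauge of \<open>S\<close>: halving the radius absorbs the supremum.\<close>
lemma avg_abs_bound:
  assumes n: "n > 0" and S: "\<And>u. u \<in> S \<Longrightarrow> norm2 p u \<le> R" "R \<ge> 0"
    and net: "\<And>u. u \<in> S \<Longrightarrow> \<exists>v\<in>N. \<exists>s\<in>S. \<forall>i<p. \<bar>u i - v i - 1/2 * s i\<bar> < 1/2 * \<tau>"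
    and t: "\<And>v. v \<in> N \<Longrightarrow> avg_abs n p x v \<le> t" and \<tau>: "\<tau> > 0"
    and x: "\<And>l. l < n \<Longrightarrow> \<tau> * (\<Sum>i<p. \<bar>x l i\<bar>) \<le> 1"
    and u: "u \<in> S"
  shows "avg_abs n p x u \<le> 2 * t + 1"
proof -
  \<comment> \<open>A crude bound, needed only to make the supremum \<open>W\<close> finite:
    otherwise half of it could not be absorbed.\<close>
  have "avg_abs n p x u \<le> R / \<tau>" if "u \<in> S" for u
  proof (rule avg_abs_small[OF n])
    fix i assume "i < p"
    then have "\<bar>u i\<bar> \<le> R" using coordinate_le_norm2[of i p u] S(1)[OF that] by linarith
    then show "\<bar>u i\<bar> \<le> R / \<tau> * \<tau>" using \<tau> by simp
  qed (use \<tau> S x in auto)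
  then have bdd: "bdd_above (avg_abs n p x ` S)" by (intro bdd_aboveI[of _ "R / \<tau>"]) auto
  define W where "W = (SUP u\<in>S. avg_abs n p x u)"
  have le: "avg_abs n p x u \<le> t + 1/2 * W + 1/2" if "u \<in> S" for u
  proof -
    obtain v s where vs: "v \<in> N" "s \<in> S" "\<And>i. i < p \<Longrightarrow> \<bar>u i - v i - 1/2 * s i\<bar> < 1/2 * \<tau>"
      using net[OF \<open>u \<in> S\<close>] by blast
    have "avg_abs n p x (\<lambda>i. v i + (u i - v i)) \<le> avg_abs n p x v + avg_abs n p x (\<lambda>i. u i - v i)"
      by (rule avg_abs_add)
    also have "avg_abs n p x (\<lambda>i. u i - v i) \<le> 1/2 * avg_abs n p x s + 1/2"
      using \<tau> by (intro avg_abs_net_diff[OF n vs(3)] x) auto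
    also have "avg_abs n p x s \<le> W" unfolding W_def by (rule cSUP_upper[OF vs(2) bdd])
    finally show ?thesis using t[OF vs(1)] by simp
  qed
  have "W \<le> t + 1/2 * W + 1/2"
    unfolding W_def[symmetric] using u le by (subst W_def) (intro cSUP_least, auto)
  then show ?thesis using le[OF u] by simp
qed

subsection \<open>Probability estimates for a single sample size\<close>

lemma (in finite_measure) measure_tail_small:
  assumes [measurable]: "f \<in> borel_measurable M" and e: "e > 0"
  obtains m :: nat where "\<And>t. t \<ge> real m \<Longrightarrow> measure M {z\<in>space M. f z > t} < e"
proof -
  have "(\<lambda>m. measure M {z\<in>space M. f z > real m}) \<longlonglongrightarrow> measure M (\<Inter>m. {z\<in>space M. f z > real m})"
    by (rule finite_Lim_measure_decseq) (auto simp: decseq_def)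
  moreover have "\<exists>m. \<not> f z > real m" for z using reals_Archimedean2[of "f z"] less_asym by blast
  then have "(\<Inter>m. {z\<in>space M. f z > real m}) = {}" by blast
  ultimately have "(\<lambda>m. measure M {z\<in>space M. f z > real m}) \<longlonglongrightarrow> 0" by simp
  from order_tendstoD(2)[OF this e] obtain m where m: "measure M {z\<in>space M. f z > real m} < e"
    by (auto simp: eventually_sequentially)
  show ?thesis
  proof (rule that)
    fix t assume "t \<ge> real m"
    then have "measure M {z\<in>space M. f z > t} \<le> measure M {z\<in>space M. f z > real m}"
      by (intro finite_measure_mono) auto
    with m show "measure M {z\<in>space M. f z > t} < e" by simp
  qed
qed

lemma distr_PiM_component':
  assumes "prob_space D" "l < n"
  shows "distr (\<Pi>\<^sub>M a\<in>{..<n}. D) D (\<lambda>Z. Z l) = D"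
  using distr_PiM_component[of "{..<n}" "\<lambda>_. D" l] assms by auto

lemma PiM_union_bound:
  assumes D: "prob_space D" and A: "A \<in> sets D" and le: "measure D A \<le> e"
  shows "measure (\<Pi>\<^sub>M a\<in>{..<n}. D) {Z \<in> space (\<Pi>\<^sub>M a\<in>{..<n}. D). \<exists>l<n. Z l \<in> A} \<le> real n * e"
proof -
  let ?P = "\<Pi>\<^sub>M a\<in>{..<n}. D"
  interpret P: prob_space ?P by (rule prob_space_PiM) (rule D)
  have m: "{Z \<in> space ?P. Z l \<in> A} \<in> sets ?P" if "l < n" for l
    using measurable_sets[OF measurable_component_singleton[of l "{..<n}" "\<lambda>_. D"] A] that
    by (simp add: vimage_def Int_def conj_commute)
  have eq: "measure ?P {Z \<in> space ?P. Z l \<in> A} = measure D A" if "l < n" for l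
  proof -
    have "measure D A = measure (distr ?P D (\<lambda>Z. Z l)) A" using distr_PiM_component'[OF D that] by simp
    also have "\<dots> = measure ?P ((\<lambda>Z. Z l) -` A \<inter> space ?P)"
      using that by (intro measure_distr measurable_component_singleton A) auto
    also have "(\<lambda>Z. Z l) -` A \<inter> space ?P = {Z \<in> space ?P. Z l \<in> A}" by auto
    finally show ?thesis ..
  qed
  have "{Z \<in> space ?P. \<exists>l<n. Z l \<in> A} = (\<Union>l<n. {Z \<in> space ?P. Z l \<in> A})" by auto
  also have "measure ?P \<dots> \<le> (\<Sum>l<n. measure ?P {Z \<in> space ?P. Z l \<in> A})"
    using m by (intro P.finite_measure_subadditive_finite) auto
  also have "\<dots> \<le> (\<Sum>l<n. e)" using eq le by (intro sum_mono) auto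
  finally show ?thesis by simp
qed

text \<open>Exponential Markov inequality. The base \<open>c * exp (- t)\<close> is as small as
  desired for large \<open>t\<close>, so the bound survives a union over a net whose cardinality is
  exponential in \<open>n\<close>.\<close>

lemma PiM_chernoff:
  assumes D: "prob_space D" and [measurable]: "f \<in> borel_measurable D"
    and c: "(\<integral>\<^sup>+z. ennreal (exp (f z)) \<partial>D) \<le> ennreal c" "c \<ge> 0" and n: "n > 0"
  shows "measure (\<Pi>\<^sub>M a\<in>{..<n}. D) {Z \<in> space (\<Pi>\<^sub>M a\<in>{..<n}. D). (\<Sum>l<n. f (Z l)) / real n > t} \<le> (c * exp (- t)) ^ n"
proof -
  let ?P = "\<Pi>\<^sub>M a\<in>{..<n}. D"
  interpret D: prob_space D by fact
  interpret P: prob_space ?P by (rule prob_space_PiM) (rule D)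
  interpret product_sigma_finite "\<lambda>_::nat. D" by (simp add: product_sigma_finite_def D.sigma_finite_measure_axioms)
  let ?A = "{Z \<in> space ?P. (\<Sum>l<n. f (Z l)) / real n > t}"
  have A: "?A \<in> sets ?P" by measurable
  have "emeasure ?P ?A = (\<integral>\<^sup>+Z. indicator ?A Z \<partial>?P)" using A by simp
  also have "\<dots> \<le> (\<integral>\<^sup>+Z. (\<Prod>l<n. ennreal (exp (f (Z l)) * exp (- t))) \<partial>?P)"
  proof (rule nn_integral_mono)
    fix Z
    have "(\<Prod>l<n. ennreal (exp (f (Z l)) * exp (- t))) = ennreal (exp ((\<Sum>l<n. f (Z l)) - real n * t))"
    proof -
      have "(\<Prod>l<n. exp (f (Z l)) * exp (- t)) = exp (\<Sum>l<n. f (Z l) + - t)"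
        by (simp only: exp_sum[OF finite_lessThan] exp_add)
      also have "(\<Sum>l<n. f (Z l) + - t) = (\<Sum>l<n. f (Z l)) - real n * t"
        by (simp add: sum_subtractf)
      finally show ?thesis by (subst prod_ennreal) auto
    qed
    moreover have "1 \<le> exp ((\<Sum>l<n. f (Z l)) - real n * t)" if "Z \<in> ?A"
      using that n by (simp add: field_simps)
    ultimately show "indicator ?A Z \<le> (\<Prod>l<n. ennreal (exp (f (Z l)) * exp (- t)))"
      by (cases "Z \<in> ?A") auto
  qed
  also have "\<dots> = (\<Prod>l<n. \<integral>\<^sup>+z. ennreal (exp (f z) * exp (- t)) \<partial>D)"
    by (rule product_nn_integral_prod) auto
  also have "(\<integral>\<^sup>+z. ennreal (exp (f z) * exp (- t)) \<partial>D) = (\<integral>\<^sup>+z. ennreal (exp (f z)) \<partial>D) * ennreal (exp (- t))"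
    by (subst nn_integral_multc[symmetric]) (auto simp: ennreal_mult')
  also have "(\<Prod>l<n. (\<integral>\<^sup>+z. ennreal (exp (f z)) \<partial>D) * ennreal (exp (- t))) \<le> (\<Prod>l<n. ennreal (c * exp (- t)))"
  proof -
    have "(\<integral>\<^sup>+z. ennreal (exp (f z)) \<partial>D) * ennreal (exp (- t)) \<le> ennreal c * ennreal (exp (- t))"
      using c by (intro mult_right_mono) auto
    also have "\<dots> = ennreal (c * exp (- t))" using c(2) by (intro ennreal_mult[symmetric]) auto
    finally have *: "(\<integral>\<^sup>+z. ennreal (exp (f z)) \<partial>D) * ennreal (exp (- t)) \<le> ennreal (c * exp (- t))" .
    show ?thesis
      by (induction n) (auto intro!: mult_mono *)
  qed
  also have "\<dots> = ennreal ((c * exp (- t)) ^ n)" using c(2) by (simp add: ennreal_power)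
  finally show ?thesis
    using c(2) by (simp add: P.emeasure_eq_measure ennreal_le_iff)
qed

text \<open>A sublevel set condition over a compact set is decided by a countable dense subset.\<close>
lemma measurable_exists_le:
  fixes h :: "'t::{metric_space,second_countable_topology} \<Rightarrow> 'z \<Rightarrow> real"
  assumes A: "compact A" and hm: "\<And>T. T \<in> A \<Longrightarrow> h T \<in> borel_measurable M"
    and hc: "\<And>z. z \<in> space M \<Longrightarrow> continuous_on A (\<lambda>T. h T z)"
  shows "{z \<in> space M. \<exists>T\<in>A. h T z \<le> s} \<in> sets M"
proof -
  obtain A0 where A0: "countable A0" "A0 \<subseteq> A" "A \<subseteq> closure A0" using separable by blast
  \<comment> \<open>The slack \<open>1 / real (Suc m)\<close> lets a nearby point of
    \<open>A0\<close> stand in for a point of \<open>A\<close>. Conversely, compactness extracts an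
    exact solution from approximate ones.\<close>
  have eq: "{z \<in> space M. \<exists>T\<in>A. h T z \<le> s} = (\<Inter>m::nat. \<Union>T\<in>A0. {z \<in> space M. h T z < s + 1 / real (Suc m)})"
    (is "?L = ?R")
  proof (intro set_eqI iffI)
    fix z assume "z \<in> ?L"
    then obtain T where T: "T \<in> A" "h T z \<le> s" and z: "z \<in> space M" by auto
    have "\<exists>T0\<in>A0. h T0 z < s + 1 / real (Suc m)" for m
    proof -
      obtain d where d: "d > 0" "\<And>T'. T' \<in> A \<Longrightarrow> dist T' T < d \<Longrightarrow> dist (h T' z) (h T z) < 1 / real (Suc m)"
        using hc[OF z] T(1) unfolding continuous_on_iff by (metis of_nat_0_less_iff zero_less_Suc zero_less_divide_1_iff)
      obtain T0 where T0: "T0 \<in> A0" "dist T0 T < d"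
        using A0(3) T(1) d(1) closure_approachable by blast
      have "dist (h T0 z) (h T z) < 1 / real (Suc m)" using d(2) T0 A0(2) by blast
      then have "h T0 z < s + 1 / real (Suc m)" using T(2) unfolding dist_real_def by linarith
      then show ?thesis using T0(1) by blast
    qed
    then show "z \<in> ?R" using z by auto
  next
    fix z assume zR: "z \<in> ?R"
    then have z: "z \<in> space M" by auto
    have "\<exists>T\<in>A0. h T z < s + 1 / real (Suc m)" for m using zR by auto
    then obtain T where T: "\<And>m. T m \<in> A0" "\<And>m. h (T m) z < s + 1 / real (Suc m)" by metis
    then have "\<forall>m. T m \<in> A" using A0(2) by auto
    then obtain l \<phi> where l: "l \<in> A" "strict_mono \<phi>" "(T \<circ> \<phi>) \<longlonglongrightarrow> l"
      using A unfolding compact_eq_seq_compact_metric seq_compact_def by blast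
    have "(\<lambda>m. h ((T \<circ> \<phi>) m) z) \<longlonglongrightarrow> h l z"
      using l(1) \<open>\<forall>m. T m \<in> A\<close> by (intro continuous_on_tendsto_compose[OF hc[OF z] l(3)]) auto
    moreover have "(\<lambda>m. s + 1 / real (Suc (\<phi> m))) \<longlonglongrightarrow> s + 0"
      using LIMSEQ_subseq_LIMSEQ[OF LIMSEQ_inverse_real_of_nat l(2)]
      by (intro tendsto_add tendsto_const) (simp add: o_def inverse_eq_divide)
    ultimately have "h l z \<le> s + 0"
      using T(2) by (intro LIMSEQ_le) (auto intro!: exI[of _ 0] less_imp_le)
    then show "z \<in> ?L" using z l(1) by auto
  qed
  have "(\<Union>T\<in>A0. {z \<in> space M. h T z < s + 1 / real (Suc m)}) \<in> sets M" for m
  proof (rule sets.countable_UN'[OF A0(1)])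
    show "(\<lambda>T. {z \<in> space M. h T z < s + 1 / real (Suc m)}) ` A0 \<subseteq> sets M"
    proof (intro image_subsetI)
      fix T assume "T \<in> A0"
      then have [measurable]: "h T \<in> borel_measurable M" using hm A0(2) by auto
      show "{z \<in> space M. h T z < s + 1 / real (Suc m)} \<in> sets M" by measurable
    qed
  qed
  then show ?thesis unfolding eq by (intro sets.countable_INT) auto
qed

text \<open>A rescaled \<open>tanh\<close>, decreasing from 1 to 0. Its first two derivatives are
  polynomials in \<open>tanh\<close>, hence bounded on the whole line, which yields the quadratic
  remainder. The values 1 and 0 are reached up to \<open>e\<close> only, and this loss is carried
  along as an error.\<close>

lemma smooth_step:
  fixes s s' e :: real
  assumes "s < s'" "e > 0"
  obtains \<psi> \<psi>' :: "real \<Rightarrow> real" and c1 c2 where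
    "\<And>x. 0 \<le> \<psi> x \<and> \<psi> x \<le> 1" "\<psi> \<in> borel_measurable borel"
    "\<And>x. x \<le> s \<Longrightarrow> 1 - e \<le> \<psi> x" "\<And>x. s' \<le> x \<Longrightarrow> \<psi> x \<le> e"
    "\<And>a t. \<bar>\<psi> (a + t) - \<psi> a - \<psi>' a * t\<bar> \<le> c2 * t\<^sup>2" "c2 \<ge> 0" "\<And>a. \<bar>\<psi>' a\<bar> \<le> c1"
proof -
  have "eventually (\<lambda>x::real. tanh x > 1 - e) at_top"
    using order_tendstoD(1)[OF tanh_real_at_top, of "1 - e"] assms by simp
  then obtain y0 where y0: "\<And>y. y \<ge> y0 \<Longrightarrow> tanh y > 1 - e" unfolding eventually_at_top_linorder by blast
  define y where "y = max y0 1"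
  \<comment> \<open>The slope that makes the argument of \<open>tanh\<close> run from
    \<open>- y\<close> to \<open>y\<close> while \<open>x\<close> runs from \<open>s\<close> to
    \<open>s'\<close>.\<close>
  define c where "c = 2 * y / (s' - s)"
  define m where "m = (s + s') / 2"
  have y: "y > 0" "tanh y > 1 - e" using y0 by (auto simp: y_def)
  have c: "c > 0" using y assms by (simp add: c_def)
  have cs: "c * (s' - m) = y" "c * (s - m) = - y" using assms by (auto simp: c_def m_def field_simps)
  define \<psi> where "\<psi> x = (1 - tanh (c * (x - m))) / 2" for x
  define \<psi>' where "\<psi>' x = - c * (1 - (tanh (c * (x - m)))\<^sup>2) / 2" for x
  define \<psi>'' where "\<psi>'' x = c\<^sup>2 * tanh (c * (x - m)) * (1 - (tanh (c * (x - m)))\<^sup>2)" for x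
  have ch: "cosh x \<noteq> 0" for x :: real using cosh_real_pos[of x] by simp
  have tb: "\<bar>tanh x\<bar> \<le> 1" for x :: real using tanh_real_lt_1[of x] tanh_real_gt_neg1[of x] by simp
  have tb2: "0 \<le> 1 - (tanh x)\<^sup>2" "1 - (tanh x)\<^sup>2 \<le> 1" for x :: real
    using tb[of x] by (auto simp: abs_square_le_1)
  have d1: "(\<psi> has_real_derivative \<psi>' x) (at x)" for x
    unfolding \<psi>_def[abs_def] \<psi>'_def by (rule derivative_eq_intros refl ch | simp add: field_simps)+
  have d2: "(\<psi>' has_real_derivative \<psi>'' x) (at x)" for x
    unfolding \<psi>'_def[abs_def] \<psi>''_def
    by (rule derivative_eq_intros refl ch | simp add: field_simps power2_eq_square)+
  have b2: "\<bar>\<psi>'' x\<bar> \<le> c\<^sup>2" for x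
  proof -
    have "\<bar>\<psi>'' x\<bar> = c\<^sup>2 * (\<bar>tanh (c * (x - m))\<bar> * (1 - (tanh (c * (x - m)))\<^sup>2))"
      unfolding \<psi>''_def using tb2(1)[of "c * (x - m)"] by (simp add: abs_mult)
    also have "\<dots> \<le> c\<^sup>2 * (1 * 1)" using tb tb2 by (intro mult_left_mono mult_mono) auto
    finally show ?thesis by simp
  qed
  have lip: "\<bar>\<psi>' a - \<psi>' b\<bar> \<le> c\<^sup>2 * \<bar>a - b\<bar>" for a b
    using field_differentiable_bound[of UNIV \<psi>' \<psi>'' "c\<^sup>2" a b] d2 b2 by simp
  have taylor: "\<bar>\<psi> (a + t) - \<psi> a - \<psi>' a * t\<bar> \<le> c\<^sup>2 * t\<^sup>2" for a t
  proof -
    have "\<exists>z. \<bar>z - a\<bar> \<le> \<bar>t\<bar> \<and> \<psi> (a + t) - \<psi> a = t * \<psi>' z"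
    proof (cases t "0 :: real" rule: linorder_cases)
      case less
      then obtain z where "a + t < z" "z < a" "\<psi> a - \<psi> (a + t) = (a - (a + t)) * \<psi>' z"
        using MVT2[of "a + t" a \<psi> \<psi>'] d1 by auto
      then show ?thesis using less by (intro exI[of _ z]) (auto simp: algebra_simps)
    next
      case greater
      then obtain z where "a < z" "z < a + t" "\<psi> (a + t) - \<psi> a = (a + t - a) * \<psi>' z"
        using MVT2[of a "a + t" \<psi> \<psi>'] d1 by auto
      then show ?thesis using greater by (intro exI[of _ z]) (auto simp: algebra_simps)
    qed auto
    then obtain z where z: "\<bar>z - a\<bar> \<le> \<bar>t\<bar>" "\<psi> (a + t) - \<psi> a = t * \<psi>' z" by blast
    have "\<psi> (a + t) - \<psi> a - \<psi>' a * t = t * (\<psi>' z - \<psi>' a)" using z(2) by (simp add: algebra_simps)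
    then have "\<bar>\<psi> (a + t) - \<psi> a - \<psi>' a * t\<bar> = \<bar>t\<bar> * \<bar>\<psi>' z - \<psi>' a\<bar>" by (simp add: abs_mult)
    also have "\<dots> \<le> \<bar>t\<bar> * (c\<^sup>2 * \<bar>z - a\<bar>)" by (intro mult_left_mono lip) auto
    also have "\<dots> \<le> \<bar>t\<bar> * (c\<^sup>2 * \<bar>t\<bar>)" using z(1) by (intro mult_left_mono) auto
    finally show ?thesis by (simp add: power2_eq_square abs_mult_self_eq mult_ac)
  qed
  have aux: "T \<le> - t \<Longrightarrow> 1 - e < t \<Longrightarrow> 0 < e \<Longrightarrow> 1 - e \<le> (1 - T) / 2"
    "t \<le> T \<Longrightarrow> 1 - e < t \<Longrightarrow> 0 < e \<Longrightarrow> (1 - T) / 2 \<le> e" for T t :: real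
    by simp_all
  show ?thesis
  proof (rule that[OF _ _ _ _ taylor])
    show "0 \<le> \<psi> x \<and> \<psi> x \<le> 1" for x using tb[of "c * (x - m)"] unfolding \<psi>_def abs_le_iff by auto
    have "continuous_on UNIV \<psi>" using d1 DERIV_isCont by (intro continuous_at_imp_continuous_on) blast
    then show "\<psi> \<in> borel_measurable borel" by (rule borel_measurable_continuous_onI)
    show "1 - e \<le> \<psi> x" if "x \<le> s" for x
    proof -
      have "c * (x - m) \<le> - y" unfolding cs(2)[symmetric] using that c by (intro mult_left_mono) auto
      then have "tanh (c * (x - m)) \<le> - tanh y" using tanh_real_le_iff[of "c * (x - m)" "- y"] by simp
      then show ?thesis using y(2) assms(2) unfolding \<psi>_def by (rule aux(1))
    qed
    show "\<psi> x \<le> e" if "s' \<le> x" for x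
    proof -
      have "y \<le> c * (x - m)" unfolding cs(1)[symmetric] using that c by (intro mult_left_mono) auto
      then have "tanh y \<le> tanh (c * (x - m))" by (simp only: tanh_real_le_iff)
      then show ?thesis using y(2) assms(2) unfolding \<psi>_def by (rule aux(2))
    qed
    show "0 \<le> c\<^sup>2" by simp
    show "\<bar>\<psi>' a\<bar> \<le> c" for a
    proof -
      have "\<bar>\<psi>' a\<bar> = c * (1 - (tanh (c * (a - m)))\<^sup>2) / 2"
        unfolding \<psi>'_def using c tb2(1)[of "c * (a - m)"] by (simp add: abs_mult)
      also have "\<dots> \<le> c * 1 / 2" using c tb2 by (intro divide_right_mono mult_left_mono) auto
      finally show ?thesis using c by simp
    qed
  qed
qed

subsection \<open>Comparison of two models with asymptotically equal cavity fields\<close>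

lemma borel_fst_coordinate [measurable]: "(\<lambda>z :: rvec \<times> real. fst z i) \<in> borel_measurable borel"
  by (rule measurable_compose[OF _ measurable_coordinate]) (simp add: borel_prod[symmetric])

lemma borel_dotp_fst [measurable]: "(\<lambda>z :: rvec \<times> real. dotp p u (fst z)) \<in> borel_measurable borel"
  unfolding dotp_def by measurable

text \<open>The interface between the comparison of risks and the two alternatives for the loss. The
  index \<open>True\<close> stands for the law of the given features, \<open>False\<close> for the
  Gaussian one; all results are symmetric in it, so each inequality can be read in both directions.
  The Lipschitz bound is almost sure because binary labels take their two values only almost surely.
  All closeness of the two models is in \<open>cavity_close\<close>, which is uniform over finite
  sets and weights.\<close>

locale universal_pair =
  fixes p :: "nat \<Rightarrow> nat" and R :: real and S C :: "nat \<Rightarrow> rvec set"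
    and r :: "nat \<Rightarrow> ('k::finite \<Rightarrow> rvec) \<Rightarrow> real"
    and lf :: "nat \<Rightarrow> ('k \<Rightarrow> rvec) \<Rightarrow> rvec \<times> real \<Rightarrow> real"
    and D :: "bool \<Rightarrow> nat \<Rightarrow> (rvec \<times> real) measure"
  assumes prob_D: "n > 0 \<Longrightarrow> prob_space (D b n)"
    and sets_D: "n > 0 \<Longrightarrow> sets (D b n) = sets borel"
    and regime: "proportional_regime p"
    and S_sub: "n > 0 \<Longrightarrow> S n \<subseteq> Rvec (p n)"
    and S_sym: "n > 0 \<Longrightarrow> symmetric_convex (S n)"
    and S_ne: "n > 0 \<Longrightarrow> S n \<noteq> {}"
    and S_norm: "n > 0 \<Longrightarrow> u \<in> S n \<Longrightarrow> norm2 (p n) u \<le> R"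
    and C_sub: "n > 0 \<Longrightarrow> C n \<subseteq> S n"
    and pen: "penalty p r"
    and lf_meas: "n > 0 \<Longrightarrow> lf n T \<in> borel_measurable borel"
    and lf_nonneg: "0 \<le> lf n T z"
    and lf_cont: "n > 0 \<Longrightarrow> continuous_on UNIV (\<lambda>T. lf n T z)"
    and lf_moment: "\<exists>M\<ge>0. \<forall>b n T. n > 0 \<longrightarrow> (\<forall>j. T j \<in> C n) \<longrightarrow>
      (\<integral>\<^sup>+z. ennreal ((lf n T z)\<^sup>2) \<partial>D b n) \<le> ennreal M"
    and lf_lip: "B > 0 \<Longrightarrow> \<exists>K\<ge>0. \<forall>b n. n > 0 \<longrightarrow> (AE z in D b n. \<forall>T T'.
      \<bar>min (lf n T z) B - min (lf n T' z) B\<bar> \<le> K * (\<Sum>j\<in>UNIV. \<bar>dotp (p n) (\<lambda>i. T j i - T' j i) (fst z)\<bar>))"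
    and exp_moment: "\<exists>c\<ge>1. \<forall>b n u. n > 0 \<longrightarrow> u \<in> S n \<longrightarrow>
      (\<integral>\<^sup>+z. ennreal (exp \<bar>dotp (p n) u (fst z)\<bar>) \<partial>D b n) \<le> ennreal c"
    and cavity_close: "\<beta> > 0 \<Longrightarrow> B > 0 \<Longrightarrow> e > 0 \<Longrightarrow> \<forall>\<^sub>F n in sequentially. \<forall>N \<nu>.
      finite N \<longrightarrow> N \<subseteq> {T. \<forall>j. T j \<in> C n} \<longrightarrow> weights N \<nu> \<longrightarrow>
      \<bar>(\<integral>z. cavity \<beta> N \<nu> (\<lambda>T. min (lf n T z) B) \<partial>D True n) -
       (\<integral>z. cavity \<beta> N \<nu> (\<lambda>T. min (lf n T z) B) \<partial>D False n)\<bar> \<le> e"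
begin

definition CC :: "nat \<Rightarrow> ('k \<Rightarrow> rvec) set" where
  "CC n = {T. \<forall>j. T j \<in> C n}"

definition risk :: "nat \<Rightarrow> (nat \<Rightarrow> rvec \<times> real) \<Rightarrow> ('k \<Rightarrow> rvec) \<Rightarrow> real" where
  "risk n Z T = (\<Sum>a<n. lf n T (Z a)) / real n + r n T"

definition capped_risk :: "real \<Rightarrow> nat \<Rightarrow> (nat \<Rightarrow> rvec \<times> real) \<Rightarrow> ('k \<Rightarrow> rvec) \<Rightarrow> real" where
  "capped_risk B n Z T = (\<Sum>a<n. min (lf n T (Z a)) B) / real n + r n T"

definition P :: "bool \<Rightarrow> nat \<Rightarrow> (nat \<Rightarrow> rvec \<times> real) measure" where
  "P b n = (\<Pi>\<^sub>M a\<in>{..<n}. D b n)"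

lemma prob_P: "n > 0 \<Longrightarrow> prob_space (P b n)"
  unfolding P_def by (rule prob_space_PiM) (rule prob_D)

lemma meas_D: "n > 0 \<Longrightarrow> f \<in> borel_measurable borel \<Longrightarrow> f \<in> borel_measurable (D b n)"
  using measurable_cong_sets[OF sets_D refl] by blast

lemma R_nonneg: "0 \<le> R"
  using S_ne[of 1] S_norm[of 1] norm2_nonneg order_trans by (metis all_not_in_conv zero_less_one)

lemma l1_meas [measurable]: "(\<lambda>z. \<Sum>i<q. \<bar>fst z i\<bar>) \<in> borel_measurable (borel :: (rvec \<times> real) measure)"
  by measurable

text \<open>Uniform integrability from a second moment: \<open>max (x - B) 0 \<le> x * x / B\<close>
  for \<open>x \<ge> 0\<close>.\<close>

lemma lf_overflow:
  obtains M where "M \<ge> 0" "\<And>b n T B. n > 0 \<Longrightarrow> T \<in> CC n \<Longrightarrow> B > 0 \<Longrightarrow>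
    (\<integral>\<^sup>+z. ennreal (max (lf n T z - B) 0) \<partial>D b n) \<le> ennreal (M / B)"
    "\<And>b n T. n > 0 \<Longrightarrow> T \<in> CC n \<Longrightarrow> integrable (D b n) (lf n T)"
proof -
  obtain M where M: "M \<ge> 0" "\<And>b n T. n > 0 \<Longrightarrow> \<forall>j. T j \<in> C n \<Longrightarrow> (\<integral>\<^sup>+z. ennreal ((lf n T z)\<^sup>2) \<partial>D b n) \<le> ennreal M"
    using lf_moment by blast
  have le: "(\<integral>\<^sup>+z. ennreal (max (lf n T z - B) 0) \<partial>D b n) \<le> ennreal (M / B)"
    if n: "n > 0" and T: "T \<in> CC n" and B: "B > 0" for b n T B
  proof -
    have [measurable]: "lf n T \<in> borel_measurable (D b n)" by (rule meas_D[OF n lf_meas[OF n]])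
    have "(\<integral>\<^sup>+z. ennreal (max (lf n T z - B) 0) \<partial>D b n) \<le> (\<integral>\<^sup>+z. ennreal ((lf n T z)\<^sup>2) * ennreal (1 / B) \<partial>D b n)"
    proof (rule nn_integral_mono)
      fix z
      have "max (x - B) 0 \<le> x\<^sup>2 * (1 / B)" if "x \<ge> 0" for x
      proof (cases "x \<le> B")
        case False
        then have "(x - B) * B \<le> x * x" using that B by (intro mult_mono) auto
        then show ?thesis using False B by (simp add: power2_eq_square pos_le_divide_eq)
      qed (use that B in simp)
      from this[OF lf_nonneg] show "ennreal (max (lf n T z - B) 0) \<le> ennreal ((lf n T z)\<^sup>2) * ennreal (1 / B)"
        using B by (subst ennreal_mult[symmetric]) (auto intro: ennreal_leI)
    qed
    also have "\<dots> = (\<integral>\<^sup>+z. ennreal ((lf n T z)\<^sup>2) \<partial>D b n) * ennreal (1 / B)"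
      by (rule nn_integral_multc) measurable
    also have "\<dots> \<le> ennreal M * ennreal (1 / B)"
      using M(2)[OF n, of T b] T by (intro mult_right_mono) (auto simp: CC_def)
    also have "\<dots> = ennreal (M / B)" using M(1) B by (subst ennreal_mult[symmetric]) auto
    finally show ?thesis .
  qed
  have "integrable (D b n) (lf n T)" if n: "n > 0" and T: "T \<in> CC n" for b n T
  proof (rule integrableI_bounded)
    have [measurable]: "lf n T \<in> borel_measurable (D b n)" by (rule meas_D[OF n lf_meas[OF n]])
    then show "lf n T \<in> borel_measurable (D b n)" .
    have "(\<integral>\<^sup>+z. ennreal (norm (lf n T z)) \<partial>D b n) \<le> (\<integral>\<^sup>+z. ennreal (max (lf n T z - 1) 0) + ennreal 1 \<partial>D b n)"
    proof (rule nn_integral_mono)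
      fix z
      have "ennreal (norm (lf n T z)) \<le> ennreal (max (lf n T z - 1) 0 + 1)"
        using lf_nonneg[of n T z] by (intro ennreal_leI) auto
      then show "ennreal (norm (lf n T z)) \<le> ennreal (max (lf n T z - 1) 0) + ennreal 1"
        by (subst ennreal_plus[symmetric]) auto
    qed
    also have "\<dots> = (\<integral>\<^sup>+z. ennreal (max (lf n T z - 1) 0) \<partial>D b n) + 1"
      using prob_space.emeasure_space_1[OF prob_D[OF n]] by (subst nn_integral_add) auto
    also have "\<dots> \<le> ennreal (M / 1) + 1" using le[OF n T, of 1 b] by (intro add_mono) auto
    also have "\<dots> < \<infinity>" by simp
    finally show "(\<integral>\<^sup>+z. ennreal (norm (lf n T z)) \<partial>D b n) < \<infinity>" .
  qed
  with M(1) le show ?thesis by (rule that)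
qed

text \<open>For a single point of weight 1 the cavity term is the capped loss itself, so
  \<open>cavity_close\<close> at inverse temperature 1 already compares the test errors, uniformly
  in \<open>T\<close>. In each model the cap costs at most \<open>M / B\<close>.\<close>

lemma expected_loss_close:
  assumes e: "e > 0"
  shows "\<forall>\<^sub>F n in sequentially. \<forall>T\<in>CC n.
    \<bar>(\<integral>z. lf n T z \<partial>D b n) - (\<integral>z. lf n T z \<partial>D (\<not> b) n)\<bar> \<le> e"
proof -
  obtain M where M: "M \<ge> 0" "\<And>b n T B. n > 0 \<Longrightarrow> T \<in> CC n \<Longrightarrow> B > 0 \<Longrightarrow>
      (\<integral>\<^sup>+z. ennreal (max (lf n T z - B) 0) \<partial>D b n) \<le> ennreal (M / B)"
    "\<And>b n T. n > 0 \<Longrightarrow> T \<in> CC n \<Longrightarrow> integrable (D b n) (lf n T)"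
    by (rule lf_overflow) blast
  define B where "B = 3 * M / e + 1"
  have B: "B > 0" "M / B \<le> e / 3"
    using M(1) e by (auto simp: B_def field_simps intro: add_nonneg_pos)
  have "e / 3 > 0" using e by simp
  from cavity_close[OF zero_less_one B(1) this] eventually_gt_at_top[of 0]
  show ?thesis
  proof eventually_elim
    case (elim n)
    show ?case
    proof
      fix T assume T: "T \<in> CC n"
      have ti: "\<bar>(\<integral>z. lf n T z \<partial>D b n) - (\<integral>z. min (lf n T z) B \<partial>D b n)\<bar> \<le> e / 3" for b
      proof -
        interpret prob_space "D b n" by (rule prob_D[OF elim(2)])
        have lm [measurable]: "lf n T \<in> borel_measurable (D b n)" by (rule meas_D[OF elim(2) lf_meas[OF elim(2)]])
        have i: "integrable (D b n) (lf n T)" by (rule M(3)[OF elim(2) T])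
        have i2: "integrable (D b n) (\<lambda>z. min (lf n T z) B)"
          using i by (rule Bochner_Integration.integrable_bound) (use lf_nonneg B in auto)
        have "(\<integral>z. lf n T z \<partial>D b n) - (\<integral>z. min (lf n T z) B \<partial>D b n) = (\<integral>z. lf n T z - min (lf n T z) B \<partial>D b n)"
          using i i2 by simp
        also have "\<dots> = (\<integral>z. max (lf n T z - B) 0 \<partial>D b n)" by (intro Bochner_Integration.integral_cong) auto
        also have "\<dots> = enn2real (\<integral>\<^sup>+z. ennreal (max (lf n T z - B) 0) \<partial>D b n)"
          by (rule integral_eq_nn_integral) auto
        finally have eq: "(\<integral>z. lf n T z \<partial>D b n) - (\<integral>z. min (lf n T z) B \<partial>D b n) = \<dots>" .
        have "enn2real (\<integral>\<^sup>+z. ennreal (max (lf n T z - B) 0) \<partial>D b n) \<le> M / B"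
          using M(2)[OF elim(2) T B(1), of b] M(1) B(1) by (intro enn2real_leI) auto
        then show ?thesis unfolding eq abs_of_nonneg[OF enn2real_nonneg] using B(2) by (rule order_trans)
      qed
      have "{T} \<subseteq> {T. \<forall>j. T j \<in> C n}" using T by (simp add: CC_def)
      with elim(1) have "\<bar>(\<integral>z. cavity 1 {T} (\<lambda>_. 1) (\<lambda>T. min (lf n T z) B) \<partial>D True n) -
           (\<integral>z. cavity 1 {T} (\<lambda>_. 1) (\<lambda>T. min (lf n T z) B) \<partial>D False n)\<bar> \<le> e / 3"
        by (auto simp: weights_def)
      then have "\<bar>(\<integral>z. min (lf n T z) B \<partial>D True n) - (\<integral>z. min (lf n T z) B \<partial>D False n)\<bar> \<le> e / 3"
        by (simp add: cavity_def)
      moreover have "\<bar>x - y\<bar> \<le> e" "\<bar>y - x\<bar> \<le> e"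
        if "\<bar>x - x'\<bar> \<le> e / 3" "\<bar>y - y'\<bar> \<le> e / 3" "\<bar>x' - y'\<bar> \<le> e / 3" for x y x' y' :: real
        using that by linarith+
      ultimately show "\<bar>(\<integral>z. lf n T z \<partial>D b n) - (\<integral>z. lf n T z \<partial>D (\<not> b) n)\<bar> \<le> e"
        using ti[of True] ti[of False] by (cases b) auto
    qed
  qed
qed

text \<open>Both matrices are compared with a common centre \<open>v\<close>, whence the factor 2.
  The centre itself need not be admissible: its columns lie in a net of \<open>S\<close>, not of
  \<open>C\<close>.\<close>

lemma capped_risk_close:
  fixes T T' v :: "'k \<Rightarrow> rvec"
  assumes n: "n > 0" and T: "T \<in> CC n" "T' \<in> CC n"
    and lip: "\<And>a. a < n \<Longrightarrow> \<bar>min (lf n T (Z a)) B - min (lf n T' (Z a)) B\<bar>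
      \<le> K * (\<Sum>j\<in>UNIV. \<bar>dotp (p n) (\<lambda>i. T j i - T' j i) (fst (Z a))\<bar>)" and K: "K \<ge> 0"
    and Kr: "\<And>T T'. T \<in> Rmat (p n) \<Longrightarrow> T' \<in> Rmat (p n) \<Longrightarrow> frob_norm (p n) T \<le> real CARD('k) * (R + 1) \<Longrightarrow>
      frob_norm (p n) T' \<le> real CARD('k) * (R + 1) \<Longrightarrow> \<bar>r n T - r n T'\<bar> \<le> Kr * frob_norm (p n) (mat_diff T T')" "Kr \<ge> 0"
    and near: "\<And>j. avg_abs n (p n) (fst \<circ> Z) (\<lambda>i. T j i - v j i) \<le> d1"
      "\<And>j. avg_abs n (p n) (fst \<circ> Z) (\<lambda>i. T' j i - v j i) \<le> d1"
      "\<And>j. norm2 (p n) (\<lambda>i. T j i - v j i) \<le> d2" "\<And>j. norm2 (p n) (\<lambda>i. T' j i - v j i) \<le> d2"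
  shows "\<bar>capped_risk B n Z T - capped_risk B n Z T'\<bar> \<le> 2 * real CARD('k) * (K * d1 + Kr * d2)"
proof -
  have eq: "(\<lambda>i. T j i - T' j i) = (\<lambda>i. (T j i - v j i) - (T' j i - v j i))" for j by auto
  have a: "avg_abs n (p n) (fst \<circ> Z) (\<lambda>i. T j i - T' j i) \<le> 2 * d1" for j
    unfolding eq using avg_abs_diff[of n "p n" "fst \<circ> Z" "\<lambda>i. T j i - v j i" "\<lambda>i. T' j i - v j i"] near(1,2)[of j]
    by linarith
  have nn: "norm2 (p n) (\<lambda>i. T j i - T' j i) \<le> 2 * d2" for j
    unfolding eq using norm2_diff[of "p n" "\<lambda>i. T j i - v j i" "\<lambda>i. T' j i - v j i"] near(3,4)[of j]
    by linarith
  have frob: "frob_norm (p n) U \<le> real CARD('k) * (R + 1)" if "U \<in> CC n" for U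
  proof -
    have "frob_norm (p n) U \<le> (\<Sum>j\<in>UNIV. norm2 (p n) (U j))" by (rule frob_norm_le)
    also have "\<dots> \<le> (\<Sum>j\<in>(UNIV :: 'k set). R + 1)"
    proof (rule sum_mono)
      fix j
      have "U j \<in> S n" using that C_sub[OF n] by (auto simp: CC_def)
      from S_norm[OF n this] show "norm2 (p n) (U j) \<le> R + 1" by simp
    qed
    finally show ?thesis by simp
  qed
  have mat: "U \<in> Rmat (p n)" if "U \<in> CC n" for U
    using that C_sub[OF n] S_sub[OF n] by (auto simp: CC_def Rmat_def)
  have "frob_norm (p n) (mat_diff T T') \<le> (\<Sum>j\<in>UNIV. norm2 (p n) (mat_diff T T' j))" by (rule frob_norm_le)
  also have "\<dots> \<le> (\<Sum>j\<in>(UNIV :: 'k set). 2 * d2)" using nn by (intro sum_mono) (simp add: mat_diff_def)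
  finally have f: "frob_norm (p n) (mat_diff T T') \<le> 2 * real CARD('k) * d2" by simp
  have "\<bar>r n T - r n T'\<bar> \<le> Kr * frob_norm (p n) (mat_diff T T')"
    using T by (intro Kr mat frob)
  also have "\<dots> \<le> Kr * (2 * real CARD('k) * d2)" using f Kr(2) by (rule mult_left_mono)
  finally have rr: "\<bar>r n T - r n T'\<bar> \<le> 2 * real CARD('k) * (Kr * d2)" by (simp add: mult_ac)
  have "\<bar>(\<Sum>a<n. min (lf n T (Z a)) B) - (\<Sum>a<n. min (lf n T' (Z a)) B)\<bar> \<le>
      (\<Sum>a<n. \<bar>min (lf n T (Z a)) B - min (lf n T' (Z a)) B\<bar>)"
    unfolding sum_subtractf[symmetric] by (rule sum_abs)
  also have "\<dots> \<le> (\<Sum>a<n. K * (\<Sum>j\<in>UNIV. \<bar>dotp (p n) (\<lambda>i. T j i - T' j i) (fst (Z a))\<bar>))"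
    using lip by (intro sum_mono) auto
  also have "\<dots> = K * (\<Sum>j\<in>UNIV. \<Sum>a<n. \<bar>dotp (p n) (\<lambda>i. T j i - T' j i) (fst (Z a))\<bar>)"
    by (subst sum.swap) (simp add: sum_distrib_left)
  also have "\<dots> = K * (\<Sum>j\<in>UNIV. real n * avg_abs n (p n) (fst \<circ> Z) (\<lambda>i. T j i - T' j i))"
    using n by (simp add: avg_abs_def)
  also have "\<dots> \<le> K * (\<Sum>j\<in>(UNIV :: 'k set). real n * (2 * d1))"
    using a K by (intro mult_left_mono sum_mono) auto
  also have "\<dots> = real n * (2 * real CARD('k) * (K * d1))" by simp
  finally have "\<bar>(\<Sum>a<n. min (lf n T (Z a)) B) - (\<Sum>a<n. min (lf n T' (Z a)) B)\<bar> / real n \<le> 2 * real CARD('k) * (K * d1)"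
    using n by (simp add: divide_le_eq mult.commute)
  then have "\<bar>(\<Sum>a<n. min (lf n T (Z a)) B) / real n - (\<Sum>a<n. min (lf n T' (Z a)) B) / real n\<bar> \<le> 2 * real CARD('k) * (K * d1)"
    by (simp add: abs_divide flip: diff_divide_distrib)
  with rr show ?thesis unfolding capped_risk_def by (simp add: algebra_simps)
qed

end

text \<open>Rounding by \<open>\<pi>\<close> leaves the set \<open>A\<close>. One point of
  \<open>A\<close> from each fibre gives a subset of \<open>A\<close> that is no larger than the net
  and still close to every point, at twice the distance.\<close>

lemma choose_fibre_representatives:
  assumes fin: "finite F" and \<pi>: "\<pi> ` A \<subseteq> F" and ne: "A \<noteq> {}"
  shows "\<exists>N\<subseteq>A. finite N \<and> N \<noteq> {} \<and> card N \<le> card F \<and> (\<forall>T\<in>A. \<exists>T'\<in>N. \<pi> T' = \<pi> T)"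
proof -
  define \<rho> where "\<rho> y = (SOME T. T \<in> A \<and> \<pi> T = y)" for y
  have \<rho>: "\<rho> (\<pi> T) \<in> A \<and> \<pi> (\<rho> (\<pi> T)) = \<pi> T" if "T \<in> A" for T
    unfolding \<rho>_def by (rule someI[of _ T]) (use that in simp)
  show ?thesis
  proof (intro exI[of _ "\<rho> ` \<pi> ` A"] conjI ballI)
    show "\<rho> ` \<pi> ` A \<subseteq> A" using \<rho> by auto
    show "finite (\<rho> ` \<pi> ` A)" using fin \<pi> by (meson finite_imageI finite_subset)
    show "\<rho> ` \<pi> ` A \<noteq> {}" using ne by simp
    show "card (\<rho> ` \<pi> ` A) \<le> card F"
      using fin \<pi> by (meson card_image_le card_mono finite_subset le_trans)
    show "\<exists>T'\<in>\<rho> ` \<pi> ` A. \<pi> T' = \<pi> T" if "T \<in> A" for T using \<rho>[OF that] that by blast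
  qed
qed

section \<open>Nets that serve both models with high probability\<close>

context universal_pair
begin

text \<open>Two nets in the gauge of \<open>S\<close> are used. The coarse one, \<open>N0\<close>,
  bounds the empirical \<open>L1\<close> norm on all of \<open>S\<close> outside an exceptional
  event; given this bound, the fine one, \<open>N1\<close>, approximates columns to within a
  multiple of \<open>\<epsilon>\<close>. The set \<open>N\<close> is deterministic and the same for
  both models; only the exceptional event \<open>X\<close> depends on the model.\<close>

lemma net_exists:
  assumes B: "B > 0" and \<eta>: "\<eta> > 0"
  obtains c where "c \<ge> 0" "\<And>n A. n > 0 \<Longrightarrow> A \<subseteq> CC n \<Longrightarrow> A \<noteq> {} \<Longrightarrow>
    \<exists>N\<subseteq>A. finite N \<and> N \<noteq> {} \<and> ln (real (card N)) \<le> c * real n \<and>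
      (\<forall>b. \<exists>X\<in>sets (P b n). measure (P b n) X \<le> 2 / real n \<and>
        (AE Z in P b n. Z \<notin> X \<longrightarrow> (\<forall>T\<in>A. \<exists>T'\<in>N. capped_risk B n Z T' \<le> capped_risk B n Z T + \<eta>)))"
proof -
  obtain K where K: "K \<ge> 0" "\<And>b n. n > 0 \<Longrightarrow> AE z in D b n. \<forall>T T'.
      \<bar>min (lf n T z) B - min (lf n T' z) B\<bar> \<le> K * (\<Sum>j\<in>UNIV. \<bar>dotp (p n) (\<lambda>i. T j i - T' j i) (fst z)\<bar>)"
    using lf_lip[OF B] by blast
  obtain c0 where c0: "c0 \<ge> 1" "\<And>b n u. n > 0 \<Longrightarrow> u \<in> S n \<Longrightarrow>
      (\<integral>\<^sup>+z. ennreal (exp \<bar>dotp (p n) u (fst z)\<bar>) \<partial>D b n) \<le> ennreal c0"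
    using exp_moment by blast
  obtain C0 where C0: "C0 > 0" "\<And>n. n > 0 \<Longrightarrow> real (p n) / real n \<le> C0"
    using regime by (auto simp: proportional_regime_def)
  have pC0: "real (p n) \<le> C0 * real n" if "n > 0" for n
    using C0(2)[OF that] that by (simp add: divide_le_eq)
  \<comment> \<open>\<open>R\<close> may be 0, while the Lipschitz constant of the penalty is
    provided for positive radii only; hence \<open>R + 1\<close>.\<close>
  have kR: "real CARD('k) * (R + 1) > 0" using R_nonneg by (intro mult_pos_pos) auto
  have "\<forall>B>0. \<exists>K>0. \<forall>n>0. \<forall>T\<in>Rmat (p n). \<forall>T'\<in>Rmat (p n).
      frob_norm (p n) T \<le> B \<longrightarrow> frob_norm (p n) T' \<le> B \<longrightarrow> \<bar>r n T - r n T'\<bar> \<le> K * frob_norm (p n) (mat_diff T T')"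
    using pen unfolding penalty_def by (rule conjunct2)
  from this[rule_format, OF kR] obtain Kr where Kr0: "Kr > 0"
    and Kr': "\<forall>n>0. \<forall>T\<in>Rmat (p n). \<forall>T'\<in>Rmat (p n). frob_norm (p n) T \<le> real CARD('k) * (R + 1) \<longrightarrow>
      frob_norm (p n) T' \<le> real CARD('k) * (R + 1) \<longrightarrow> \<bar>r n T - r n T'\<bar> \<le> Kr * frob_norm (p n) (mat_diff T T')"
    by (elim exE conjE)
  note Kr = Kr0 Kr'[rule_format]
  \<comment> \<open>\<open>N0\<close> has at most \<open>6 ^ p n\<close> points, with
    \<open>6 = 3 / (1/2)\<close>. The three terms of \<open>t\<close> compensate this cardinality,
    the moment bound \<open>c0\<close>, and leave a margin \<open>exp (- n)\<close>.\<close>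
  define t where "t = C0 * ln 6 + ln c0 + 1"
  define W where "W = 2 * t + 1"
  have t: "t \<ge> 1" using C0(1) c0(1) by (simp add: t_def)
  \<comment> \<open>The total variation of the capped risk per unit of \<open>\<epsilon>\<close>,
    from the loss and from the penalty.\<close>
  define q where "q = 2 * real CARD('k) * (K * (W + 1) + Kr * (R + 1))"
  have q: "q \<ge> 0" unfolding q_def W_def using K Kr R_nonneg t
    by (intro mult_nonneg_nonneg add_nonneg_nonneg) auto
  define \<epsilon> where "\<epsilon> = min 1 (\<eta> / (q + 1))"
  have \<epsilon>: "0 < \<epsilon>" "\<epsilon> \<le> 1" using \<eta> q by (auto simp: \<epsilon>_def)
  have \<epsilon>q: "\<epsilon> * q \<le> \<eta>"
  proof -
    have "\<epsilon> * q \<le> \<eta> / (q + 1) * (q + 1)"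
      using q \<eta> \<epsilon> by (intro mult_mono) (auto simp: \<epsilon>_def)
    then show ?thesis using q by simp
  qed
  define c where "c = real CARD('k) * (C0 * ln (3 / \<epsilon>))"
  have ln3: "ln (3 / \<epsilon>) \<ge> 0" using \<epsilon> by (intro ln_ge_zero) (auto simp: le_divide_eq)
  have c: "c \<ge> 0" unfolding c_def using C0 ln3 by (intro mult_nonneg_nonneg) auto
  show ?thesis
  proof (rule that[OF c])
    fix n :: nat and A assume n: "n > 0" and A: "A \<subseteq> CC n" "A \<noteq> {}"
    let ?f = "\<lambda>z :: rvec \<times> real. \<Sum>i<p n. \<bar>fst z i\<bar>"
    have fm [measurable]: "?f \<in> borel_measurable (D b n)" for b by (rule meas_D[OF n l1_meas])
    \<comment> \<open>A tail below \<open>1 / n^2\<close> for one row leaves \<open>1 / n\<close>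
      after the union over the \<open>n\<close> rows.\<close>
    have "\<exists>m. \<forall>s\<ge>real m. measure (D b n) {z \<in> space (D b n). ?f z > s} < 1 / (real n)\<^sup>2" for b
    proof -
      interpret prob_space "D b n" by (rule prob_D[OF n])
      have "0 < 1 / (real n)\<^sup>2" using n by simp
      then show ?thesis by (rule measure_tail_small[OF fm[of b]]) blast
    qed
    then have "\<forall>b. \<exists>m. \<forall>s\<ge>real m. measure (D b n) {z \<in> space (D b n). ?f z > s} < 1 / (real n)\<^sup>2" by (rule allI)
    from choice[OF this] obtain m where
      m0: "\<forall>b. \<forall>s\<ge>real (m b). measure (D b n) {z \<in> space (D b n). ?f z > s} < 1 / (real n)\<^sup>2" by (rule exE)
    note m = m0[rule_format]
    \<comment> \<open>Small enough for the rows of both models and for \<open>p n\<close>. It may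
      depend on \<open>n\<close> and on the laws without any rate, because the cardinality of the
      nets does not involve it.\<close>
    define \<tau> where "\<tau> = 1 / (real (m True) + real (m False) + real (p n) + 1)"
    have \<tau>0: "\<tau> > 0" by (simp add: \<tau>_def add_nonneg_pos)
    have \<tau>1: "1 / \<tau> \<ge> real (m b)" for b by (cases b) (auto simp: \<tau>_def)
    have \<tau>2: "real (p n) * \<tau> \<le> 1" by (simp add: \<tau>_def divide_le_eq)
    have SR: "\<forall>u\<in>S n. \<forall>i. \<bar>u i\<bar> \<le> R"
    proof (intro ballI allI)
      fix u i assume that: "u \<in> S n"
      show "\<bar>u i\<bar> \<le> R"
    proof (cases "i < p n")
      case True
      then show ?thesis using coordinate_le_norm2[of i "p n" u] S_norm[OF n that] by linarith
    next
      case False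
      then show ?thesis using S_sub[OF n] that R_nonneg by (auto simp: Rvec_def)
    qed
    qed
    have half: "(0::real) < 1/2" "(1/2 :: real) \<le> 1" by auto
    obtain N0 where N0: "finite N0" "N0 \<subseteq> S n" "real (card N0) \<le> (3 / (1/2)) ^ p n"
      "\<And>u. u \<in> S n \<Longrightarrow> \<exists>v\<in>N0. \<exists>s\<in>S n. \<forall>i<p n. \<bar>u i - v i - 1/2 * s i\<bar> < 1/2 * \<tau>"
      using gauge_net[OF S_sub[OF n] S_ne[OF n] S_sym[OF n] SR \<tau>0 half] by blast
    obtain N1 where N1: "finite N1" "N1 \<subseteq> S n" "real (card N1) \<le> (3 / \<epsilon>) ^ p n"
      "\<And>u. u \<in> S n \<Longrightarrow> \<exists>v\<in>N1. \<exists>s\<in>S n. \<forall>i<p n. \<bar>u i - v i - \<epsilon> * s i\<bar> < \<epsilon> * \<tau>"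
      using gauge_net[OF S_sub[OF n] S_ne[OF n] S_sym[OF n] SR \<tau>0 \<epsilon>] by blast
    define near where "near u v \<longleftrightarrow> (\<exists>s\<in>S n. \<forall>i<p n. \<bar>u i - v i - \<epsilon> * s i\<bar> < \<epsilon> * \<tau>)" for u v :: rvec
    \<comment> \<open>Columnwise rounding to the fine net. Two matrices with the same image are
      close to the same centre.\<close>
    define \<pi> where "\<pi> T j = (SOME v. v \<in> N1 \<and> near (T j) v)" for T :: "'k \<Rightarrow> rvec" and j
    have \<pi>: "\<pi> T j \<in> N1 \<and> near (T j) (\<pi> T j)" if "T \<in> CC n" for T j
    proof -
      have "T j \<in> S n" using that C_sub[OF n] by (auto simp: CC_def)
      from N1(4)[OF this] have "\<exists>v. v \<in> N1 \<and> near (T j) v" unfolding near_def by blast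
      then show ?thesis unfolding \<pi>_def by (rule someI_ex)
    qed
    let ?F = "PiE UNIV (\<lambda>_ :: 'k. N1)"
    have "\<pi> ` A \<subseteq> ?F" using \<pi> A by (auto simp: PiE_iff)
    moreover have "finite ?F" using N1(1) by (intro finite_PiE) auto
    ultimately obtain N where N': "N \<subseteq> A" "finite N" "N \<noteq> {}" "card N \<le> card ?F" "\<forall>T\<in>A. \<exists>T'\<in>N. \<pi> T' = \<pi> T"
      using choose_fibre_representatives[of ?F \<pi> A] A(2) by blast
    note N = N'(1-4) N'(5)[rule_format]
    have "ln (real (card N)) \<le> c * real n"
    proof -
      have cN: "real (card N) > 0" using N by (simp add: card_gt_0_iff)
      have "real (card N) \<le> real (card N1) ^ CARD('k)"
        using N(4) by (simp add: card_PiE flip: of_nat_power)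
      also have "\<dots> \<le> ((3 / \<epsilon>) ^ p n) ^ CARD('k)" using N1(3) by (intro power_mono) auto
      finally have "ln (real (card N)) \<le> ln (((3 / \<epsilon>) ^ p n) ^ CARD('k))" using cN by (intro ln_mono) auto
      also have "\<dots> = real CARD('k) * (real (p n) * ln (3 / \<epsilon>))"
        using \<epsilon> by (simp add: ln_realpow)
      also have "\<dots> \<le> real CARD('k) * (C0 * real n * ln (3 / \<epsilon>))"
        using pC0[OF n] ln3 by (intro mult_left_mono mult_right_mono) auto
      finally show ?thesis by (simp add: c_def mult_ac)
    qed
    moreover have "\<exists>X\<in>sets (P b n). measure (P b n) X \<le> 2 / real n \<and>
        (AE Z in P b n. Z \<notin> X \<longrightarrow> (\<forall>T\<in>A. \<exists>T'\<in>N. capped_risk B n Z T' \<le> capped_risk B n Z T + \<eta>))" for b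
    proof -
      interpret D: prob_space "D b n" by (rule prob_D[OF n])
      interpret P: prob_space "P b n" by (rule prob_P[OF n])
      let ?A = "{z \<in> space (D b n). ?f z > 1 / \<tau>}"
      define X1 where "X1 = {Z \<in> space (P b n). \<exists>l<n. Z l \<in> ?A}"
      define X2 where "X2 v = {Z \<in> space (P b n). (\<Sum>l<n. \<bar>dotp (p n) v (fst (Z l))\<bar>) / real n > t}" for v
      have X1m: "X1 \<in> sets (P b n)"
      proof -
        have "X1 = (\<Union>l<n. (\<lambda>Z. Z l) -` ?A \<inter> space (P b n))" by (auto simp: X1_def)
        also have "\<dots> \<in> sets (P b n)" unfolding P_def
          by (intro sets.finite_UN measurable_sets[OF measurable_component_singleton]) auto
        finally show ?thesis .
      qed
      have dm [measurable]: "(\<lambda>z. dotp (p n) v (fst z)) \<in> borel_measurable (D b n)" for v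
        by (rule meas_D[OF n borel_dotp_fst])
      have X2m: "X2 v \<in> sets (P b n)" for v unfolding X2_def P_def by measurable
      have "measure (P b n) X1 \<le> real n * (1 / (real n)\<^sup>2)"
        unfolding X1_def P_def using m[OF \<tau>1, of b]
        by (intro PiM_union_bound[OF prob_D[OF n]]) auto
      then have mX1: "measure (P b n) X1 \<le> 1 / real n" using n by (simp add: power2_eq_square)
      have mX2: "measure (P b n) (X2 v) \<le> (c0 * exp (- t)) ^ n" if "v \<in> N0" for v
        unfolding X2_def P_def using that N0(2) c0(1)
        by (intro PiM_chernoff[OF prob_D[OF n] _ c0(2)[OF n] _ n]) auto
      have "measure (P b n) (\<Union>v\<in>N0. X2 v) \<le> (\<Sum>v\<in>N0. measure (P b n) (X2 v))"
        using X2m N0(1) by (intro P.finite_measure_subadditive_finite) auto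
      also have "\<dots> \<le> (\<Sum>v\<in>N0. (c0 * exp (- t)) ^ n)" using mX2 by (rule sum_mono)
      also have "\<dots> \<le> 6 ^ p n * (c0 * exp (- t)) ^ n"
        using N0(3) c0(1) by (auto intro!: mult_right_mono)
      also have "\<dots> \<le> 1 / real n"
      proof -
        have "(6::real) ^ p n = exp (real (p n) * ln 6)" by (simp add: exp_of_nat_mult)
        also have "\<dots> \<le> exp (C0 * real n * ln 6)" using pC0[OF n] by simp
        finally have a: "(6::real) ^ p n \<le> exp (C0 * real n * ln 6)" .
        have "c0 * exp (- t) = exp (ln c0 - t)" using c0(1) by (simp add: exp_diff exp_minus field_simps)
        then have b: "(c0 * exp (- t)) ^ n = exp (real n * (ln c0 - t))" by (simp add: exp_of_nat_mult)
        have "6 ^ p n * (c0 * exp (- t)) ^ n \<le> exp (C0 * real n * ln 6) * exp (real n * (ln c0 - t))"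
          unfolding b by (intro mult_right_mono a) auto
        also have "\<dots> = exp (- real n)" by (simp add: t_def algebra_simps flip: exp_add)
        also have "\<dots> = 1 / exp (real n)" by (simp add: exp_minus field_simps)
        also have "\<dots> \<le> 1 / real n"
        proof (rule divide_left_mono)
          show "real n \<le> exp (real n)" using exp_ge_add_one_self[of "real n"] by linarith
        qed (use n in auto)
        finally show ?thesis .
      qed
      finally have mX2': "measure (P b n) (\<Union>v\<in>N0. X2 v) \<le> 1 / real n" .
      let ?X = "X1 \<union> (\<Union>v\<in>N0. X2 v)"
      have "?X \<in> sets (P b n)" using X1m X2m N0(1) by (intro sets.Un sets.finite_UN) auto
      moreover have "measure (P b n) ?X \<le> 2 / real n"
      proof -
        have "measure (P b n) ?X \<le> measure (P b n) X1 + measure (P b n) (\<Union>v\<in>N0. X2 v)"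
          using X1m X2m N0(1) by (intro measure_Un_le sets.finite_UN) auto
        then show ?thesis using mX1 mX2' by simp
      qed
      moreover have "AE Z in P b n. Z \<notin> ?X \<longrightarrow> (\<forall>T\<in>A. \<exists>T'\<in>N. capped_risk B n Z T' \<le> capped_risk B n Z T + \<eta>)"
      proof -
        define L where "L z \<longleftrightarrow> (\<forall>T T'. \<bar>min (lf n T z) B - min (lf n T' z) B\<bar>
              \<le> K * (\<Sum>j\<in>UNIV. \<bar>dotp (p n) (\<lambda>i. T j i - T' j i) (fst z)\<bar>))" for z
        have "AE z in D b n. L z" unfolding L_def by (rule K(2)[OF n])
        then have "AE Z in P b n. L (Z a)" if "a < n" for a
          unfolding P_def using that
          by (intro AE_PiM_component[where M="\<lambda>_. D b n" and P=L]) (auto intro: prob_D[OF n])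
        then have "AE Z in P b n. \<forall>a\<in>{..<n}. L (Z a)"
          by (intro AE_finite_allI) auto
        with AE_space show ?thesis
        proof (eventually_elim, intro impI ballI)
          fix Z T assume Z: "Z \<in> space (P b n)" "Z \<notin> ?X" and T: "T \<in> A"
            and lip: "\<forall>a\<in>{..<n}. L (Z a)"
          obtain T' where T': "T' \<in> N" "\<pi> T' = \<pi> T" using N(5)[OF T] by blast
          have row: "\<tau> * (\<Sum>i<p n. \<bar>(fst \<circ> Z) l i\<bar>) \<le> 1" if "l < n" for l
          proof -
            have "Z l \<in> space (D b n)" using Z(1) that by (auto simp: P_def space_PiM)
            then have "?f (Z l) \<le> 1 / \<tau>" using Z that by (auto simp: X1_def not_less)
            then show ?thesis using \<tau>0 by (simp add: pos_le_divide_eq mult.commute)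
          qed
          have avg: "avg_abs n (p n) (fst \<circ> Z) v \<le> t" if "v \<in> N0" for v
            using Z that by (auto simp: X2_def avg_abs_def not_less)
          have W: "avg_abs n (p n) (fst \<circ> Z) u \<le> W" if "u \<in> S n" for u
            unfolding W_def by (rule avg_abs_bound[OF n S_norm[OF n] R_nonneg N0(4) avg \<tau>0 row that])
          have bounds: "avg_abs n (p n) (fst \<circ> Z) (\<lambda>i. U j i - \<pi> U j i) \<le> \<epsilon> * (W + 1)"
            "norm2 (p n) (\<lambda>i. U j i - \<pi> U j i) \<le> \<epsilon> * (R + 1)" if U: "U \<in> CC n" for U j
          proof -
            obtain s where s0: "s \<in> S n" "\<forall>i<p n. \<bar>U j i - \<pi> U j i - \<epsilon> * s i\<bar> < \<epsilon> * \<tau>"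
              using \<pi>[OF U, of j] unfolding near_def by blast
            note s = s0(1) s0(2)[rule_format]
            have "avg_abs n (p n) (fst \<circ> Z) (\<lambda>i. U j i - \<pi> U j i) \<le> \<epsilon> * avg_abs n (p n) (fst \<circ> Z) s + \<epsilon>"
              using \<epsilon>(1) \<tau>0 by (intro avg_abs_net_diff[OF n s(2)] row) auto
            also have "\<epsilon> * avg_abs n (p n) (fst \<circ> Z) s \<le> \<epsilon> * W" using W[OF s(1)] \<epsilon>(1) by (intro mult_left_mono) auto
            finally show "avg_abs n (p n) (fst \<circ> Z) (\<lambda>i. U j i - \<pi> U j i) \<le> \<epsilon> * (W + 1)" by (simp add: algebra_simps)
            show "norm2 (p n) (\<lambda>i. U j i - \<pi> U j i) \<le> \<epsilon> * (R + 1)"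
              using \<epsilon>(1) by (intro norm2_net_diff[OF s(2) _ \<tau>2 S_norm[OF n s(1)]]) auto
          qed
          have TC: "T \<in> CC n" "T' \<in> CC n" using T T' N A by auto
          have "\<bar>capped_risk B n Z T - capped_risk B n Z T'\<bar> \<le> 2 * real CARD('k) * (K * (\<epsilon> * (W + 1)) + Kr * (\<epsilon> * (R + 1)))"
          proof (rule capped_risk_close[OF n TC _ K(1) _ _ bounds(1)[OF TC(1)] _ bounds(2)[OF TC(1)]])
            show "avg_abs n (p n) (fst \<circ> Z) (\<lambda>i. T' j i - \<pi> T j i) \<le> \<epsilon> * (W + 1)" for j
              using bounds(1)[OF TC(2), of j] T'(2) by simp
            show "norm2 (p n) (\<lambda>i. T' j i - \<pi> T j i) \<le> \<epsilon> * (R + 1)" for j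
              using bounds(2)[OF TC(2), of j] T'(2) by simp
            show "\<bar>min (lf n T (Z a)) B - min (lf n T' (Z a)) B\<bar>
              \<le> K * (\<Sum>j\<in>UNIV. \<bar>dotp (p n) (\<lambda>i. T j i - T' j i) (fst (Z a))\<bar>)" if "a < n" for a
              using lip that unfolding L_def by blast
            show "\<bar>r n T - r n T'\<bar> \<le> Kr * frob_norm (p n) (mat_diff T T')"
              if "T \<in> Rmat (p n)" "T' \<in> Rmat (p n)" "frob_norm (p n) T \<le> real CARD('k) * (R + 1)"
                "frob_norm (p n) T' \<le> real CARD('k) * (R + 1)" for T T'
              using Kr(2)[OF n that] .
            show "0 \<le> Kr" using Kr(1) by simp
          qed
          also have "\<dots> = \<epsilon> * q" by (simp add: q_def algebra_simps)
          also have "\<dots> \<le> \<eta>" by (rule \<epsilon>q)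
          finally show "\<exists>T'\<in>N. capped_risk B n Z T' \<le> capped_risk B n Z T + \<eta>"
            using T'(1) by (intro bexI[of _ T']) auto
        qed
      qed
      ultimately show ?thesis by blast
    qed
    ultimately show "\<exists>N\<subseteq>A. finite N \<and> N \<noteq> {} \<and> ln (real (card N)) \<le> c * real n \<and>
      (\<forall>b. \<exists>X\<in>sets (P b n). measure (P b n) X \<le> 2 / real n \<and>
        (AE Z in P b n. Z \<notin> X \<longrightarrow> (\<forall>T\<in>A. \<exists>T'\<in>N. capped_risk B n Z T' \<le> capped_risk B n Z T + \<eta>)))"
      using N(1-3) by blast
  qed
qed

end

section \<open>Free energy of the capped risk and the excess over the cap\<close>

context universal_pair
begin

lemma exists_risk_sets:
  assumes n: "n > 0" and A: "compact A" and rc: "continuous_on A (r n)"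
  shows "{Z \<in> space (P b n). \<exists>T\<in>A. risk n Z T \<le> s} \<in> sets (P b n)"
proof (rule measurable_exists_le[OF A])
  fix T
  have [measurable]: "lf n T \<in> borel_measurable (D b n)" by (rule meas_D[OF n lf_meas[OF n]])
  show "(\<lambda>Z. risk n Z T) \<in> borel_measurable (P b n)"
    unfolding risk_def P_def by measurable
next
  fix Z
  show "continuous_on A (risk n Z)"
    unfolding risk_def[abs_def] using n rc continuous_on_subset[OF lf_cont[OF n] subset_UNIV]
    by (intro continuous_intros) auto
qed

text \<open>The free energy per sample. The energies are \<open>n\<close> times the capped risk, so
  that \<open>\<beta>\<close> stays fixed while \<open>n\<close> grows.\<close>

definition log_partition :: "real \<Rightarrow> real \<Rightarrow> ('k \<Rightarrow> rvec) set \<Rightarrow> nat \<Rightarrow> (nat \<Rightarrow> rvec \<times> real) \<Rightarrow> real" where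
  "log_partition \<beta> B N n Z =
    free_energy \<beta> N (\<lambda>T. real n * r n T + (\<Sum>a<n. min (lf n T (Z a)) B)) / real n"

text \<open>What the cap cuts off, averaged with the Gibbs weights of the capped energies. These
  weights are the ones to which \<open>gibbs_overflow\<close> applies.\<close>

definition overflow :: "real \<Rightarrow> real \<Rightarrow> ('k \<Rightarrow> rvec) set \<Rightarrow> nat \<Rightarrow> (nat \<Rightarrow> rvec \<times> real) \<Rightarrow> real" where
  "overflow \<beta> B N n Z = (\<Sum>T\<in>N. gibbs \<beta> N (\<lambda>T. real n * r n T + (\<Sum>a<n. min (lf n T (Z a)) B)) T *
      (\<Sum>a<n. max (lf n T (Z a) - B) 0)) / real n"

lemma log_partition_le:
  assumes "n > 0" "finite N" "T \<in> N" "\<beta> > 0"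
  shows "log_partition \<beta> B N n Z \<le> capped_risk B n Z T"
proof -
  have "log_partition \<beta> B N n Z \<le> (real n * r n T + (\<Sum>a<n. min (lf n T (Z a)) B)) / real n"
    unfolding log_partition_def using assms by (intro divide_right_mono free_energy_le) auto
  then show ?thesis using assms by (simp add: capped_risk_def add_divide_distrib)
qed

text \<open>A minimum is at most an average. Under the Gibbs weights the capped part of the risk
  averages to the free energy up to entropy, and the excess averages to \<open>overflow\<close>;
  thus a single average replaces a uniform bound on the excess over the net.\<close>

lemma exists_risk_le_log_partition:
  assumes n: "n > 0" and N: "finite N" "N \<noteq> {}" and \<beta>: "\<beta> > 0" and c: "ln (real (card N)) \<le> c * real n"
  shows "\<exists>T\<in>N. risk n Z T \<le> log_partition \<beta> B N n Z + c / \<beta> + overflow \<beta> B N n Z"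
proof (rule ccontr)
  let ?E = "\<lambda>T. real n * r n T + (\<Sum>a<n. min (lf n T (Z a)) B)"
  let ?w = "gibbs \<beta> N ?E"
  let ?b = "log_partition \<beta> B N n Z + c / \<beta> + overflow \<beta> B N n Z"
  assume "\<not> ?thesis"
  then have gt: "?b < risk n Z T" if "T \<in> N" for T using that by (auto simp: not_le)
  have w: "weights N ?w" by (rule weights_gibbs[OF N])
  have risk: "real n * risk n Z T = ?E T + (\<Sum>a<n. max (lf n T (Z a) - B) 0)" for T
  proof -
    have "(\<Sum>a<n. lf n T (Z a)) = (\<Sum>a<n. min (lf n T (Z a)) B + max (lf n T (Z a) - B) 0)"
      by (intro sum.cong) auto
    moreover have "real n * risk n Z T = (\<Sum>a<n. lf n T (Z a)) + real n * r n T"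
      using n by (simp add: risk_def distrib_left)
    ultimately show ?thesis by (simp add: sum.distrib)
  qed
  have "(\<Sum>T\<in>N. ?w T * (real n * risk n Z T)) =
      (\<Sum>T\<in>N. ?w T * ?E T) + (\<Sum>T\<in>N. ?w T * (\<Sum>a<n. max (lf n T (Z a) - B) 0))"
    unfolding risk by (simp add: distrib_left sum.distrib)
  also have "(\<Sum>T\<in>N. ?w T * ?E T) \<le> free_energy \<beta> N ?E + ln (real (card N)) / \<beta>"
    by (rule gibbs_average_le[OF N \<beta>])
  also have "ln (real (card N)) / \<beta> \<le> c * real n / \<beta>" using c \<beta> by (intro divide_right_mono) auto
  finally have "(\<Sum>T\<in>N. ?w T * (real n * risk n Z T)) \<le> real n * ?b"
    using n by (simp add: log_partition_def overflow_def distrib_left mult.commute)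
  also have "real n * ?b = (\<Sum>T\<in>N. ?w T * (real n * ?b))"
    using w by (simp add: weights_def flip: sum_distrib_right)
  also have "\<dots> < (\<Sum>T\<in>N. ?w T * (real n * risk n Z T))"
  proof (rule sum_strict_mono[OF N])
    fix T assume "T \<in> N"
    have "?w T > 0" unfolding gibbs_def using partition_sum_pos[OF N] by (intro divide_pos_pos) auto
    then show "?w T * (real n * ?b) < ?w T * (real n * risk n Z T)"
      using gt[OF \<open>T \<in> N\<close>] n by (intro mult_strict_left_mono) auto
  qed
  finally show False by simp
qed

lemma log_partition_meas: "n > 0 \<Longrightarrow> log_partition \<beta> B N n \<in> borel_measurable (P b n)"
proof -
  assume n: "n > 0"
  have [measurable]: "lf n T \<in> borel_measurable (D b n)" for T by (rule meas_D[OF n lf_meas[OF n]])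
  show ?thesis unfolding log_partition_def[abs_def] P_def
    by (intro borel_measurable_divide measurable_free_energy) measurable
qed

lemma overflow_meas:
  assumes n: "n > 0"
  shows "overflow \<beta> B N n \<in> borel_measurable (P b n)"
proof -
  have [measurable]: "lf n T \<in> borel_measurable (D b n)" for T by (rule meas_D[OF n lf_meas[OF n]])
  show ?thesis unfolding overflow_def[abs_def] P_def
    by (intro borel_measurable_divide borel_measurable_sum borel_measurable_times measurable_gibbs) measurable
qed

text \<open>Markov's inequality: the mean of \<open>overflow\<close> is at most \<open>e\<close>, as
  the number of samples in \<open>gibbs_overflow\<close> cancels against the division by
  \<open>n\<close>.\<close>

lemma overflow_prob:
  assumes n: "n > 0" and N: "finite N" "N \<noteq> {}" "N \<subseteq> CC n" and \<beta>: "\<beta> > 0" and h: "h > 0" and e: "e \<ge> 0"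
    and le: "\<And>T. T \<in> CC n \<Longrightarrow> (\<integral>\<^sup>+z. ennreal (max (lf n T z - B) 0) \<partial>D b n) \<le> ennreal e"
  shows "measure (P b n) {Z \<in> space (P b n). overflow \<beta> B N n Z > h} \<le> e / h"
proof -
  interpret P: prob_space "P b n" by (rule prob_P[OF n])
  have lm [measurable]: "lf n T \<in> borel_measurable (D b n)" for T by (rule meas_D[OF n lf_meas[OF n]])
  note om [measurable] = overflow_meas[OF n, of \<beta> B N b]
  let ?G = "\<lambda>Z. \<Sum>T\<in>N. gibbs \<beta> N (\<lambda>T. real n * r n T + (\<Sum>a<n. min (lf n T (Z a)) B)) T *
      (\<Sum>a<n. max (lf n T (Z a) - B) 0)"
  have G: "(\<integral>\<^sup>+Z. ennreal (?G Z) \<partial>P b n) \<le> ennreal (real n * e)"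
    unfolding P_def
  proof (rule gibbs_overflow[OF prob_D[OF n] N(1,2) \<beta>, where B=B])
    fix T assume "T \<in> N"
    then show "(\<integral>\<^sup>+z. ennreal (max (lf n T z - B) 0) \<partial>D b n) \<le> ennreal e" using N(3) le by blast
  qed (use e in \<open>auto simp: max_def min_def split: if_splits\<close>)
  let ?A = "{Z \<in> space (P b n). overflow \<beta> B N n Z > h}"
  have nn: "0 \<le> ?G Z" for Z
    using weights_gibbs[OF N(1,2)] by (intro sum_nonneg mult_nonneg_nonneg) (auto simp: weights_def)
  have "ennreal (real n * h) * emeasure (P b n) ?A = (\<integral>\<^sup>+Z. ennreal (real n * h) * indicator ?A Z \<partial>P b n)"
    by (subst nn_integral_cmult_indicator) auto
  also have "\<dots> \<le> (\<integral>\<^sup>+Z. ennreal (?G Z) \<partial>P b n)"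
  proof (rule nn_integral_mono)
    fix Z
    show "ennreal (real n * h) * indicator ?A Z \<le> ennreal (?G Z)"
    proof (cases "Z \<in> ?A")
      case True
      then have "h < ?G Z / real n" by (simp add: overflow_def)
      then have "real n * h \<le> ?G Z" using n by (simp add: pos_less_divide_eq mult.commute)
      then show ?thesis using True by (simp add: ennreal_leI)
    qed simp
  qed
  also note G
  finally have "ennreal (real n * h * measure (P b n) ?A) \<le> ennreal (real n * e)"
    using h by (simp add: P.emeasure_eq_measure ennreal_mult)
  then have "real n * h * measure (P b n) ?A \<le> real n * e"
    using e by (subst (asm) ennreal_le_iff) auto
  then have "h * measure (P b n) ?A \<le> e" using n by (simp add: mult.assoc)
  then show ?thesis using h by (simp add: pos_le_divide_eq mult.commute)
qed

text \<open>Up to \<open>e\<close>, the function \<open>\<psi>\<close> lies above the indicator of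
  arguments at most \<open>s\<close> and below that of arguments at most \<open>s'\<close>. This
  turns the comparison of expectations from \<open>lindeberg_swap\<close> into one of
  probabilities.\<close>

lemma smooth_comparison:
  assumes n: "n > 0" and N: "finite N" "N \<noteq> {}" "N \<subseteq> CC n" and \<beta>: "\<beta> > 0" and B: "B > 0"
    and \<kappa>: "\<And>\<nu>. weights N \<nu> \<Longrightarrow> \<bar>(\<integral>z. cavity \<beta> N \<nu> (\<lambda>T. min (lf n T z) B) \<partial>D b n) -
       (\<integral>z. cavity \<beta> N \<nu> (\<lambda>T. min (lf n T z) B) \<partial>D (\<not> b) n)\<bar> \<le> \<kappa>"
    and \<psi>: "\<And>x. 0 \<le> \<psi> x \<and> \<psi> x \<le> 1" "\<psi> \<in> borel_measurable borel"
      "\<And>x. x \<le> s \<Longrightarrow> 1 - e \<le> \<psi> x" "\<And>x. s' \<le> x \<Longrightarrow> \<psi> x \<le> e"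
      "\<And>a t. \<bar>\<psi> (a + t) - \<psi> a - \<psi>' a * t\<bar> \<le> c2 * t\<^sup>2" "c2 \<ge> 0" "\<And>a. \<bar>\<psi>' a\<bar> \<le> c1" and e: "e \<ge> 0"
  shows "measure (P b n) {Z \<in> space (P b n). log_partition \<beta> B N n Z \<le> s} \<le>
    measure (P (\<not> b) n) {Z \<in> space (P (\<not> b) n). log_partition \<beta> B N n Z \<le> s'} + (c1 * \<kappa> + 2 * c2 * B\<^sup>2 / real n) + 2 * e"
proof -
  let ?f = "log_partition \<beta> B N n"
  have fm [measurable]: "?f \<in> borel_measurable (P b' n)" for b' by (rule log_partition_meas[OF n])
  note \<psi>(2)[measurable]
  have lm: "lf n T \<in> borel_measurable (D b' n)" for T b' by (rule meas_D[OF n lf_meas[OF n]])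
  have sets_eq: "sets (D b n) = sets (D (\<not> b) n)" using sets_D[OF n] by simp
  have ipsi: "integrable (P b' n) (\<lambda>Z. \<psi> (?f Z))" for b'
  proof -
    interpret prob_space "P b' n" by (rule prob_P[OF n])
    show ?thesis using \<psi>(1) by (intro integrable_const_bound[where B=1]) auto
  qed
  have "\<bar>(\<integral>Z. \<psi> (?f Z) \<partial>P b n) - (\<integral>Z. \<psi> (?f Z) \<partial>P (\<not> b) n)\<bar> \<le> c1 * \<kappa> + 2 * c2 * B\<^sup>2 / real n"
    unfolding log_partition_def P_def
    by (rule lindeberg_swap[OF prob_D[OF n] prob_D[OF n] sets_eq N(1,2) n \<beta> less_imp_le[OF B] _ _ \<kappa> \<psi>(1,2,5-7)])
       (use lm lf_nonneg B in auto)
  then have sw: "(\<integral>Z. \<psi> (?f Z) \<partial>P b n) \<le> (\<integral>Z. \<psi> (?f Z) \<partial>P (\<not> b) n) + (c1 * \<kappa> + 2 * c2 * B\<^sup>2 / real n)"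
    by linarith
  have lower: "measure (P b n) {Z \<in> space (P b n). ?f Z \<le> s} \<le> (\<integral>Z. \<psi> (?f Z) \<partial>P b n) + e"
  proof -
    interpret prob_space "P b n" by (rule prob_P[OF n])
    let ?A = "{Z \<in> space (P b n). ?f Z \<le> s}"
    have "measure (P b n) ?A = (\<integral>Z. indicator ?A Z \<partial>P b n)" by simp
    also have "\<dots> \<le> (\<integral>Z. \<psi> (?f Z) + e \<partial>P b n)"
    proof (rule integral_mono)
      show "integrable (P b n) (\<lambda>Z. indicator ?A Z :: real)" by (intro integrable_const_bound[where B=1]) auto
      show "integrable (P b n) (\<lambda>Z. \<psi> (?f Z) + e)" using ipsi[of b] by auto
      show "indicator ?A Z \<le> \<psi> (?f Z) + e" for Z
        using \<psi>(1)[of "?f Z"] \<psi>(3)[of "?f Z"] e by (cases "Z \<in> ?A") auto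
    qed
    also have "\<dots> = (\<integral>Z. \<psi> (?f Z) \<partial>P b n) + e" using ipsi[of b] by (simp add: prob_space)
    finally show ?thesis .
  qed
  have upper: "(\<integral>Z. \<psi> (?f Z) \<partial>P (\<not> b) n) \<le> measure (P (\<not> b) n) {Z \<in> space (P (\<not> b) n). ?f Z \<le> s'} + e"
  proof -
    interpret prob_space "P (\<not> b) n" by (rule prob_P[OF n])
    let ?A = "{Z \<in> space (P (\<not> b) n). ?f Z \<le> s'}"
    have ii: "integrable (P (\<not> b) n) (\<lambda>Z. indicator ?A Z :: real)" by (intro integrable_const_bound[where B=1]) auto
    have "(\<integral>Z. \<psi> (?f Z) \<partial>P (\<not> b) n) \<le> (\<integral>Z. indicator ?A Z + e \<partial>P (\<not> b) n)"
    proof (rule integral_mono)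
      show "integrable (P (\<not> b) n) (\<lambda>Z. \<psi> (?f Z))" by (rule ipsi)
      show "integrable (P (\<not> b) n) (\<lambda>Z. indicator ?A Z + e)" using ii by auto
      show "\<psi> (?f Z) \<le> indicator ?A Z + e" if "Z \<in> space (P (\<not> b) n)" for Z
        using \<psi>(1)[of "?f Z"] \<psi>(4)[of "?f Z"] e that by (cases "Z \<in> ?A") auto
    qed
    also have "\<dots> = (\<integral>Z. indicator ?A Z \<partial>P (\<not> b) n) + e"
      by (subst Bochner_Integration.integral_add[OF ii]) (auto simp: prob_space)
    also have "(\<integral>Z. indicator ?A Z \<partial>P (\<not> b) n) = measure (P (\<not> b) n) ?A" by simp
    finally show ?thesis .
  qed
  show ?thesis using sw lower upper by linarith
qed

text \<open>The chain of sublevel events is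
  risk \<open>\<longrightarrow>\<close> capped risk on a net \<open>\<longrightarrow>\<close> free energy, then the swap of the models, and back from the
  free energy to the risk at a Gibbs-typical point of the net.\<close>
proposition min_risk_universality:
  assumes A: "\<And>n. n > 0 \<Longrightarrow> compact (A n) \<and> A n \<subseteq> CC n" and s: "s < s'" and e: "e > 0"
  shows "\<forall>\<^sub>F n in sequentially. measure (P b n) {Z \<in> space (P b n). \<exists>T\<in>A n. risk n Z T \<le> s} \<le>
    measure (P (\<not> b) n) {Z \<in> space (P (\<not> b) n). \<exists>T\<in>A n. risk n Z T \<le> s'} + e"
proof -
  obtain M where M: "M \<ge> 0" "\<And>b n T B. n > 0 \<Longrightarrow> T \<in> CC n \<Longrightarrow> B > 0 \<Longrightarrow>
      (\<integral>\<^sup>+z. ennreal (max (lf n T z - B) 0) \<partial>D b n) \<le> ennreal (M / B)"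
    by (rule lf_overflow) blast
  \<comment> \<open>The gap is spent in four equal parts: approximation on the net, transition of
    the smooth step, entropy \<open>c / \<beta>\<close>, overflow.\<close>
  define g where "g = (s' - s) / 4"
  have g: "g > 0" using s by (simp add: g_def)
  \<comment> \<open>Five errors of size \<open>e1\<close> occur: one from the terms of order
    \<open>1 / n\<close>, one from \<open>c1 * \<kappa>\<close>, two from the smooth step, one from
    the overflow.\<close>
  define e1 where "e1 = e / 8"
  have e1: "e1 > 0" using e by (simp add: e1_def)
  \<comment> \<open>The overflow has mean at most \<open>M / B\<close>; by Markov it exceeds
    \<open>g\<close> with probability at most \<open>e1\<close>.\<close>
  define B where "B = M / (g * e1) + 1"
  have B: "B > 0" using M(1) g e1 by (simp add: B_def add_nonneg_pos)
  have MB: "M / B / g \<le> e1"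
  proof -
    have "M / (g * e1) \<le> B" by (simp add: B_def)
    then have "M \<le> B * (g * e1)" using g e1 by (simp add: pos_divide_le_eq)
    then show ?thesis using B g by (simp add: pos_divide_le_eq mult_ac)
  qed
  obtain c where c: "c \<ge> 0" "\<And>n A. n > 0 \<Longrightarrow> A \<subseteq> CC n \<Longrightarrow> A \<noteq> {} \<Longrightarrow>
    \<exists>N\<subseteq>A. finite N \<and> N \<noteq> {} \<and> ln (real (card N)) \<le> c * real n \<and>
      (\<forall>b. \<exists>X\<in>sets (P b n). measure (P b n) X \<le> 2 / real n \<and>
        (AE Z in P b n. Z \<notin> X \<longrightarrow> (\<forall>T\<in>A. \<exists>T'\<in>N. capped_risk B n Z T' \<le> capped_risk B n Z T + g)))"
    by (rule net_exists[OF B g]) blast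
  \<comment> \<open>The entropy constant \<open>c\<close> depends on the net, hence on
    \<open>B\<close>; only now can \<open>\<beta>\<close> be fixed so large that the entropy costs
    at most \<open>g\<close>.\<close>
  define \<beta> where "\<beta> = c / g + 1"
  have \<beta>: "\<beta> > 0" using c(1) g by (simp add: \<beta>_def add_nonneg_pos)
  have c\<beta>: "c / \<beta> \<le> g"
  proof -
    have "c / g \<le> \<beta>" by (simp add: \<beta>_def)
    then show ?thesis using g \<beta> by (simp add: pos_divide_le_eq mult.commute)
  qed
  have "s + g < s + 2 * g" using g by simp
  then obtain \<psi> \<psi>' :: "real \<Rightarrow> real" and c1 c2 where \<psi>:
    "\<And>x. 0 \<le> \<psi> x \<and> \<psi> x \<le> 1" "\<psi> \<in> borel_measurable borel"
    "\<And>x. x \<le> s + g \<Longrightarrow> 1 - e1 \<le> \<psi> x" "\<And>x. s + 2 * g \<le> x \<Longrightarrow> \<psi> x \<le> e1"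
    "\<And>a t. \<bar>\<psi> (a + t) - \<psi> a - \<psi>' a * t\<bar> \<le> c2 * t\<^sup>2" "c2 \<ge> 0" "\<And>a. \<bar>\<psi>' a\<bar> \<le> c1"
    using e1 by (rule smooth_step) blast
  have c1: "c1 \<ge> 0" using \<psi>(7)[of 0] by linarith
  \<comment> \<open>The required accuracy of the cavity comparison depends on the slope of the
    smooth step, which is known by now; adding 1 covers \<open>c1 = 0\<close>.\<close>
  define \<kappa> where "\<kappa> = e1 / (c1 + 1)"
  have \<kappa>: "\<kappa> > 0" "c1 * \<kappa> \<le> e1" using c1 e1 by (auto simp: \<kappa>_def field_simps)
  have lim: "(\<lambda>n. 2 * c2 * B\<^sup>2 / real n + 2 / real n) \<longlonglongrightarrow> 0"
    by (rule tendsto_eq_intros lim_const_over_n refl | simp)+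
  from order_tendstoD(2)[OF lim e1] cavity_close[OF \<beta> B \<kappa>(1)] eventually_gt_at_top[of 0]
  show ?thesis
  proof eventually_elim
    case (elim n)
    interpret Pb: prob_space "P b n" by (rule prob_P[OF elim(3)])
    interpret Pc: prob_space "P (\<not> b) n" by (rule prob_P[OF elim(3)])
    show ?case
    proof (cases "A n = {}")
      case True
      then show ?thesis using e by simp
    next
      case False
      have AC: "compact (A n)" "A n \<subseteq> CC n" using A[OF elim(3)] by auto
      obtain N where N: "N \<subseteq> A n" "finite N" "N \<noteq> {}" "ln (real (card N)) \<le> c * real n"
        and X0: "\<forall>b. \<exists>X\<in>sets (P b n). measure (P b n) X \<le> 2 / real n \<and>
        (AE Z in P b n. Z \<notin> X \<longrightarrow> (\<forall>T\<in>A n. \<exists>T'\<in>N. capped_risk B n Z T' \<le> capped_risk B n Z T + g))"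
        using c(2)[OF elim(3) AC(2) False] by blast
      obtain X where X: "X \<in> sets (P b n)" "measure (P b n) X \<le> 2 / real n"
        "AE Z in P b n. Z \<notin> X \<longrightarrow> (\<forall>T\<in>A n. \<exists>T'\<in>N. capped_risk B n Z T' \<le> capped_risk B n Z T + g)"
        using X0 by blast
      have NC: "N \<subseteq> CC n" using N(1) AC(2) by blast
      let ?f = "log_partition \<beta> B N n"
      have fm [measurable]: "?f \<in> borel_measurable (P b' n)" for b' by (rule log_partition_meas[OF elim(3)])
      have om [measurable]: "overflow \<beta> B N n \<in> borel_measurable (P b' n)" for b' by (rule overflow_meas[OF elim(3)])
      have capped_le: "capped_risk B n Z T \<le> risk n Z T" for Z T
        unfolding capped_risk_def risk_def by (intro add_right_mono divide_right_mono sum_mono) auto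
      have "measure (P b n) {Z \<in> space (P b n). \<exists>T\<in>A n. risk n Z T \<le> s} \<le>
          measure (P b n) ({Z \<in> space (P b n). ?f Z \<le> s + g} \<union> X)"
      proof (rule Pb.finite_measure_mono_AE)
        show "AE Z in P b n. Z \<in> {Z \<in> space (P b n). \<exists>T\<in>A n. risk n Z T \<le> s} \<longrightarrow>
            Z \<in> {Z \<in> space (P b n). ?f Z \<le> s + g} \<union> X"
          using X(3)
        proof eventually_elim
          case (elim Z)
          have "?f Z \<le> s + g" if h: "Z \<notin> X" "T \<in> A n" "risk n Z T \<le> s" for T
          proof -
            obtain T' where T': "T' \<in> N" "capped_risk B n Z T' \<le> capped_risk B n Z T + g"
              using elim h(1,2) by blast
            have "?f Z \<le> capped_risk B n Z T'" by (rule log_partition_le[OF \<open>0 < n\<close> N(2) T'(1) \<beta>])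
            then show ?thesis using T'(2) capped_le[of Z T] h(3) by linarith
          qed
          then show ?case by blast
        qed
        show "{Z \<in> space (P b n). ?f Z \<le> s + g} \<union> X \<in> sets (P b n)" using X(1) by measurable
      qed
      also have "\<dots> \<le> measure (P b n) {Z \<in> space (P b n). ?f Z \<le> s + g} + measure (P b n) X"
        using X(1) by (intro measure_Un_le) measurable
      finally have 1: "measure (P b n) {Z \<in> space (P b n). \<exists>T\<in>A n. risk n Z T \<le> s} \<le>
        measure (P b n) {Z \<in> space (P b n). ?f Z \<le> s + g} + 2 / real n" using X(2) by linarith
      have kap: "\<bar>(\<integral>z. cavity \<beta> N \<nu> (\<lambda>T. min (lf n T z) B) \<partial>D b n) -
         (\<integral>z. cavity \<beta> N \<nu> (\<lambda>T. min (lf n T z) B) \<partial>D (\<not> b) n)\<bar> \<le> \<kappa>" if "weights N \<nu>" for \<nu>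
        using elim(2)[rule_format, OF N(2) NC[unfolded CC_def] that] by (cases b) (auto simp: abs_minus_commute)
      have 2: "measure (P b n) {Z \<in> space (P b n). ?f Z \<le> s + g} \<le>
        measure (P (\<not> b) n) {Z \<in> space (P (\<not> b) n). ?f Z \<le> s + 2 * g} + (c1 * \<kappa> + 2 * c2 * B\<^sup>2 / real n) + 2 * e1"
        using smooth_comparison[OF elim(3) N(2,3) NC \<beta> B kap \<psi>] e1 by simp
      let ?O = "{Z \<in> space (P (\<not> b) n). overflow \<beta> B N n Z > g}"
      let ?E = "{Z \<in> space (P (\<not> b) n). \<exists>T\<in>A n. risk n Z T \<le> s'}"
      have rc: "continuous_on (A n) (r n)"
      proof (rule continuous_on_subset)
        show "continuous_on (Rmat (p n)) (r n)" using pen elim(3) by (simp add: penalty_def)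
        show "A n \<subseteq> Rmat (p n)"
          using AC(2) C_sub[OF elim(3)] S_sub[OF elim(3)] by (auto simp: CC_def Rmat_def)
      qed
      have E: "?E \<in> sets (P (\<not> b) n)" by (rule exists_risk_sets[OF elim(3) AC(1) rc])
      have O: "?O \<in> sets (P (\<not> b) n)" by measurable
      have "{Z \<in> space (P (\<not> b) n). ?f Z \<le> s + 2 * g} \<subseteq> ?E \<union> ?O"
      proof
        fix Z assume Z: "Z \<in> {Z \<in> space (P (\<not> b) n). ?f Z \<le> s + 2 * g}"
        obtain T where T: "T \<in> N" "risk n Z T \<le> ?f Z + c / \<beta> + overflow \<beta> B N n Z"
          using exists_risk_le_log_partition[OF elim(3) N(2,3) \<beta> N(4)] by blast
        have "s' = s + 4 * g" by (simp add: g_def field_simps)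
        then have "risk n Z T \<le> s'" if "overflow \<beta> B N n Z \<le> g"
          using T(2) Z c\<beta> that by simp
        then show "Z \<in> ?E \<union> ?O" using Z T(1) N(1) by (auto simp: not_less)
      qed
      then have "measure (P (\<not> b) n) {Z \<in> space (P (\<not> b) n). ?f Z \<le> s + 2 * g} \<le> measure (P (\<not> b) n) (?E \<union> ?O)"
        using E O by (intro Pc.finite_measure_mono) auto
      also have "\<dots> \<le> measure (P (\<not> b) n) ?E + measure (P (\<not> b) n) ?O" using E O by (rule measure_Un_le)
      also have "measure (P (\<not> b) n) ?O \<le> M / B / g"
        using M B by (intro overflow_prob[OF elim(3) N(2,3) NC \<beta> g] M(2)[OF elim(3)]) auto
      finally have 3: "measure (P (\<not> b) n) {Z \<in> space (P (\<not> b) n). ?f Z \<le> s + 2 * g} \<le> measure (P (\<not> b) n) ?E + e1"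
        using MB by linarith
      have "e1 + e1 + e1 + 2 * e1 \<le> e" using e by (simp add: e1_def)
      then show ?thesis using 1 2 3 \<kappa>(2) elim(1) by linarith
    qed
  qed
qed

end

subsection \<open>Trigonometric approximation of functions of linear forms\<close>

text \<open>Finite combinations, of total weight \<open>w\<close>, of cosines whose frequencies in the feature lie in \<open>a \<cdot> S\<close>;
  since \<open>S\<close> is symmetric and convex, products stay in the class, with frequencies in \<open>(a + a') \<cdot> S\<close>.\<close>
inductive trig :: "nat \<Rightarrow> rvec set \<Rightarrow> real \<Rightarrow> (rvec \<times> real \<Rightarrow> real) \<Rightarrow> real \<Rightarrow> bool" for p S a where
  trig_cos: "u \<in> S \<Longrightarrow> trig p S a (\<lambda>z. cos (a * dotp p u (fst z) + c * snd z + b)) 1"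
| trig_add: "trig p S a f w \<Longrightarrow> trig p S a g w' \<Longrightarrow> trig p S a (\<lambda>z. f z + g z) (w + w')"
| trig_scale: "trig p S a f w \<Longrightarrow> trig p S a (\<lambda>z. c * f z) (\<bar>c\<bar> * w)"

lemma trig_nonneg: "trig p S a f w \<Longrightarrow> 0 \<le> w"
  by (induction rule: trig.induct) auto

lemma borel_snd_real [measurable]: "(\<lambda>z :: rvec \<times> real. snd z) \<in> borel_measurable borel"
  by (simp add: borel_prod[symmetric])

lemma trig_measurable: "trig p S a f w \<Longrightarrow> f \<in> borel_measurable borel"
proof (induction rule: trig.induct)
  case (trig_cos u c b)
  have "(\<lambda>z :: rvec \<times> real. a * dotp p u (fst z) + c * snd z + b) \<in> borel_measurable borel"
    by (intro borel_measurable_add borel_measurable_times borel_measurable_const borel_dotp_fst borel_snd_real)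
  then show ?case
    by (rule measurable_compose) (intro borel_measurable_continuous_onI continuous_intros)
qed (auto intro: borel_measurable_add borel_measurable_times borel_measurable_const)

lemma trig_le: "trig p S a f w \<Longrightarrow> \<bar>f z\<bar> \<le> w"
proof (induction rule: trig.induct)
  case (trig_add f w g w')
  then show ?case using abs_triangle_ineq[of "f z" "g z"] by linarith
next
  case (trig_scale f w c)
  then show ?case by (simp add: abs_mult mult_left_mono)
qed auto

text \<open>A frequency \<open>a u\<close> is also \<open>a'\<close> times
  \<open>(a / a') u\<close>, and \<open>S\<close> absorbs factors at most 1.\<close>

lemma trig_mono:
  assumes "trig p S a f w" "0 \<le> a" "a \<le> a'" and S: "symmetric_convex S"
  shows "trig p S a' f w"
  using assms(1)
proof (induction rule: trig.induct)
  case (trig_cos u c b)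
  show ?case
  proof (cases "a' = 0")
    case True
    then have "a = a'" using assms by simp
    then show ?thesis using trig.trig_cos[OF trig_cos, of p a' c b] by simp
  next
    case False
    then have a': "a' > 0" using assms by simp
    have "(\<lambda>i. (a / a') * u i + 0 * u i) \<in> S"
      using assms a' by (intro symmetric_convex_comb[OF S trig_cos trig_cos]) auto
    then have "(\<lambda>i. (a / a') * u i) \<in> S" by simp
    moreover have "a' * (a / a' * x) = a * x" for x using a' by simp
    ultimately show ?thesis using trig.trig_cos[of "\<lambda>i. (a / a') * u i" S p a' c b] by (simp only: dotp_scale)
  qed
qed (auto intro: trig.intros)

lemma trig_const:
  assumes "S \<noteq> {}" "0 \<le> a" and S: "symmetric_convex S"
  shows "trig p S a (\<lambda>z. c) \<bar>c\<bar>"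
proof -
  obtain u where "u \<in> S" using assms by auto
  from trig_scale[OF trig_cos[OF this, of p 0 0 0], of c] have "trig p S 0 (\<lambda>z. c) \<bar>c\<bar>" by simp
  then show ?thesis by (rule trig_mono[OF _ order_refl assms(2) S])
qed

text \<open>Product-to-sum formula for cosines, extended to both factors by a nested induction. This
  is how marginals of single linear forms come to control functions of several of them.\<close>

lemma trig_mult:
  assumes f: "trig p S a f w" and g: "trig p S a' g w'" and a: "0 \<le> a" "0 \<le> a'" and S: "symmetric_convex S"
  shows "trig p S (a + a') (\<lambda>z. f z * g z) (w * w')"
  using f
proof (induction rule: trig.induct)
  case (trig_cos u c b)
  show ?case using g
  proof (induction rule: trig.induct)
    case (trig_cos u' c' b')
    \<comment> \<open>Sum and difference of the two phases together, with \<open>\<sigma>\<close>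
      equal to 1 or -1: the frequency is \<open>a + a'\<close> times an absolutely convex
      combination of \<open>u\<close> and \<open>u'\<close>.\<close>
    have comb: "trig p S (a + a') (\<lambda>z. cos (a * dotp p u (fst z) + \<sigma> * (a' * dotp p u' (fst z)) + (c + \<sigma> * c') * snd z + (b + \<sigma> * b'))) 1"
      if \<sigma>: "\<bar>\<sigma>\<bar> = 1" for \<sigma>
    proof (cases "a + a' = 0")
      case True
      then have "a = 0" "a' = 0" using a by auto
      then show ?thesis using trig.trig_cos[OF \<open>u \<in> S\<close>, of p 0 "c + \<sigma> * c'" "b + \<sigma> * b'"] by simp
    next
      case False
      then have pos: "a + a' > 0" using a by simp
      have "(\<lambda>i. (a / (a + a')) * u i + (\<sigma> * a' / (a + a')) * u' i) \<in> S"
        using a pos \<sigma> by (intro symmetric_convex_comb[OF S \<open>u \<in> S\<close> \<open>u' \<in> S\<close>])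
          (auto simp: abs_mult abs_divide simp flip: add_divide_distrib)
      moreover have "(a + a') * ((a / (a + a')) * x + (\<sigma> * a' / (a + a')) * y) = a * x + \<sigma> * (a' * y)" for x y
      proof -
        have "s * ((a / s) * x + (k / s) * y) = a * x + k * y" if "s \<noteq> 0" for s k :: real
          using that by (simp add: distrib_left)
        from this[of "a + a'" "\<sigma> * a'"] pos show ?thesis by (simp add: mult.assoc)
      qed
      ultimately show ?thesis
        using trig.trig_cos[of "\<lambda>i. (a / (a + a')) * u i + (\<sigma> * a' / (a + a')) * u' i" S p "a + a'" "c + \<sigma> * c'" "b + \<sigma> * b'"]
        by (simp only: dotp_add dotp_scale)
    qed
    have eq: "cos (a * dotp p u (fst z) + c * snd z + b) * cos (a' * dotp p u' (fst z) + c' * snd z + b') =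
      1/2 * cos (a * dotp p u (fst z) + 1 * (a' * dotp p u' (fst z)) + (c + 1 * c') * snd z + (b + 1 * b')) +
      1/2 * cos (a * dotp p u (fst z) + (-1) * (a' * dotp p u' (fst z)) + (c + (-1) * c') * snd z + (b + (-1) * b'))" for z
    proof -
      have "cos x * cos y = 1/2 * cos (x + y) + 1/2 * cos (x - y)" for x y :: real
        by (simp add: cos_add cos_diff field_simps)
      from this[of "a * dotp p u (fst z) + c * snd z + b" "a' * dotp p u' (fst z) + c' * snd z + b'"]
      show ?thesis
        by (simp add: algebra_simps)
    qed
    have "trig p S (a + a') (\<lambda>z. cos (a * dotp p u (fst z) + c * snd z + b) * cos (a' * dotp p u' (fst z) + c' * snd z + b')) (\<bar>1/2\<bar> * 1 + \<bar>1/2\<bar> * 1)"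
      unfolding eq by (intro trig.trig_add trig.trig_scale comb) auto
    then show ?case by simp
  next
    case (trig_add g w g' w')
    from trig.trig_add[OF trig_add.IH] show ?case by (simp add: distrib_left)
  next
    case (trig_scale g w k)
    from trig.trig_scale[OF trig_scale.IH, of k] show ?case by (simp add: mult_ac)
  qed
next
  case (trig_add f w f' w'')
  from trig.trig_add[OF trig_add.IH] show ?case by (simp add: distrib_right)
next
  case (trig_scale f w k)
  from trig.trig_scale[OF trig_scale.IH, of k] show ?case by (simp add: mult_ac)
qed

text \<open>For nonnegative weights with sum 1 the total coefficient is again \<open>w\<close>,
  however large \<open>N\<close> is. The later estimates are independent of the size of the net for
  this reason.\<close>

lemma trig_weighted_sum:
  assumes N: "finite N" and q: "\<And>T. T \<in> N \<Longrightarrow> trig p S a (q T) w"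
    and S: "S \<noteq> {}" "symmetric_convex S" "0 \<le> a"
  shows "trig p S a (\<lambda>z. \<Sum>T\<in>N. \<nu> T * q T z) (\<Sum>T\<in>N. \<bar>\<nu> T\<bar> * w)"
  using N q
proof (induction rule: finite_induct)
  case empty
  then show ?case using trig_const[of S a p 0] S by simp
next
  case (insert T N)
  then show ?case by (auto intro!: trig_add trig_scale)
qed

text \<open>The frequency and weight after substitution depend on the polynomial only.\<close>
lemma trig_polynomial:
  fixes g :: "'a::euclidean_space \<Rightarrow> real"
  assumes "real_polynomial_function g" and a: "0 \<le> a"
  shows "\<exists>a' w'. 0 \<le> a' \<and> (\<forall>p S Y. S \<noteq> {} \<longrightarrow> symmetric_convex S \<longrightarrow>
    (\<forall>b\<in>Basis. trig p S a (\<lambda>z. Y z \<bullet> b) w) \<longrightarrow> trig p S a' (\<lambda>z. g (Y z)) w')"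
  using assms(1)
proof (induction rule: real_polynomial_function.induct)
  case (linear h)
  show ?case
  proof (rule exI[of _ a], rule exI[of _ "\<Sum>b\<in>Basis. \<bar>h b\<bar> * w"], intro conjI allI impI a)
    fix p S and Y :: "rvec \<times> real \<Rightarrow> 'a"
    assume S: "S \<noteq> {}" "symmetric_convex S" and Y: "\<forall>b\<in>Basis. trig p S a (\<lambda>z. Y z \<bullet> b) w"
    have eq: "h (Y z) = (\<Sum>b\<in>Basis. h b * (Y z \<bullet> b))" for z
    proof -
      have "h (Y z) = h (\<Sum>b\<in>Basis. (Y z \<bullet> b) *\<^sub>R b)" by (simp add: euclidean_representation)
      also have "\<dots> = (\<Sum>b\<in>Basis. (Y z \<bullet> b) *\<^sub>R h b)"
        using linear by (simp add: linear_sum linear_scale bounded_linear.linear)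
      finally show ?thesis by (simp add: mult.commute)
    qed
    show "trig p S a (\<lambda>z. h (Y z)) (\<Sum>b\<in>Basis. \<bar>h b\<bar> * w)"
      unfolding eq using Y by (intro trig_weighted_sum S a) auto
  qed
next
  case (const c)
  show ?case using a by (intro exI[of _ a] exI[of _ "\<bar>c\<bar>"]) (auto intro: trig_const)
next
  case (add f g)
  from add.IH obtain a1 w1 a2 w2 where
    h: "0 \<le> a1" "0 \<le> a2" "\<And>p S Y. S \<noteq> {} \<Longrightarrow> symmetric_convex S \<Longrightarrow>
      (\<forall>b\<in>Basis. trig p S a (\<lambda>z. Y z \<bullet> b) w) \<Longrightarrow> trig p S a1 (\<lambda>z. f (Y z)) w1"
      "\<And>p S Y. S \<noteq> {} \<Longrightarrow> symmetric_convex S \<Longrightarrow>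
      (\<forall>b\<in>Basis. trig p S a (\<lambda>z. Y z \<bullet> b) w) \<Longrightarrow> trig p S a2 (\<lambda>z. g (Y z)) w2"
    by metis
  show ?case
  proof (rule exI[of _ "a1 + a2"], rule exI[of _ "w1 + w2"], intro conjI allI impI)
    fix p S and Y :: "rvec \<times> real \<Rightarrow> 'a"
    assume S: "S \<noteq> {}" "symmetric_convex S" and Y: "\<forall>b\<in>Basis. trig p S a (\<lambda>z. Y z \<bullet> b) w"
    show "trig p S (a1 + a2) (\<lambda>z. f (Y z) + g (Y z)) (w1 + w2)"
    proof (rule trig_add)
      show "trig p S (a1 + a2) (\<lambda>z. f (Y z)) w1" by (rule trig_mono[OF h(3)[OF S Y] h(1) _ S(2)]) (use h(2) in simp)
      show "trig p S (a1 + a2) (\<lambda>z. g (Y z)) w2" by (rule trig_mono[OF h(4)[OF S Y] h(2) _ S(2)]) (use h(1) in simp)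
    qed
  qed (use h in auto)
next
  case (mult f g)
  from mult.IH obtain a1 w1 a2 w2 where
    h: "0 \<le> a1" "0 \<le> a2" "\<And>p S Y. S \<noteq> {} \<Longrightarrow> symmetric_convex S \<Longrightarrow>
      (\<forall>b\<in>Basis. trig p S a (\<lambda>z. Y z \<bullet> b) w) \<Longrightarrow> trig p S a1 (\<lambda>z. f (Y z)) w1"
      "\<And>p S Y. S \<noteq> {} \<Longrightarrow> symmetric_convex S \<Longrightarrow>
      (\<forall>b\<in>Basis. trig p S a (\<lambda>z. Y z \<bullet> b) w) \<Longrightarrow> trig p S a2 (\<lambda>z. g (Y z)) w2"
    by metis
  show ?case
  proof (rule exI[of _ "a1 + a2"], rule exI[of _ "w1 * w2"], intro conjI allI impI)
    fix p S and Y :: "rvec \<times> real \<Rightarrow> 'a"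
    assume S: "S \<noteq> {}" "symmetric_convex S" and Y: "\<forall>b\<in>Basis. trig p S a (\<lambda>z. Y z \<bullet> b) w"
    show "trig p S (a1 + a2) (\<lambda>z. f (Y z) * g (Y z)) (w1 * w2)"
      by (intro trig_mult h S Y)
  qed (use h in auto)
qed

text \<open>Replacing \<open>y\<close> by \<open>\<tau> sin (y / \<tau>)\<close> coordinatewise makes the polynomial approximation bounded on the whole space.\<close>
lemma sine_polynomial_approx:
  fixes v :: "'a::euclidean_space \<Rightarrow> real"
  assumes v: "continuous_on UNIV v" "\<And>y. \<bar>v y\<bar> \<le> 1" and e: "0 < e" "e \<le> 1" and T: "T > 0"
  obtains g \<tau> where "real_polynomial_function g" "\<tau> > 0"
    "\<And>y. \<bar>g (\<Sum>b\<in>Basis. sin ((y \<bullet> b) / \<tau>) *\<^sub>R b)\<bar> \<le> 2"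
    "\<And>y. norm y \<le> T \<Longrightarrow> \<bar>v y - g (\<Sum>b\<in>Basis. sin ((y \<bullet> b) / \<tau>) *\<^sub>R b)\<bar> \<le> e"
proof -
  have "uniformly_continuous_on (cball 0 T) v"
    using v(1) by (intro compact_uniformly_continuous continuous_on_subset[OF v(1)]) auto
  then obtain d where d: "d > 0" "\<And>x y. x \<in> cball 0 T \<Longrightarrow> y \<in> cball 0 T \<Longrightarrow> dist y x < d \<Longrightarrow> dist (v y) (v x) < e / 2"
    unfolding uniformly_continuous_on_def using e(1) by (metis half_gt_zero)
  \<comment> \<open>Each coordinate of \<open>y\<close> differs from \<open>\<tau>\<close> times its
    sine by at most \<open>T^2 / \<tau>\<close> on the ball; summed over the coordinates this must
    stay below the modulus \<open>d\<close> of uniform continuity.\<close>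
  define \<tau> where "\<tau> = real DIM('a) * T\<^sup>2 / d + 1"
  have \<tau>: "\<tau> > 0" using d T by (simp add: \<tau>_def add_nonneg_pos)
  define sn where "sn y = (\<Sum>b\<in>Basis. sin ((y \<bullet> b) / \<tau>) *\<^sub>R b)" for y :: 'a
  have snb: "sn y \<bullet> b = sin ((y \<bullet> b) / \<tau>)" if "b \<in> Basis" for y b
    using that by (simp add: sn_def inner_sum_left inner_Basis if_distrib[where f="\<lambda>x. _ * x"] cong: if_cong)
  have close: "norm (y - \<tau> *\<^sub>R sn y) < d" if y: "norm y \<le> T" for y
  proof -
    have "norm (y - \<tau> *\<^sub>R sn y) \<le> (\<Sum>b\<in>Basis. \<bar>(y - \<tau> *\<^sub>R sn y) \<bullet> b\<bar>)" by (rule norm_le_l1)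
    also have "\<dots> \<le> (\<Sum>b\<in>(Basis :: 'a set). T\<^sup>2 / \<tau>)"
    proof (rule sum_mono)
      fix b :: 'a assume b: "b \<in> Basis"
      let ?x = "(y \<bullet> b) / \<tau>"
      have "\<bar>sin ?x - (\<Sum>m<2. sin_coeff m * ?x ^ m)\<bar> \<le> inverse (fact 2) * \<bar>?x\<bar> ^ 2"
        by (rule Maclaurin_sin_bound)
      then have s: "\<bar>sin ?x - ?x\<bar> \<le> ?x\<^sup>2"
        by (simp add: numeral_2_eq_2 sin_coeff_def)
      have "(y - \<tau> *\<^sub>R sn y) \<bullet> b = \<tau> * (?x - sin ?x)"
        using \<tau> snb[OF b, of y] by (simp add: inner_diff_left algebra_simps)
      then have "\<bar>(y - \<tau> *\<^sub>R sn y) \<bullet> b\<bar> = \<tau> * \<bar>sin ?x - ?x\<bar>"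
        using \<tau> by (simp add: abs_mult abs_minus_commute)
      also have "\<dots> \<le> \<tau> * ?x\<^sup>2" using s \<tau> by (intro mult_left_mono) auto
      also have "\<dots> = (y \<bullet> b)\<^sup>2 / \<tau>" using \<tau> by (simp add: power2_eq_square field_simps)
      also have "\<dots> \<le> T\<^sup>2 / \<tau>"
      proof (intro divide_right_mono)
        have "\<bar>y \<bullet> b\<bar> \<le> T" using Basis_le_norm[OF b, of y] y by linarith
        then show "(y \<bullet> b)\<^sup>2 \<le> T\<^sup>2" using T by (metis abs_ge_zero power2_abs power_mono)
      qed (use \<tau> in simp)
      finally show "\<bar>(y - \<tau> *\<^sub>R sn y) \<bullet> b\<bar> \<le> T\<^sup>2 / \<tau>" .
    qed
    also have "\<dots> = real DIM('a) * T\<^sup>2 / \<tau>" by simp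
    also have "\<dots> < d"
    proof -
      have "real DIM('a) * T\<^sup>2 / d < \<tau>" by (simp add: \<tau>_def)
      then show ?thesis using d(1) \<tau> by (simp add: pos_divide_less_eq mult.commute)
    qed
    finally show ?thesis .
  qed
  have small: "norm (\<tau> *\<^sub>R sn y) \<le> T" if y: "norm y \<le> T" for y
  proof -
    have "norm (\<tau> *\<^sub>R sn y) \<le> norm y"
    proof (rule norm_le_componentwise)
      fix b :: 'a assume b: "b \<in> Basis"
      have "\<bar>\<tau> * sin ((y \<bullet> b) / \<tau>)\<bar> \<le> \<tau> * \<bar>(y \<bullet> b) / \<tau>\<bar>"
        using \<tau> by (simp only: abs_mult abs_of_pos) (intro mult_left_mono abs_sin_x_le_abs_x, simp)
      then show "\<bar>(\<tau> *\<^sub>R sn y) \<bullet> b\<bar> \<le> \<bar>y \<bullet> b\<bar>" using \<tau> snb[OF b] by simp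
    qed
    with y show ?thesis by simp
  qed
  let ?c = "cbox (- One) One :: 'a set"
  \<comment> \<open>The polynomial approximates \<open>v\<close> in the rescaled variable on the
    unit cube. The sines land in this cube for every \<open>y\<close>, which gives the bound 2
    without restriction on \<open>y\<close>.\<close>
  have "continuous_on ?c (\<lambda>u. v (\<tau> *\<^sub>R u))"
    by (intro continuous_on_compose2[OF v(1)] continuous_intros) auto
  then obtain g where g: "real_polynomial_function g" "\<And>u. u \<in> ?c \<Longrightarrow> \<bar>v (\<tau> *\<^sub>R u) - g u\<bar> < e / 2"
    using Stone_Weierstrass_real_polynomial_function[of ?c "\<lambda>u. v (\<tau> *\<^sub>R u)" "e / 2"] e(1) by auto
  have snc: "sn y \<in> ?c" for y using snb by (auto simp: mem_box abs_le_iff[symmetric] intro: abs_sin_le_one)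
  have b1: "\<bar>g (sn y)\<bar> \<le> 2" for y
    using g(2)[OF snc[of y]] v(2)[of "\<tau> *\<^sub>R sn y"] e by linarith
  have b2: "\<bar>v y - g (sn y)\<bar> \<le> e" if y: "norm y \<le> T" for y
  proof -
    have "dist (\<tau> *\<^sub>R sn y) y < d" using close[OF y] by (simp add: dist_norm norm_minus_commute)
    then have "dist (v (\<tau> *\<^sub>R sn y)) (v y) < e / 2" using small[OF y] y by (intro d(2)) auto
    then show ?thesis using g(2)[OF snc[of y]] unfolding dist_real_def by linarith
  qed
  show ?thesis using that[OF g(1) \<tau>] b1 b2 unfolding sn_def by blast
qed

text \<open>The arguments of a loss: linear forms with coefficients in \<open>S\<close>, or the
  noise. The noise is independent of the feature and has the same law in both models, so the cosines
  of \<open>trig\<close> may contain it with any coefficient.\<close>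

definition linear_coords :: "nat \<Rightarrow> rvec set \<Rightarrow> (rvec \<times> real \<Rightarrow> 'a::euclidean_space) \<Rightarrow> bool" where
  "linear_coords p S Y \<longleftrightarrow>
    (\<forall>b\<in>Basis. (\<exists>u\<in>S. \<forall>z. Y z \<bullet> b = dotp p u (fst z)) \<or> (\<forall>z. Y z \<bullet> b = snd z))"

lemma linear_coords_measurable:
  fixes Y :: "rvec \<times> real \<Rightarrow> 'a::euclidean_space"
  assumes "linear_coords p S Y"
  shows "Y \<in> borel_measurable borel"
proof -
  have "(\<lambda>z. Y z \<bullet> b) \<in> borel_measurable borel" if b: "b \<in> Basis" for b
  proof -
    have "(\<exists>u\<in>S. \<forall>z. Y z \<bullet> b = dotp p u (fst z)) \<or> (\<forall>z. Y z \<bullet> b = snd z)"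
      using assms b unfolding linear_coords_def by (rule bspec)
    then show ?thesis
    proof (elim disjE bexE)
      fix u assume "\<forall>z. Y z \<bullet> b = dotp p u (fst z)"
      then have "(\<lambda>z. Y z \<bullet> b) = (\<lambda>z. dotp p u (fst z))" by (intro ext) (rule spec)
      then show ?thesis by (simp only: borel_dotp_fst)
    next
      assume "\<forall>z. Y z \<bullet> b = snd z"
      then have "(\<lambda>z. Y z \<bullet> b) = (\<lambda>z. snd z)" by (intro ext) (rule spec)
      then show ?thesis by (simp only: borel_snd_real)
    qed
  qed
  then show ?thesis by (rule borel_measurable_euclidean_space[THEN iffD2, rule_format])
qed

text \<open>First moments play the role of tightness: with a common \<open>c\<close> they bound the
  mass outside a large ball uniformly over laws and coordinates.\<close>

definition good_law :: "real \<Rightarrow> (rvec \<times> real) measure \<Rightarrow> (rvec \<times> real \<Rightarrow> 'a::euclidean_space) \<Rightarrow> bool" where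
  "good_law c D Y \<longleftrightarrow> prob_space D \<and> sets D = sets borel \<and>
    (\<forall>b\<in>Basis. (\<integral>\<^sup>+z. ennreal \<bar>Y z \<bullet> b\<bar> \<partial>D) \<le> ennreal c)"

text \<open>On the ball of radius \<open>T\<close> the error is at most \<open>e / 2\<close>.
  Outside, it is at most \<open>3 = 1 + 2\<close>, hence at most \<open>3 / T\<close> times the
  \<open>l1\<close> norm of \<open>Y z\<close>, whose mean is controlled. The numbers
  \<open>a\<close> and \<open>w\<close> are found before \<open>p\<close>, \<open>S\<close>,
  \<open>Y\<close> and the law, so they do not change with \<open>n\<close>.\<close>

lemma trig_approx:
  fixes v :: "'a::euclidean_space \<Rightarrow> real"
  assumes v: "continuous_on UNIV v" "\<And>y. \<bar>v y\<bar> \<le> 1" and e: "0 < e" and c: "0 \<le> c"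
  shows "\<exists>a w. 0 \<le> a \<and> (\<forall>p S Y. S \<noteq> {} \<longrightarrow> symmetric_convex S \<longrightarrow> linear_coords p S Y \<longrightarrow>
    (\<exists>q. trig p S a q w \<and> (\<forall>z. \<bar>q z\<bar> \<le> 2) \<and>
      (\<forall>D. good_law c D Y \<longrightarrow> (\<integral>z. \<bar>v (Y z) - q z\<bar> \<partial>D) \<le> e)))"
proof -
  define e' where "e' = min (e / 2) 1"
  have e': "0 < e'" "e' \<le> 1" "e' \<le> e / 2" using e by (auto simp: e'_def)
  \<comment> \<open>Makes \<open>3 / T\<close> times the moment bound \<open>DIM('a) * c\<close> at
    most \<open>e / 2\<close>.\<close>
  define T where "T = 6 * (real DIM('a) * c) / e + 1"
  have T: "T > 0" using e c by (simp add: T_def add_nonneg_pos)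
  obtain g \<tau> where g: "real_polynomial_function g" "\<tau> > 0"
    "\<And>y. \<bar>g (\<Sum>b\<in>Basis. sin ((y \<bullet> b) / \<tau>) *\<^sub>R b)\<bar> \<le> 2"
    "\<And>y. norm y \<le> T \<Longrightarrow> \<bar>v y - g (\<Sum>b\<in>Basis. sin ((y \<bullet> b) / \<tau>) *\<^sub>R b)\<bar> \<le> e'"
    by (rule sine_polynomial_approx[OF v e'(1,2) T]) (rule that; assumption)
  have \<tau>i: "0 \<le> 1 / \<tau>" using g(2) by simp
  obtain a' w' where aw: "0 \<le> a'" "\<forall>p S Y. S \<noteq> {} \<longrightarrow> symmetric_convex S \<longrightarrow>
    (\<forall>b\<in>Basis. trig p S (1 / \<tau>) (\<lambda>z. Y z \<bullet> b) 1) \<longrightarrow> trig p S a' (\<lambda>z. g (Y z)) w'"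
    using trig_polynomial[OF g(1) \<tau>i, of 1] by blast
  show ?thesis
  proof (rule exI[of _ a'], rule exI[of _ w'], intro conjI allI impI aw(1))
    fix p S and Y :: "rvec \<times> real \<Rightarrow> 'a"
    assume S: "S \<noteq> {}" "symmetric_convex S" and Y: "linear_coords p S Y"
    define sn where "sn z = (\<Sum>b\<in>Basis. sin ((Y z \<bullet> b) / \<tau>) *\<^sub>R b)" for z
    have "trig p S (1 / \<tau>) (\<lambda>z. sn z \<bullet> b) 1" if b: "b \<in> Basis" for b
    proof -
      have snb: "sn z \<bullet> b = sin ((Y z \<bullet> b) / \<tau>)" for z
        using b by (simp add: sn_def inner_sum_left inner_Basis if_distrib[where f="\<lambda>x. _ * x"] cong: if_cong)
      have "(\<exists>u\<in>S. \<forall>z. Y z \<bullet> b = dotp p u (fst z)) \<or> (\<forall>z. Y z \<bullet> b = snd z)"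
        using Y b unfolding linear_coords_def by (rule bspec)
      then show ?thesis
      proof (elim disjE bexE)
        fix u assume u: "u \<in> S" "\<forall>z. Y z \<bullet> b = dotp p u (fst z)"
        \<comment> \<open>The phase shift by \<open>- pi / 2\<close> turns the cosine into the sine
          required here.\<close>
        from trig_cos[OF u(1), of p "1 / \<tau>" 0 "- (pi / 2)"] show ?thesis
          unfolding snb u(2)[rule_format] by (simp add: cos_diff)
      next
        assume s: "\<forall>z. Y z \<bullet> b = snd z"
        obtain u where "u \<in> S" using S by auto
        from trig_cos[OF this, of p 0 "1 / \<tau>" "- (pi / 2)"]
        have "trig p S 0 (\<lambda>z. sin (snd z / \<tau>)) 1" by (simp add: cos_diff)
        then show ?thesis unfolding snb s[rule_format] by (rule trig_mono[OF _ order_refl \<tau>i S(2)])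
      qed
    qed
    then have q: "trig p S a' (\<lambda>z. g (sn z)) w'" using aw(2) S by blast
    have gb: "\<bar>g (sn z)\<bar> \<le> 2" for z unfolding sn_def by (rule g(3))
    have "(\<integral>z. \<bar>v (Y z) - g (sn z)\<bar> \<partial>D) \<le> e" if D: "good_law c D Y" for D
    proof -
      interpret prob_space D using D by (simp add: good_law_def)
      have sD: "sets D = sets borel" using D by (simp add: good_law_def)
      have mD: "f \<in> borel_measurable D" if "f \<in> borel_measurable borel" for f :: "rvec \<times> real \<Rightarrow> real"
        using that measurable_cong_sets[OF sD refl] by blast
      have Ym: "Y \<in> borel_measurable borel" by (rule linear_coords_measurable[OF Y])
      have vY: "(\<lambda>z. v (Y z)) \<in> borel_measurable D"
        by (intro mD measurable_compose[OF Ym] borel_measurable_continuous_onI v)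
      have Yb: "(\<lambda>z. Y z \<bullet> b) \<in> borel_measurable D" for b
        by (intro mD borel_measurable_inner Ym borel_measurable_const)
      have iY: "integrable D (\<lambda>z. \<bar>Y z \<bullet> b\<bar>)" "(\<integral>z. \<bar>Y z \<bullet> b\<bar> \<partial>D) \<le> c" if b: "b \<in> Basis" for b
      proof -
        have le: "(\<integral>\<^sup>+z. ennreal \<bar>Y z \<bullet> b\<bar> \<partial>D) \<le> ennreal c" using D b by (simp add: good_law_def)
        have am: "(\<lambda>z. \<bar>Y z \<bullet> b\<bar>) \<in> borel_measurable D" using Yb by measurable
        show "integrable D (\<lambda>z. \<bar>Y z \<bullet> b\<bar>)"
          using am le by (intro integrableI_bounded) (auto intro: le_less_trans)
        have "(\<integral>z. \<bar>Y z \<bullet> b\<bar> \<partial>D) = enn2real (\<integral>\<^sup>+z. ennreal \<bar>Y z \<bullet> b\<bar> \<partial>D)"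
          using am by (intro integral_eq_nn_integral) auto
        also have "\<dots> \<le> c" using le c by (intro enn2real_leI) auto
        finally show "(\<integral>z. \<bar>Y z \<bullet> b\<bar> \<partial>D) \<le> c" .
      qed
      have pt: "\<bar>v (Y z) - g (sn z)\<bar> \<le> e / 2 + (3 / T) * (\<Sum>b\<in>Basis. \<bar>Y z \<bullet> b\<bar>)" for z
      proof (cases "norm (Y z) \<le> T")
        case True
        have "0 \<le> (3 / T) * (\<Sum>b\<in>Basis. \<bar>Y z \<bullet> b\<bar>)" using T by (intro mult_nonneg_nonneg sum_nonneg) auto
        with g(4)[OF True] e'(3) show ?thesis unfolding sn_def by linarith
      next
        case False
        have "T \<le> (\<Sum>b\<in>Basis. \<bar>Y z \<bullet> b\<bar>)" using False norm_le_l1[of "Y z"] by linarith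
        then have "3 \<le> (3 / T) * (\<Sum>b\<in>Basis. \<bar>Y z \<bullet> b\<bar>)" using T by (simp add: field_simps)
        with gb[of z] v(2)[of "Y z"] e show ?thesis by linarith
      qed
      have qm: "(\<lambda>z. g (sn z)) \<in> borel_measurable D" by (rule mD[OF trig_measurable[OF q]])
      have "(\<integral>z. \<bar>v (Y z) - g (sn z)\<bar> \<partial>D) \<le> (\<integral>z. e / 2 + (3 / T) * (\<Sum>b\<in>Basis. \<bar>Y z \<bullet> b\<bar>) \<partial>D)"
      proof (rule integral_mono)
        have "\<bar>v (Y z) - g (sn z)\<bar> \<le> 3" for z using gb[of z] v(2)[of "Y z"] by linarith
        then show "integrable D (\<lambda>z. \<bar>v (Y z) - g (sn z)\<bar>)"
          using vY qm by (intro integrable_const_bound[where B=3]) auto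
        show "integrable D (\<lambda>z. e / 2 + (3 / T) * (\<Sum>b\<in>Basis. \<bar>Y z \<bullet> b\<bar>))"
          using iY by (intro Bochner_Integration.integrable_add integrable_mult_right Bochner_Integration.integrable_sum) auto
      qed (rule pt)
      also have "\<dots> = e / 2 + (3 / T) * (\<Sum>b\<in>Basis. \<integral>z. \<bar>Y z \<bullet> b\<bar> \<partial>D)"
        using iY by (subst Bochner_Integration.integral_add) (auto simp: prob_space)
      also have "\<dots> \<le> e / 2 + (3 / T) * (\<Sum>b\<in>(Basis :: 'a set). c)"
        using iY T by (intro add_left_mono mult_left_mono sum_mono) auto
      also have "(3 / T) * (\<Sum>b\<in>(Basis :: 'a set). c) \<le> e / 2"
      proof -
        have "6 * (real DIM('a) * c) / e \<le> T" by (simp add: T_def)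
        then show ?thesis using e T by (simp add: pos_divide_le_eq field_simps)
      qed
      finally show ?thesis by simp
    qed
    then show "\<exists>q. trig p S a' q w' \<and> (\<forall>z. \<bar>q z\<bar> \<le> 2) \<and> (\<forall>D. good_law c D Y \<longrightarrow> (\<integral>z. \<bar>v (Y z) - q z\<bar> \<partial>D) \<le> e)"
      using q gb by blast
  qed
qed

text \<open>Bound and Lipschitz constant go through the induction together, because the difference
  of two products needs both. The interval from -2 to 2 is the common range of the approximations
  produced by \<open>trig_approx\<close> and of their averages.\<close>

lemma polynomial_lipschitz:
  fixes g :: "real \<Rightarrow> real"
  assumes "real_polynomial_function g"
  shows "\<exists>\<Lambda>\<ge>0. \<forall>x y. \<bar>x\<bar> \<le> 2 \<longrightarrow> \<bar>y\<bar> \<le> 2 \<longrightarrow> \<bar>g x\<bar> \<le> \<Lambda> \<and> \<bar>g x - g y\<bar> \<le> \<Lambda> * \<bar>x - y\<bar>"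
  using assms
proof (induction rule: real_polynomial_function.induct)
  case (linear h)
  have h: "h x = x * h 1" for x using linear linear_scale[OF bounded_linear.linear[OF linear], of x 1] by simp
  show ?case
  proof (intro exI[of _ "2 * \<bar>h 1\<bar>"] conjI allI impI)
    fix x y :: real assume x: "\<bar>x\<bar> \<le> 2"
    show "\<bar>h x\<bar> \<le> 2 * \<bar>h 1\<bar>" unfolding h[of x] abs_mult using x by (intro mult_right_mono) auto
    have "\<bar>h x - h y\<bar> = \<bar>x - y\<bar> * \<bar>h 1\<bar>" unfolding h[of x] h[of y] by (simp add: abs_mult flip: left_diff_distrib)
    also have "\<dots> \<le> \<bar>x - y\<bar> * (2 * \<bar>h 1\<bar>)" by (intro mult_left_mono) auto
    finally show "\<bar>h x - h y\<bar> \<le> 2 * \<bar>h 1\<bar> * \<bar>x - y\<bar>" by (simp add: mult_ac)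
  qed simp
next
  case (const c)
  show ?case by (intro exI[of _ "\<bar>c\<bar>"]) auto
next
  case (add f g)
  then obtain A B where A: "A \<ge> 0" "\<And>x y. \<bar>x\<bar> \<le> 2 \<Longrightarrow> \<bar>y\<bar> \<le> 2 \<Longrightarrow> \<bar>f x\<bar> \<le> A \<and> \<bar>f x - f y\<bar> \<le> A * \<bar>x - y\<bar>"
    and B: "B \<ge> 0" "\<And>x y. \<bar>x\<bar> \<le> 2 \<Longrightarrow> \<bar>y\<bar> \<le> 2 \<Longrightarrow> \<bar>g x\<bar> \<le> B \<and> \<bar>g x - g y\<bar> \<le> B * \<bar>x - y\<bar>" by metis
  show ?case
  proof (intro exI[of _ "A + B"] conjI allI impI)
    fix x y :: real assume xy: "\<bar>x\<bar> \<le> 2" "\<bar>y\<bar> \<le> 2"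
    show "\<bar>f x + g x\<bar> \<le> A + B" using A(2)[OF xy] B(2)[OF xy] by linarith
    show "\<bar>f x + g x - (f y + g y)\<bar> \<le> (A + B) * \<bar>x - y\<bar>"
      using A(2)[OF xy] B(2)[OF xy] unfolding distrib_right by linarith
  qed (use A B in simp)
next
  case (mult f g)
  then obtain A B where A: "A \<ge> 0" "\<And>x y. \<bar>x\<bar> \<le> 2 \<Longrightarrow> \<bar>y\<bar> \<le> 2 \<Longrightarrow> \<bar>f x\<bar> \<le> A \<and> \<bar>f x - f y\<bar> \<le> A * \<bar>x - y\<bar>"
    and B: "B \<ge> 0" "\<And>x y. \<bar>x\<bar> \<le> 2 \<Longrightarrow> \<bar>y\<bar> \<le> 2 \<Longrightarrow> \<bar>g x\<bar> \<le> B \<and> \<bar>g x - g y\<bar> \<le> B * \<bar>x - y\<bar>" by metis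
  show ?case
  proof (intro exI[of _ "2 * (A * B)"] conjI allI impI)
    fix x y :: real assume xy: "\<bar>x\<bar> \<le> 2" "\<bar>y\<bar> \<le> 2"
    have "\<bar>f x * g x\<bar> \<le> A * B" unfolding abs_mult using A B A(2)[OF xy] B(2)[OF xy] by (intro mult_mono) auto
    then show "\<bar>f x * g x\<bar> \<le> 2 * (A * B)" using A B mult_nonneg_nonneg[of A B] by linarith
    have "f x * g x - f y * g y = f x * (g x - g y) + (f x - f y) * g y" by (simp add: algebra_simps)
    then have "\<bar>f x * g x - f y * g y\<bar> \<le> \<bar>f x\<bar> * \<bar>g x - g y\<bar> + \<bar>f x - f y\<bar> * \<bar>g y\<bar>"
      using abs_triangle_ineq[of "f x * (g x - g y)" "(f x - f y) * g y"] by (simp only: abs_mult)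
    also have "\<dots> \<le> A * (B * \<bar>x - y\<bar>) + (A * \<bar>x - y\<bar>) * B"
      using A(1) B(1) A(2)[OF xy] B(2)[OF xy] B(2)[OF xy(2,1)] by (intro add_mono mult_mono) auto
    finally show "\<bar>f x * g x - f y * g y\<bar> \<le> 2 * (A * B) * \<bar>x - y\<bar>" by (simp add: algebra_simps)
  qed (use A B in simp)
qed

lemma trig_discrepancy:
  assumes "trig p S a f w" and D: "prob_space D1" "prob_space D2" "sets D1 = sets borel" "sets D2 = sets borel"
    and \<delta>: "\<And>u c b. u \<in> S \<Longrightarrow> \<bar>(\<integral>z. cos (a * dotp p u (fst z) + c * snd z + b) \<partial>D1) -
      (\<integral>z. cos (a * dotp p u (fst z) + c * snd z + b) \<partial>D2)\<bar> \<le> \<delta>"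
  shows "\<bar>(\<integral>z. f z \<partial>D1) - (\<integral>z. f z \<partial>D2)\<bar> \<le> w * \<delta>"
  using assms(1)
proof (induction rule: trig.induct)
  case (trig_cos u c b)
  then show ?case using \<delta> by simp
next
  case (trig_add f w g w')
  have i: "integrable D h" if "prob_space D" "sets D = sets borel" "trig p S a h w" for D h w
  proof -
    interpret prob_space D by fact
    show ?thesis using trig_le[OF that(3)] trig_measurable[OF that(3)] measurable_cong_sets[OF that(2) refl]
      by (intro integrable_const_bound[where B=w]) auto
  qed
  have "(\<integral>z. f z + g z \<partial>D1) - (\<integral>z. f z + g z \<partial>D2) = ((\<integral>z. f z \<partial>D1) - (\<integral>z. f z \<partial>D2)) + ((\<integral>z. g z \<partial>D1) - (\<integral>z. g z \<partial>D2))"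
    using i[OF D(1,3) trig_add.hyps(1)] i[OF D(1,3) trig_add.hyps(2)] i[OF D(2,4) trig_add.hyps(1)] i[OF D(2,4) trig_add.hyps(2)]
    by simp
  then show ?case using trig_add.IH by (simp add: distrib_right)
next
  case (trig_scale f w c)
  have "(\<integral>z. c * f z \<partial>D1) - (\<integral>z. c * f z \<partial>D2) = c * ((\<integral>z. f z \<partial>D1) - (\<integral>z. f z \<partial>D2))"
    by (simp add: right_diff_distrib)
  then show ?case using trig_scale.IH by (simp add: abs_mult mult.assoc mult_left_mono)
qed

text \<open>Three approximations compose: \<open>v\<close> and \<open>g\<close> by trigonometric
  sums, the logarithm on \<open>{lo..1}\<close> by a polynomial \<open>P\<close>. The lower bound
  \<open>lo\<close> keeps the logarithm away from its singularity. Since \<open>P\<close> of an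
  average of trigonometric sums is again one, with frequency bound and weight fixed by the
  tolerances, a single condition on cosines remains. The factor \<open>g\<close> makes room for the
  conditional label probability in the binary model.\<close>

lemma cavity_discrepancy:
  fixes v :: "'a::euclidean_space \<Rightarrow> real" and g :: "'b::euclidean_space \<Rightarrow> real"
  assumes v: "continuous_on UNIV v" "\<And>y. lo \<le> v y \<and> v y \<le> 1" "lo > 0"
    and g: "continuous_on UNIV g" "\<And>y. \<bar>g y\<bar> \<le> 1"
    and \<beta>: "\<beta> > 0" and e: "e > 0" and c: "c \<ge> 0"
  shows "\<exists>a w. w \<ge> 0 \<and> (\<forall>p S D1 D2 (N :: 't set) \<nu> Y Y0 \<delta>. S \<noteq> {} \<longrightarrow> symmetric_convex S \<longrightarrow>
    finite N \<longrightarrow> weights N \<nu> \<longrightarrow> linear_coords p S Y0 \<longrightarrow> (\<forall>T\<in>N. linear_coords p S (Y T)) \<longrightarrow>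
    good_law c D1 Y0 \<longrightarrow> good_law c D2 Y0 \<longrightarrow> (\<forall>T\<in>N. good_law c D1 (Y T) \<and> good_law c D2 (Y T)) \<longrightarrow>
    (\<forall>u\<in>S. \<forall>c b. \<bar>(\<integral>z. cos (a * dotp p u (fst z) + c * snd z + b) \<partial>D1) -
      (\<integral>z. cos (a * dotp p u (fst z) + c * snd z + b) \<partial>D2)\<bar> \<le> \<delta>) \<longrightarrow>
    \<bar>(\<integral>z. g (Y0 z) * (- ln (\<Sum>T\<in>N. \<nu> T * v (Y T z)) / \<beta>) \<partial>D1) -
     (\<integral>z. g (Y0 z) * (- ln (\<Sum>T\<in>N. \<nu> T * v (Y T z)) / \<beta>) \<partial>D2)\<bar> \<le> e + w * \<delta>)"
proof -
  define L where "L y = - ln y / \<beta>" for y :: real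
  have vb: "\<bar>v y\<bar> \<le> 1" for y using v(2)[of y] v(3) by (simp add: abs_le_iff)
  have lo1: "lo \<le> 1" using v(2)[of undefined] by linarith
  have Lc: "continuous_on {lo..1} L" unfolding L_def[abs_def] using v(3) \<beta>
    by (intro continuous_intros) auto
  have Lb: "\<bar>L y\<bar> \<le> - ln lo / \<beta>" if "lo \<le> y" "y \<le> 1" for y
  proof -
    have "ln lo \<le> ln y" "ln y \<le> 0" using that v(3) by auto
    then show ?thesis using \<beta> by (simp add: L_def divide_right_mono)
  qed
  have e16: "e / 16 > 0" using e by simp
  obtain P where P: "real_polynomial_function P" "\<And>y. y \<in> {lo..1} \<Longrightarrow> \<bar>L y - P y\<bar> < e / 16"
    using Stone_Weierstrass_real_polynomial_function[OF compact_Icc Lc e16] by blast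
  from polynomial_lipschitz[OF P(1)] obtain \<Lambda> where
    L0: "\<Lambda> \<ge> 0" and L1: "\<forall>x y. \<bar>x\<bar> \<le> 2 \<longrightarrow> \<bar>y\<bar> \<le> 2 \<longrightarrow> \<bar>P x\<bar> \<le> \<Lambda> \<and> \<bar>P x - P y\<bar> \<le> \<Lambda> * \<bar>x - y\<bar>"
    by (elim exE conjE)
  \<comment> \<open>In each model the error \<open>e / 16\<close> of \<open>P\<close> and the two
    errors multiplied by \<open>\<Lambda>\<close> add up to at most \<open>e / 2\<close>.\<close>
  define e1 where "e1 = e / (8 * (\<Lambda> + 1))"
  have e1: "e1 > 0" "\<Lambda> * e1 \<le> e / 8"
    using e L0 by (auto simp: e1_def field_simps)
  from trig_approx[OF v(1) vb e1(1) c] obtain a1 w1 where a1: "0 \<le> a1"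
    and A1: "\<forall>p S Y. S \<noteq> {} \<longrightarrow> symmetric_convex S \<longrightarrow> linear_coords p S Y \<longrightarrow>
    (\<exists>q. trig p S a1 q w1 \<and> (\<forall>z. \<bar>q z\<bar> \<le> 2) \<and>
      (\<forall>D. good_law c D Y \<longrightarrow> (\<integral>z. \<bar>v (Y z) - q z\<bar> \<partial>D) \<le> e1))" by (elim exE conjE)
  from trig_approx[OF g e1(1) c] obtain a2 w2 where a2: "0 \<le> a2"
    and A2: "\<forall>p S Y. S \<noteq> {} \<longrightarrow> symmetric_convex S \<longrightarrow> linear_coords p S Y \<longrightarrow>
    (\<exists>q. trig p S a2 q w2 \<and> (\<forall>z. \<bar>q z\<bar> \<le> 2) \<and>
      (\<forall>D. good_law c D Y \<longrightarrow> (\<integral>z. \<bar>g (Y z) - q z\<bar> \<partial>D) \<le> e1))" by (elim exE conjE)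
  from trig_polynomial[OF P(1) a1, of w1] obtain a3 w3 where a3: "0 \<le> a3"
    and A3: "\<forall>p S Y. S \<noteq> {} \<longrightarrow> symmetric_convex S \<longrightarrow>
      (\<forall>b\<in>Basis. trig p S a1 (\<lambda>z. Y z \<bullet> b) w1) \<longrightarrow> trig p S a3 (\<lambda>z. P (Y z)) w3" by (elim exE conjE)
  show ?thesis
  proof (rule exI[of _ "a2 + a3"], rule exI[of _ "\<bar>w2 * w3\<bar>"], intro conjI allI impI)
    fix p S D1 D2 and N :: "'t set" and \<nu> and Y :: "'t \<Rightarrow> rvec \<times> real \<Rightarrow> 'a" and Y0 :: "rvec \<times> real \<Rightarrow> 'b" and \<delta>
    assume S: "S \<noteq> {}" "symmetric_convex S" and N: "finite N" and \<nu>: "weights N \<nu>"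
      and lc: "linear_coords p S Y0" "\<forall>T\<in>N. linear_coords p S (Y T)"
      and gl: "good_law c D1 Y0" "good_law c D2 Y0" "\<forall>T\<in>N. good_law c D1 (Y T) \<and> good_law c D2 (Y T)"
      and \<delta>: "\<forall>u\<in>S. \<forall>c b. \<bar>(\<integral>z. cos ((a2 + a3) * dotp p u (fst z) + c * snd z + b) \<partial>D1) -
      (\<integral>z. cos ((a2 + a3) * dotp p u (fst z) + c * snd z + b) \<partial>D2)\<bar> \<le> \<delta>"
    have "\<forall>T\<in>N. \<exists>q. trig p S a1 q w1 \<and> (\<forall>z. \<bar>q z\<bar> \<le> 2) \<and>
      (\<forall>D. good_law c D (Y T) \<longrightarrow> (\<integral>z. \<bar>v (Y T z) - q z\<bar> \<partial>D) \<le> e1)"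
      using A1 S lc(2) by blast
    from bchoice[OF this] obtain q where q: "\<forall>T\<in>N. trig p S a1 (q T) w1 \<and> (\<forall>z. \<bar>q T z\<bar> \<le> 2) \<and>
      (\<forall>D. good_law c D (Y T) \<longrightarrow> (\<integral>z. \<bar>v (Y T z) - q T z\<bar> \<partial>D) \<le> e1)" by (rule exE)
    have q2: "\<bar>q T z\<bar> \<le> 2" if "T \<in> N" for T z using q that by blast
    obtain q0 where q0: "trig p S a2 q0 w2" "\<forall>z. \<bar>q0 z\<bar> \<le> 2"
      "\<forall>D. good_law c D Y0 \<longrightarrow> (\<integral>z. \<bar>g (Y0 z) - q0 z\<bar> \<partial>D) \<le> e1"
      using A2 S lc(1) by blast
    define m where "m z = (\<Sum>T\<in>N. \<nu> T * v (Y T z))" for z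
    define qm where "qm z = (\<Sum>T\<in>N. \<nu> T * q T z)" for z
    have sumw: "(\<Sum>T\<in>N. \<bar>\<nu> T\<bar> * w1) = w1"
    proof -
      have "(\<Sum>T\<in>N. \<bar>\<nu> T\<bar> * w1) = (\<Sum>T\<in>N. \<nu> T * w1)"
        using \<nu> by (intro sum.cong) (auto simp: weights_def)
      then show ?thesis using \<nu> by (simp add: weights_def flip: sum_distrib_right)
    qed
    have tqm: "trig p S a1 qm w1"
      unfolding qm_def[abs_def] using trig_weighted_sum[OF N _ S a1, of p q w1 \<nu>] q sumw by simp
    have mb: "lo \<le> m z \<and> m z \<le> 1" for z
      unfolding m_def using v(2) weighted_average_le[OF N \<nu>] weighted_average_ge[OF N \<nu>] by simp
    have qmb: "\<bar>qm z\<bar> \<le> 2" for z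
    proof -
      have b: "- 2 \<le> q T z \<and> q T z \<le> 2" if "T \<in> N" for T
        using q2[OF that, of z] by linarith
      have "qm z \<le> 2" unfolding qm_def using b by (intro weighted_average_le[OF N \<nu>]) auto
      moreover have "- 2 \<le> qm z" unfolding qm_def using b by (intro weighted_average_ge[OF N \<nu>]) auto
      ultimately show ?thesis by (simp add: abs_le_iff)
    qed
    have tP: "trig p S a3 (\<lambda>z. P (qm z)) w3" using A3 S tqm by simp
    have tprod: "trig p S (a2 + a3) (\<lambda>z. q0 z * P (qm z)) (w2 * w3)"
      by (rule trig_mult[OF q0(1) tP a2 a3 S(2)])
    define F where "F z = g (Y0 z) * L (m z)" for z
    have pt: "\<bar>F z - q0 z * P (qm z)\<bar> \<le> e / 16 + \<Lambda> * \<bar>m z - qm z\<bar> + \<Lambda> * \<bar>g (Y0 z) - q0 z\<bar>" for z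
    proof -
      have m2: "\<bar>m z\<bar> \<le> 2" using mb[of z] v(3) by (simp add: abs_le_iff)
      \<comment> \<open>\<open>P\<close> replaces the logarithm before \<open>m\<close> is replaced
        by \<open>qm\<close>: the approximation \<open>qm\<close> may leave \<open>{lo..1}\<close>,
        but \<open>P\<close> remains Lipschitz on its range.\<close>
      have "F z - q0 z * P (qm z) = g (Y0 z) * (L (m z) - P (m z)) + g (Y0 z) * (P (m z) - P (qm z))
          + (g (Y0 z) - q0 z) * P (qm z)" by (simp add: F_def algebra_simps)
      then have "\<bar>F z - q0 z * P (qm z)\<bar> \<le> \<bar>g (Y0 z)\<bar> * \<bar>L (m z) - P (m z)\<bar> + \<bar>g (Y0 z)\<bar> * \<bar>P (m z) - P (qm z)\<bar>
          + \<bar>g (Y0 z) - q0 z\<bar> * \<bar>P (qm z)\<bar>" unfolding abs_mult[symmetric] by linarith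
      moreover have "\<bar>g (Y0 z)\<bar> * \<bar>L (m z) - P (m z)\<bar> \<le> 1 * (e / 16)"
        using g(2) P(2)[of "m z"] mb by (intro mult_mono) (auto intro: less_imp_le)
      moreover have "\<bar>g (Y0 z)\<bar> * \<bar>P (m z) - P (qm z)\<bar> \<le> 1 * (\<Lambda> * \<bar>m z - qm z\<bar>)"
        using g(2) L1[rule_format, OF m2 qmb[of z]] by (intro mult_mono) auto
      moreover have "\<bar>g (Y0 z) - q0 z\<bar> * \<bar>P (qm z)\<bar> \<le> \<bar>g (Y0 z) - q0 z\<bar> * \<Lambda>"
        using L1[rule_format, OF qmb[of z] qmb[of z]] by (intro mult_left_mono) auto
      ultimately show ?thesis by (simp add: mult.commute)
    qed
    have approx: "\<bar>(\<integral>z. F z \<partial>D) - (\<integral>z. q0 z * P (qm z) \<partial>D)\<bar> \<le> e / 2"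
      if D: "good_law c D Y0" "\<forall>T\<in>N. good_law c D (Y T)" for D
    proof -
      interpret prob_space D using D by (simp add: good_law_def)
      have sD: "sets D = sets borel" using D by (simp add: good_law_def)
      have mD: "f \<in> borel_measurable D" if "f \<in> borel_measurable borel" for f :: "rvec \<times> real \<Rightarrow> real"
        using that measurable_cong_sets[OF sD refl] by blast
      have [measurable]: "(\<lambda>z. v (Y T z)) \<in> borel_measurable D" if "T \<in> N" for T
        using lc(2) that by (intro mD measurable_compose[OF linear_coords_measurable] borel_measurable_continuous_onI v) auto
      have [measurable]: "(\<lambda>z. g (Y0 z)) \<in> borel_measurable D"
        using lc(1) by (intro mD measurable_compose[OF linear_coords_measurable] borel_measurable_continuous_onI g) auto
      have [measurable]: "q T \<in> borel_measurable D" if "T \<in> N" for T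
        using q that by (intro mD trig_measurable) auto
      have [measurable]: "q0 \<in> borel_measurable D" using q0(1) by (intro mD trig_measurable)
      have [measurable]: "(\<lambda>z. P (qm z)) \<in> borel_measurable D" using tP by (intro mD trig_measurable)
      have [measurable]: "m \<in> borel_measurable D" "qm \<in> borel_measurable D"
        unfolding m_def[abs_def] qm_def[abs_def] by measurable
      have [measurable]: "F \<in> borel_measurable D" unfolding F_def[abs_def] L_def by measurable
      have i1: "integrable D F"
      proof (rule integrable_const_bound[where B="- ln lo / \<beta>"])
        have "\<bar>F z\<bar> \<le> 1 * (- ln lo / \<beta>)" for z
          unfolding F_def abs_mult using g(2) Lb mb by (intro mult_mono) auto
        then show "AE z in D. norm (F z) \<le> - ln lo / \<beta>" by simp
      qed simp
      have i2: "integrable D (\<lambda>z. q0 z * P (qm z))"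
        using trig_le[OF tprod] by (intro integrable_const_bound[where B="w2 * w3"]) auto
      have i3: "integrable D (\<lambda>z. \<bar>v (Y T z) - q T z\<bar>)" if "T \<in> N" for T
      proof (rule integrable_const_bound[where B=3])
        have "\<bar>v (Y T z) - q T z\<bar> \<le> 3" for z using vb[of "Y T z"] q2[OF that, of z] by linarith
        then show "AE z in D. norm \<bar>v (Y T z) - q T z\<bar> \<le> 3" by simp
      qed (use that in measurable)
      have i4: "integrable D (\<lambda>z. \<bar>m z - qm z\<bar>)"
      proof (rule integrable_const_bound[where B=3])
        have "\<bar>m z - qm z\<bar> \<le> 3" for z using mb[of z] qmb[of z] v(3) by linarith
        then show "AE z in D. norm \<bar>m z - qm z\<bar> \<le> 3" by simp
      qed simp
      have i5: "integrable D (\<lambda>z. \<bar>g (Y0 z) - q0 z\<bar>)"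
      proof (rule integrable_const_bound[where B=3])
        have "\<bar>g (Y0 z) - q0 z\<bar> \<le> 3" for z using g(2)[of "Y0 z"] q0(2)[rule_format, of z] by linarith
        then show "AE z in D. norm \<bar>g (Y0 z) - q0 z\<bar> \<le> 3" by simp
      qed simp
      have mq: "(\<integral>z. \<bar>m z - qm z\<bar> \<partial>D) \<le> e1"
      proof -
        have "(\<integral>z. \<bar>m z - qm z\<bar> \<partial>D) \<le> (\<integral>z. (\<Sum>T\<in>N. \<nu> T * \<bar>v (Y T z) - q T z\<bar>) \<partial>D)"
        proof (rule integral_mono[OF i4])
          show "integrable D (\<lambda>z. \<Sum>T\<in>N. \<nu> T * \<bar>v (Y T z) - q T z\<bar>)"
            using i3 by (intro Bochner_Integration.integrable_sum integrable_mult_right) auto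
          fix z
          have "m z - qm z = (\<Sum>T\<in>N. \<nu> T * (v (Y T z) - q T z))"
            by (simp add: m_def qm_def sum_subtractf right_diff_distrib)
          then have "\<bar>m z - qm z\<bar> \<le> (\<Sum>T\<in>N. \<bar>\<nu> T * (v (Y T z) - q T z)\<bar>)" by (simp add: sum_abs)
          also have "\<dots> = (\<Sum>T\<in>N. \<nu> T * \<bar>v (Y T z) - q T z\<bar>)"
            using \<nu> by (intro sum.cong) (auto simp: abs_mult weights_def)
          finally show "\<bar>m z - qm z\<bar> \<le> (\<Sum>T\<in>N. \<nu> T * \<bar>v (Y T z) - q T z\<bar>)" .
        qed
        also have "\<dots> = (\<Sum>T\<in>N. \<nu> T * (\<integral>z. \<bar>v (Y T z) - q T z\<bar> \<partial>D))"
          using i3 by (subst Bochner_Integration.integral_sum) auto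
        also have "\<dots> \<le> e1" using q D by (intro weighted_average_le[OF N \<nu>]) auto
        finally show ?thesis .
      qed
      have "\<bar>(\<integral>z. F z \<partial>D) - (\<integral>z. q0 z * P (qm z) \<partial>D)\<bar> = \<bar>\<integral>z. F z - q0 z * P (qm z) \<partial>D\<bar>"
        using i1 i2 by simp
      also have "\<dots> \<le> (\<integral>z. \<bar>F z - q0 z * P (qm z)\<bar> \<partial>D)" by (rule integral_abs_bound)
      also have "\<dots> \<le> (\<integral>z. e / 16 + \<Lambda> * \<bar>m z - qm z\<bar> + \<Lambda> * \<bar>g (Y0 z) - q0 z\<bar> \<partial>D)"
        using i1 i2 i4 i5 pt by (intro integral_mono) auto
      also have "\<dots> = e / 16 + \<Lambda> * (\<integral>z. \<bar>m z - qm z\<bar> \<partial>D) + \<Lambda> * (\<integral>z. \<bar>g (Y0 z) - q0 z\<bar> \<partial>D)"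
        using i4 i5 by (simp add: prob_space)
      also have "\<dots> \<le> e / 16 + \<Lambda> * e1 + \<Lambda> * e1"
        using mq q0(3) D(1) L0 by (intro add_mono mult_left_mono) auto
      also have "\<dots> \<le> e / 2" using e1(2) e by simp
      finally show ?thesis .
    qed
    have D12: "prob_space D1" "prob_space D2" "sets D1 = sets borel" "sets D2 = sets borel"
      using gl by (auto simp: good_law_def)
    have "\<bar>(\<integral>z. q0 z * P (qm z) \<partial>D1) - (\<integral>z. q0 z * P (qm z) \<partial>D2)\<bar> \<le> w2 * w3 * \<delta>"
      using \<delta> by (intro trig_discrepancy[OF tprod D12]) auto
    moreover have "w2 * w3 * \<delta> \<le> \<bar>w2 * w3\<bar> * \<delta>"
      using trig_nonneg[OF tprod] by simp
    moreover have "\<bar>(\<integral>z. F z \<partial>D1) - (\<integral>z. q0 z * P (qm z) \<partial>D1)\<bar> \<le> e / 2"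
      using gl(1,3) by (intro approx) auto
    moreover have "\<bar>(\<integral>z. F z \<partial>D2) - (\<integral>z. q0 z * P (qm z) \<partial>D2)\<bar> \<le> e / 2"
      using gl(2,3) by (intro approx) auto
    ultimately have "\<bar>(\<integral>z. F z \<partial>D1) - (\<integral>z. F z \<partial>D2)\<bar> \<le> e + \<bar>w2 * w3\<bar> * \<delta>"
      by linarith
    then show "\<bar>(\<integral>z. g (Y0 z) * (- ln (\<Sum>T\<in>N. \<nu> T * v (Y T z)) / \<beta>) \<partial>D1) -
     (\<integral>z. g (Y0 z) * (- ln (\<Sum>T\<in>N. \<nu> T * v (Y T z)) / \<beta>) \<partial>D2)\<bar> \<le> e + \<bar>w2 * w3\<bar> * \<delta>"
      unfolding F_def m_def L_def .
  qed simp
qed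

subsection \<open>Exponential moments\<close>

text \<open>Completing the square: \<open>k * x \<le> k^2 * t0^2 / 4 + x^2 / t0^2\<close>, and the
  last term has an exponential moment at most 2.\<close>

lemma subgaussian_exp_moment:
  assumes "subgaussian_norm D Z \<le> ennreal K" and [measurable]: "Z \<in> borel_measurable D" and "k \<ge> 0"
  shows "(\<integral>\<^sup>+\<omega>. ennreal (exp (k * \<bar>Z \<omega>\<bar>)) \<partial>D) \<le> ennreal (2 * exp (k\<^sup>2 * (max K 0 + 1)\<^sup>2 / 4))"
proof -
  \<comment> \<open>Strictly above the norm, so that an admissible \<open>t\<close> exists below it
    even if the infimum is not attained; the maximum with 0 matches \<open>ennreal K\<close> for
    negative \<open>K\<close>.\<close>
  define t0 where "t0 = max K 0 + 1"
  have t0: "t0 > 0" by (simp add: t0_def)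
  have "subgaussian_norm D Z < ennreal t0"
    using assms(1) by (rule le_less_trans) (simp add: t0_def ennreal_lessI)
  then obtain t :: real where t: "0 < t" "(\<integral>\<^sup>+\<omega>. ennreal (exp ((Z \<omega>)\<^sup>2 / t\<^sup>2)) \<partial>D) \<le> 2" "ennreal t < ennreal t0"
    unfolding subgaussian_norm_def INF_less_iff by auto
  have tt: "t < t0" using t(1,3) by (simp add: ennreal_less_iff)
  have "(\<integral>\<^sup>+\<omega>. ennreal (exp (k * \<bar>Z \<omega>\<bar>)) \<partial>D) \<le>
      (\<integral>\<^sup>+\<omega>. ennreal (exp (k\<^sup>2 * t0\<^sup>2 / 4)) * ennreal (exp ((Z \<omega>)\<^sup>2 / t\<^sup>2)) \<partial>D)"
  proof (rule nn_integral_mono)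
    fix \<omega>
    have "k * \<bar>Z \<omega>\<bar> \<le> k\<^sup>2 * t0\<^sup>2 / 4 + (Z \<omega>)\<^sup>2 / t0\<^sup>2"
    proof -
      have "0 \<le> (k * t0 / 2 - \<bar>Z \<omega>\<bar> / t0)\<^sup>2" by simp
      also have "\<dots> = k\<^sup>2 * t0\<^sup>2 / 4 + (Z \<omega>)\<^sup>2 / t0\<^sup>2 - k * \<bar>Z \<omega>\<bar>"
        using t0 by (simp add: power2_eq_square field_simps)
      finally show ?thesis by simp
    qed
    also have "(Z \<omega>)\<^sup>2 / t0\<^sup>2 \<le> (Z \<omega>)\<^sup>2 / t\<^sup>2"
      using t(1) tt by (intro divide_left_mono power_mono mult_pos_pos) auto
    finally have "exp (k * \<bar>Z \<omega>\<bar>) \<le> exp (k\<^sup>2 * t0\<^sup>2 / 4) * exp ((Z \<omega>)\<^sup>2 / t\<^sup>2)"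
      by (simp flip: exp_add)
    then show "ennreal (exp (k * \<bar>Z \<omega>\<bar>)) \<le> ennreal (exp (k\<^sup>2 * t0\<^sup>2 / 4)) * ennreal (exp ((Z \<omega>)\<^sup>2 / t\<^sup>2))"
      by (subst ennreal_mult[symmetric]) (auto intro: ennreal_leI)
  qed
  also have "\<dots> = ennreal (exp (k\<^sup>2 * t0\<^sup>2 / 4)) * (\<integral>\<^sup>+\<omega>. ennreal (exp ((Z \<omega>)\<^sup>2 / t\<^sup>2)) \<partial>D)"
    by (rule nn_integral_cmult) measurable
  also have "\<dots> \<le> ennreal (exp (k\<^sup>2 * t0\<^sup>2 / 4)) * ennreal 2" using t(2) by (intro mult_left_mono) auto
  also have "\<dots> = ennreal (2 * exp (k\<^sup>2 * t0\<^sup>2 / 4))" by (subst ennreal_mult[symmetric]) (auto simp: mult.commute)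
  finally show ?thesis by (simp add: t0_def)
qed

text \<open>The exponentially tilted normal density is a multiple of the normal density with mean
  \<open>m + k * \<sigma>^2\<close>.\<close>

lemma normal_mgf:
  assumes "\<sigma> > 0"
  shows "(\<integral>\<^sup>+y. ennreal (exp (k * y)) \<partial>density lborel (normal_density m \<sigma>)) = ennreal (exp (k * m + k\<^sup>2 * \<sigma>\<^sup>2 / 2))"
proof -
  have eq: "normal_density m \<sigma> y * exp (k * y) = exp (k * m + k\<^sup>2 * \<sigma>\<^sup>2 / 2) * normal_density (m + k * \<sigma>\<^sup>2) \<sigma> y" for y
  proof -
    have "- (y - m)\<^sup>2 / (2 * \<sigma>\<^sup>2) + k * y = (k * m + k\<^sup>2 * \<sigma>\<^sup>2 / 2) + - (y - (m + k * \<sigma>\<^sup>2))\<^sup>2 / (2 * \<sigma>\<^sup>2)"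
      using assms by (simp add: field_simps power2_eq_square)
    then show ?thesis unfolding normal_density_def by (simp add: mult_ac flip: exp_add)
  qed
  have "(\<integral>\<^sup>+y. ennreal (exp (k * y)) \<partial>density lborel (normal_density m \<sigma>)) =
      (\<integral>\<^sup>+y. ennreal (normal_density m \<sigma> y) * ennreal (exp (k * y)) \<partial>lborel)"
    by (subst nn_integral_density) auto
  also have "\<dots> = (\<integral>\<^sup>+y. ennreal (exp (k * m + k\<^sup>2 * \<sigma>\<^sup>2 / 2)) * ennreal (normal_density (m + k * \<sigma>\<^sup>2) \<sigma> y) \<partial>lborel)"
  proof (rule nn_integral_cong)
    fix y
    show "ennreal (normal_density m \<sigma> y) * ennreal (exp (k * y)) =
        ennreal (exp (k * m + k\<^sup>2 * \<sigma>\<^sup>2 / 2)) * ennreal (normal_density (m + k * \<sigma>\<^sup>2) \<sigma> y)"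
      by (subst (1 2) ennreal_mult[symmetric]) (auto simp: eq)
  qed
  also have "\<dots> = ennreal (exp (k * m + k\<^sup>2 * \<sigma>\<^sup>2 / 2)) * (\<integral>\<^sup>+y. ennreal (normal_density (m + k * \<sigma>\<^sup>2) \<sigma> y) \<partial>lborel)"
    by (rule nn_integral_cmult) auto
  also have "(\<integral>\<^sup>+y. ennreal (normal_density (m + k * \<sigma>\<^sup>2) \<sigma> y) \<partial>lborel) = 1"
    using prob_space.emeasure_space_1[OF prob_space_normal_density[OF assms, of "m + k * \<sigma>\<^sup>2"]]
    by (simp add: emeasure_density)
  finally show ?thesis by simp
qed

lemma normal_law_exp_moment:
  assumes "s \<ge> 0"
  shows "(\<integral>\<^sup>+y. ennreal (exp \<bar>y\<bar>) \<partial>normal_law m s) \<le> ennreal (2 * exp (\<bar>m\<bar> + s / 2))"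
proof (cases "s = 0")
  case True
  have "exp \<bar>m\<bar> \<le> 2 * exp \<bar>m\<bar>" by simp
  then show ?thesis using True by (simp add: normal_law_def nn_integral_return ennreal_leI)
next
  case False
  define \<sigma> where "\<sigma> = sqrt s"
  have \<sigma>: "\<sigma> > 0" "\<sigma>\<^sup>2 = s" using assms False by (auto simp: \<sigma>_def)
  let ?N = "density lborel (normal_density m \<sigma>)"
  have "(\<integral>\<^sup>+y. ennreal (exp \<bar>y\<bar>) \<partial>?N) \<le> (\<integral>\<^sup>+y. ennreal (exp (1 * y)) + ennreal (exp ((-1) * y)) \<partial>?N)"
  proof (rule nn_integral_mono)
    fix y :: real
    have "exp \<bar>y\<bar> \<le> exp (1 * y) + exp ((-1) * y)" by (cases "y \<ge> 0") auto
    then show "ennreal (exp \<bar>y\<bar>) \<le> ennreal (exp (1 * y)) + ennreal (exp ((-1) * y))"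
      by (subst ennreal_plus[symmetric]; simp add: ennreal_leI del: ennreal_plus)
  qed
  also have "\<dots> = (\<integral>\<^sup>+y. ennreal (exp (1 * y)) \<partial>?N) + (\<integral>\<^sup>+y. ennreal (exp ((-1) * y)) \<partial>?N)"
    by (rule nn_integral_add) auto
  also have "\<dots> = ennreal (exp (1 * m + 1\<^sup>2 * \<sigma>\<^sup>2 / 2)) + ennreal (exp ((-1) * m + (-1)\<^sup>2 * \<sigma>\<^sup>2 / 2))"
    unfolding normal_mgf[OF \<sigma>(1)] ..
  also have "\<dots> = ennreal (exp (m + s / 2) + exp (- m + s / 2))"
    by (subst ennreal_plus[symmetric]) (auto simp: \<sigma>(2))
  also have "\<dots> \<le> ennreal (2 * exp (\<bar>m\<bar> + s / 2))"
  proof (rule ennreal_leI)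
    have "exp (m + s / 2) \<le> exp (\<bar>m\<bar> + s / 2)" "exp (- m + s / 2) \<le> exp (\<bar>m\<bar> + s / 2)" by auto
    then show "exp (m + s / 2) + exp (- m + s / 2) \<le> 2 * exp (\<bar>m\<bar> + s / 2)" by linarith
  qed
  finally show ?thesis using False by (simp add: normal_law_def \<sigma>_def)
qed

text \<open>\<open>ln x \<le> x - 1\<close> at \<open>x = t / (m * q)\<close>. The parameter
  \<open>m\<close> will be the dimension, to match \<open>exp_norm_le\<close>.\<close>

lemma powr_le_exp:
  fixes t q m :: real
  assumes "t \<ge> 0" "q > 0" "m > 0"
  shows "t powr q \<le> exp (q * ln (m * q)) * exp (t / m)"
proof (cases "t = 0")
  case False
  then have t: "t > 0" using assms by simp
  have "ln (t / (m * q)) \<le> t / (m * q) - 1" using assms t by (intro ln_le_minus_one) auto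
  then have "q * ln (t / (m * q)) \<le> q * (t / (m * q))" using assms by (intro mult_left_mono) auto
  also have "q * (t / (m * q)) = t / m" using assms by simp
  finally have "q * ln t \<le> q * ln (m * q) + t / m"
    using assms t by (simp add: ln_div algebra_simps)
  then show ?thesis using t by (simp add: powr_def flip: exp_add)
qed simp

text \<open>The norm is at most the dimension times the largest coordinate. After division by the
  dimension it is controlled by exponential moments of single coordinates at unit rate, without
  information on their joint law.\<close>

lemma exp_norm_le:
  fixes w :: "'a::euclidean_space"
  shows "exp (norm w / real DIM('a)) \<le> (\<Sum>b\<in>Basis. exp \<bar>w \<bullet> b\<bar>)"
proof -
  let ?A = "\<Sum>b\<in>Basis. exp \<bar>w \<bullet> b\<bar>"
  have A: "?A > 0" by (intro sum_pos) auto
  have le: "\<bar>w \<bullet> b\<bar> \<le> ln ?A" if "b \<in> Basis" for b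
  proof -
    have "exp \<bar>w \<bullet> b\<bar> \<le> ?A" using that by (intro member_le_sum[of b Basis "\<lambda>b. exp \<bar>w \<bullet> b\<bar>"]) auto
    then show ?thesis using A by (simp add: ln_ge_iff)
  qed
  have "norm w \<le> (\<Sum>b\<in>Basis. \<bar>w \<bullet> b\<bar>)" by (rule norm_le_l1)
  also have "\<dots> \<le> (\<Sum>b\<in>(Basis :: 'a set). ln ?A)" using le by (rule sum_mono)
  also have "\<dots> = real DIM('a) * ln ?A" by simp
  finally have "norm w / real DIM('a) \<le> ln ?A" by (simp add: pos_divide_le_eq mult.commute)
  then show ?thesis using A by (simp add: ln_ge_iff)
qed

subsection \<open>The two regression models\<close>

text \<open>The setting common to both alternatives; each alternative, added to it, is then shown to
  produce a \<open>universal_pair\<close>.\<close>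

locale erm_models =
  fixes p :: "nat \<Rightarrow> nat"
    and M :: "nat \<Rightarrow> 'w measure"
    and X G :: "nat \<Rightarrow> nat \<Rightarrow> 'w \<Rightarrow> rvec"
    and e :: "nat \<Rightarrow> nat \<Rightarrow> 'w \<Rightarrow> real"
    and Px Pg :: "nat \<Rightarrow> rvec measure"
    and Q :: "nat \<Rightarrow> real measure"
    and mu :: "nat \<Rightarrow> rvec"
    and Sg :: "nat \<Rightarrow> nat \<Rightarrow> nat \<Rightarrow> real"
    and L :: "real \<Rightarrow> real \<Rightarrow> real"
    and F :: "real ^ 'k::finite \<Rightarrow> real"
    and \<eta> :: "real ^ 'm::finite \<Rightarrow> real \<Rightarrow> real"
    and r :: "nat \<Rightarrow> ('k \<Rightarrow> rvec) \<Rightarrow> real"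
    and Ts :: "nat \<Rightarrow> 'm \<Rightarrow> rvec"
    and C S :: "nat \<Rightarrow> rvec set"
    and R :: real
  assumes prob: "\<forall>n>0. prob_space (M n)"
    and x_law: "\<forall>n>0. law_on (p n) (Px n)"
    and g_law: "\<forall>n>0. gaussian_law (p n) (mu n) (Sg n) (Pg n)"
    and x_sample: "\<forall>n>0. regression_sample (M n) n (Px n) (Q n) (X n) (e n)"
    and g_sample: "\<forall>n>0. regression_sample (M n) n (Pg n) (Q n) (G n) (e n)"
    and L_nonneg: "\<forall>a b. 0 \<le> L a b"
    and \<eta>_measurable: "(\<lambda>(v, s). \<eta> v s) \<in> borel_measurable borel"
    and domain: "domain_of_gaussianity p Px Pg S"
    and regime: "proportional_regime p"
    and constraint: "constraint_sets p R C Ts"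
    and penalty: "penalty p r"
    and subgaussian: "restricted_subgaussian p R Px mu Sg S"
    and C_subset: "\<forall>n>0. C n \<subseteq> S n"
    and Ts_in: "\<forall>n>0. \<forall>j. Ts n j \<in> S n"
begin

definition lf :: "nat \<Rightarrow> ('k \<Rightarrow> rvec) \<Rightarrow> rvec \<times> real \<Rightarrow> real" where
  "lf n T z = loss L F \<eta> (transp_mult (p n) T (fst z), transp_mult (p n) (Ts n) (fst z)) (snd z)"

definition feature_law :: "bool \<Rightarrow> nat \<Rightarrow> rvec measure" where
  "feature_law b n = (if b then Px n else Pg n)"

definition D :: "bool \<Rightarrow> nat \<Rightarrow> (rvec \<times> real) measure" where
  "D b n = feature_law b n \<Otimes>\<^sub>M Q n"

definition feature :: "bool \<Rightarrow> nat \<Rightarrow> nat \<Rightarrow> 'w \<Rightarrow> rvec" where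
  "feature b n = (if b then X n else G n)"

lemma sample: "n > 0 \<Longrightarrow> regression_sample (M n) n (feature_law b n) (Q n) (feature b n) (e n)"
  using x_sample g_sample by (simp add: feature_law_def feature_def)

lemma feature_law_props:
  assumes "n > 0"
  shows prob_feature_law: "prob_space (feature_law b n)"
    and sets_feature_law: "sets (feature_law b n) = sets borel"
  using x_law g_law assms by (auto simp: feature_law_def law_on_def gaussian_law_def)

text \<open>\<open>Q n\<close> is the law of the noise variable with index 0, which belongs to the
  sample because \<open>n > 0\<close>.\<close>

lemma noise_law_props:
  assumes n: "n > 0"
  shows prob_Q: "prob_space (Q n)" and sets_Q: "sets (Q n) = sets borel"
proof -
  interpret prob_space "M n" using prob n by blast
  have iid: "iid_sample (M n) n (Q n) (e n)" using sample[OF n, of True] by (simp add: regression_sample_def)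
  then have "e n 0 \<in> borel_measurable (M n)" "distr (M n) borel (e n 0) = Q n"
    using n by (auto simp: iid_sample_def indep_vars_def2)
  then show "prob_space (Q n)" "sets (Q n) = sets borel"
    using prob_space_distr[of "e n 0" borel] sets_distr[of "M n" borel "e n 0"] by auto
qed

lemma S_props:
  assumes n: "n > 0"
  shows S_sub: "S n \<subseteq> Rvec (p n)" and S_sym: "symmetric_convex (S n)" and S_ne: "S n \<noteq> {}"
    and S_norm: "u \<in> S n \<Longrightarrow> norm2 (p n) u \<le> R"
proof -
  show "S n \<subseteq> Rvec (p n)" "symmetric_convex (S n)" using domain n by (auto simp: domain_of_gaussianity_def)
  \<comment> \<open>The index type of the columns of \<open>Ts n\<close> is nonempty.\<close>
  show "S n \<noteq> {}" using Ts_in n by blast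
  show "norm2 (p n) u \<le> R" if "u \<in> S n" using subgaussian n that by (auto simp: restricted_subgaussian_def)
qed

lemma prob_D: "n > 0 \<Longrightarrow> prob_space (D b n)"
  unfolding D_def by (intro prob_space_pair prob_feature_law prob_Q)

lemma sets_D:
  assumes n: "n > 0" shows "sets (D b n) = sets borel"
proof -
  have "sets (D b n) = sets ((borel :: rvec measure) \<Otimes>\<^sub>M (borel :: real measure))"
    unfolding D_def by (intro sets_pair_measure_cong sets_feature_law sets_Q n)
  then show ?thesis unfolding borel_prod .
qed

lemma meas_D: "n > 0 \<Longrightarrow> f \<in> borel_measurable borel \<Longrightarrow> f \<in> borel_measurable (D b n)"
  using measurable_cong_sets[OF sets_D refl] by blast

lemma meas_feature_law: "n > 0 \<Longrightarrow> f \<in> borel_measurable borel \<Longrightarrow> f \<in> borel_measurable (feature_law b n)"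
  using measurable_cong_sets[OF sets_feature_law refl] by blast

lemma meas_Q: "n > 0 \<Longrightarrow> f \<in> borel_measurable borel \<Longrightarrow> f \<in> borel_measurable (Q n)"
  using measurable_cong_sets[OF sets_Q refl] by blast

lemma nn_integral_D_fst:
  assumes n: "n > 0" and f: "f \<in> borel_measurable borel"
  shows "(\<integral>\<^sup>+z. f (fst z) \<partial>D b n) = (\<integral>\<^sup>+x. f x \<partial>feature_law b n)"
proof -
  interpret A: prob_space "feature_law b n" by (rule prob_feature_law[OF n])
  interpret B: prob_space "Q n" by (rule prob_Q[OF n])
  interpret pair_prob_space "feature_law b n" "Q n" ..
  have [measurable]: "f \<in> borel_measurable (feature_law b n)" using f by (rule meas_feature_law[OF n])
  show ?thesis unfolding D_def by (subst B.nn_integral_fst[symmetric]) (auto simp: B.emeasure_space_1)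
qed

lemma nn_integral_D_snd:
  assumes n: "n > 0" and f: "f \<in> borel_measurable borel"
  shows "(\<integral>\<^sup>+z. f (snd z) \<partial>D b n) = (\<integral>\<^sup>+s. f s \<partial>Q n)"
proof -
  interpret A: prob_space "feature_law b n" by (rule prob_feature_law[OF n])
  interpret B: prob_space "Q n" by (rule prob_Q[OF n])
  interpret pair_prob_space "feature_law b n" "Q n" ..
  have [measurable]: "f \<in> borel_measurable (Q n)" using f by (rule meas_Q[OF n])
  show ?thesis unfolding D_def by (subst B.nn_integral_fst[symmetric]) (auto simp: A.emeasure_space_1)
qed

lemma dotp_borel [measurable]: "dotp q u \<in> borel_measurable borel"
  unfolding dotp_def[abs_def] by measurable

text \<open>The hypothesis concerns points of \<open>S\<close> in the unit ball. Since
  \<open>S\<close> is absolutely convex, every point can be scaled into that ball without leaving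
  \<open>S\<close>, and the factor \<open>R'\<close> reappears in the exponent. In the Gaussian
  model a linear form is normal, and its mean and variance are bounded by \<open>R' * K\<close> and
  its square.\<close>

lemma exp_moment_features:
  obtains c where "c \<ge> 1" "\<And>b n u. n > 0 \<Longrightarrow> u \<in> S n \<Longrightarrow>
    (\<integral>\<^sup>+z. ennreal (exp \<bar>dotp (p n) u (fst z)\<bar>) \<partial>D b n) \<le> ennreal c"
proof -
  from subgaussian[unfolded restricted_subgaussian_def, THEN conjunct2] obtain K where
    Kall: "\<forall>n>0. (\<forall>u\<in>S n. norm2 (p n) u \<le> 1 \<longrightarrow> subgaussian_norm (Px n) (\<lambda>v. dotp (p n) v u) \<le> ennreal K) \<and>
        (\<exists>A. psd_sqrt (p n) (Sg n) A \<and>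
             (\<forall>u\<in>S n. norm2 (p n) u \<le> 1 \<longrightarrow> norm2 (p n) (mat_apply (p n) A u) \<le> K)) \<and>
        norm2 (p n) (mu n) \<le> K" by (rule exE)
  have K: "n > 0 \<Longrightarrow> \<forall>u\<in>S n. norm2 (p n) u \<le> 1 \<longrightarrow> subgaussian_norm (Px n) (\<lambda>v. dotp (p n) v u) \<le> ennreal K"
    "n > 0 \<Longrightarrow> \<exists>A. psd_sqrt (p n) (Sg n) A \<and>
             (\<forall>u\<in>S n. norm2 (p n) u \<le> 1 \<longrightarrow> norm2 (p n) (mat_apply (p n) A u) \<le> K)"
    "n > 0 \<Longrightarrow> norm2 (p n) (mu n) \<le> K" for n
    using Kall by simp_all
  \<comment> \<open>At least 1, so that division by \<open>R'\<close> is a contraction.\<close>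
  define R' where "R' = max R 1"
  have R': "R' \<ge> 1" "R \<le> R'" by (auto simp: R'_def)
  have K0: "K \<ge> 0" using K(3)[of 1] norm2_nonneg[of "p 1" "mu 1"] by linarith
  have scaled: "(\<lambda>i. (1 / R') * u i) \<in> S n" "norm2 (p n) (\<lambda>i. (1 / R') * u i) \<le> 1" if n: "n > 0" and u: "u \<in> S n" for n u
  proof -
    have "(\<lambda>i. (1 / R') * u i + 0 * u i) \<in> S n"
      using R' by (intro symmetric_convex_comb[OF S_sym[OF n] u u]) auto
    then show "(\<lambda>i. (1 / R') * u i) \<in> S n" by simp
    have "norm2 (p n) u \<le> R'" using S_norm[OF n u] R' by linarith
    then show "norm2 (p n) (\<lambda>i. (1 / R') * u i) \<le> 1"
      using R' by (simp only: norm2_scale) (simp add: divide_le_eq)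
  qed
  define c1 where "c1 = 2 * exp (R'\<^sup>2 * (max K 0 + 1)\<^sup>2 / 4)"
  define c2 where "c2 = 2 * exp (R' * K + (R' * K)\<^sup>2 / 2)"
  have "c1 \<ge> 2" unfolding c1_def by (simp add: divide_nonneg_pos)
  then have c: "max c1 c2 \<ge> 1" by simp
  have x: "(\<integral>\<^sup>+x. ennreal (exp \<bar>dotp (p n) u x\<bar>) \<partial>Px n) \<le> ennreal c1" if n: "n > 0" and u: "u \<in> S n" for n u
  proof -
    let ?u = "\<lambda>i. (1 / R') * u i"
    have m: "(\<lambda>v. dotp (p n) v ?u) \<in> borel_measurable (Px n)"
    proof -
      have "(\<lambda>v. dotp (p n) v ?u) = dotp (p n) ?u" by (rule ext) (rule dotp_commute)
      then show ?thesis
        using meas_feature_law[OF n dotp_borel[of "p n" ?u], of True] by (simp only: feature_law_def if_True)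
    qed
    have "(\<integral>\<^sup>+x. ennreal (exp (R' * \<bar>dotp (p n) x ?u\<bar>)) \<partial>Px n) \<le> ennreal c1"
      unfolding c1_def using R' by (intro subgaussian_exp_moment K(1)[OF n, rule_format, OF scaled[OF n u]] m) auto
    moreover have "R' * \<bar>dotp (p n) x ?u\<bar> = \<bar>dotp (p n) u x\<bar>" for x
      unfolding dotp_commute[of _ x] dotp_scale abs_mult using R' by simp
    ultimately show ?thesis by simp
  qed
  have g: "(\<integral>\<^sup>+x. ennreal (exp \<bar>dotp (p n) u x\<bar>) \<partial>Pg n) \<le> ennreal c2" if n: "n > 0" and u: "u \<in> S n" for n u
  proof -
    have gl: "gaussian_law (p n) (mu n) (Sg n) (Pg n)" using g_law n by blast
    from K(2)[OF n] obtain A where A: "psd_sqrt (p n) (Sg n) A"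
      "\<forall>u\<in>S n. norm2 (p n) u \<le> 1 \<longrightarrow> norm2 (p n) (mat_apply (p n) A u) \<le> K"
      by (elim exE conjE)
    let ?m = "dotp (p n) u (mu n)" and ?s = "dotp (p n) u (mat_apply (p n) (Sg n) u)"
    have ms: "(\<lambda>x. dotp (p n) u x) \<in> borel_measurable (Pg n)"
      using meas_feature_law[OF n dotp_borel[of "p n" u], of False] by (simp add: feature_law_def)
    have law: "distr (Pg n) borel (dotp (p n) u) = normal_law ?m ?s"
      using gl u S_sub[OF n] by (auto simp: gaussian_law_def)
    \<comment> \<open>\<open>Sg n\<close> is the square of the symmetric matrix \<open>A\<close>, so
      the variance is the squared norm of \<open>A u\<close>, the quantity bounded by the
      hypothesis.\<close>
    have s_eq: "?s = (norm2 (p n) (mat_apply (p n) A u))\<^sup>2"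
    proof -
      have sym: "A l i = A i l" if "i < p n" "l < p n" for i l
        using A(1) that by (simp add: psd_sqrt_def sym_psd_def)
      have "?s = (\<Sum>i<p n. u i * (\<Sum>j<p n. (\<Sum>l<p n. A i l * A l j) * u j))"
        using A(1) by (simp add: dotp_def mat_apply_def psd_sqrt_def)
      also have "\<dots> = (\<Sum>i<p n. \<Sum>j<p n. \<Sum>l<p n. (A l i * u i) * (A l j * u j))"
        using sym by (simp add: sum_distrib_left sum_distrib_right mult_ac)
      also have "\<dots> = (\<Sum>i<p n. \<Sum>l<p n. \<Sum>j<p n. (A l i * u i) * (A l j * u j))"
        by (intro sum.cong refl sum.swap)
      also have "\<dots> = (\<Sum>l<p n. \<Sum>i<p n. \<Sum>j<p n. (A l i * u i) * (A l j * u j))"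
        by (rule sum.swap)
      also have "\<dots> = (\<Sum>l<p n. (\<Sum>j<p n. A l j * u j)\<^sup>2)"
        by (simp add: power2_eq_square sum_product)
      also have "\<dots> = (norm2 (p n) (mat_apply (p n) A u))\<^sup>2"
        by (simp add: norm2_def L2_set_def mat_apply_def sum_nonneg)
      finally show ?thesis .
    qed
    have "norm2 (p n) (mat_apply (p n) A (\<lambda>i. (1 / R') * u i)) \<le> K" by (rule A(2)[rule_format, OF scaled[OF n u]])
    moreover have "mat_apply (p n) A (\<lambda>i. (1 / R') * u i) = (\<lambda>i. (1 / R') * mat_apply (p n) A u i)"
      by (rule ext) (simp add: mat_apply_def sum_divide_distrib)
    ultimately have "(1 / R') * norm2 (p n) (mat_apply (p n) A u) \<le> K"
      using R' by (simp only: norm2_scale) simp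
    then have "norm2 (p n) (mat_apply (p n) A u) \<le> R' * K" using R' by (simp add: divide_le_eq mult.commute)
    then have s: "0 \<le> ?s" "?s \<le> (R' * K)\<^sup>2" unfolding s_eq using norm2_nonneg by (auto intro!: power_mono)
    have "\<bar>?m\<bar> \<le> (\<Sum>i<p n. \<bar>u i\<bar> * \<bar>mu n i\<bar>)"
      unfolding dotp_def by (rule order_trans[OF sum_abs]) (simp add: abs_mult)
    also have "\<dots> \<le> norm2 (p n) u * norm2 (p n) (mu n)" unfolding norm2_def by (rule L2_set_mult_ineq)
    also have "\<dots> \<le> R' * K"
      using S_norm[OF n u] R' K(3)[OF n] norm2_nonneg by (intro mult_mono) (auto intro: order_trans)
    finally have m: "\<bar>?m\<bar> \<le> R' * K" .
    have "(\<integral>\<^sup>+x. ennreal (exp \<bar>dotp (p n) u x\<bar>) \<partial>Pg n) = (\<integral>\<^sup>+y. ennreal (exp \<bar>y\<bar>) \<partial>distr (Pg n) borel (dotp (p n) u))"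
      using ms by (subst nn_integral_distr) auto
    also have "\<dots> \<le> ennreal (2 * exp (\<bar>?m\<bar> + ?s / 2))" unfolding law by (rule normal_law_exp_moment[OF s(1)])
    also have "\<dots> \<le> ennreal c2" unfolding c2_def using m s by (intro ennreal_leI) auto
    finally show ?thesis .
  qed
  show ?thesis
  proof (rule that[OF c])
    fix b n u assume n: "n > (0::nat)" and u: "u \<in> S n"
    have "(\<integral>\<^sup>+z. ennreal (exp \<bar>dotp (p n) u (fst z)\<bar>) \<partial>D b n) = (\<integral>\<^sup>+x. ennreal (exp \<bar>dotp (p n) u x\<bar>) \<partial>feature_law b n)"
      by (rule nn_integral_D_fst[OF n]) measurable
    also have "\<dots> \<le> ennreal (max c1 c2)"
    proof -
      have "ennreal c1 \<le> ennreal (max c1 c2)" "ennreal c2 \<le> ennreal (max c1 c2)" by (rule ennreal_leI; simp)+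
      then show ?thesis
        using order_trans[OF x[OF n u]] order_trans[OF g[OF n u]] by (cases b) (simp_all add: feature_law_def)
    qed
    finally show "(\<integral>\<^sup>+z. ennreal (exp \<bar>dotp (p n) u (fst z)\<bar>) \<partial>D b n) \<le> ennreal (max c1 c2)" .
  qed
qed

text \<open>The addition formula separates feature and noise, and by independence the integrals
  factor. The noise integrals have modulus at most 1 and are common to both models, so the estimate
  is uniform in \<open>c\<close> and \<open>b\<close>; the cosine and sine of \<open>a\<close> times
  a linear form are bounded Lipschitz functions of it.\<close>

lemma cosine_close:
  assumes d: "d > 0"
  shows "\<forall>\<^sub>F n in sequentially. \<forall>u\<in>S n. \<forall>c b.
    \<bar>(\<integral>z. cos (a * dotp (p n) u (fst z) + c * snd z + b) \<partial>D True n) -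
     (\<integral>z. cos (a * dotp (p n) u (fst z) + c * snd z + b) \<partial>D False n)\<bar> \<le> d"
proof -
  have conv: "\<forall>\<^sub>F n in sequentially. \<forall>u\<in>S n.
      \<bar>(\<integral>x. \<phi> (dotp (p n) u x) \<partial>Pg n) - (\<integral>x. \<phi> (dotp (p n) u x) \<partial>Px n)\<bar> \<le> d / 2"
    if \<phi>: "\<And>y. \<bar>\<phi> y\<bar> \<le> 1" "K-lipschitz_on UNIV \<phi>" for \<phi> :: "real \<Rightarrow> real" and K
  proof -
    let ?s = "\<lambda>n u. \<bar>(\<integral>x. \<phi> (dotp (p n) u x) \<partial>Pg n) - (\<integral>x. \<phi> (dotp (p n) u x) \<partial>Px n)\<bar>"
    have "bounded (range \<phi>)" using \<phi>(1) by (auto simp: bounded_iff)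
    then have "(\<lambda>n. SUP u\<in>S n. ?s n u) \<longlonglongrightarrow> 0"
      using domain \<phi>(2) unfolding domain_of_gaussianity_def by blast
    from order_tendstoD(2)[OF this, of "d / 2"] d eventually_gt_at_top[of 0]
    have "\<forall>\<^sub>F n in sequentially. (SUP u\<in>S n. ?s n u) < d / 2 \<and> n > 0" by (simp add: eventually_conj_iff)
    then show ?thesis
    proof (rule eventually_mono, intro ballI)
      fix n u assume n: "(SUP u\<in>S n. ?s n u) < d / 2 \<and> n > 0" and u: "u \<in> S n"
      have b: "\<bar>\<integral>x. \<phi> (dotp (p n) u x) \<partial>P\<bar> \<le> 1" if P: "prob_space P" for P u
      proof -
        interpret prob_space P by fact
        have "\<bar>\<integral>x. \<phi> (dotp (p n) u x) \<partial>P\<bar> \<le> (\<integral>x. \<bar>\<phi> (dotp (p n) u x)\<bar> \<partial>P)" by (rule integral_abs_bound)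
        also have "\<dots> \<le> 1"
          using \<phi>(1) by (cases "integrable P (\<lambda>x. \<bar>\<phi> (dotp (p n) u x)\<bar>)")
            (auto intro!: integral_le_const simp: not_integrable_integral_eq)
        finally show ?thesis .
      qed
      have pr: "prob_space (Pg n)" "prob_space (Px n)"
        using prob_feature_law[of n False] prob_feature_law[of n True] n by (auto simp: feature_law_def)
      have "?s n u \<le> 2" for u using b[OF pr(1), of u] b[OF pr(2), of u] by linarith
      \<comment> \<open>A supremum of reals bounds its members only if they are bounded
        above.\<close>
      then have "bdd_above (?s n ` S n)" by (intro bdd_aboveI[of _ 2]) auto
      then have "?s n u \<le> (SUP u\<in>S n. ?s n u)" by (rule cSUP_upper[OF u])
      then show "?s n u \<le> d / 2" using n by linarith
    qed
  qed
  have lc: "\<bar>a\<bar>-lipschitz_on UNIV (\<lambda>y::real. cos (a * y))"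
  proof (rule lipschitz_onI)
    fix x y :: real
    have "\<bar>cos (a * x) - cos (a * y)\<bar> \<le> \<bar>a\<bar> * \<bar>x - y\<bar>"
    proof -
      have d: "((\<lambda>y. cos (a * y)) has_field_derivative (- (sin (a * z)) * a)) (at z within UNIV)" for z
        by (auto intro!: derivative_eq_intros)
      have b: "norm (- (sin (a * z)) * a) \<le> \<bar>a\<bar>" for z
        by (simp add: abs_mult mult_left_le_one_le)
      show ?thesis using field_differentiable_bound[OF convex_UNIV d b, of x y] by simp
    qed
    then show "dist (cos (a * x)) (cos (a * y)) \<le> \<bar>a\<bar> * dist x y" by (simp add: dist_real_def)
  qed simp
  have ls: "\<bar>a\<bar>-lipschitz_on UNIV (\<lambda>y::real. sin (a * y))"
  proof (rule lipschitz_onI)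
    fix x y :: real
    have "\<bar>sin (a * x) - sin (a * y)\<bar> \<le> \<bar>a\<bar> * \<bar>x - y\<bar>"
    proof -
      have d: "((\<lambda>y. sin (a * y)) has_field_derivative (cos (a * z) * a)) (at z within UNIV)" for z
        by (auto intro!: derivative_eq_intros)
      have b: "norm (cos (a * z) * a) \<le> \<bar>a\<bar>" for z
        by (simp add: abs_mult mult_left_le_one_le)
      show ?thesis using field_differentiable_bound[OF convex_UNIV d b, of x y] by simp
    qed
    then show "dist (sin (a * x)) (sin (a * y)) \<le> \<bar>a\<bar> * dist x y" by (simp add: dist_real_def)
  qed simp
  have split: "(\<integral>z. cos (a * dotp (p n) u (fst z) + c * snd z + b) \<partial>D b' n) =
      (\<integral>x. cos (a * dotp (p n) u x) \<partial>feature_law b' n) * (\<integral>s. cos (c * s + b) \<partial>Q n) -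
      (\<integral>x. sin (a * dotp (p n) u x) \<partial>feature_law b' n) * (\<integral>s. sin (c * s + b) \<partial>Q n)"
    if n: "n > 0" for n u c b b'
  proof -
    interpret A: prob_space "feature_law b' n" by (rule prob_feature_law[OF n])
    interpret B: prob_space "Q n" by (rule prob_Q[OF n])
    interpret pair_prob_space "feature_law b' n" "Q n" ..
    have [measurable]: "dotp (p n) u \<in> borel_measurable (feature_law b' n)"
      by (rule meas_feature_law[OF n dotp_borel])
    have [measurable]: "(\<lambda>s. s) \<in> borel_measurable (Q n)" by (rule meas_Q[OF n]) simp
    have iQ: "integrable (Q n) (\<lambda>s. cos (c * s + b))" "integrable (Q n) (\<lambda>s. sin (c * s + b))"
      by (rule B.integrable_const_bound[where B=1]; simp)+
    have iA: "integrable (feature_law b' n) (\<lambda>x. cos (a * dotp (p n) u x))" "integrable (feature_law b' n) (\<lambda>x. sin (a * dotp (p n) u x))"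
      by (rule A.integrable_const_bound[where B=1]; simp)+
    have "integrable (feature_law b' n \<Otimes>\<^sub>M Q n) (\<lambda>z. cos (a * dotp (p n) u (fst z) + c * snd z + b))"
      by (rule integrable_const_bound[where B=1]) auto
    then have "(\<integral>z. cos (a * dotp (p n) u (fst z) + c * snd z + b) \<partial>D b' n) =
      (\<integral>x. (\<integral>s. cos (a * dotp (p n) u x + c * s + b) \<partial>Q n) \<partial>feature_law b' n)"
      using integral_fst'[of "\<lambda>z. cos (a * dotp (p n) u (fst z) + c * snd z + b)"] by (simp add: D_def)
    also have "\<dots> = (\<integral>x. cos (a * dotp (p n) u x) * (\<integral>s. cos (c * s + b) \<partial>Q n) -
        sin (a * dotp (p n) u x) * (\<integral>s. sin (c * s + b) \<partial>Q n) \<partial>feature_law b' n)"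
    proof (rule Bochner_Integration.integral_cong[OF refl])
      fix x
      have "(\<integral>s. cos (a * dotp (p n) u x + c * s + b) \<partial>Q n) =
          (\<integral>s. cos (a * dotp (p n) u x) * cos (c * s + b) - sin (a * dotp (p n) u x) * sin (c * s + b) \<partial>Q n)"
        by (simp add: add.assoc cos_add)
      then show "(\<integral>s. cos (a * dotp (p n) u x + c * s + b) \<partial>Q n) = cos (a * dotp (p n) u x) * (\<integral>s. cos (c * s + b) \<partial>Q n) -
        sin (a * dotp (p n) u x) * (\<integral>s. sin (c * s + b) \<partial>Q n)"
        using iQ by simp
    qed
    finally show ?thesis using iA by simp
  qed
  note cc = conv[of "\<lambda>y. cos (a * y)", OF abs_cos_le_one lc] and ss = conv[of "\<lambda>y. sin (a * y)", OF abs_sin_le_one ls]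
  from cc ss eventually_gt_at_top[of 0]
  show ?thesis
  proof (eventually_elim, intro ballI allI)
    fix n u c b
    assume h: "\<forall>u\<in>S n. \<bar>(\<integral>x. cos (a * dotp (p n) u x) \<partial>Pg n) - (\<integral>x. cos (a * dotp (p n) u x) \<partial>Px n)\<bar> \<le> d / 2"
      "\<forall>u\<in>S n. \<bar>(\<integral>x. sin (a * dotp (p n) u x) \<partial>Pg n) - (\<integral>x. sin (a * dotp (p n) u x) \<partial>Px n)\<bar> \<le> d / 2"
      and n: "0 < n" and u: "u \<in> S n"
    interpret B: prob_space "Q n" by (rule prob_Q[OF n])
    have bd: "\<bar>\<integral>s. f s \<partial>Q n\<bar> \<le> 1" if "\<And>s. \<bar>f s\<bar> \<le> 1" for f :: "real \<Rightarrow> real"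
    proof -
      have "\<bar>\<integral>s. f s \<partial>Q n\<bar> \<le> (\<integral>s. \<bar>f s\<bar> \<partial>Q n)" by (rule integral_abs_bound)
      also have "\<dots> \<le> 1"
        using that by (cases "integrable (Q n) (\<lambda>s. \<bar>f s\<bar>)") (auto intro!: B.integral_le_const simp: not_integrable_integral_eq)
      finally show ?thesis .
    qed
    define A1 A2 B1 B2 \<alpha> \<gamma> where
      "A1 = (\<integral>x. cos (a * dotp (p n) u x) \<partial>Px n)" "A2 = (\<integral>x. cos (a * dotp (p n) u x) \<partial>Pg n)"
      "B1 = (\<integral>x. sin (a * dotp (p n) u x) \<partial>Px n)" "B2 = (\<integral>x. sin (a * dotp (p n) u x) \<partial>Pg n)"
      "\<alpha> = (\<integral>s. cos (c * s + b) \<partial>Q n)" "\<gamma> = (\<integral>s. sin (c * s + b) \<partial>Q n)"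
    have ab: "\<bar>\<alpha>\<bar> \<le> 1" "\<bar>\<gamma>\<bar> \<le> 1" unfolding A1_A2_B1_B2_\<alpha>_\<gamma>_def by (rule bd; simp)+
    have dd: "\<bar>A1 - A2\<bar> \<le> d / 2" "\<bar>B1 - B2\<bar> \<le> d / 2"
      unfolding A1_A2_B1_B2_\<alpha>_\<gamma>_def using h u by (auto simp: abs_minus_commute)
    have "\<bar>(A1 * \<alpha> - B1 * \<gamma>) - (A2 * \<alpha> - B2 * \<gamma>)\<bar> = \<bar>(A1 - A2) * \<alpha> - (B1 - B2) * \<gamma>\<bar>" by (simp add: algebra_simps)
    also have "\<dots> \<le> \<bar>A1 - A2\<bar> * \<bar>\<alpha>\<bar> + \<bar>B1 - B2\<bar> * \<bar>\<gamma>\<bar>" unfolding abs_mult[symmetric] by (rule abs_triangle_ineq4)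
    also have "\<dots> \<le> d / 2 * 1 + d / 2 * 1" using ab dd d by (intro add_mono mult_mono) auto
    finally show "\<bar>(\<integral>z. cos (a * dotp (p n) u (fst z) + c * snd z + b) \<partial>D True n) -
     (\<integral>z. cos (a * dotp (p n) u (fst z) + c * snd z + b) \<partial>D False n)\<bar> \<le> d"
      unfolding split[OF n] by (simp add: feature_law_def A1_A2_B1_B2_\<alpha>_\<gamma>_def)
  qed
qed

end

text \<open>Conditions on finitely many rows are cylinder events of the whole sample, the form in
  which independence of features and noise is given.\<close>

lemma (in prob_space) sample_algebra_memI:
  fixes Y :: "nat \<Rightarrow> 'a \<Rightarrow> 'b::topological_space"
  assumes J: "J \<subseteq> {..<n}" "finite J" and A: "\<And>j. j \<in> J \<Longrightarrow> A j \<in> sets borel"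
    and Y: "\<And>i. i < n \<Longrightarrow> Y i \<in> borel_measurable M"
  shows "{\<omega> \<in> space M. \<forall>j\<in>J. Y j \<omega> \<in> A j} \<in> sets (sample_algebra M n Y)"
proof -
  let ?f = "\<lambda>\<omega>. \<lambda>i\<in>{..<n}. Y i \<omega>"
  let ?P = "\<Pi>\<^sub>M i\<in>{..<n}. (borel :: 'b measure)"
  have "{x \<in> space ?P. \<forall>j\<in>J. x j \<in> A j} = (\<Pi>\<^sub>E i\<in>{..<n}. if i \<in> J then A i else UNIV)"
    using J(1) by (auto simp: space_PiM PiE_def Pi_def extensional_def split: if_splits)
  also have "\<dots> \<in> sets ?P" using A by (intro sets_PiM_I_finite) auto
  finally have m: "{x \<in> space ?P. \<forall>j\<in>J. x j \<in> A j} \<in> sets ?P" .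
  have eq: "{\<omega> \<in> space M. \<forall>j\<in>J. Y j \<omega> \<in> A j} = ?f -` {x \<in> space ?P. \<forall>j\<in>J. x j \<in> A j} \<inter> space M"
    using J(1) by (auto simp: space_PiM subset_eq)
  show ?thesis unfolding sample_algebra_def eq by (rule in_vimage_algebra[OF m])
qed

lemma (in prob_space) indep_vars_prob_all:
  assumes "indep_vars (\<lambda>_. borel) Y I" "finite J" "J \<subseteq> I" "\<And>j. j \<in> J \<Longrightarrow> A j \<in> sets borel"
  shows "prob {\<omega> \<in> space M. \<forall>j\<in>J. Y j \<omega> \<in> A j} = (\<Prod>j\<in>J. prob (Y j -` A j \<inter> space M))"
proof (cases "J = {}")
  case False
  have ind: "indep_sets (\<lambda>i. {Y i -` A \<inter> space M |A. A \<in> sets borel}) I"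
    using assms(1) by (simp add: indep_vars_def2)
  have "prob (\<Inter>j\<in>J. Y j -` A j \<inter> space M) = (\<Prod>j\<in>J. prob (Y j -` A j \<inter> space M))"
    by (rule indep_setsD[OF ind assms(3) False assms(2)]) (use assms(4) in blast)
  moreover have "(\<Inter>j\<in>J. Y j -` A j \<inter> space M) = {\<omega> \<in> space M. \<forall>j\<in>J. Y j \<omega> \<in> A j}" using False by auto
  ultimately show ?thesis by simp
qed (simp add: prob_space)

text \<open>It suffices to test independence on the stable generator of measurable rectangles.\<close>
lemma (in prob_space) iid_pairs:
  fixes Y :: "nat \<Rightarrow> 'a \<Rightarrow> rvec" and s :: "nat \<Rightarrow> 'a \<Rightarrow> real"
  assumes reg: "regression_sample M n P Q Y s"
  shows "indep_vars (\<lambda>_. borel) (\<lambda>i \<omega>. (Y i \<omega>, s i \<omega>)) {..<n}"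
    and "\<And>i. i < n \<Longrightarrow> distr M borel (\<lambda>\<omega>. (Y i \<omega>, s i \<omega>)) = P \<Otimes>\<^sub>M Q"
proof -
  have Yi: "indep_vars (\<lambda>_. borel) Y {..<n}" and si: "indep_vars (\<lambda>_. borel) s {..<n}"
    and Yd: "\<And>i. i < n \<Longrightarrow> distr M borel (Y i) = P" and sd: "\<And>i. i < n \<Longrightarrow> distr M borel (s i) = Q"
    and ind: "indep_set (sets (sample_algebra M n Y)) (sets (sample_algebra M n s))"
    using reg by (auto simp: regression_sample_def iid_sample_def)
  have Ym: "Y i \<in> borel_measurable M" and sm: "s i \<in> borel_measurable M" if "i < n" for i
    using Yi si that by (auto simp: indep_vars_def2)
  let ?Z = "\<lambda>i \<omega>. (Y i \<omega>, s i \<omega>)"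
  have Zm: "?Z i \<in> measurable M (borel \<Otimes>\<^sub>M borel)" if "i < n" for i
    using Ym[OF that] sm[OF that] by (rule measurable_Pair)
  \<comment> \<open>The event is an intersection of one about the features and one about the noise.
    Independence of the two samples separates them, and independence within each sample factors them
    further.\<close>
  have rect: "prob {\<omega> \<in> space M. \<forall>j\<in>J. Y j \<omega> \<in> A j \<and> s j \<omega> \<in> B j} =
      (\<Prod>j\<in>J. prob (Y j -` A j \<inter> space M) * prob (s j -` B j \<inter> space M))"
    if J: "J \<subseteq> {..<n}" and A: "\<And>j. j \<in> J \<Longrightarrow> A j \<in> sets borel" and B: "\<And>j. j \<in> J \<Longrightarrow> B j \<in> sets borel" for J A B
  proof -
    have fin: "finite J" using J finite_subset by blast
    have a: "{\<omega> \<in> space M. \<forall>j\<in>J. Y j \<omega> \<in> A j} \<in> sets (sample_algebra M n Y)"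
      using A Ym by (intro sample_algebra_memI[OF J fin]) auto
    have b: "{\<omega> \<in> space M. \<forall>j\<in>J. s j \<omega> \<in> B j} \<in> sets (sample_algebra M n s)"
      using B sm by (intro sample_algebra_memI[OF J fin]) auto
    have "{\<omega> \<in> space M. \<forall>j\<in>J. Y j \<omega> \<in> A j \<and> s j \<omega> \<in> B j} =
      {\<omega> \<in> space M. \<forall>j\<in>J. Y j \<omega> \<in> A j} \<inter> {\<omega> \<in> space M. \<forall>j\<in>J. s j \<omega> \<in> B j}" by auto
    then have "prob {\<omega> \<in> space M. \<forall>j\<in>J. Y j \<omega> \<in> A j \<and> s j \<omega> \<in> B j} =
      prob {\<omega> \<in> space M. \<forall>j\<in>J. Y j \<omega> \<in> A j} * prob {\<omega> \<in> space M. \<forall>j\<in>J. s j \<omega> \<in> B j}"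
      using indep_setD[OF ind a b] by simp
    then show ?thesis
      using indep_vars_prob_all[OF Yi fin J A] indep_vars_prob_all[OF si fin J B] by (simp add: prod.distrib)
  qed
  have one: "prob (?Z j -` (A \<times> B) \<inter> space M) = prob (Y j -` A \<inter> space M) * prob (s j -` B \<inter> space M)"
    if "j < n" "A \<in> sets borel" "B \<in> sets borel" for j A B
  proof -
    have "?Z j -` (A \<times> B) \<inter> space M = {\<omega> \<in> space M. \<forall>i\<in>{j}. Y i \<omega> \<in> A \<and> s i \<omega> \<in> B}" by auto
    then show ?thesis using rect[of "{j}" "\<lambda>_. A" "\<lambda>_. B"] that by simp
  qed
  let ?G = "\<lambda>i. {?Z i -` (A \<times> B) \<inter> space M | A B. A \<in> sets borel \<and> B \<in> sets borel}"
  have Gev: "?G i \<subseteq> events" if "i < n" for i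
    using measurable_sets[OF Zm[OF that]] by auto
  have "indep_sets ?G {..<n}"
  proof (rule indep_setsI)
    show "?G i \<subseteq> events" if "i \<in> {..<n}" for i using Gev that by simp
    fix E J assume J: "J \<noteq> {}" "J \<subseteq> {..<n}" "finite J" and E: "\<forall>j\<in>J. E j \<in> ?G j"
    from E have "\<forall>j\<in>J. \<exists>AB. E j = ?Z j -` (fst AB \<times> snd AB) \<inter> space M \<and> fst AB \<in> sets borel \<and> snd AB \<in> sets borel"
      by force
    from bchoice[OF this] obtain AB where AB: "\<forall>j\<in>J. E j = ?Z j -` (fst (AB j) \<times> snd (AB j)) \<inter> space M \<and>
        fst (AB j) \<in> sets borel \<and> snd (AB j) \<in> sets borel" by (rule exE)
    have "(\<Inter>j\<in>J. E j) = {\<omega> \<in> space M. \<forall>j\<in>J. Y j \<omega> \<in> fst (AB j) \<and> s j \<omega> \<in> snd (AB j)}"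
      using AB J(1) by auto
    then have "prob (\<Inter>j\<in>J. E j) = (\<Prod>j\<in>J. prob (Y j -` fst (AB j) \<inter> space M) * prob (s j -` snd (AB j) \<inter> space M))"
      using rect[OF J(2), of "\<lambda>j. fst (AB j)" "\<lambda>j. snd (AB j)"] AB by simp
    also have "\<dots> = (\<Prod>j\<in>J. prob (E j))"
      using AB J(2) one by (intro prod.cong) auto
    finally show "prob (\<Inter>j\<in>J. E j) = (\<Prod>j\<in>J. prob (E j))" .
  qed
  moreover have "Int_stable (?G i)" for i
  proof (rule Int_stableI)
    fix a b assume "a \<in> ?G i" "b \<in> ?G i"
    then obtain A B A' B' where h: "a = ?Z i -` (A \<times> B) \<inter> space M" "b = ?Z i -` (A' \<times> B') \<inter> space M"
      "A \<in> sets borel" "B \<in> sets borel" "A' \<in> sets borel" "B' \<in> sets borel" by auto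
    have "a \<inter> b = ?Z i -` ((A \<inter> A') \<times> (B \<inter> B')) \<inter> space M" unfolding h by auto
    then show "a \<inter> b \<in> ?G i" using h(3-6) by blast
  qed
  ultimately have sig: "indep_sets (\<lambda>i. sigma_sets (space M) (?G i)) {..<n}"
    by (rule indep_sets_sigma)
  have sub: "{?Z i -` A \<inter> space M |A. A \<in> sets (borel \<Otimes>\<^sub>M borel)} \<subseteq> sigma_sets (space M) (?G i)" if "i < n" for i
  proof -
    have f: "?Z i \<in> space M \<rightarrow> UNIV" by simp
    have "{?Z i -` A \<inter> space M |A. A \<in> sigma_sets UNIV {a \<times> b | a b. a \<in> sets borel \<and> b \<in> sets borel}} =
       sigma_sets (space M) {?Z i -` A \<inter> space M |A. A \<in> {a \<times> b | a b. a \<in> sets borel \<and> b \<in> sets borel}}"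
      by (rule sigma_sets_vimage_commute[OF f])
    also have "{?Z i -` A \<inter> space M |A. A \<in> {a \<times> b | a b. a \<in> sets borel \<and> b \<in> sets borel}} = ?G i" by auto
    finally show ?thesis by (simp add: sets_pair_measure)
  qed
  have "indep_sets (\<lambda>i. {?Z i -` A \<inter> space M |A. A \<in> sets (borel \<Otimes>\<^sub>M borel)}) {..<n}"
    using sub by (intro indep_sets_mono_sets[OF sig]) auto
  then have "indep_vars (\<lambda>_. borel \<Otimes>\<^sub>M borel) ?Z {..<n}"
    using Zm by (simp add: indep_vars_def2)
  then show "indep_vars (\<lambda>_. borel) ?Z {..<n}" unfolding borel_prod .
  fix i assume i: "i < n"
  have pP: "prob_space P" and pQ: "prob_space Q" and sP: "sets P = sets borel" and sQ: "sets Q = sets borel"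
    using prob_space_distr[OF Ym[OF i]] prob_space_distr[OF sm[OF i]] sets_distr[of M borel "Y i"] sets_distr[of M borel "s i"]
    unfolding Yd[OF i] sd[OF i] by auto
  interpret P: prob_space P by (rule pP)
  interpret Q: prob_space Q by (rule pQ)
  have "P \<Otimes>\<^sub>M Q = distr M (borel \<Otimes>\<^sub>M borel) (?Z i)"
  proof (rule pair_measure_eqI)
    show "sets (P \<Otimes>\<^sub>M Q) = sets (distr M (borel \<Otimes>\<^sub>M borel) (?Z i))"
      using sets_pair_measure_cong[OF sP sQ] by simp
    fix A B assume "A \<in> sets P" "B \<in> sets Q"
    then have AB: "A \<in> sets borel" "B \<in> sets borel" using sP sQ by auto
    have "emeasure (distr M (borel \<Otimes>\<^sub>M borel) (?Z i)) (A \<times> B) = emeasure M (?Z i -` (A \<times> B) \<inter> space M)"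
      using AB by (intro emeasure_distr Zm[OF i]) auto
    also have "\<dots> = ennreal (prob (Y i -` A \<inter> space M) * prob (s i -` B \<inter> space M))"
      unfolding emeasure_eq_measure one[OF i AB] ..
    also have "\<dots> = emeasure M (Y i -` A \<inter> space M) * emeasure M (s i -` B \<inter> space M)"
      by (simp add: emeasure_eq_measure ennreal_mult')
    also have "emeasure M (Y i -` A \<inter> space M) = emeasure P A"
      unfolding Yd[OF i, symmetric] by (rule emeasure_distr[OF Ym[OF i] AB(1), symmetric])
    also have "emeasure M (s i -` B \<inter> space M) = emeasure Q B"
      unfolding sd[OF i, symmetric] by (rule emeasure_distr[OF sm[OF i] AB(2), symmetric])
    finally show "emeasure P A * emeasure Q B = emeasure (distr M (borel \<Otimes>\<^sub>M borel) (?Z i)) (A \<times> B)" ..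
  qed (unfold_locales)
  then show "distr M borel (?Z i) = P \<Otimes>\<^sub>M Q" unfolding borel_prod ..
qed

section \<open>Matrix products as tuples of linear forms, and their moments\<close>

lemma transp_mult_inner:
  fixes T :: "'j::finite \<Rightarrow> rvec"
  assumes "b \<in> Basis"
  shows "\<exists>j. \<forall>v. transp_mult q T v \<bullet> b = dotp q (T j) v"
proof -
  obtain j where "b = axis j 1" using assms by (auto simp: Basis_vec_def)
  then have "transp_mult q T v \<bullet> b = dotp q (T j) v" for v
    by (simp add: transp_mult_def inner_axis)
  then show ?thesis by blast
qed

lemma linear_coords_transp_mult:
  fixes T :: "'j::finite \<Rightarrow> rvec"
  assumes "\<And>j. T j \<in> S"
  shows "linear_coords q S (\<lambda>z. transp_mult q T (fst z))"
  unfolding linear_coords_def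
proof (intro ballI disjI1)
  fix b :: "real ^ 'j" assume "b \<in> Basis"
  from transp_mult_inner[OF this, of q T] obtain j where "\<forall>v. transp_mult q T v \<bullet> b = dotp q (T j) v" by (rule exE)
  then show "\<exists>u\<in>S. \<forall>z :: rvec \<times> real. transp_mult q T (fst z) \<bullet> b = dotp q u (fst z)"
    using assms by blast
qed

lemma linear_coords_snd: "linear_coords q S (\<lambda>z. snd z)"
  unfolding linear_coords_def by simp

lemma linear_coords_Pair:
  fixes Y :: "rvec \<times> real \<Rightarrow> 'a::euclidean_space" and Y' :: "rvec \<times> real \<Rightarrow> 'b::euclidean_space"
  assumes "linear_coords q S Y" "linear_coords q S Y'"
  shows "linear_coords q S (\<lambda>z. (Y z, Y' z))"
  using assms unfolding linear_coords_def Basis_prod_def by (simp add: ball_Un)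

lemma measurable_transp_mult [measurable]:
  fixes T :: "'j::finite \<Rightarrow> rvec"
  shows "(\<lambda>z :: rvec \<times> real. transp_mult q T (fst z)) \<in> borel_measurable borel"
proof (rule borel_measurable_euclidean_space[THEN iffD2, rule_format])
  fix b :: "real ^ 'j" assume "b \<in> Basis"
  from transp_mult_inner[OF this, of q T] obtain j where j: "\<forall>v. transp_mult q T v \<bullet> b = dotp q (T j) v" by (rule exE)
  show "(\<lambda>z :: rvec \<times> real. transp_mult q T (fst z) \<bullet> b) \<in> borel_measurable borel"
    unfolding j[rule_format] by (rule borel_dotp_fst)
qed

lemma continuous_transp_mult:
  "continuous_on UNIV (\<lambda>T :: 'j::finite \<Rightarrow> rvec. transp_mult q T v)"
  unfolding transp_mult_def dotp_def
proof (intro continuous_intros continuous_on_vec_lambda)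
  fix j :: 'j and i
  have c: "continuous_on UNIV (\<lambda>T :: 'j \<Rightarrow> rvec. T j)" by (rule continuous_on_product_coordinates)
  show "continuous_on UNIV (\<lambda>T :: 'j \<Rightarrow> rvec. T j i)"
    by (rule continuous_on_compose2[OF continuous_on_product_coordinates c]) simp
qed

lemma norm_transp_mult_diff_le:
  fixes T T' :: "'j::finite \<Rightarrow> rvec"
  shows "norm (transp_mult q T v - transp_mult q T' v) \<le> (\<Sum>j\<in>UNIV. \<bar>dotp q (\<lambda>i. T j i - T' j i) v\<bar>)"
proof -
  have "norm (transp_mult q T v - transp_mult q T' v) \<le> (\<Sum>j\<in>UNIV. \<bar>(transp_mult q T v - transp_mult q T' v) $ j\<bar>)"
    by (rule norm_le_l1_cart)
  then show ?thesis by (simp add: transp_mult_def dotp_diff)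
qed

text \<open>Exponential moments at unit rate, coordinate by coordinate. They yield the first moments
  of \<open>good_law\<close> and all polynomial moments.\<close>

definition exp_law :: "real \<Rightarrow> (rvec \<times> real) measure \<Rightarrow> (rvec \<times> real \<Rightarrow> 'a::euclidean_space) \<Rightarrow> bool" where
  "exp_law c D Y \<longleftrightarrow> (\<forall>b\<in>Basis. (\<integral>\<^sup>+z. ennreal (exp \<bar>Y z \<bullet> b\<bar>) \<partial>D) \<le> ennreal c)"

lemma exp_law_Pair:
  fixes Y :: "rvec \<times> real \<Rightarrow> 'a::euclidean_space" and Y' :: "rvec \<times> real \<Rightarrow> 'b::euclidean_space"
  assumes "exp_law c D Y" "exp_law c D Y'"
  shows "exp_law c D (\<lambda>z. (Y z, Y' z))"
  using assms unfolding exp_law_def Basis_prod_def by (simp add: ball_Un)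

lemma good_law_if_exp_law:
  assumes "exp_law c D Y" "prob_space D" "sets D = sets borel"
  shows "good_law c D Y"
  unfolding good_law_def
proof (intro conjI assms ballI)
  fix b :: 'a assume b: "b \<in> Basis"
  have "(\<integral>\<^sup>+z. ennreal \<bar>Y z \<bullet> b\<bar> \<partial>D) \<le> (\<integral>\<^sup>+z. ennreal (exp \<bar>Y z \<bullet> b\<bar>) \<partial>D)"
  proof (intro nn_integral_mono ennreal_leI)
    fix z
    show "\<bar>Y z \<bullet> b\<bar> \<le> exp \<bar>Y z \<bullet> b\<bar>" using exp_ge_add_one_self[of "\<bar>Y z \<bullet> b\<bar>"] by linarith
  qed
  also have "\<dots> \<le> ennreal c" using assms(1) b by (simp add: exp_law_def)
  finally show "(\<integral>\<^sup>+z. ennreal \<bar>Y z \<bullet> b\<bar> \<partial>D) \<le> ennreal c" .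
qed

text \<open>A power of the norm is dominated by an exponential of the norm divided by the dimension,
  hence by a sum of exponentials of single coordinates. The bound depends on \<open>K\<close>,
  \<open>q\<close>, \<open>c\<close> and the dimension of the target only, not on
  \<open>p\<close>.\<close>

lemma exp_law_power_moment:
  fixes Y :: "rvec \<times> real \<Rightarrow> 'a::euclidean_space"
  assumes law: "exp_law c D Y" and c: "c \<ge> 0" and Ym: "Y \<in> borel_measurable D"
    and f: "AE z in D. f z \<le> K * (1 + norm (Y z) powr q)" and K: "K \<ge> 0" and q: "q > 0"
  shows "(\<integral>\<^sup>+z. ennreal (f z) \<partial>D) \<le> ennreal (K * (1 + exp (q * ln (real DIM('a) * q))) * (real DIM('a) * c))"
proof -
  define A where "A = exp (q * ln (real DIM('a) * q))"
  have pt: "1 + norm y powr q \<le> (1 + A) * (\<Sum>b\<in>Basis. exp \<bar>y \<bullet> b\<bar>)" for y :: 'a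
  proof -
    obtain b :: 'a where b: "b \<in> Basis" using nonempty_Basis by blast
    have "exp \<bar>y \<bullet> b\<bar> \<le> (\<Sum>b\<in>Basis. exp \<bar>y \<bullet> b\<bar>)"
      using b by (intro member_le_sum[of b Basis "\<lambda>b. exp \<bar>y \<bullet> b\<bar>"]) auto
    moreover have "1 \<le> exp \<bar>y \<bullet> b\<bar>" by simp
    ultimately have 1: "1 \<le> (\<Sum>b\<in>Basis. exp \<bar>y \<bullet> b\<bar>)" by linarith
    have "norm y powr q \<le> A * exp (norm y / real DIM('a))"
      unfolding A_def by (rule powr_le_exp[OF norm_ge_zero q]) simp
    also have "\<dots> \<le> A * (\<Sum>b\<in>Basis. exp \<bar>y \<bullet> b\<bar>)"
      by (intro mult_left_mono exp_norm_le) (simp add: A_def)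
    finally show ?thesis using 1 by (simp add: distrib_right)
  qed
  have A: "A \<ge> 0" by (simp add: A_def)
  have "(\<integral>\<^sup>+z. ennreal (f z) \<partial>D) \<le> (\<integral>\<^sup>+z. ennreal (K * (1 + A)) * (\<Sum>b\<in>Basis. ennreal (exp \<bar>Y z \<bullet> b\<bar>)) \<partial>D)"
  proof (rule nn_integral_mono_AE)
    show "AE z in D. ennreal (f z) \<le> ennreal (K * (1 + A)) * (\<Sum>b\<in>Basis. ennreal (exp \<bar>Y z \<bullet> b\<bar>))"
      using f
    proof eventually_elim
      case (elim z)
      also have "K * (1 + norm (Y z) powr q) \<le> K * ((1 + A) * (\<Sum>b\<in>Basis. exp \<bar>Y z \<bullet> b\<bar>))"
        by (intro mult_left_mono pt K)
      finally have "ennreal (f z) \<le> ennreal ((K * (1 + A)) * (\<Sum>b\<in>Basis. exp \<bar>Y z \<bullet> b\<bar>))"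
        by (intro ennreal_leI) (simp add: mult.assoc)
      also have "\<dots> = ennreal (K * (1 + A)) * ennreal (\<Sum>b\<in>Basis. exp \<bar>Y z \<bullet> b\<bar>)"
        using K A by (intro ennreal_mult) (auto intro!: sum_nonneg)
      also have "ennreal (\<Sum>b\<in>Basis. exp \<bar>Y z \<bullet> b\<bar>) = (\<Sum>b\<in>Basis. ennreal (exp \<bar>Y z \<bullet> b\<bar>))"
        by (rule sum_ennreal[symmetric]) simp
      finally show ?case .
    qed
  qed
  also have "\<dots> = ennreal (K * (1 + A)) * (\<Sum>b\<in>Basis. \<integral>\<^sup>+z. ennreal (exp \<bar>Y z \<bullet> b\<bar>) \<partial>D)"
  proof -
    have [measurable]: "(\<lambda>z. Y z \<bullet> b) \<in> borel_measurable D" for b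
      by (intro borel_measurable_inner Ym borel_measurable_const)
    have "(\<integral>\<^sup>+z. ennreal (K * (1 + A)) * (\<Sum>b\<in>Basis. ennreal (exp \<bar>Y z \<bullet> b\<bar>)) \<partial>D) =
        ennreal (K * (1 + A)) * (\<integral>\<^sup>+z. (\<Sum>b\<in>Basis. ennreal (exp \<bar>Y z \<bullet> b\<bar>)) \<partial>D)"
      by (rule nn_integral_cmult) measurable
    also have "(\<integral>\<^sup>+z. (\<Sum>b\<in>Basis. ennreal (exp \<bar>Y z \<bullet> b\<bar>)) \<partial>D) = (\<Sum>b\<in>Basis. \<integral>\<^sup>+z. ennreal (exp \<bar>Y z \<bullet> b\<bar>) \<partial>D)"
      by (rule nn_integral_sum) measurable
    finally show ?thesis .
  qed
  also have "\<dots> \<le> ennreal (K * (1 + A)) * (\<Sum>b\<in>(Basis :: 'a set). ennreal c)"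
    using law by (intro mult_left_mono sum_mono) (auto simp: exp_law_def)
  also have "(\<Sum>b\<in>(Basis :: 'a set). ennreal c) = ennreal (real DIM('a) * c)"
    using c by (simp add: ennreal_mult ennreal_of_nat_eq_real_of_nat)
  also have "ennreal (K * (1 + A)) * ennreal (real DIM('a) * c) = ennreal (K * (1 + A) * (real DIM('a) * c))"
    using K A c by (intro ennreal_mult[symmetric]) auto
  finally show ?thesis unfolding A_def .
qed

section \<open>Laws of the samples and reduction of the two alternatives\<close>

context erm_models
begin

lemma configuration_law:
  assumes n: "n > 0"
  shows "distr (M n) (\<Pi>\<^sub>M i\<in>{..<n}. borel) (\<lambda>\<omega>. \<lambda>i\<in>{..<n}. (feature b n i \<omega>, e n i \<omega>)) = (\<Pi>\<^sub>M i\<in>{..<n}. D b n)"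
proof -
  interpret prob_space "M n" using prob n by blast
  note iid = iid_pairs[OF sample[OF n, of b]]
  have "distr (M n) (\<Pi>\<^sub>M i\<in>{..<n}. borel) (\<lambda>\<omega>. \<lambda>i\<in>{..<n}. (feature b n i \<omega>, e n i \<omega>)) =
      (\<Pi>\<^sub>M i\<in>{..<n}. distr (M n) borel (\<lambda>\<omega>. (feature b n i \<omega>, e n i \<omega>)))"
    using n iid(1) by (subst indep_vars_iff_distr_eq_PiM'[symmetric]) (auto simp: indep_vars_def2)
  also have "\<dots> = (\<Pi>\<^sub>M i\<in>{..<n}. D b n)"
    using iid(2) by (intro PiM_cong) (auto simp: D_def)
  finally show ?thesis .
qed

lemma pair_law:
  assumes n: "n > 0"
  shows "(\<lambda>\<omega>. (feature b n 0 \<omega>, e n 0 \<omega>)) \<in> borel_measurable (M n)"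
    and "distr (M n) borel (\<lambda>\<omega>. (feature b n 0 \<omega>, e n 0 \<omega>)) = D b n"
proof -
  interpret prob_space "M n" using prob n by blast
  note iid = iid_pairs[OF sample[OF n, of b]]
  show "(\<lambda>\<omega>. (feature b n 0 \<omega>, e n 0 \<omega>)) \<in> borel_measurable (M n)"
    using iid(1) n by (auto simp: indep_vars_def2)
  show "distr (M n) borel (\<lambda>\<omega>. (feature b n 0 \<omega>, e n 0 \<omega>)) = D b n"
    using iid(2)[OF n] by (simp add: D_def)
qed

lemma C_in_S: "n > 0 \<Longrightarrow> \<forall>j. T j \<in> C n \<Longrightarrow> T j \<in> S n"
  using C_subset by blast

lemma exp_law_transp_mult:
  fixes T :: "'j::finite \<Rightarrow> rvec"
  assumes c: "\<And>b n u. n > 0 \<Longrightarrow> u \<in> S n \<Longrightarrow> (\<integral>\<^sup>+z. ennreal (exp \<bar>dotp (p n) u (fst z)\<bar>) \<partial>D b n) \<le> ennreal c"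
    and n: "n > 0" and T: "\<And>j. T j \<in> S n"
  shows "exp_law c (D b n) (\<lambda>z. transp_mult (p n) T (fst z))"
  unfolding exp_law_def
proof
  fix b' :: "real ^ 'j" assume "b' \<in> Basis"
  from transp_mult_inner[OF this, of "p n" T] obtain j where
    j: "\<forall>v. transp_mult (p n) T v \<bullet> b' = dotp (p n) (T j) v" by (rule exE)
  show "(\<integral>\<^sup>+z. ennreal (exp \<bar>transp_mult (p n) T (fst z) \<bullet> b'\<bar>) \<partial>D b n) \<le> ennreal c"
    unfolding j[rule_format] by (rule c[OF n T])
qed

text \<open>What each alternative has to supply. The Lipschitz condition is stated in the fixed
  dimension of the loss; coordinatewise it becomes the bound by linear forms that the net argument
  uses.\<close>

lemma universal_pairI:
  assumes meas: "(\<lambda>(w, s). loss L F \<eta> w s) \<in> borel_measurable borel"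
    and ucont: "\<And>us s. continuous_on UNIV (\<lambda>u. loss L F \<eta> (u, us) s)"
    and moment: "\<exists>M\<ge>0. \<forall>b n T. n > 0 \<longrightarrow> (\<forall>j. T j \<in> C n) \<longrightarrow> (\<integral>\<^sup>+z. ennreal ((lf n T z)\<^sup>2) \<partial>D b n) \<le> ennreal M"
    and lip: "\<And>B. B > 0 \<Longrightarrow> \<exists>K\<ge>0. \<forall>b n. n > 0 \<longrightarrow> (AE z in D b n. \<forall>T T'.
      \<bar>min (lf n T z) B - min (lf n T' z) B\<bar> \<le>
        K * norm (transp_mult (p n) T (fst z) - transp_mult (p n) T' (fst z)))"
    and cav: "\<And>\<beta> B d. \<beta> > 0 \<Longrightarrow> B > 0 \<Longrightarrow> d > 0 \<Longrightarrow> \<forall>\<^sub>F n in sequentially. \<forall>N \<nu>.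
      finite N \<longrightarrow> N \<subseteq> {T. \<forall>j. T j \<in> C n} \<longrightarrow> weights N \<nu> \<longrightarrow>
      \<bar>(\<integral>z. cavity \<beta> N \<nu> (\<lambda>T. min (lf n T z) B) \<partial>D True n) -
       (\<integral>z. cavity \<beta> N \<nu> (\<lambda>T. min (lf n T z) B) \<partial>D False n)\<bar> \<le> d"
  shows "universal_pair p R S C r lf D"
proof (rule universal_pair.intro)
  fix n :: nat and T :: "'k \<Rightarrow> rvec" and z :: "rvec \<times> real"
  assume n: "n > 0"
  have "(\<lambda>z. ((transp_mult (p n) T (fst z), transp_mult (p n) (Ts n) (fst z)), snd z)) \<in> borel_measurable (borel :: (rvec \<times> real) measure)"
    by (intro borel_measurable_Pair measurable_transp_mult borel_snd_real)
  from measurable_compose[OF this meas] show "lf n T \<in> borel_measurable borel"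
    by (simp add: lf_def[abs_def])
  show "continuous_on UNIV (\<lambda>T. lf n T z)"
    unfolding lf_def by (intro continuous_on_compose2[OF ucont continuous_transp_mult]) auto
next
  fix B :: real assume "B > 0"
  from lip[OF this] obtain K where K: "K \<ge> 0" "\<forall>b n. n > 0 \<longrightarrow> (AE z in D b n. \<forall>T T'.
      \<bar>min (lf n T z) B - min (lf n T' z) B\<bar> \<le> K * norm (transp_mult (p n) T (fst z) - transp_mult (p n) T' (fst z)))"
    by blast
  show "\<exists>K\<ge>0. \<forall>b n. n > 0 \<longrightarrow> (AE z in D b n. \<forall>T T'.
      \<bar>min (lf n T z) B - min (lf n T' z) B\<bar> \<le> K * (\<Sum>j\<in>UNIV. \<bar>dotp (p n) (\<lambda>i. T j i - T' j i) (fst z)\<bar>))"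
  proof (intro exI[of _ K] conjI allI impI K(1))
    fix b n assume "(0::nat) < n"
    with K(2) have "AE z in D b n. \<forall>T T'.
      \<bar>min (lf n T z) B - min (lf n T' z) B\<bar> \<le> K * norm (transp_mult (p n) T (fst z) - transp_mult (p n) T' (fst z))" by blast
    then show "AE z in D b n. \<forall>T T'.
      \<bar>min (lf n T z) B - min (lf n T' z) B\<bar> \<le> K * (\<Sum>j\<in>UNIV. \<bar>dotp (p n) (\<lambda>i. T j i - T' j i) (fst z)\<bar>)"
    proof (eventually_elim, intro allI)
      fix z T T'
      assume "\<forall>T T'. \<bar>min (lf n T z) B - min (lf n T' z) B\<bar> \<le> K * norm (transp_mult (p n) T (fst z) - transp_mult (p n) T' (fst z))"
      then have "\<bar>min (lf n T z) B - min (lf n T' z) B\<bar> \<le> K * norm (transp_mult (p n) T (fst z) - transp_mult (p n) T' (fst z))"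
        by blast
      also have "\<dots> \<le> K * (\<Sum>j\<in>UNIV. \<bar>dotp (p n) (\<lambda>i. T j i - T' j i) (fst z)\<bar>)"
        by (intro mult_left_mono norm_transp_mult_diff_le K(1))
      finally show "\<bar>min (lf n T z) B - min (lf n T' z) B\<bar> \<le> K * (\<Sum>j\<in>UNIV. \<bar>dotp (p n) (\<lambda>i. T j i - T' j i) (fst z)\<bar>)" .
    qed
  qed
next
  show "\<exists>c\<ge>1. \<forall>b n u. n > 0 \<longrightarrow> u \<in> S n \<longrightarrow> (\<integral>\<^sup>+z. ennreal (exp \<bar>dotp (p n) u (fst z)\<bar>) \<partial>D b n) \<le> ennreal c"
    by (rule exp_moment_features) blast
next
  show "0 \<le> lf n T z" for n T z using L_nonneg by (simp add: lf_def loss_def)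
next
  show "C n \<subseteq> S n" if "n > 0" for n using C_subset that by blast
qed (fact prob_D sets_D regime S_sub S_sym S_ne S_norm penalty moment cav)+

end

subsection \<open>Losses satisfying the first alternative\<close>

lemma locally_lipschitz_continuous:
  fixes l :: "'a::real_normed_vector \<Rightarrow> real \<Rightarrow> real"
  assumes loc: "\<forall>B>0. \<exists>K. \<forall>w s w' s'. norm (w, s) \<le> B \<longrightarrow> norm (w', s') \<le> B \<longrightarrow>
      \<bar>l w s - l w' s'\<bar> \<le> K * (norm (w - w') + \<bar>s - s'\<bar>)"
  shows "continuous_on UNIV (\<lambda>z. l (fst z) (snd z))"
  unfolding continuous_on_eq_continuous_at[OF open_UNIV]
proof
  fix z0 :: "'a \<times> real"
  have "norm z0 + 1 > 0" by (simp add: add_nonneg_pos)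
  with loc obtain K where K: "\<forall>w s w' s'. norm (w, s) \<le> norm z0 + 1 \<longrightarrow> norm (w', s') \<le> norm z0 + 1 \<longrightarrow>
      \<bar>l w s - l w' s'\<bar> \<le> K * (norm (w - w') + \<bar>s - s'\<bar>)" by blast
  let ?f = "\<lambda>z. l (fst z) (snd z)"
  have "((\<lambda>z. ?f z - ?f z0) \<longlongrightarrow> 0) (at z0)"
  proof (rule Lim_null_comparison)
    show "\<forall>\<^sub>F z in at z0. norm (?f z - ?f z0) \<le> K * (norm (fst z - fst z0) + \<bar>snd z - snd z0\<bar>)"
      unfolding eventually_at
    proof (intro exI[of _ 1] conjI ballI impI)
      fix z assume "z \<noteq> z0 \<and> dist z z0 < 1"
      then have "norm z \<le> norm z0 + 1" using norm_triangle_sub[of z z0] by (simp add: dist_norm)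
      then show "norm (?f z - ?f z0) \<le> K * (norm (fst z - fst z0) + \<bar>snd z - snd z0\<bar>)"
        using K[rule_format, of "fst z" "snd z" "fst z0" "snd z0"] by simp
    qed simp
    show "((\<lambda>z. K * (norm (fst z - fst z0) + \<bar>snd z - snd z0\<bar>)) \<longlongrightarrow> 0) (at z0)"
      by (rule tendsto_eq_intros refl tendsto_ident_at | simp)+
  qed
  then show "continuous (at z0) ?f" unfolding continuous_at by (rule LIM_zero_cancel)
qed

text \<open>Coercivity makes the capped loss constant outside a ball, so the local Lipschitz bound becomes global.\<close>
lemma capped_coercive_lipschitz:
  fixes l :: "'a::real_normed_vector \<Rightarrow> real \<Rightarrow> real"
  assumes loc: "\<forall>B>0. \<exists>K. \<forall>w s w' s'. norm (w, s) \<le> B \<longrightarrow> norm (w', s') \<le> B \<longrightarrow>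
      \<bar>l w s - l w' s'\<bar> \<le> K * (norm (w - w') + \<bar>s - s'\<bar>)"
    and co: "\<And>w s. - K0 + K1 * (norm w powr a + \<bar>s\<bar> powr a) \<le> l w s"
    and K1: "K1 > 0" and a: "a > 0" and B: "B > 0" and nn: "\<And>w s. 0 \<le> l w s"
  shows "\<exists>K\<ge>0. \<forall>w w' s. \<bar>min (l w s) B - min (l w' s) B\<bar> \<le> K * norm (w - w')"
proof -
  \<comment> \<open>If the pair has norm at least \<open>2 * y\<close>, one component has norm at
    least \<open>y\<close>, and there the coercive lower bound exceeds the cap.\<close>
  define y where "y = ((B + \<bar>K0\<bar>) / K1 + 1) powr (1 / a)"
  have pos: "(B + \<bar>K0\<bar>) / K1 + 1 > 0" using B K1 by (intro add_nonneg_pos divide_nonneg_pos) auto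
  then have y: "y > 0" "y powr a = (B + \<bar>K0\<bar>) / K1 + 1" using a by (auto simp: y_def powr_powr)
  have out: "B \<le> l w s" if "2 * y \<le> norm (w, s)" for w s
  proof -
    have "norm (w, s) \<le> norm w + \<bar>s\<bar>" using norm_Pair_le[of w s] by simp
    then have "y \<le> norm w \<or> y \<le> \<bar>s\<bar>" using that by linarith
    then have "y powr a \<le> norm w powr a \<or> y powr a \<le> \<bar>s\<bar> powr a"
      using a y(1) powr_mono2[of a y "norm w"] powr_mono2[of a y "\<bar>s\<bar>"] by auto
    then have "y powr a \<le> norm w powr a + \<bar>s\<bar> powr a"
      using powr_ge_zero[of "norm w" a] powr_ge_zero[of "\<bar>s\<bar>" a] by linarith
    then have "K1 * ((B + \<bar>K0\<bar>) / K1 + 1) \<le> K1 * (norm w powr a + \<bar>s\<bar> powr a)"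
      unfolding y(2) using K1 by (intro mult_left_mono) auto
    moreover have "K1 * ((B + \<bar>K0\<bar>) / K1 + 1) = B + \<bar>K0\<bar> + K1" using K1 by (simp add: field_simps)
    ultimately show ?thesis using co[of w s] K1 by linarith
  qed
  have "4 * y > 0" using y by simp
  with loc obtain K2 where K2: "\<forall>w s w' s'. norm (w, s) \<le> 4 * y \<longrightarrow> norm (w', s') \<le> 4 * y \<longrightarrow>
      \<bar>l w s - l w' s'\<bar> \<le> K2 * (norm (w - w') + \<bar>s - s'\<bar>)" by blast
  \<comment> \<open>Two cases with one point inside \<open>2 * y\<close>: either the other is inside
    \<open>4 * y\<close>, where the local constant applies, or the points are at distance at least
    \<open>2 * y\<close> while the capped values differ by at most \<open>B\<close>.\<close>
  define K where "K = max \<bar>K2\<bar> (B / (2 * y))"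
  have K: "K \<ge> 0" "\<bar>K2\<bar> \<le> K" "B / (2 * y) \<le> K" by (auto simp: K_def)
  have main: "\<bar>min (l w s) B - min (l w' s) B\<bar> \<le> K * norm (w - w')" if w: "norm (w, s) < 2 * y" for w w' s
  proof (cases "norm (w', s) \<le> 4 * y")
    case True
    have "\<bar>min (l w s) B - min (l w' s) B\<bar> \<le> \<bar>l w s - l w' s\<bar>" by (simp add: min_def)
    also have "\<dots> \<le> K2 * norm (w - w')" using K2[rule_format, of w s w' s] w True y(1) by simp
    also have "\<dots> \<le> K * norm (w - w')" using K(2) by (intro mult_right_mono) auto
    finally show ?thesis .
  next
    case False
    have "norm (w', s) \<le> norm (w, s) + norm ((w', s) - (w, s))" by (rule norm_triangle_sub)
    also have "norm ((w', s) - (w, s)) = norm (w - w')" by (simp add: norm_Pair norm_minus_commute)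
    finally have d: "2 * y \<le> norm (w - w')" using False w by linarith
    have "\<bar>min (l w s) B - min (l w' s) B\<bar> \<le> B" using nn[of w s] nn[of w' s] B by (auto simp: min_def)
    also have "B = B / (2 * y) * (2 * y)" using y by simp
    also have "\<dots> \<le> K * norm (w - w')" using K d y by (intro mult_mono) auto
    finally show ?thesis .
  qed
  show ?thesis
  proof (intro exI[of _ K] conjI allI K(1))
    fix w w' :: 'a and s :: real
    consider "norm (w, s) < 2 * y" | "norm (w', s) < 2 * y" | "2 * y \<le> norm (w, s)" "2 * y \<le> norm (w', s)" by linarith
    then show "\<bar>min (l w s) B - min (l w' s) B\<bar> \<le> K * norm (w - w')"
    proof cases
      case 1
      then show ?thesis by (rule main)
    next
      case 2
      from main[OF this, of w] show ?thesis by (simp add: abs_minus_commute norm_minus_commute)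
    next
      case 3
      then have "min (l w s) B = B" "min (l w' s) B = B" using out by (auto intro: min_absorb2)
      then show ?thesis using K(1) by simp
    qed
  qed
qed

lemma abs_min_diff_le: "\<bar>min a B - min b B\<bar> \<le> \<bar>a - b :: real\<bar>"
  by (simp add: min_def)

context erm_models
begin

text \<open>The Lipschitz and the coercive case lead to the same three consequences: continuity for
  the trigonometric approximation, polynomial growth for the second moment, a Lipschitz bound after
  capping for the net. In the Lipschitz case the growth exponent is 1.\<close>

lemma alternative_I_props:
  assumes alt: "alternative_I (loss L F \<eta>) Q"
  shows "continuous_on UNIV (\<lambda>z. loss L F \<eta> (fst z) (snd z))"
    and "\<exists>K\<ge>0. \<exists>q>0. \<forall>w s. loss L F \<eta> w s \<le> K * (1 + norm w powr q + \<bar>s\<bar> powr q)"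
    and "B > 0 \<Longrightarrow> \<exists>K\<ge>0. \<forall>w w' s. \<bar>min (loss L F \<eta> w s) B - min (loss L F \<eta> w' s) B\<bar> \<le> K * norm (w - w')"
proof -
  let ?l = "loss L F \<eta>"
  have nn: "\<And>w s. 0 \<le> ?l w s" using L_nonneg by (simp add: loss_def)
  let ?lip = "\<lambda>K. \<forall>w s w' s'. \<bar>?l w s - ?l w' s'\<bar> \<le> K * (norm (w - w') + \<bar>s - s'\<bar>)"
  let ?loc = "\<forall>B>0. \<exists>K. \<forall>w s w' s'. norm (w, s) \<le> B \<longrightarrow> norm (w', s') \<le> B \<longrightarrow>
      \<bar>?l w s - ?l w' s'\<bar> \<le> K * (norm (w - w') + \<bar>s - s'\<bar>)"
  let ?co = "\<exists>K0 K1 K a b. 0 < K1 \<and> 0 < a \<and> a \<le> b \<and>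
           (\<forall>w s. - K0 + K1 * (norm w powr a + \<bar>s\<bar> powr a) \<le> ?l w s \<and>
                  ?l w s \<le> K * (1 + norm w powr b + \<bar>s\<bar> powr b))"
  have "(\<exists>K. ?lip K) \<or> (?loc \<and> ?co)"
    using alt unfolding alternative_I_def by (elim conjE)
  then have all: "?loc \<and> (\<exists>K\<ge>0. \<exists>q>0. \<forall>w s. ?l w s \<le> K * (1 + norm w powr q + \<bar>s\<bar> powr q)) \<and>
      (\<forall>B>0. \<exists>K\<ge>0. \<forall>w w' s. \<bar>min (?l w s) B - min (?l w' s) B\<bar> \<le> K * norm (w - w'))"
  proof (elim disjE exE conjE)
    fix K assume lip: "?lip K"
    have ?loc using lip by blast
    moreover have "?l w s \<le> (\<bar>?l 0 0\<bar> + \<bar>K\<bar>) * (1 + norm w powr 1 + \<bar>s\<bar> powr 1)" for w s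
    proof -
      have "?l w s \<le> \<bar>?l 0 0\<bar> + K * (norm w + \<bar>s\<bar>)" using lip[rule_format, of w s 0 0] by simp
      also have "K * (norm w + \<bar>s\<bar>) \<le> \<bar>K\<bar> * (norm w + \<bar>s\<bar>)" by (intro mult_right_mono) auto
      also have "\<bar>?l 0 0\<bar> + \<bar>K\<bar> * (norm w + \<bar>s\<bar>) \<le> (\<bar>?l 0 0\<bar> + \<bar>K\<bar>) * (1 + norm w + \<bar>s\<bar>)"
        by (simp add: algebra_simps)
      finally show ?thesis by simp
    qed
    then have "\<exists>K\<ge>0. \<exists>q>0. \<forall>w s. ?l w s \<le> K * (1 + norm w powr q + \<bar>s\<bar> powr q)"
      by (intro exI[of _ "\<bar>?l 0 0\<bar> + \<bar>K\<bar>"] conjI exI[of _ "1::real"]) auto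
    moreover have "\<bar>min (?l w s) B - min (?l w' s) B\<bar> \<le> \<bar>K\<bar> * norm (w - w')" for w w' s B
    proof -
      have "\<bar>min (?l w s) B - min (?l w' s) B\<bar> \<le> K * norm (w - w')"
        using abs_min_diff_le[of "?l w s" B "?l w' s"] lip[rule_format, of w s w' s] by simp
      also have "\<dots> \<le> \<bar>K\<bar> * norm (w - w')" by (intro mult_right_mono) auto
      finally show ?thesis .
    qed
    then have "\<forall>B>0. \<exists>K\<ge>0. \<forall>w w' s. \<bar>min (?l w s) B - min (?l w' s) B\<bar> \<le> K * norm (w - w')"
      by (intro allI impI exI[of _ "\<bar>K\<bar>"]) auto
    ultimately show ?thesis by blast
  next
    fix K0 K1 K a b
    assume loc: ?loc and c: "0 < K1" "0 < a" "a \<le> b"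
      and bd: "\<forall>w s. - K0 + K1 * (norm w powr a + \<bar>s\<bar> powr a) \<le> ?l w s \<and> ?l w s \<le> K * (1 + norm w powr b + \<bar>s\<bar> powr b)"
    have "?l w s \<le> \<bar>K\<bar> * (1 + norm w powr b + \<bar>s\<bar> powr b)" for w s
    proof -
      have "?l w s \<le> K * (1 + norm w powr b + \<bar>s\<bar> powr b)" using bd by blast
      also have "\<dots> \<le> \<bar>K\<bar> * (1 + norm w powr b + \<bar>s\<bar> powr b)" by (intro mult_right_mono) auto
      finally show ?thesis .
    qed
    then have "\<exists>K\<ge>0. \<exists>q>0. \<forall>w s. ?l w s \<le> K * (1 + norm w powr q + \<bar>s\<bar> powr q)"
      using c by (intro exI[of _ "\<bar>K\<bar>"] conjI exI[of _ b]) auto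
    moreover have "\<forall>B>0. \<exists>K\<ge>0. \<forall>w w' s. \<bar>min (?l w s) B - min (?l w' s) B\<bar> \<le> K * norm (w - w')"
      using bd by (intro allI impI capped_coercive_lipschitz[OF loc _ c(1,2) _ nn]) auto
    ultimately show ?thesis using loc by blast
  qed
  note loc = all[THEN conjunct1] and gr = all[THEN conjunct2, THEN conjunct1] and tr = all[THEN conjunct2, THEN conjunct2]
  show "continuous_on UNIV (\<lambda>z. ?l (fst z) (snd z))" by (rule locally_lipschitz_continuous[OF loc])
  show "\<exists>K\<ge>0. \<exists>q>0. \<forall>w s. ?l w s \<le> K * (1 + norm w powr q + \<bar>s\<bar> powr q)" by (rule gr)
  show "B > 0 \<Longrightarrow> \<exists>K\<ge>0. \<forall>w w' s. \<bar>min (?l w s) B - min (?l w' s) B\<bar> \<le> K * norm (w - w')" using tr by blast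
qed

text \<open>The loss is a continuous function of \<open>Y n T\<close>, a vector of fixed dimension
  made of admissible linear forms and the noise. So \<open>cavity_discrepancy\<close> applies with
  constant weight 1, and any vector of linear coordinates, here the noise, can serve as its
  argument.\<close>

lemma alternative_I_universal:
  assumes alt: "alternative_I (loss L F \<eta>) Q"
  shows "universal_pair p R S C r lf D"
proof -
  let ?l = "loss L F \<eta>"
  note props = alternative_I_props[OF alt]
  obtain Kq where Kq: "\<forall>n>0. subgaussian_norm (Q n) (\<lambda>s. s) \<le> ennreal Kq"
    using alt unfolding alternative_I_def by blast
  obtain cF where cF: "cF \<ge> 1" "\<forall>b n u. n > 0 \<longrightarrow> u \<in> S n \<longrightarrow>
      (\<integral>\<^sup>+z. ennreal (exp \<bar>dotp (p n) u (fst z)\<bar>) \<partial>D b n) \<le> ennreal cF"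
    by (rule exp_moment_features) blast
  define cQ where "cQ = 2 * exp (1\<^sup>2 * (max Kq 0 + 1)\<^sup>2 / 4)"
  define c where "c = max cF cQ"
  have c: "c \<ge> 0" "cF \<le> c" "cQ \<le> c" using cF(1) by (auto simp: c_def)
  have cFc: "(\<integral>\<^sup>+z. ennreal (exp \<bar>dotp (p n) u (fst z)\<bar>) \<partial>D b n) \<le> ennreal c" if "n > 0" "u \<in> S n" for b n u
    using cF(2) that ennreal_leI[OF c(2)] order_trans by blast
  have snd_law: "exp_law c (D b n) (\<lambda>z. snd z)" if n: "n > 0" for b n
  proof -
    have "(\<integral>\<^sup>+z. ennreal (exp \<bar>snd z\<bar>) \<partial>D b n) = (\<integral>\<^sup>+s. ennreal (exp \<bar>s\<bar>) \<partial>Q n)"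
      by (rule nn_integral_D_snd[OF n]) measurable
    also have "\<dots> \<le> ennreal cQ"
      using subgaussian_exp_moment[OF Kq[rule_format, OF n] meas_Q[OF n] zero_le_one] by (simp add: cQ_def)
    also have "\<dots> \<le> ennreal c" by (rule ennreal_leI[OF c(3)])
    finally show ?thesis by (simp add: exp_law_def)
  qed
  define Y where "Y n T z = ((transp_mult (p n) T (fst z), transp_mult (p n) (Ts n) (fst z)), snd z)"
    for n and T :: "'k \<Rightarrow> rvec" and z :: "rvec \<times> real"
  have lf_Y: "lf n T z = ?l (fst (Y n T z)) (snd (Y n T z))" for n T z by (simp add: lf_def Y_def)
  have Y_lin: "linear_coords (p n) (S n) (Y n T)" if "n > 0" "\<forall>j. T j \<in> C n" for n T
    unfolding Y_def[abs_def] using C_in_S[OF that] Ts_in that(1)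
    by (intro linear_coords_Pair linear_coords_transp_mult linear_coords_snd) auto
  have Y_law: "exp_law c (D b n) (Y n T)" if n: "n > 0" and T: "\<forall>j. T j \<in> C n" for b n T
    unfolding Y_def[abs_def] using C_in_S[OF n T] Ts_in n
    by (intro exp_law_Pair exp_law_transp_mult cFc snd_law) auto
  show ?thesis
  proof (rule universal_pairI)
    show "(\<lambda>(w, s). ?l w s) \<in> borel_measurable borel"
      unfolding case_prod_unfold by (rule borel_measurable_continuous_onI[OF props(1)])
    show "continuous_on UNIV (\<lambda>u. ?l (u, us) s)" for us s
    proof -
      have "continuous_on UNIV (\<lambda>u :: real ^ 'k. ((u, us), s))" by (intro continuous_intros)
      from continuous_on_compose2[OF props(1) this] show ?thesis by simp
    qed
    show "\<exists>M\<ge>0. \<forall>b n T. n > 0 \<longrightarrow> (\<forall>j. T j \<in> C n) \<longrightarrow> (\<integral>\<^sup>+z. ennreal ((lf n T z)\<^sup>2) \<partial>D b n) \<le> ennreal M"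
    proof -
      from props(2) obtain K q where Kq: "K \<ge> 0" "q > 0" "\<forall>w s. ?l w s \<le> K * (1 + norm w powr q + \<bar>s\<bar> powr q)"
        by (elim exE conjE)
      let ?Mo = "(8 * K\<^sup>2) * (1 + exp ((2 * q) * ln (real DIM(((real ^ 'k) \<times> (real ^ 'm)) \<times> real) * (2 * q)))) *
          (real DIM(((real ^ 'k) \<times> (real ^ 'm)) \<times> real) * c)"
      have "?Mo \<ge> 0" using c(1) by (intro mult_nonneg_nonneg add_nonneg_nonneg) auto
      moreover have "(\<integral>\<^sup>+z. ennreal ((lf n T z)\<^sup>2) \<partial>D b n) \<le> ennreal ?Mo" if n: "n > 0" and T: "\<forall>j. T j \<in> C n" for b n T
      proof (rule exp_law_power_moment[OF Y_law[OF n T] c(1)])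
        show "Y n T \<in> borel_measurable (D b n)"
          using linear_coords_measurable[OF Y_lin[OF n T]] measurable_cong_sets[OF sets_D[OF n] refl] by blast
        have "(lf n T z)\<^sup>2 \<le> 8 * K\<^sup>2 * (1 + norm (Y n T z) powr (2 * q))" for z
        proof -
          let ?y = "Y n T z" and ?t = "norm (Y n T z) powr q"
          have "norm (fst ?y) powr q \<le> ?t" "\<bar>snd ?y\<bar> powr q \<le> ?t"
            using Kq(2) norm_fst_le[of "fst ?y" "snd ?y"] norm_snd_le[of "snd ?y" "fst ?y"]
            by (auto intro!: powr_mono2)
          then have "K * (1 + norm (fst ?y) powr q + \<bar>snd ?y\<bar> powr q) \<le> K * (1 + 2 * ?t)"
            using Kq(1) by (intro mult_left_mono) auto
          then have "lf n T z \<le> K * (1 + 2 * ?t)"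
            unfolding lf_Y using Kq(3)[rule_format, of "fst ?y" "snd ?y"] by linarith
          moreover have "0 \<le> lf n T z" using L_nonneg by (simp add: lf_def loss_def)
          ultimately have "(lf n T z)\<^sup>2 \<le> (K * (1 + 2 * ?t))\<^sup>2" by (intro power_mono)
          also have "\<dots> = K\<^sup>2 * (1 + 2 * ?t)\<^sup>2" by (rule power_mult_distrib)
          also have "\<dots> \<le> K\<^sup>2 * (8 * (1 + ?t\<^sup>2))"
          proof (rule mult_left_mono)
            have "0 \<le> (1 - 2 * ?t)\<^sup>2" by simp
            then show "(1 + 2 * ?t)\<^sup>2 \<le> 8 * (1 + ?t\<^sup>2)" by (simp add: power2_eq_square algebra_simps)
          qed simp
          also have "?t\<^sup>2 = norm (Y n T z) powr (2 * q)"
            by (simp add: power2_eq_square flip: powr_add)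
          finally show ?thesis by (simp only: mult.left_commute[of "K\<^sup>2" 8] mult.assoc)
        qed
        then show "AE z in D b n. (lf n T z)\<^sup>2 \<le> 8 * K\<^sup>2 * (1 + norm (Y n T z) powr (2 * q))" by simp
      qed (use Kq in auto)
      ultimately show ?thesis by blast
    qed
    show "\<exists>K\<ge>0. \<forall>b n. n > 0 \<longrightarrow> (AE z in D b n. \<forall>T T'.
      \<bar>min (lf n T z) B - min (lf n T' z) B\<bar> \<le> K * norm (transp_mult (p n) T (fst z) - transp_mult (p n) T' (fst z)))"
      if B: "B > 0" for B
    proof -
      from props(3)[OF B] obtain K where K: "K \<ge> 0" "\<forall>w w' s. \<bar>min (?l w s) B - min (?l w' s) B\<bar> \<le> K * norm (w - w')"
        by (elim exE conjE)
      have "\<bar>min (lf n T z) B - min (lf n T' z) B\<bar> \<le> K * norm (transp_mult (p n) T (fst z) - transp_mult (p n) T' (fst z))" for n T T' z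
        unfolding lf_def
        using K(2)[rule_format, of "(transp_mult (p n) T (fst z), transp_mult (p n) (Ts n) (fst z))" "snd z"
            "(transp_mult (p n) T' (fst z), transp_mult (p n) (Ts n) (fst z))"]
        by (simp add: norm_Pair)
      then show ?thesis using K(1) by (intro exI[of _ K]) auto
    qed
    fix \<beta> B d :: real assume \<beta>: "\<beta> > 0" and B: "B > 0" and d: "d > 0"
    \<comment> \<open>The Boltzmann factor of the capped loss; the cap gives it the positive lower
      bound \<open>exp (- \<beta> * B)\<close>.\<close>
    define v where "v y = exp (- \<beta> * min (?l (fst y) (snd y)) B)" for y :: "((real ^ 'k) \<times> (real ^ 'm)) \<times> real"
    have vc: "continuous_on UNIV v" unfolding v_def by (intro continuous_intros props(1))
    have vb: "exp (- \<beta> * B) \<le> v y \<and> v y \<le> 1" for y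
      unfolding v_def using \<beta> B L_nonneg by (auto simp: loss_def)
    have d2: "d / 2 > 0" using d by simp
    from cavity_discrepancy[where 't="'k \<Rightarrow> rvec" and 'b=real, OF vc vb exp_gt_zero continuous_on_const _ \<beta> d2 c(1), of 1]
    obtain a w where w: "w \<ge> 0" and disc: "\<forall>p S D1 D2 (N :: ('k \<Rightarrow> rvec) set) \<nu> Y (Y0 :: rvec \<times> real \<Rightarrow> real) \<delta>. S \<noteq> {} \<longrightarrow> symmetric_convex S \<longrightarrow>
      finite N \<longrightarrow> weights N \<nu> \<longrightarrow> linear_coords p S Y0 \<longrightarrow> (\<forall>T\<in>N. linear_coords p S (Y T)) \<longrightarrow>
      good_law c D1 Y0 \<longrightarrow> good_law c D2 Y0 \<longrightarrow> (\<forall>T\<in>N. good_law c D1 (Y T) \<and> good_law c D2 (Y T)) \<longrightarrow>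
      (\<forall>u\<in>S. \<forall>c b. \<bar>(\<integral>z. cos (a * dotp p u (fst z) + c * snd z + b) \<partial>D1) -
        (\<integral>z. cos (a * dotp p u (fst z) + c * snd z + b) \<partial>D2)\<bar> \<le> \<delta>) \<longrightarrow>
      \<bar>(\<integral>z. 1 * (- ln (\<Sum>T\<in>N. \<nu> T * v (Y T z)) / \<beta>) \<partial>D1) -
       (\<integral>z. 1 * (- ln (\<Sum>T\<in>N. \<nu> T * v (Y T z)) / \<beta>) \<partial>D2)\<bar> \<le> d / 2 + w * \<delta>"
      by auto
    define \<delta> where "\<delta> = d / (2 * (w + 1))"
    have \<delta>: "\<delta> > 0" "w * \<delta> \<le> d / 2" using d w by (auto simp: \<delta>_def field_simps)
    from cosine_close[OF \<delta>(1), of a] eventually_gt_at_top[of 0]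
    show "\<forall>\<^sub>F n in sequentially. \<forall>N \<nu>.
      finite N \<longrightarrow> N \<subseteq> {T. \<forall>j. T j \<in> C n} \<longrightarrow> weights N \<nu> \<longrightarrow>
      \<bar>(\<integral>z. cavity \<beta> N \<nu> (\<lambda>T. min (lf n T z) B) \<partial>D True n) -
       (\<integral>z. cavity \<beta> N \<nu> (\<lambda>T. min (lf n T z) B) \<partial>D False n)\<bar> \<le> d"
    proof (eventually_elim, intro allI impI)
      fix n and N :: "('k \<Rightarrow> rvec) set" and \<nu>
      assume cc: "\<forall>u\<in>S n. \<forall>c b. \<bar>(\<integral>z. cos (a * dotp (p n) u (fst z) + c * snd z + b) \<partial>D True n) -
        (\<integral>z. cos (a * dotp (p n) u (fst z) + c * snd z + b) \<partial>D False n)\<bar> \<le> \<delta>"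
        and n: "0 < n" and N: "finite N" "N \<subseteq> {T. \<forall>j. T j \<in> C n}" "weights N \<nu>"
      have TC: "\<forall>j. T j \<in> C n" if "T \<in> N" for T using N(2) that by blast
      have lin: "\<forall>T\<in>N. linear_coords (p n) (S n) (Y n T)" using Y_lin[OF n TC] by blast
      have gl: "good_law c (D b n) (Y n T)" if "T \<in> N" for b T
        by (rule good_law_if_exp_law[OF Y_law[OF n TC[OF that]] prob_D[OF n] sets_D[OF n]])
      have gl2: "\<forall>T\<in>N. good_law c (D True n) (Y n T) \<and> good_law c (D False n) (Y n T)" using gl by blast
      have gl0: "good_law c (D b n) (\<lambda>z. snd z)" for b
        by (rule good_law_if_exp_law[OF snd_law[OF n] prob_D[OF n] sets_D[OF n]])
      have cav: "cavity \<beta> N \<nu> (\<lambda>T. min (lf n T z) B) = 1 * (- ln (\<Sum>T\<in>N. \<nu> T * v (Y n T z)) / \<beta>)" for z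
        by (simp add: cavity_def v_def lf_Y)
      have "\<bar>(\<integral>z. cavity \<beta> N \<nu> (\<lambda>T. min (lf n T z) B) \<partial>D True n) -
       (\<integral>z. cavity \<beta> N \<nu> (\<lambda>T. min (lf n T z) B) \<partial>D False n)\<bar> \<le> d / 2 + w * \<delta>"
        unfolding cav
        by (rule disc[rule_format, OF S_ne[OF n] S_sym[OF n] N(1,3) linear_coords_snd lin[rule_format] gl0 gl0 gl2[rule_format] cc[rule_format]])
      with \<delta>(2) show "\<bar>(\<integral>z. cavity \<beta> N \<nu> (\<lambda>T. min (lf n T z) B) \<partial>D True n) -
       (\<integral>z. cavity \<beta> N \<nu> (\<lambda>T. min (lf n T z) B) \<partial>D False n)\<bar> \<le> d" by linarith
    qed
  qed
qed

end

subsection \<open>Binary labels\<close>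

lemma two_argument_lipschitz_continuous:
  fixes f :: "'a::real_normed_vector \<Rightarrow> real \<Rightarrow> real"
  assumes f: "\<forall>v v' y y'. \<bar>f v y - f v' y\<bar> \<le> K * (1 + \<bar>y\<bar>) * norm (v - v') \<and>
        \<bar>f v y - f v y'\<bar> \<le> K * (1 + norm v) * \<bar>y - y'\<bar>"
  shows "continuous_on UNIV (\<lambda>z. f (fst z) (snd z))"
  unfolding continuous_on_eq_continuous_at[OF open_UNIV]
proof
  fix z0 :: "'a \<times> real"
  let ?f = "\<lambda>z. f (fst z) (snd z)"
  let ?b = "\<lambda>z. K * (1 + \<bar>snd z0\<bar>) * norm (fst z - fst z0) + K * (1 + norm (fst z)) * \<bar>snd z - snd z0\<bar>"
  have "((\<lambda>z. ?f z - ?f z0) \<longlongrightarrow> 0) (at z0)"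
  proof (rule Lim_null_comparison)
    have "norm (?f z - ?f z0) \<le> ?b z" for z
    proof -
      have "\<bar>f (fst z) (snd z) - f (fst z) (snd z0)\<bar> \<le> K * (1 + norm (fst z)) * \<bar>snd z - snd z0\<bar>"
        "\<bar>f (fst z) (snd z0) - f (fst z0) (snd z0)\<bar> \<le> K * (1 + \<bar>snd z0\<bar>) * norm (fst z - fst z0)"
        using f by blast+
      then show ?thesis unfolding real_norm_def by linarith
    qed
    then show "\<forall>\<^sub>F z in at z0. norm (?f z - ?f z0) \<le> ?b z" by simp
    show "(?b \<longlongrightarrow> 0) (at z0)"
      by (rule tendsto_eq_intros refl tendsto_ident_at | simp)+
  qed
  then show "continuous (at z0) ?f" unfolding continuous_at by (rule LIM_zero_cancel)
qed

lemma quadratic_lipschitz_continuous: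
  fixes g :: "'a::real_normed_vector \<Rightarrow> real"
  assumes g: "\<forall>v v'. \<bar>g v - g v'\<bar> \<le> K * (1 + norm v + norm v') * norm (v - v')"
  shows "continuous_on UNIV g"
  unfolding continuous_on_eq_continuous_at[OF open_UNIV]
proof
  fix v0 :: 'a
  have "((\<lambda>v. g v - g v0) \<longlongrightarrow> 0) (at v0)"
  proof (rule Lim_null_comparison)
    show "\<forall>\<^sub>F v in at v0. norm (g v - g v0) \<le> K * (1 + norm v + norm v0) * norm (v - v0)"
      using g by (simp add: always_eventually)
    show "((\<lambda>v. K * (1 + norm v + norm v0) * norm (v - v0)) \<longlongrightarrow> 0) (at v0)"
      by (rule tendsto_eq_intros refl tendsto_ident_at | simp)+
  qed
  then show "continuous (at v0) g" unfolding continuous_at by (rule LIM_zero_cancel)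
qed

context erm_models
begin

definition lab :: "nat \<Rightarrow> rvec \<times> real \<Rightarrow> real" where
  "lab n z = \<eta> (transp_mult (p n) (Ts n) (fst z)) (snd z)"

lemma lab_measurable [measurable]: "lab n \<in> borel_measurable borel"
proof -
  have "(\<lambda>z :: rvec \<times> real. (transp_mult (p n) (Ts n) (fst z), snd z)) \<in> borel_measurable borel"
    by (intro borel_measurable_Pair measurable_transp_mult borel_snd_real)
  from measurable_compose[OF this \<eta>_measurable] show ?thesis by (simp add: lab_def[abs_def])
qed

text \<open>\<open>\<eta>\<close> is only measurable, so the label is no continuous function of the
  linear forms and the noise. The conditional probability \<open>g\<close> is continuous in the
  linear forms, and the defining property of conditional expectation lets it replace the label in
  integrals against functions of the feature. The identity is taken from the sample with index
  0.\<close>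

lemma binary_label_law:
  assumes n: "n > 0"
    and lb: "binary_label (M n) (feature b n 0) (\<lambda>\<omega>. label \<eta> (p n) (Ts n) (feature b n 0 \<omega>) (e n 0 \<omega>)) (\<lambda>v. g (transp_mult (p n) (Ts n) v))"
    and g: "continuous_on UNIV g" "\<And>v. 0 \<le> g v \<and> g v \<le> 1"
  shows "AE z in D b n. lab n z = 1 \<or> lab n z = - 1"
    and "h \<in> borel_measurable borel \<Longrightarrow> (\<And>x. \<bar>h x\<bar> \<le> B) \<Longrightarrow>
      (\<integral>z. h (fst z) * indicator {z. lab n z = 1} z \<partial>D b n) =
      (\<integral>z. g (transp_mult (p n) (Ts n) (fst z)) * h (fst z) \<partial>D b n)"
proof -
  interpret prob_space "M n" using prob n by blast
  let ?x = "feature b n 0"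
  let ?Z = "\<lambda>\<omega>. (?x \<omega>, e n 0 \<omega>)"
  note Zm = pair_law(1)[OF n, of b] and Zd = pair_law(2)[OF n, of b]
  have lab_Z: "label \<eta> (p n) (Ts n) (?x \<omega>) (e n 0 \<omega>) = lab n (?Z \<omega>)" for \<omega>
    by (simp add: label_def lab_def)
  have ae: "AE \<omega> in M n. lab n (?Z \<omega>) = 1 \<or> lab n (?Z \<omega>) = - 1"
    and ce: "AE \<omega> in M n. real_cond_exp (M n) (vimage_algebra (space (M n)) ?x borel)
                    (indicator {\<omega>'\<in>space (M n). lab n (?Z \<omega>') = 1}) \<omega> = g (transp_mult (p n) (Ts n) (?x \<omega>))"
    using lb unfolding binary_label_def lab_Z by auto
  have "AE z in distr (M n) borel ?Z. lab n z = 1 \<or> lab n z = - 1"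
    using ae by (subst AE_distr_iff[OF Zm]) (auto, measurable)
  then show "AE z in D b n. lab n z = 1 \<or> lab n z = - 1" unfolding Zd .
  assume hm [measurable]: "h \<in> borel_measurable borel" and hB: "\<And>x. \<bar>h x\<bar> \<le> B"
  have xm: "?x \<in> borel_measurable (M n)"
    using iid_pairs(1)[OF sample[OF n, of b]] sample[OF n, of b] n
    by (auto simp: regression_sample_def iid_sample_def indep_vars_def2)
  let ?F = "vimage_algebra (space (M n)) ?x borel"
  have sub: "subalgebra (M n) ?F"
    unfolding subalgebra_def using measurable_sets[OF xm] by (auto simp: sets_vimage_algebra2)
  interpret finite_measure_subalgebra "M n" ?F by unfold_locales (rule sub)
  let ?I = "indicator {\<omega>'\<in>space (M n). lab n (?Z \<omega>') = 1} :: _ \<Rightarrow> real"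
  have lZ [measurable]: "(\<lambda>\<omega>. lab n (?Z \<omega>)) \<in> borel_measurable (M n)"
    by (rule measurable_compose[OF Zm lab_measurable])
  have Im: "?I \<in> borel_measurable (M n)" by measurable
  have hx: "(\<lambda>\<omega>. h (?x \<omega>)) \<in> borel_measurable (M n)" by (rule measurable_compose[OF xm hm])
  have hF: "(\<lambda>\<omega>. h (?x \<omega>)) \<in> borel_measurable ?F"
    by (rule measurable_compose[OF measurable_vimage_algebra1 hm]) simp
  have int: "integrable (M n) (\<lambda>\<omega>. h (?x \<omega>) * ?I \<omega>)"
  proof (rule integrable_const_bound[where B=B])
    have "\<bar>h (?x \<omega>) * ?I \<omega>\<bar> \<le> B" for \<omega>
      using hB[of "?x \<omega>"] by (auto simp: indicator_def intro: order_trans[OF abs_ge_zero])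
    then show "AE \<omega> in M n. norm (h (?x \<omega>) * ?I \<omega>) \<le> B" by simp
  qed (rule borel_measurable_times[OF hx Im])
  have gm: "g \<in> borel_measurable borel" by (rule borel_measurable_continuous_onI[OF g(1)])
  have gx: "(\<lambda>z :: rvec \<times> real. g (transp_mult (p n) (Ts n) (fst z))) \<in> borel_measurable borel"
    by (rule measurable_compose[OF measurable_transp_mult gm])
  have hfst: "(\<lambda>z :: rvec \<times> real. h (fst z)) \<in> borel_measurable borel"
    by (rule measurable_compose[OF _ hm]) (simp add: borel_prod[symmetric])
  have "(\<integral>z. h (fst z) * indicator {z. lab n z = 1} z \<partial>D b n) = (\<integral>\<omega>. h (?x \<omega>) * indicator {z. lab n z = 1} (?Z \<omega>) \<partial>M n)"
  proof -
    have "(\<lambda>z. h (fst z) * indicator {z. lab n z = 1} z) \<in> borel_measurable borel"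
    proof (rule borel_measurable_times[OF hfst borel_measurable_indicator])
      show "{z. lab n z = 1} \<in> sets borel"
        using measurable_sets[OF lab_measurable, of "{1}"] by (simp add: vimage_def)
    qed
    from integral_distr[OF Zm this] show ?thesis unfolding Zd by simp
  qed
  also have "\<dots> = (\<integral>\<omega>. h (?x \<omega>) * ?I \<omega> \<partial>M n)"
    by (intro Bochner_Integration.integral_cong) (auto simp: indicator_def)
  also have "\<dots> = (\<integral>\<omega>. h (?x \<omega>) * real_cond_exp (M n) ?F ?I \<omega> \<partial>M n)"
    by (rule real_cond_exp_intg(2)[OF int hF Im, symmetric])
  also have "\<dots> = (\<integral>\<omega>. g (transp_mult (p n) (Ts n) (?x \<omega>)) * h (?x \<omega>) \<partial>M n)"
  proof (rule integral_cong_AE)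
    show "(\<lambda>\<omega>. h (?x \<omega>) * real_cond_exp (M n) ?F ?I \<omega>) \<in> borel_measurable (M n)"
      using hx by (rule borel_measurable_times) (rule borel_measurable_cond_exp2)
    have "(\<lambda>\<omega>. g (transp_mult (p n) (Ts n) (?x \<omega>))) \<in> borel_measurable (M n)"
      using measurable_compose[OF Zm gx] by simp
    then show "(\<lambda>\<omega>. g (transp_mult (p n) (Ts n) (?x \<omega>)) * h (?x \<omega>)) \<in> borel_measurable (M n)"
      using hx by (rule borel_measurable_times)
    show "AE \<omega> in M n. h (?x \<omega>) * real_cond_exp (M n) ?F ?I \<omega> = g (transp_mult (p n) (Ts n) (?x \<omega>)) * h (?x \<omega>)"
      using ce by eventually_elim simp
  qed
  also have "\<dots> = (\<integral>z. g (transp_mult (p n) (Ts n) (fst z)) * h (fst z) \<partial>D b n)"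
  proof -
    have "(\<lambda>z :: rvec \<times> real. g (transp_mult (p n) (Ts n) (fst z)) * h (fst z)) \<in> borel_measurable borel"
      using gx hfst by (rule borel_measurable_times)
    from integral_distr[OF Zm this] show ?thesis unfolding Zd by simp
  qed
  finally show "(\<integral>z. h (fst z) * indicator {z. lab n z = 1} z \<partial>D b n) =
      (\<integral>z. g (transp_mult (p n) (Ts n) (fst z)) * h (fst z) \<partial>D b n)" .
qed

text \<open>Splitting the cavity integral by the label leaves two integrals over the feature,
  weighted by \<open>g\<close> and \<open>1 - g\<close>. In each of them the label is a fixed
  number, so the integrand is continuous in the linear forms and \<open>cavity_discrepancy\<close>
  applies.\<close>

lemma alternative_II_universal:
  assumes alt: "alternative_II L F \<eta> p Ts M X G e"
  shows "universal_pair p R S C r lf D"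
proof -
  let ?f = "loss_F L F"
  obtain K where K: "\<forall>v v' y y'. \<bar>?f v y - ?f v' y\<bar> \<le> K * (1 + \<bar>y\<bar>) * norm (v - v') \<and>
        \<bar>?f v y - ?f v y'\<bar> \<le> K * (1 + norm v) * \<bar>y - y'\<bar>"
    using alt unfolding alternative_II_def by (elim conjE exE)
  from alt[unfolded alternative_II_def, THEN conjunct2, THEN conjunct2] obtain g Kg where
    g01: "\<forall>v. 0 \<le> g v \<and> g v \<le> 1"
    and Kg: "\<forall>v v'. \<bar>g v - g v'\<bar> \<le> Kg * (1 + norm v + norm v') * norm (v - v')"
    and labels: "\<forall>n. \<forall>i<n.
           binary_label (M n) (X n i) (\<lambda>\<omega>. label \<eta> (p n) (Ts n) (X n i \<omega>) (e n i \<omega>)) (\<lambda>v. g (transp_mult (p n) (Ts n) v)) \<and>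
           binary_label (M n) (G n i) (\<lambda>\<omega>. label \<eta> (p n) (Ts n) (G n i \<omega>) (e n i \<omega>)) (\<lambda>v. g (transp_mult (p n) (Ts n) v))"
    by (elim exE conjE)
  have gc: "continuous_on UNIV g" by (rule quadratic_lipschitz_continuous[OF Kg])
  have fc: "continuous_on UNIV (\<lambda>z. ?f (fst z) (snd z))" by (rule two_argument_lipschitz_continuous[OF K])
  have fc1: "continuous_on UNIV (\<lambda>v. ?f v y)" for y
  proof -
    have "continuous_on UNIV (\<lambda>v :: real ^ 'k. (v, y))" by (intro continuous_intros)
    from continuous_on_compose2[OF fc this] show ?thesis by simp
  qed
  have f0: "0 \<le> ?f v y" for v y using L_nonneg by (simp add: loss_F_def)
  have lb: "binary_label (M n) (feature b n 0) (\<lambda>\<omega>. label \<eta> (p n) (Ts n) (feature b n 0 \<omega>) (e n 0 \<omega>))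
      (\<lambda>v. g (transp_mult (p n) (Ts n) v))" if "n > 0" for n b
    using labels that by (cases b) (auto simp: feature_def)
  have gb: "\<And>v. 0 \<le> g v \<and> g v \<le> 1" using g01 by blast
  have lab_ae: "AE z in D b n. lab n z = 1 \<or> lab n z = - 1" if "n > 0" for b n
    by (rule binary_label_law(1)[OF that lb[OF that] gc gb])
  have lab_int: "(\<integral>z. h (fst z) * indicator {z. lab n z = 1} z \<partial>D b n) =
      (\<integral>z. g (transp_mult (p n) (Ts n) (fst z)) * h (fst z) \<partial>D b n)"
    if "n > 0" "h \<in> borel_measurable borel" "\<And>x. \<bar>h x\<bar> \<le> B" for h b n B
    by (rule binary_label_law(2)[OF that(1) lb[OF that(1)] gc gb that(2,3)])
  define u where "u n T z = transp_mult (p n) T (fst z)" for n and T :: "'k \<Rightarrow> rvec" and z :: "rvec \<times> real"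
  have lf_lab: "lf n T z = ?f (u n T z) (lab n z)" for n T z
    by (simp add: lf_def loss_def loss_F_def u_def lab_def)
  obtain c where c: "c \<ge> 1" "\<forall>b n u. n > 0 \<longrightarrow> u \<in> S n \<longrightarrow>
      (\<integral>\<^sup>+z. ennreal (exp \<bar>dotp (p n) u (fst z)\<bar>) \<partial>D b n) \<le> ennreal c"
    by (rule exp_moment_features) blast
  have c0: "c \<ge> 0" using c(1) by simp
  have u_lin: "linear_coords (p n) (S n) (u n T)" if "n > 0" "\<forall>j. T j \<in> C n" for n T
    unfolding u_def[abs_def] using C_in_S[OF that] by (intro linear_coords_transp_mult) auto
  have u_law: "exp_law c (D b n) (u n T)" if n: "n > 0" and T: "\<forall>j. T j \<in> C n" for b n T
    unfolding u_def[abs_def] using C_in_S[OF n T] c(2) n by (intro exp_law_transp_mult) auto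
  have um: "u n T \<in> borel_measurable borel" for n T unfolding u_def[abs_def] by (rule measurable_transp_mult)
  show ?thesis
  proof (rule universal_pairI)
    show "(\<lambda>(w, s). loss L F \<eta> w s) \<in> borel_measurable borel"
    proof -
      have p1: "(\<lambda>z :: ((real ^ 'k) \<times> (real ^ 'm)) \<times> real. (snd (fst z), snd z)) \<in> borel_measurable borel"
        by (intro borel_measurable_continuous_onI continuous_intros)
      have p2: "(\<lambda>z :: ((real ^ 'k) \<times> (real ^ 'm)) \<times> real. fst (fst z)) \<in> borel_measurable borel"
        by (intro borel_measurable_continuous_onI continuous_intros)
      have "(\<lambda>z :: ((real ^ 'k) \<times> (real ^ 'm)) \<times> real. \<eta> (snd (fst z)) (snd z)) \<in> borel_measurable borel"
        using measurable_compose[OF p1 \<eta>_measurable] by simp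
      with p2 have "(\<lambda>z :: ((real ^ 'k) \<times> (real ^ 'm)) \<times> real. (fst (fst z), \<eta> (snd (fst z)) (snd z))) \<in> borel_measurable borel"
        by (rule borel_measurable_Pair)
      from measurable_compose[OF this borel_measurable_continuous_onI[OF fc]] show ?thesis
        by (simp add: loss_def loss_F_def case_prod_unfold)
    qed
    show "continuous_on UNIV (\<lambda>u. loss L F \<eta> (u, us) s)" for us s
      using fc1[of "\<eta> us s"] by (simp add: loss_def loss_F_def)
    have lipu: "\<bar>?f v y - ?f v' y\<bar> \<le> 2 * \<bar>K\<bar> * norm (v - v')" if "y = 1 \<or> y = - 1" for v v' y
    proof -
      have "\<bar>?f v y - ?f v' y\<bar> \<le> K * (1 + \<bar>y\<bar>) * norm (v - v')" using K by blast
      also have "\<dots> = K * 2 * norm (v - v')" using that by auto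
      also have "\<dots> \<le> \<bar>K\<bar> * 2 * norm (v - v')" by (intro mult_right_mono) auto
      finally show ?thesis by (simp add: mult_ac)
    qed
    \<comment> \<open>Bounds the loss at 0 for either label, as both terms are nonnegative.\<close>
    define A where "A = ?f 0 1 + ?f 0 (-1)"
    have A: "A \<ge> 0" using f0 by (simp add: A_def)
    show "\<exists>M\<ge>0. \<forall>b n T. n > 0 \<longrightarrow> (\<forall>j. T j \<in> C n) \<longrightarrow> (\<integral>\<^sup>+z. ennreal ((lf n T z)\<^sup>2) \<partial>D b n) \<le> ennreal M"
    proof -
      let ?Mo = "(2 * A\<^sup>2 + 8 * K\<^sup>2) * (1 + exp (2 * ln (real DIM(real ^ 'k) * 2))) * (real DIM(real ^ 'k) * c)"
      have "?Mo \<ge> 0" using c0 by (intro mult_nonneg_nonneg add_nonneg_nonneg) auto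
      moreover have "(\<integral>\<^sup>+z. ennreal ((lf n T z)\<^sup>2) \<partial>D b n) \<le> ennreal ?Mo" if n: "n > 0" and T: "\<forall>j. T j \<in> C n" for b n T
      proof (rule exp_law_power_moment[OF u_law[OF n T] c0])
        show "u n T \<in> borel_measurable (D b n)"
          using um measurable_cong_sets[OF sets_D[OF n] refl] by blast
        show "AE z in D b n. (lf n T z)\<^sup>2 \<le> (2 * A\<^sup>2 + 8 * K\<^sup>2) * (1 + norm (u n T z) powr 2)"
          using lab_ae[OF n, of b]
        proof eventually_elim
          case (elim z)
          let ?t = "norm (u n T z)"
          have "?f 0 (lab n z) \<le> A" using elim f0[of 0 1] f0[of 0 "-1"] by (auto simp: A_def)
          then have "lf n T z \<le> A + 2 * \<bar>K\<bar> * ?t"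
            unfolding lf_lab using lipu[OF elim, of "u n T z" 0] by simp
          then have "(lf n T z)\<^sup>2 \<le> (A + 2 * \<bar>K\<bar> * ?t)\<^sup>2" using f0 by (intro power_mono) (auto simp: lf_lab)
          also have "\<dots> \<le> 2 * A\<^sup>2 + 2 * (2 * \<bar>K\<bar> * ?t)\<^sup>2"
          proof -
            have "0 \<le> (A - 2 * \<bar>K\<bar> * ?t)\<^sup>2" by simp
            moreover have "(A + x)\<^sup>2 + (A - x)\<^sup>2 = 2 * A\<^sup>2 + 2 * x\<^sup>2" for x :: real
              by (simp add: power2_eq_square algebra_simps)
            ultimately show ?thesis by (metis add_increasing2 le_add_same_cancel1 order_refl)
          qed
          also have "2 * (2 * \<bar>K\<bar> * ?t)\<^sup>2 = 8 * K\<^sup>2 * ?t\<^sup>2" by (simp add: power_mult_distrib)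
          also have "?t\<^sup>2 = ?t powr 2" by (simp add: powr_numeral)
          also have "2 * A\<^sup>2 + 8 * K\<^sup>2 * (?t powr 2) \<le> (2 * A\<^sup>2 + 8 * K\<^sup>2) * (1 + ?t powr 2)"
          proof -
            have "0 \<le> 2 * A\<^sup>2 * (?t powr 2)" "0 \<le> 8 * K\<^sup>2" by auto
            then show ?thesis unfolding distrib_right distrib_left mult_1_right by linarith
          qed
          finally show ?case .
        qed
      qed auto
      ultimately show ?thesis by blast
    qed
    show "\<exists>K\<ge>0. \<forall>b n. n > 0 \<longrightarrow> (AE z in D b n. \<forall>T T'.
      \<bar>min (lf n T z) B - min (lf n T' z) B\<bar> \<le> K * norm (transp_mult (p n) T (fst z) - transp_mult (p n) T' (fst z)))"
      if B: "B > 0" for B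
    proof (intro exI[of _ "2 * \<bar>K\<bar>"] conjI allI impI)
      fix b n assume n: "(0::nat) < n"
      show "AE z in D b n. \<forall>T T'. \<bar>min (lf n T z) B - min (lf n T' z) B\<bar> \<le>
          2 * \<bar>K\<bar> * norm (transp_mult (p n) T (fst z) - transp_mult (p n) T' (fst z))"
        using lab_ae[OF n, of b]
      proof (eventually_elim, intro allI)
        fix z T T' assume z: "lab n z = 1 \<or> lab n z = - 1"
        show "\<bar>min (lf n T z) B - min (lf n T' z) B\<bar> \<le> 2 * \<bar>K\<bar> * norm (transp_mult (p n) T (fst z) - transp_mult (p n) T' (fst z))"
          using abs_min_diff_le[of "lf n T z" B "lf n T' z"] lipu[OF z, of "u n T z" "u n T' z"]
          unfolding lf_lab u_def by linarith
      qed
    qed simp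
    fix \<beta> B d :: real assume \<beta>: "\<beta> > 0" and B: "B > 0" and d: "d > 0"
    define v where "v y x = exp (- \<beta> * min (?f x y) B)" for y and x :: "real ^ 'k"
    have vc: "continuous_on UNIV (v y)" for y unfolding v_def[abs_def] by (intro continuous_intros fc1)
    have vb: "\<And>x. exp (- \<beta> * B) \<le> v y x \<and> v y x \<le> 1" for y
      unfolding v_def using \<beta> B f0 by auto
    define W where "W n z = transp_mult (p n) (Ts n) (fst z)" for n and z :: "rvec \<times> real"
    define H where "H n N \<nu> y z = - ln (\<Sum>T\<in>N. \<nu> T * v y (u n T z)) / \<beta>"
      for n and N :: "('k \<Rightarrow> rvec) set" and \<nu> y and z :: "rvec \<times> real"
    have half: "\<forall>\<^sub>F n in sequentially. \<forall>N \<nu>. finite N \<longrightarrow> N \<subseteq> {T. \<forall>j. T j \<in> C n} \<longrightarrow> weights N \<nu> \<longrightarrow>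
      \<bar>(\<integral>z. g' (W n z) * H n N \<nu> y z \<partial>D True n) - (\<integral>z. g' (W n z) * H n N \<nu> y z \<partial>D False n)\<bar> \<le> d / 2"
      if g': "continuous_on UNIV g'" "\<And>v. \<bar>g' v\<bar> \<le> 1" for g' y
    proof -
      have d4: "d / 4 > 0" using d by simp
      from cavity_discrepancy[where 't="'k \<Rightarrow> rvec", OF vc[of y] vb exp_gt_zero g' \<beta> d4 c0]
      obtain a w where w: "w \<ge> 0" and disc: "\<forall>p S D1 D2 (N :: ('k \<Rightarrow> rvec) set) \<nu> Y Y0 \<delta>. S \<noteq> {} \<longrightarrow> symmetric_convex S \<longrightarrow>
        finite N \<longrightarrow> weights N \<nu> \<longrightarrow> linear_coords p S Y0 \<longrightarrow> (\<forall>T\<in>N. linear_coords p S (Y T)) \<longrightarrow>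
        good_law c D1 Y0 \<longrightarrow> good_law c D2 Y0 \<longrightarrow> (\<forall>T\<in>N. good_law c D1 (Y T) \<and> good_law c D2 (Y T)) \<longrightarrow>
        (\<forall>u\<in>S. \<forall>c b. \<bar>(\<integral>z. cos (a * dotp p u (fst z) + c * snd z + b) \<partial>D1) -
          (\<integral>z. cos (a * dotp p u (fst z) + c * snd z + b) \<partial>D2)\<bar> \<le> \<delta>) \<longrightarrow>
        \<bar>(\<integral>z. g' (Y0 z) * (- ln (\<Sum>T\<in>N. \<nu> T * v y (Y T z)) / \<beta>) \<partial>D1) -
         (\<integral>z. g' (Y0 z) * (- ln (\<Sum>T\<in>N. \<nu> T * v y (Y T z)) / \<beta>) \<partial>D2)\<bar> \<le> d / 4 + w * \<delta>"
        by (elim exE conjE)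
      define \<delta> where "\<delta> = d / (4 * (w + 1))"
      have \<delta>: "\<delta> > 0" "w * \<delta> \<le> d / 4" using d w by (auto simp: \<delta>_def field_simps)
      from cosine_close[OF \<delta>(1), of a] eventually_gt_at_top[of 0] show ?thesis
      proof (eventually_elim, intro allI impI)
        fix n and N :: "('k \<Rightarrow> rvec) set" and \<nu>
        assume cc: "\<forall>u\<in>S n. \<forall>c b. \<bar>(\<integral>z. cos (a * dotp (p n) u (fst z) + c * snd z + b) \<partial>D True n) -
          (\<integral>z. cos (a * dotp (p n) u (fst z) + c * snd z + b) \<partial>D False n)\<bar> \<le> \<delta>"
          and n: "0 < n" and N: "finite N" "N \<subseteq> {T. \<forall>j. T j \<in> C n}" "weights N \<nu>"
        have TC: "\<forall>j. T j \<in> C n" if "T \<in> N" for T using N(2) that by blast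
        have lin: "\<forall>T\<in>N. linear_coords (p n) (S n) (u n T)" using u_lin[OF n TC] by blast
        have Ts: "\<And>j. Ts n j \<in> S n" using Ts_in n by blast
        have linW: "linear_coords (p n) (S n) (W n)"
          unfolding W_def[abs_def] by (rule linear_coords_transp_mult[OF Ts])
        have "exp_law c (D b n) (W n)" for b
          unfolding W_def[abs_def] using c(2) by (intro exp_law_transp_mult[OF _ n Ts]) auto
        then have gl0: "good_law c (D b n) (W n)" for b
          by (rule good_law_if_exp_law[OF _ prob_D[OF n] sets_D[OF n]])
        have gl: "good_law c (D b n) (u n T)" if "T \<in> N" for b T
          by (rule good_law_if_exp_law[OF u_law[OF n TC[OF that]] prob_D[OF n] sets_D[OF n]])
        have gl2: "\<forall>T\<in>N. good_law c (D True n) (u n T) \<and> good_law c (D False n) (u n T)" using gl by blast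
        have "\<bar>(\<integral>z. g' (W n z) * H n N \<nu> y z \<partial>D True n) - (\<integral>z. g' (W n z) * H n N \<nu> y z \<partial>D False n)\<bar> \<le> d / 4 + w * \<delta>"
          unfolding H_def
          by (rule disc[rule_format, OF S_ne[OF n] S_sym[OF n] N(1,3) linW lin[rule_format] gl0 gl0 gl2[rule_format] cc[rule_format]])
        with \<delta>(2) show "\<bar>(\<integral>z. g' (W n z) * H n N \<nu> y z \<partial>D True n) - (\<integral>z. g' (W n z) * H n N \<nu> y z \<partial>D False n)\<bar> \<le> d / 2" by linarith
      qed
    qed
    have g1: "\<And>v. \<bar>g v\<bar> \<le> 1" "\<And>v. \<bar>1 - g v\<bar> \<le> 1" using gb by (auto simp: abs_le_iff)
    have gc2: "continuous_on UNIV (\<lambda>v. 1 - g v)" by (intro continuous_intros gc)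
    from half[OF gc g1(1), of 1] half[OF gc2 g1(2), of "-1"] eventually_gt_at_top[of 0]
    show "\<forall>\<^sub>F n in sequentially. \<forall>N \<nu>.
      finite N \<longrightarrow> N \<subseteq> {T. \<forall>j. T j \<in> C n} \<longrightarrow> weights N \<nu> \<longrightarrow>
      \<bar>(\<integral>z. cavity \<beta> N \<nu> (\<lambda>T. min (lf n T z) B) \<partial>D True n) -
       (\<integral>z. cavity \<beta> N \<nu> (\<lambda>T. min (lf n T z) B) \<partial>D False n)\<bar> \<le> d"
    proof (eventually_elim, intro allI impI)
      fix n and N :: "('k \<Rightarrow> rvec) set" and \<nu>
      assume h1: "\<forall>N \<nu>. finite N \<longrightarrow> N \<subseteq> {T. \<forall>j. T j \<in> C n} \<longrightarrow> weights N \<nu> \<longrightarrow>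
          \<bar>(\<integral>z. g (W n z) * H n N \<nu> 1 z \<partial>D True n) - (\<integral>z. g (W n z) * H n N \<nu> 1 z \<partial>D False n)\<bar> \<le> d / 2"
        and h2: "\<forall>N \<nu>. finite N \<longrightarrow> N \<subseteq> {T. \<forall>j. T j \<in> C n} \<longrightarrow> weights N \<nu> \<longrightarrow>
          \<bar>(\<integral>z. (1 - g (W n z)) * H n N \<nu> (-1) z \<partial>D True n) - (\<integral>z. (1 - g (W n z)) * H n N \<nu> (-1) z \<partial>D False n)\<bar> \<le> d / 2"
        and n: "0 < n" and N: "finite N" "N \<subseteq> {T. \<forall>j. T j \<in> C n}" "weights N \<nu>"
      have Hcav: "H n N \<nu> y z = cavity \<beta> N \<nu> (\<lambda>T. min (?f (u n T z) y) B)" for y z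
        by (simp add: H_def cavity_def v_def)
      have Hb: "\<bar>H n N \<nu> y z\<bar> \<le> B" for y z
        unfolding Hcav using cavity_bounds[OF N(1,3) \<beta>, of "\<lambda>T. min (?f (u n T z) y) B" B] f0 B by auto
      have decomp: "(\<integral>z. cavity \<beta> N \<nu> (\<lambda>T. min (lf n T z) B) \<partial>D b n) =
        (\<integral>z. g (W n z) * H n N \<nu> 1 z \<partial>D b n) + (\<integral>z. (1 - g (W n z)) * H n N \<nu> (-1) z \<partial>D b n)" for b
      proof -
        interpret prob_space "D b n" by (rule prob_D[OF n])
        \<comment> \<open>\<open>H\<close> depends on the feature only once the label is fixed; the
          0 is a placeholder for the noise.\<close>
        define h where "h y x = H n N \<nu> y (x, 0)" for y x
        have Hh: "H n N \<nu> y z = h y (fst z)" for y z by (simp add: h_def H_def u_def)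
        have hm: "h y \<in> borel_measurable borel" for y
        proof -
          have [measurable]: "(\<lambda>x. v y (u n T (x, 0))) \<in> borel_measurable borel" for T
          proof -
            have 1: "(\<lambda>x :: rvec. (x, 0 :: real)) \<in> borel_measurable borel"
              by (intro borel_measurable_Pair) auto
            show ?thesis
              by (rule measurable_compose[OF measurable_compose[OF 1 um] borel_measurable_continuous_onI[OF vc]])
          qed
          show ?thesis unfolding h_def H_def by measurable
        qed
        have hB: "\<bar>h y x\<bar> \<le> B" for y x unfolding h_def by (rule Hb)
        have hD: "(\<lambda>z. h y (fst z)) \<in> borel_measurable (D b n)" for y
          by (rule meas_D[OF n], rule measurable_compose[OF _ hm]) (simp add: borel_prod[symmetric])
        have gm: "g \<in> borel_measurable borel" by (rule borel_measurable_continuous_onI[OF gc])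
        have gD: "(\<lambda>z. g (W n z)) \<in> borel_measurable (D b n)"
          unfolding W_def by (rule meas_D[OF n measurable_compose[OF measurable_transp_mult gm]])
        have labD: "lab n \<in> borel_measurable (D b n)" by (rule meas_D[OF n lab_measurable])
        let ?I = "\<lambda>z. indicator {z. lab n z = 1} z :: real"
        have ID: "?I \<in> borel_measurable (D b n)" 
        proof (rule meas_D[OF n borel_measurable_indicator])
          show "{z. lab n z = 1} \<in> sets borel"
            using measurable_sets[OF lab_measurable, of "{1}"] by (simp add: vimage_def)
        qed
        have bnd: "integrable (D b n) k" if "k \<in> borel_measurable (D b n)" "\<And>z. \<bar>k z\<bar> \<le> B" for k :: "_ \<Rightarrow> real"
          using that by (intro integrable_const_bound[where B=B]) auto
        have m1: "\<bar>x * y\<bar> \<le> B" if "\<bar>x\<bar> \<le> 1" "\<bar>y\<bar> \<le> B" for x y :: real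
        proof -
          have "\<bar>x\<bar> * \<bar>y\<bar> \<le> 1 * B" using that by (intro mult_mono) auto
          then show ?thesis by (simp add: abs_mult)
        qed
        have ih: "integrable (D b n) (\<lambda>z. h y (fst z))" for y using hD hB by (intro bnd) auto
        have iI: "integrable (D b n) (\<lambda>z. h y (fst z) * ?I z)" for y
          using hD ID hB B by (intro bnd borel_measurable_times) (auto simp: indicator_def less_imp_le)
        have ig: "integrable (D b n) (\<lambda>z. g (W n z) * h y (fst z))" for y
          using hD gD hB g1(1) by (intro bnd borel_measurable_times m1) auto
        \<comment> \<open>Almost surely the label is -1 wherever it is not 1, so the second
          indicator is written as \<open>1 - ?I\<close> and only the conditional probability of the
          label 1 is needed.\<close>
        have "(\<integral>z. cavity \<beta> N \<nu> (\<lambda>T. min (lf n T z) B) \<partial>D b n) =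
          (\<integral>z. h 1 (fst z) * ?I z + (h (-1) (fst z) - h (-1) (fst z) * ?I z) \<partial>D b n)"
        proof (rule integral_cong_AE)
          have "lf n T \<in> borel_measurable (D b n)" for T
          proof -
            have "(\<lambda>z. (u n T z, lab n z)) \<in> borel_measurable borel" by (intro borel_measurable_Pair um lab_measurable)
            from measurable_compose[OF this borel_measurable_continuous_onI[OF fc]] show ?thesis
              using meas_D[OF n] by (simp add: lf_lab[abs_def])
          qed
          then show "(\<lambda>z. cavity \<beta> N \<nu> (\<lambda>T. min (lf n T z) B)) \<in> borel_measurable (D b n)"
            by (intro measurable_cavity borel_measurable_min borel_measurable_const)
          show "(\<lambda>z. h 1 (fst z) * ?I z + (h (-1) (fst z) - h (-1) (fst z) * ?I z)) \<in> borel_measurable (D b n)"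
            using hD ID by (intro borel_measurable_add borel_measurable_diff borel_measurable_times)
          show "AE z in D b n. cavity \<beta> N \<nu> (\<lambda>T. min (lf n T z) B) = h 1 (fst z) * ?I z + (h (-1) (fst z) - h (-1) (fst z) * ?I z)"
            using lab_ae[OF n, of b]
          proof eventually_elim
            case (elim z)
            have "cavity \<beta> N \<nu> (\<lambda>T. min (lf n T z) B) = h (lab n z) (fst z)"
              unfolding lf_lab Hcav[symmetric] Hh ..
            then show ?case using elim by (auto simp: indicator_def)
          qed
        qed
        also have "\<dots> = (\<integral>z. h 1 (fst z) * ?I z \<partial>D b n) + ((\<integral>z. h (-1) (fst z) \<partial>D b n) - (\<integral>z. h (-1) (fst z) * ?I z \<partial>D b n))"
          using iI ih by simp
        also have "\<dots> = (\<integral>z. g (W n z) * h 1 (fst z) \<partial>D b n) + ((\<integral>z. h (-1) (fst z) \<partial>D b n) - (\<integral>z. g (W n z) * h (-1) (fst z) \<partial>D b n))"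
          unfolding W_def lab_int[OF n hm hB] ..
        also have "(\<integral>z. h (-1) (fst z) \<partial>D b n) - (\<integral>z. g (W n z) * h (-1) (fst z) \<partial>D b n) =
            (\<integral>z. (1 - g (W n z)) * h (-1) (fst z) \<partial>D b n)"
          using ih ig by (simp add: left_diff_distrib)
        finally show ?thesis unfolding Hh .
      qed
      show "\<bar>(\<integral>z. cavity \<beta> N \<nu> (\<lambda>T. min (lf n T z) B) \<partial>D True n) -
       (\<integral>z. cavity \<beta> N \<nu> (\<lambda>T. min (lf n T z) B) \<partial>D False n)\<bar> \<le> d"
        unfolding decomp using h1[rule_format, OF N] h2[rule_format, OF N] by linarith
    qed
  qed
qed

end

subsection \<open>From restricted minima to test errors of near-minimizers\<close>

lemma Limsup_ereal_le_if_eventually_le_add: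
  fixes f g :: "'i \<Rightarrow> real"
  assumes "\<And>d. d > 0 \<Longrightarrow> \<forall>\<^sub>F x in F. f x \<le> g x + d" and F: "F \<noteq> bot"
  shows "Limsup F (\<lambda>x. ereal (f x)) \<le> Limsup F (\<lambda>x. ereal (g x))"
    and "Liminf F (\<lambda>x. ereal (f x)) \<le> Liminf F (\<lambda>x. ereal (g x))"
proof -
  have le: "\<forall>\<^sub>F x in F. ereal (f x) \<le> ereal (g x) + ereal d" if "d > 0" for d
    using assms(1)[OF that] by simp
  have fin: "\<bar>ereal d\<bar> \<noteq> \<infinity>" for d by simp
  show "Limsup F (\<lambda>x. ereal (f x)) \<le> Limsup F (\<lambda>x. ereal (g x))"
  proof (rule ereal_le_epsilon2)
    fix d :: real assume "0 < d"
    from Limsup_mono[OF le[OF this]] show "Limsup F (\<lambda>x. ereal (f x)) \<le> Limsup F (\<lambda>x. ereal (g x)) + ereal d"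
      unfolding Limsup_add_ereal_right[OF F fin] .
  qed
  show "Liminf F (\<lambda>x. ereal (f x)) \<le> Liminf F (\<lambda>x. ereal (g x))"
  proof (rule ereal_le_epsilon2)
    fix d :: real assume "0 < d"
    from Liminf_mono[OF le[OF this]] show "Liminf F (\<lambda>x. ereal (f x)) \<le> Liminf F (\<lambda>x. ereal (g x)) + ereal d"
      unfolding Liminf_add_ereal_right[OF F fin] .
  qed
qed

lemma compact_columns:
  fixes K :: "rvec set"
  assumes "compact K"
  shows "compact {T :: 'k::finite \<Rightarrow> rvec. \<forall>j. T j \<in> K}"
proof -
  have "{T :: 'k \<Rightarrow> rvec. \<forall>j. T j \<in> K} = PiE UNIV (\<lambda>_. K)" by auto
  moreover have "compactin (product_topology (\<lambda>_. euclidean) UNIV) (PiE (UNIV :: 'k set) (\<lambda>_. K))"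
    using assms by (simp add: compactin_PiE)
  ultimately show ?thesis by (simp add: euclidean_product_topology)
qed

context erm_models
begin

definition configuration :: "bool \<Rightarrow> nat \<Rightarrow> 'w \<Rightarrow> nat \<Rightarrow> rvec \<times> real" where
  "configuration b n \<omega> = (\<lambda>i\<in>{..<n}. (feature b n i \<omega>, e n i \<omega>))"

definition best_test_risk :: "bool \<Rightarrow> nat \<Rightarrow> real \<Rightarrow> 'w \<Rightarrow> ereal" where
  "best_test_risk b n t \<omega> = min_test_risk (p n) (loss L F \<eta>) (Ts n) (feature_law b n) (Q n)
    (ERM n (p n) (loss L F \<eta>) (r n) (Ts n) (C n) (\<lambda>i. feature b n i \<omega>) (\<lambda>i. e n i \<omega>) t)"

context
  assumes up: "universal_pair p R S C r lf D"
begin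

interpretation U: universal_pair p R S C r lf D by (rule up)

definition low_test_risk :: "bool \<Rightarrow> nat \<Rightarrow> real \<Rightarrow> ('k \<Rightarrow> rvec) set" where
  "low_test_risk b n s = {T \<in> U.CC n. (\<integral>z. lf n T z \<partial>D b n) \<le> s}"

lemma compact_CC: "n > 0 \<Longrightarrow> compact (U.CC n)"
  unfolding U.CC_def using constraint by (intro compact_columns) (auto simp: constraint_sets_def)

lemma integrable_lf: "n > 0 \<Longrightarrow> T \<in> U.CC n \<Longrightarrow> integrable (D b n) (lf n T)"
  by (rule U.lf_overflow)

lemma continuous_on_penalty:
  assumes "n > 0" "A \<subseteq> U.CC n" shows "continuous_on A (r n)"
proof -
  have "C n \<subseteq> Rvec (p n)" using assms(1) constraint by (simp add: constraint_sets_def)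
  then have "A \<subseteq> Rmat (p n)" using assms(2) unfolding U.CC_def Rmat_def by blast
  moreover have "continuous_on (Rmat (p n)) (r n)" using penalty assms(1) by (auto simp: penalty_def)
  ultimately show ?thesis by (rule continuous_on_subset[rotated])
qed

text \<open>Fatou's lemma makes the test error lower semicontinuous.\<close>

lemma test_risk_limit_le:
  assumes n: "n > 0" and Tk: "\<And>k. Tk k \<in> U.CC n" and T: "T \<in> U.CC n" and lim: "Tk \<longlonglongrightarrow> T"
    and le: "\<And>k. (\<integral>z. lf n (Tk k) z \<partial>D b n) \<le> c k" and c: "c \<longlonglongrightarrow> s"
  shows "(\<integral>z. lf n T z \<partial>D b n) \<le> s"
proof -
  have eq: "ennreal (\<integral>z. lf n T' z \<partial>D b n) = (\<integral>\<^sup>+z. ennreal (lf n T' z) \<partial>D b n)" if "T' \<in> U.CC n" for T'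
    by (rule nn_integral_eq_integral[symmetric, OF integrable_lf[OF n that]]) (simp add: U.lf_nonneg)
  \<comment> \<open>Nonnegativity of the limit \<open>s\<close> is what allows the return from
    \<open>ennreal\<close> to the reals.\<close>
  have "0 \<le> c k" for k
    by (rule order_trans[OF _ le]) (rule Bochner_Integration.integral_nonneg, rule U.lf_nonneg)
  then have s: "0 \<le> s" using LIMSEQ_le_const[OF c] by blast
  have pt: "ennreal (lf n T z) = liminf (\<lambda>k. ennreal (lf n (Tk k) z))" for z
  proof -
    have "(\<lambda>k. lf n (Tk k) z) \<longlonglongrightarrow> lf n T z"
      using continuous_on_tendsto_compose[OF U.lf_cont[OF n] lim] by simp
    then have "(\<lambda>k. ennreal (lf n (Tk k) z)) \<longlonglongrightarrow> ennreal (lf n T z)" by (rule tendsto_ennrealI)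
    from lim_imp_Liminf[OF sequentially_bot this] show ?thesis by (rule sym)
  qed
  have "ennreal (\<integral>z. lf n T z \<partial>D b n) = (\<integral>\<^sup>+z. liminf (\<lambda>k. ennreal (lf n (Tk k) z)) \<partial>D b n)"
    unfolding eq[OF T] pt ..
  also have "\<dots> \<le> liminf (\<lambda>k. \<integral>\<^sup>+z. ennreal (lf n (Tk k) z) \<partial>D b n)"
    by (intro nn_integral_liminf measurable_compose[OF _ measurable_ennreal] meas_D[OF n] U.lf_meas n)
  also have "\<dots> \<le> liminf (\<lambda>k. ennreal (c k))"
    unfolding eq[OF Tk, symmetric] by (intro Liminf_mono always_eventually allI ennreal_leI le)
  also have "\<dots> = ennreal s" by (rule lim_imp_Liminf[OF sequentially_bot tendsto_ennrealI[OF c]])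
  finally show ?thesis using s by (simp add: ennreal_le_iff)
qed

lemma compact_low_test_risk:
  assumes n: "n > 0" shows "compact (low_test_risk b n s)"
proof -
  have CC: "closed (U.CC n)" by (rule compact_imp_closed[OF compact_CC[OF n]])
  have "closed (low_test_risk b n s)"
    unfolding closed_sequential_limits
  proof (intro allI impI, elim conjE)
    fix Tk T assume Tk: "\<forall>k. Tk k \<in> low_test_risk b n s" and lim: "Tk \<longlonglongrightarrow> T"
    have C: "\<forall>k. Tk k \<in> U.CC n" and le: "\<forall>k. (\<integral>z. lf n (Tk k) z \<partial>D b n) \<le> s"
      using Tk by (auto simp: low_test_risk_def)
    have T: "T \<in> U.CC n" using CC C lim unfolding closed_sequential_limits by blast
    have "(\<integral>z. lf n T z \<partial>D b n) \<le> s"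
      by (rule test_risk_limit_le[OF n C[rule_format] T lim le[rule_format] tendsto_const])
    with T show "T \<in> low_test_risk b n s" by (simp add: low_test_risk_def)
  qed
  with compact_CC[OF n] have "compact (U.CC n \<inter> low_test_risk b n s)" by (rule compact_Int_closed)
  moreover have "U.CC n \<inter> low_test_risk b n s = low_test_risk b n s" by (auto simp: low_test_risk_def)
  ultimately show ?thesis by simp
qed

lemma compact_sublevel_risk:
  assumes n: "n > 0" shows "compact {T \<in> U.CC n. U.risk n Z T \<le> t}"
proof -
  have "continuous_on (U.CC n) (U.risk n Z)"
    unfolding U.risk_def[abs_def]
    using n continuous_on_penalty[OF n subset_refl] continuous_on_subset[OF U.lf_cont[OF n] subset_UNIV]
    by (intro continuous_intros) auto
  from continuous_closed_preimage[OF this compact_imp_closed[OF compact_CC[OF n]] closed_atMost[of t]]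
  have "closed (U.CC n \<inter> U.risk n Z -` {..t})" .
  with compact_CC[OF n] have "compact (U.CC n \<inter> (U.CC n \<inter> U.risk n Z -` {..t}))" by (rule compact_Int_closed)
  moreover have "U.CC n \<inter> (U.CC n \<inter> U.risk n Z -` {..t}) = {T \<in> U.CC n. U.risk n Z T \<le> t}" by auto
  ultimately show ?thesis by simp
qed

text \<open>A lower semicontinuous function attains its infimum on a nonempty compact set. On the
  empty set the infimum is infinite and both sides are false.\<close>

lemma INF_test_risk_le_iff:
  assumes n: "n > 0" and K: "compact K" "K \<subseteq> U.CC n"
  shows "(INF T\<in>K. ereal (\<integral>z. lf n T z \<partial>D b n)) \<le> ereal s \<longleftrightarrow> (\<exists>T\<in>K. (\<integral>z. lf n T z \<partial>D b n) \<le> s)"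
proof
  assume inf: "(INF T\<in>K. ereal (\<integral>z. lf n T z \<partial>D b n)) \<le> ereal s"
  define c where "c k = s + inverse (real (Suc k))" for k
  have c: "c \<longlonglongrightarrow> s" unfolding c_def by (rule LIMSEQ_inverse_real_of_nat_add)
  have "\<exists>T\<in>K. (\<integral>z. lf n T z \<partial>D b n) \<le> c k" for k
  proof -
    have "ereal s < ereal (c k)" by (simp add: c_def)
    with inf have "(INF T\<in>K. ereal (\<integral>z. lf n T z \<partial>D b n)) < ereal (c k)" by (rule le_less_trans)
    then show ?thesis by (auto simp: INF_less_iff intro: less_imp_le)
  qed
  then obtain Tk where Tk: "\<forall>k. Tk k \<in> K \<and> (\<integral>z. lf n (Tk k) z \<partial>D b n) \<le> c k" by metis
  then obtain T q where T: "T \<in> K" "strict_mono q" "(Tk \<circ> q) \<longlonglongrightarrow> T"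
    using K(1) unfolding compact_eq_seq_compact_metric seq_compact_def by blast
  have "(c \<circ> q) \<longlonglongrightarrow> s" by (rule LIMSEQ_subseq_LIMSEQ[OF c T(2)])
  with T Tk K(2) have "(\<integral>z. lf n T z \<partial>D b n) \<le> s"
    by (intro test_risk_limit_le[OF n, of "Tk \<circ> q" T b "c \<circ> q" s]) auto
  with T(1) show "\<exists>T\<in>K. (\<integral>z. lf n T z \<partial>D b n) \<le> s" by blast
next
  assume "\<exists>T\<in>K. (\<integral>z. lf n T z \<partial>D b n) \<le> s"
  then show "(INF T\<in>K. ereal (\<integral>z. lf n T z \<partial>D b n)) \<le> ereal s" by (auto intro: INF_lower2)
qed

text \<open>Two sublevel conditions change roles: the random one defines the set of near-minimizers
  on the left, but becomes the inequality on the right. The set searched is then deterministic and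
  compact, as \<open>min_risk_universality\<close> requires.\<close>

lemma best_test_risk_le_iff:
  assumes n: "n > 0"
  shows "best_test_risk b n t \<omega> \<le> ereal s \<longleftrightarrow>
    (\<exists>T\<in>low_test_risk b n s. U.risk n (configuration b n \<omega>) T \<le> t)"
proof -
  let ?Z = "configuration b n \<omega>"
  have emp: "emp_risk n (p n) (loss L F \<eta>) (r n) (Ts n) (\<lambda>i. feature b n i \<omega>) (\<lambda>i. e n i \<omega>) T = U.risk n ?Z T" for T
  proof -
    have "(\<Sum>a<n. lf n T (?Z a)) = (\<Sum>a<n. loss L F \<eta> (transp_mult (p n) T (feature b n a \<omega>),
        transp_mult (p n) (Ts n) (feature b n a \<omega>)) (e n a \<omega>))"
      by (intro sum.cong) (auto simp: configuration_def lf_def)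
    then show ?thesis by (simp add: emp_risk_def U.risk_def)
  qed
  have "best_test_risk b n t \<omega> = (INF T\<in>{T \<in> U.CC n. U.risk n ?Z T \<le> t}. ereal (\<integral>z. lf n T z \<partial>D b n))"
    unfolding best_test_risk_def min_test_risk_def test_risk_def ERM_def emp U.CC_def lf_def D_def by simp
  then show ?thesis
    using INF_test_risk_le_iff[OF n compact_sublevel_risk[OF n], of ?Z t b s] by (auto simp: low_test_risk_def)
qed

lemma configuration_event:
  assumes n: "n > 0" and A: "compact A" "A \<subseteq> U.CC n"
  shows "{\<omega> \<in> space (M n). \<exists>T\<in>A. U.risk n (configuration b n \<omega>) T \<le> t} \<in> sets (M n)" (is ?sets)
    and "measure (M n) {\<omega> \<in> space (M n). \<exists>T\<in>A. U.risk n (configuration b n \<omega>) T \<le> t} =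
      measure (U.P b n) {Z \<in> space (U.P b n). \<exists>T\<in>A. U.risk n Z T \<le> t}" (is ?measure)
proof -
  interpret prob_space "M n" using prob n by blast
  let ?B = "\<Pi>\<^sub>M i\<in>{..<n}. (borel :: (rvec \<times> real) measure)"
  let ?E = "{Z \<in> space (U.P b n). \<exists>T\<in>A. U.risk n Z T \<le> t}"
  have m: "configuration b n \<in> measurable (M n) ?B"
    unfolding configuration_def[abs_def] using iid_pairs(1)[OF sample[OF n, of b]]
    by (intro measurable_restrict) (auto simp: indep_vars_def2)
  have law: "distr (M n) ?B (configuration b n) = U.P b n"
    unfolding U.P_def configuration_def[abs_def] by (rule configuration_law[OF n])
  have "sets (U.P b n) = sets ?B" unfolding law[symmetric] by simp
  then have sp: "space (U.P b n) = space ?B" and E: "?E \<in> sets ?B"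
    using U.exists_risk_sets[OF n A(1) continuous_on_penalty[OF n A(2)], of b t] sets_eq_imp_space_eq by auto
  have pre: "configuration b n -` ?E \<inter> space (M n) =
      {\<omega> \<in> space (M n). \<exists>T\<in>A. U.risk n (configuration b n \<omega>) T \<le> t}"
    using measurable_space[OF m] unfolding sp by auto
  show ?sets using measurable_sets[OF m E] unfolding pre .
  show ?measure using measure_distr[OF m E] unfolding law pre by simp
qed

lemma best_test_risk_event:
  assumes n: "n > 0"
  shows "{\<omega> \<in> space (M n). best_test_risk b n t \<omega> \<le> ereal s} \<in> sets (M n)"
    and "measure (M n) {\<omega> \<in> space (M n). best_test_risk b n t \<omega> \<le> ereal s} =
      measure (U.P b n) {Z \<in> space (U.P b n). \<exists>T\<in>low_test_risk b n s. U.risk n Z T \<le> t}"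
proof -
  have "low_test_risk b n s \<subseteq> U.CC n" by (auto simp: low_test_risk_def)
  from configuration_event[OF n compact_low_test_risk[OF n] this]
  show "{\<omega> \<in> space (M n). best_test_risk b n t \<omega> \<le> ereal s} \<in> sets (M n)"
    "measure (M n) {\<omega> \<in> space (M n). best_test_risk b n t \<omega> \<le> ereal s} =
      measure (U.P b n) {Z \<in> space (U.P b n). \<exists>T\<in>low_test_risk b n s. U.risk n Z T \<le> t}"
    unfolding best_test_risk_le_iff[OF n] .
qed

lemma low_test_risk_admissible: "n > 0 \<Longrightarrow> compact (low_test_risk b n s) \<and> low_test_risk b n s \<subseteq> U.CC n"
  using compact_low_test_risk by (auto simp: low_test_risk_def)

text \<open>Passage to complements. The set \<open>?A\<close> is defined by the test error of the
  model \<open>\<not> b\<close>; when the empirical risk of that model drops to \<open>t\<close> on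
  \<open>?A\<close>, universality makes the risk of model \<open>b\<close> drop to
  \<open>\<alpha>\<close> on the same set with nearly the same probability, and points of
  \<open>?A\<close> have test error close to \<open>s\<close> or below in model \<open>b\<close> as
  well.\<close>

lemma best_test_risk_ge:
  assumes t: "t < \<alpha>" and \<delta>: "\<delta> > 0" and d: "d > 0"
  shows "\<forall>\<^sub>F n in sequentially. \<P>(\<omega> in M n. best_test_risk b n \<alpha> \<omega> \<ge> ereal (s + \<delta>)) \<le>
    \<P>(\<omega> in M n. best_test_risk (\<not> b) n t \<omega> > ereal s) + d"
proof -
  \<comment> \<open>The event to be bounded contains equality with \<open>s + \<delta>\<close>, so
    the test errors must be closer than \<open>\<delta>\<close>.\<close>
  have \<delta>2: "\<delta> / 2 > 0" using \<delta> by simp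
  have "\<forall>\<^sub>F n in sequentially.
    measure (U.P (\<not> b) n) {Z \<in> space (U.P (\<not> b) n). \<exists>T\<in>low_test_risk (\<not> b) n s. U.risk n Z T \<le> t} \<le>
    measure (U.P (\<not> \<not> b) n) {Z \<in> space (U.P (\<not> \<not> b) n). \<exists>T\<in>low_test_risk (\<not> b) n s. U.risk n Z T \<le> \<alpha>} + d"
    by (intro U.min_risk_universality low_test_risk_admissible t d)
  from this U.expected_loss_close[OF \<delta>2, of b] eventually_gt_at_top[of 0]
  show ?thesis
  proof eventually_elim
    fix n :: nat
    let ?A = "low_test_risk (\<not> b) n s"
    let ?E = "{\<omega> \<in> space (M n). \<exists>T\<in>?A. U.risk n (configuration b n \<omega>) T \<le> \<alpha>}"
    let ?G = "{\<omega> \<in> space (M n). best_test_risk (\<not> b) n t \<omega> \<le> ereal s}"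
    assume u: "measure (U.P (\<not> b) n) {Z \<in> space (U.P (\<not> b) n). \<exists>T\<in>?A. U.risk n Z T \<le> t} \<le>
        measure (U.P (\<not> \<not> b) n) {Z \<in> space (U.P (\<not> \<not> b) n). \<exists>T\<in>?A. U.risk n Z T \<le> \<alpha>} + d"
      and cl: "\<forall>T\<in>U.CC n. \<bar>(\<integral>z. lf n T z \<partial>D b n) - (\<integral>z. lf n T z \<partial>D (\<not> b) n)\<bar> \<le> \<delta> / 2" and n: "0 < n"
    interpret prob_space "M n" using prob n by blast
    note E = configuration_event[OF n low_test_risk_admissible[OF n, THEN conjunct1]
        low_test_risk_admissible[OF n, THEN conjunct2]]
    have GE: "prob ?G \<le> prob ?E + d" using u unfolding best_test_risk_event(2)[OF n] E(2) by simp
    have sub: "{\<omega> \<in> space (M n). ereal (s + \<delta>) \<le> best_test_risk b n \<alpha> \<omega>} \<subseteq> space (M n) - ?E"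
    proof
      fix \<omega> assume \<omega>: "\<omega> \<in> {\<omega> \<in> space (M n). ereal (s + \<delta>) \<le> best_test_risk b n \<alpha> \<omega>}"
      have False if T: "T \<in> ?A" "U.risk n (configuration b n \<omega>) T \<le> \<alpha>" for T
      proof -
        have TC: "T \<in> U.CC n" "(\<integral>z. lf n T z \<partial>D (\<not> b) n) \<le> s" using T(1) by (auto simp: low_test_risk_def)
        have "\<bar>(\<integral>z. lf n T z \<partial>D b n) - (\<integral>z. lf n T z \<partial>D (\<not> b) n)\<bar> \<le> \<delta> / 2"
          using cl TC(1) by (rule bspec)
        with TC(2) have "(\<integral>z. lf n T z \<partial>D b n) \<le> s + \<delta> / 2" by linarith
        with TC T(2) have "best_test_risk b n \<alpha> \<omega> \<le> ereal (s + \<delta> / 2)"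
          unfolding best_test_risk_le_iff[OF n] by (auto simp: low_test_risk_def)
        moreover have "ereal (s + \<delta>) \<le> best_test_risk b n \<alpha> \<omega>" using \<omega> by simp
        ultimately have "ereal (s + \<delta>) \<le> ereal (s + \<delta> / 2)" by (rule order_trans[rotated])
        then show False using \<delta> by simp
      qed
      then show "\<omega> \<in> space (M n) - ?E" using \<omega> by blast
    qed
    have "prob {\<omega> \<in> space (M n). ereal (s + \<delta>) \<le> best_test_risk b n \<alpha> \<omega>} \<le> prob (space (M n) - ?E)"
      by (rule finite_measure_mono[OF sub]) (rule sets.compl_sets, rule E(1))
    also have "\<dots> = 1 - prob ?E" by (rule prob_compl) (rule E(1))
    also have "\<dots> \<le> 1 - prob ?G + d" using GE by linarith
    also have "1 - prob ?G = prob (space (M n) - ?G)"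
      by (rule prob_compl[symmetric]) (rule best_test_risk_event(1)[OF n])
    also have "space (M n) - ?G = {\<omega> \<in> space (M n). ereal s < best_test_risk (\<not> b) n t \<omega>}" by auto
    finally show "prob {\<omega> \<in> space (M n). ereal (s + \<delta>) \<le> best_test_risk b n \<alpha> \<omega>} \<le>
      prob {\<omega> \<in> space (M n). ereal s < best_test_risk (\<not> b) n t \<omega>} + d" .
  qed
qed

text \<open>Closeness of the test errors embeds the sublevel set of model \<open>b\<close> at
  \<open>s - \<delta>\<close> into that of model \<open>\<not> b\<close> at \<open>s\<close>. On
  this larger set, which no longer depends on model \<open>b\<close>, the empirical risks are
  exchanged.\<close>

lemma best_test_risk_le:
  assumes t: "t < \<alpha>" and \<delta>: "\<delta> > 0" and d: "d > 0"
  shows "\<forall>\<^sub>F n in sequentially. \<P>(\<omega> in M n. best_test_risk b n t \<omega> \<le> ereal (s - \<delta>)) \<le>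
    \<P>(\<omega> in M n. best_test_risk (\<not> b) n \<alpha> \<omega> \<le> ereal s) + d"
proof -
  have "\<forall>\<^sub>F n in sequentially.
    measure (U.P b n) {Z \<in> space (U.P b n). \<exists>T\<in>low_test_risk (\<not> b) n s. U.risk n Z T \<le> t} \<le>
    measure (U.P (\<not> b) n) {Z \<in> space (U.P (\<not> b) n). \<exists>T\<in>low_test_risk (\<not> b) n s. U.risk n Z T \<le> \<alpha>} + d"
    by (intro U.min_risk_universality low_test_risk_admissible t d)
  from this U.expected_loss_close[OF \<delta>, of b] eventually_gt_at_top[of 0] show ?thesis
  proof eventually_elim
    fix n :: nat
    let ?A = "low_test_risk (\<not> b) n s"
    let ?E = "{\<omega> \<in> space (M n). \<exists>T\<in>?A. U.risk n (configuration b n \<omega>) T \<le> t}"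
    assume u: "measure (U.P b n) {Z \<in> space (U.P b n). \<exists>T\<in>?A. U.risk n Z T \<le> t} \<le>
        measure (U.P (\<not> b) n) {Z \<in> space (U.P (\<not> b) n). \<exists>T\<in>?A. U.risk n Z T \<le> \<alpha>} + d"
      and cl: "\<forall>T\<in>U.CC n. \<bar>(\<integral>z. lf n T z \<partial>D b n) - (\<integral>z. lf n T z \<partial>D (\<not> b) n)\<bar> \<le> \<delta>" and n: "0 < n"
    interpret prob_space "M n" using prob n by blast
    note E = configuration_event[OF n low_test_risk_admissible[OF n, THEN conjunct1]
        low_test_risk_admissible[OF n, THEN conjunct2]]
    have "low_test_risk b n (s - \<delta>) \<subseteq> ?A" using cl by (fastforce simp: low_test_risk_def)
    then have sub: "{\<omega> \<in> space (M n). best_test_risk b n t \<omega> \<le> ereal (s - \<delta>)} \<subseteq> ?E"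
      unfolding best_test_risk_le_iff[OF n] by blast
    have "prob {\<omega> \<in> space (M n). best_test_risk b n t \<omega> \<le> ereal (s - \<delta>)} \<le> prob ?E"
      by (rule finite_measure_mono[OF sub]) (rule E(1))
    also have "\<dots> \<le> prob {\<omega> \<in> space (M n). best_test_risk (\<not> b) n \<alpha> \<omega> \<le> ereal s} + d"
      using u unfolding best_test_risk_event(2)[OF n] E(2) .
    finally show "prob {\<omega> \<in> space (M n). best_test_risk b n t \<omega> \<le> ereal (s - \<delta>)} \<le>
        prob {\<omega> \<in> space (M n). best_test_risk (\<not> b) n \<alpha> \<omega> \<le> ereal s} + d" .
  qed
qed

end

end

theorem theorem3:
  fixes p :: "nat \<Rightarrow> nat"
    and M :: "nat \<Rightarrow> 'w measure"
    and X G :: "nat \<Rightarrow> nat \<Rightarrow> 'w \<Rightarrow> rvec"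
    and e :: "nat \<Rightarrow> nat \<Rightarrow> 'w \<Rightarrow> real"
    and Px Pg :: "nat \<Rightarrow> rvec measure"
    and Q :: "nat \<Rightarrow> real measure"
    and mu :: "nat \<Rightarrow> rvec"
    and Sg :: "nat \<Rightarrow> nat \<Rightarrow> nat \<Rightarrow> real"
    and L :: "real \<Rightarrow> real \<Rightarrow> real"
    and F :: "real ^ 'k::finite \<Rightarrow> real"
    and \<eta> :: "real ^ 'm::finite \<Rightarrow> real \<Rightarrow> real"
    and r :: "nat \<Rightarrow> ('k \<Rightarrow> rvec) \<Rightarrow> real"
    and Ts :: "nat \<Rightarrow> 'm \<Rightarrow> rvec"
    and C S :: "nat \<Rightarrow> rvec set"
    and R \<delta> \<alpha> \<rho> :: real
  assumes prob: "\<forall>n>0. prob_space (M n)"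
    and x_law: "\<forall>n>0. law_on (p n) (Px n)"
    and g_law: "\<forall>n>0. gaussian_law (p n) (mu n) (Sg n) (Pg n)"
    and x_sample: "\<forall>n>0. regression_sample (M n) n (Px n) (Q n) (X n) (e n)"
    and g_sample: "\<forall>n>0. regression_sample (M n) n (Pg n) (Q n) (G n) (e n)"
    and L_nonneg: "\<forall>a b. 0 \<le> L a b"
    and \<eta>_measurable: "(\<lambda>(v, s). \<eta> v s) \<in> borel_measurable borel"
    and domain: "domain_of_gaussianity p Px Pg S"
    and regime: "proportional_regime p"
    and constraint: "constraint_sets p R C Ts"
    and penalty: "penalty p r"
    and subgaussian: "restricted_subgaussian p R Px mu Sg S"
    and loss_labels: "alternative_I (loss L F \<eta>) Q \<or> alternative_II L F \<eta> p Ts M X G e"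
    and C_subset: "\<forall>n>0. C n \<subseteq> S n"
    and Ts_in: "\<forall>n>0. \<forall>j. Ts n j \<in> S n"
    and interpolation:
      "(\<lambda>n. \<P>(\<omega> in M n. ERM n (p n) (loss L F \<eta>) (r n) (Ts n) (C n)
                             (\<lambda>i. G n i \<omega>) (\<lambda>i. e n i \<omega>) 0 \<noteq> {})) \<longlonglongrightarrow> 1"
    and "\<delta> > 0" and "\<alpha> > 0"
  shows
    "let minX = (\<lambda>n t \<omega>. min_test_risk (p n) (loss L F \<eta>) (Ts n) (Px n) (Q n)
                    (ERM n (p n) (loss L F \<eta>) (r n) (Ts n) (C n) (\<lambda>i. X n i \<omega>) (\<lambda>i. e n i \<omega>) t));
         minG = (\<lambda>n t \<omega>. min_test_risk (p n) (loss L F \<eta>) (Ts n) (Pg n) (Q n)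
                    (ERM n (p n) (loss L F \<eta>) (r n) (Ts n) (C n) (\<lambda>i. G n i \<omega>) (\<lambda>i. e n i \<omega>) t))
     in
       limsup (\<lambda>n. ereal \<P>(\<omega> in M n. minX n \<alpha> \<omega> \<ge> ereal (\<rho> + \<delta>)))
         \<le> limsup (\<lambda>n. ereal \<P>(\<omega> in M n. minG n 0 \<omega> > ereal \<rho>))
     \<and> Limsup (at_right 0) (\<lambda>t. limsup (\<lambda>n. ereal \<P>(\<omega> in M n. minX n t \<omega> \<le> ereal (\<rho> - \<delta>))))
         \<le> limsup (\<lambda>n. ereal \<P>(\<omega> in M n. minG n \<alpha> \<omega> \<le> ereal \<rho>))
     \<and> liminf (\<lambda>n. ereal \<P>(\<omega> in M n. minX n \<alpha> \<omega> \<ge> ereal (\<rho> + \<delta>)))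
         \<le> liminf (\<lambda>n. ereal \<P>(\<omega> in M n. minG n 0 \<omega> > ereal \<rho>))
     \<and> Limsup (at_right 0) (\<lambda>t. liminf (\<lambda>n. ereal \<P>(\<omega> in M n. minX n t \<omega> \<le> ereal (\<rho> - \<delta>))))
         \<le> liminf (\<lambda>n. ereal \<P>(\<omega> in M n. minG n \<alpha> \<omega> \<le> ereal \<rho>))"
proof -
  interpret E: erm_models p M X G e Px Pg Q mu Sg L F \<eta> r Ts C S R
    by (rule erm_models.intro; fact)
  have up: "universal_pair p R S C r E.lf E.D"
    using loss_labels
  proof
    assume "alternative_I (loss L F \<eta>) Q"
    then show ?thesis by (rule E.alternative_I_universal)
  next
    assume "alternative_II L F \<eta> p Ts M X G e"
    then show ?thesis by (rule E.alternative_II_universal)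
  qed
  have minX: "min_test_risk (p n) (loss L F \<eta>) (Ts n) (Px n) (Q n)
      (ERM n (p n) (loss L F \<eta>) (r n) (Ts n) (C n) (\<lambda>i. X n i \<omega>) (\<lambda>i. e n i \<omega>) t) =
      E.best_test_risk True n t \<omega>" for n t \<omega>
    by (simp add: E.best_test_risk_def E.feature_def E.feature_law_def)
  have minG: "min_test_risk (p n) (loss L F \<eta>) (Ts n) (Pg n) (Q n)
      (ERM n (p n) (loss L F \<eta>) (r n) (Ts n) (C n) (\<lambda>i. G n i \<omega>) (\<lambda>i. e n i \<omega>) t) =
      E.best_test_risk False n t \<omega>" for n t \<omega>
    by (simp add: E.best_test_risk_def E.feature_def E.feature_law_def)
  have ge: "\<forall>\<^sub>F n in sequentially. \<P>(\<omega> in M n. E.best_test_risk True n \<alpha> \<omega> \<ge> ereal (\<rho> + \<delta>)) \<le>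
      \<P>(\<omega> in M n. E.best_test_risk False n 0 \<omega> > ereal \<rho>) + d" if "d > 0" for d
    using E.best_test_risk_ge[OF up \<open>\<alpha> > 0\<close> \<open>\<delta> > 0\<close> that, where b=True] by simp
  have le: "\<forall>\<^sub>F n in sequentially. \<P>(\<omega> in M n. E.best_test_risk True n t \<omega> \<le> ereal (\<rho> - \<delta>)) \<le>
      \<P>(\<omega> in M n. E.best_test_risk False n \<alpha> \<omega> \<le> ereal \<rho>) + d" if "t < \<alpha>" "d > 0" for t d
    using E.best_test_risk_le[OF up that(1) \<open>\<delta> > 0\<close> that(2), where b=True] by simp
  \<comment> \<open>The limit superior at 0 from the right only sees levels below
    \<open>\<alpha>\<close>, where the comparison has room to raise the level.\<close>
  have small: "\<forall>\<^sub>F t in at_right 0. t < \<alpha>"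
    using eventually_at_right_real[OF \<open>\<alpha> > 0\<close>] by (rule eventually_mono) simp
  show ?thesis
    unfolding Let_def minX minG
  proof (intro conjI)
    show "limsup (\<lambda>n. ereal \<P>(\<omega> in M n. E.best_test_risk True n \<alpha> \<omega> \<ge> ereal (\<rho> + \<delta>)))
        \<le> limsup (\<lambda>n. ereal \<P>(\<omega> in M n. E.best_test_risk False n 0 \<omega> > ereal \<rho>))"
      by (rule Limsup_ereal_le_if_eventually_le_add(1)[OF ge sequentially_bot])
    show "liminf (\<lambda>n. ereal \<P>(\<omega> in M n. E.best_test_risk True n \<alpha> \<omega> \<ge> ereal (\<rho> + \<delta>)))
        \<le> liminf (\<lambda>n. ereal \<P>(\<omega> in M n. E.best_test_risk False n 0 \<omega> > ereal \<rho>))"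
      by (rule Limsup_ereal_le_if_eventually_le_add(2)[OF ge sequentially_bot])
    show "Limsup (at_right 0) (\<lambda>t. limsup (\<lambda>n. ereal \<P>(\<omega> in M n. E.best_test_risk True n t \<omega> \<le> ereal (\<rho> - \<delta>))))
        \<le> limsup (\<lambda>n. ereal \<P>(\<omega> in M n. E.best_test_risk False n \<alpha> \<omega> \<le> ereal \<rho>))"
      by (rule Limsup_bounded, rule eventually_mono[OF small])
        (rule Limsup_ereal_le_if_eventually_le_add(1)[OF le sequentially_bot])
    show "Limsup (at_right 0) (\<lambda>t. liminf (\<lambda>n. ereal \<P>(\<omega> in M n. E.best_test_risk True n t \<omega> \<le> ereal (\<rho> - \<delta>))))
        \<le> liminf (\<lambda>n. ereal \<P>(\<omega> in M n. E.best_test_risk False n \<alpha> \<omega> \<le> ereal \<rho>))"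
      by (rule Limsup_bounded, rule eventually_mono[OF small])
        (rule Limsup_ereal_le_if_eventually_le_add(2)[OF le sequentially_bot])
  qed
qed

end
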